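(* Let $(W_t)_{t\ge0}$ be a scalar Brownian motion and, for $s>e$, let $$Z_s(t,\omega):=\frac{W_{s\cdot t}(\omega)}{\sqrt{2s\ln(\ln s)}},\qquad t\in[0,1].$$ (1) For almost all $\omega\in\Omega$ the set $\{Z_s(\cdot,\omega):s>e\}$ is relatively compact in the Banach space $(\mathcal C_0[0,1],\|\cdot\|_\infty)$, and the set of almost sure limit points (as $s\to\infty$) is $\mathcal K(\frac12)$, where for $r>0$ $$\mathcal K(r)=\Big\{w\in\mathcal C_0[0,1]:w\text{ is absolutely continuous and }\tfrac12\int_0^1|w'(s)|^2ds\le r\Big\}.$$ For $q>1$, $\eta>0$, $\varepsilon>0$ let $\mathcal O_{q,\eta,\varepsilon}$ be the number, and $\mathfrak m_{q,\eta,\varepsilon}$ the supremum, of the set of those $n\in\mathbb N$ with $q^n>e$ for which $d(Z_{q^n},\mathcal K(\tfrac12+\eta))>\varepsilon$. (2) Let $\eta>0$. For any $\varepsilon>0$, $q>1$ and $0<\vartheta<\eta$ there is a positive constant $a=a(\eta,\vartheta,q,\varepsilon)$ such that $$\mathbb P(\mathcal O_{q,\eta,\varepsilon}\ge k)\le k^{-1}\cdot\frac{a\,\zeta(1+2\vartheta)}{(\ln q)^{1+2\vartheta}},\qquad k\ge1.$$ (3) Let $\eta>\frac12$ and $b=b(\eta,\varepsilon)=2e^2e^{\frac{4+8\eta}{\varepsilon^2}}$. (a) For any $\varepsilon>0$, $q>1$, $\frac12<\vartheta<\eta$ and all $p$ with $-1<p<2\vartheta-1$: for a.a. $\omega$ and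 all $n>\mathfrak m_{q,\eta,\varepsilon}(\omega)$ (with $q^n>e$), $d(Z_{q^n}(\cdot,\omega),\mathcal K(\frac12+\eta))\le\varepsilon$, and for all $k\in\mathbb N$ $$\mathbb P(\mathcal O_{q,\eta,\varepsilon}\ge k)\le\mathbb P(\mathfrak m_{q,\eta,\varepsilon}\ge k)\le k^{-(1+p)}\cdot\frac{(p+1)(1+2\vartheta)}{2\vartheta}\cdot\frac{b\,\zeta(2\vartheta-p)}{(\ln q)^{1+2\vartheta}}+k^{-(1+p)}\mathbf 1(\{p<0\})$$ $$\le k^{-(1+p)}\cdot(1+2\vartheta)\frac{b\,\zeta(2\vartheta-p)}{(\ln q)^{1+2\vartheta}}+k^{-(1+p)}\mathbf 1(\{p<0\}).$$ (b) For any $\varepsilon>0$, $q>1$ and all $k\ge\max\{\frac{1}{\ln q},e^{\frac{1}{2\eta}-\gamma}\}$, $$\mathbb P(\mathcal O_{q,\eta,\varepsilon}\ge k)\le\mathbb P(\mathfrak m_{q,\eta,\varepsilon}\ge k)\le k^{-2\eta}\cdot\zeta\Big(1+\tfrac{1}{\ln(k)+\gamma}\Big)\cdot k^{\frac{1}{\ln(k)+\gamma}}\cdot\frac{b}{(\ln q)^{1+2\eta}}\Big(2\eta-\frac{1}{\ln(k)+\gamma}\Big)\Big(1+\frac{1}{2\eta}\Big)+k^{-2\eta}\,\mathbf 1\big(\{k<e^{\frac{1}{2\eta-1}-\gamma}\}\big),$$ and the right-hand side is asymptotically equal, as $k\to\infty$, to $k^{-2\eta}\cdot(2\gamma+\ln(k))\cdot\frac{e\,b\,(2\eta+1)}{(\ln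 q)^{1+2\eta}}$. (c) For any $\theta>0$, $q>1$ and $\frac12<\vartheta<\eta$, with $$\varepsilon_n:=\sqrt{\frac{4+8\eta}{\ln\big(\tfrac{(\ln q)^{1+2\vartheta}}{2e^2}\big)+\ln\big(\tfrac{n^{2\vartheta}}{(\ln(n+1))^{1+\theta}}\big)}}$$ (which is of order $\ln\big(\frac{n}{(\ln(n+1))^{(1+\theta)/(2\vartheta)}}\big)^{-1/2}$), we have $$\limsup_{n\to\infty}d\big(Z_{q^n},\mathcal K(\tfrac12+\eta)\big)\cdot\varepsilon_n^{-1}\le1\qquad\mathbb P\text{-a.s.},$$ and for all $k\ge1$ $$\mathbb P\big(\#\{n\in\mathbb N:d(Z_{q^n},\mathcal K(\tfrac12+\eta))>\varepsilon_n\}\ge k\big)\le k^{-1}\cdot\sum_{n=1}^\infty\frac{1}{n(\ln(n+1))^{1+\theta}}.$$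
   Context: $\mathcal C_0[0,1]$ is the space of continuous $f:[0,1]\to\mathbb R$ with $f(0)=0$ with the supremum norm $\|\cdot\|_\infty$; $d(w,A)=\inf_{v\in A}\|w-v\|_\infty$. $\zeta(s)=\sum_{n\ge1}n^{-s}$ is Riemann's zeta function, $\gamma\approx0.5772$ the Euler--Mascheroni constant, $\sup\emptyset:=0$, and $\mathbf 1(\cdot)$ is $1$ if the condition in the argument holds and $0$ otherwise. In (c), only indices $n$ with $q^n>e$ for which the denominator under the root is positive are considered.
   Formalization: In (1), relative compactness is proved for {Z_s : s ≥ s₀} for every s₀ > e (a.s. simultaneously) instead of {Z_s : s > e}, which is a.s. unbounded because ln ln s → 0 as s decreases to e while W_e ≠ 0. *)

theory Defs
  imports "HOL-Probability.Probability" "HOL-Library.Landau_Symbols"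
begin

text \<open>All paths are required to be continuous and to start in \<open>0\<close>, so that the rescaled
  processes below take their values in \<open>C\<^sub>0[0,1]\<close> everywhere. Only \<open>W t\<close> with \<open>t \<ge> 0\<close> matters.\<close>

locale brownian_motion = prob_space M for M :: "'a measure" +
  fixes W :: "real \<Rightarrow> 'a \<Rightarrow> real"
  assumes measurable_W: "\<And>t. 0 \<le> t \<Longrightarrow> W t \<in> borel_measurable M"
    and start_W: "\<And>\<omega>. \<omega> \<in> space M \<Longrightarrow> W 0 \<omega> = 0"
    and continuous_W: "\<And>\<omega>. \<omega> \<in> space M \<Longrightarrow> continuous_on {0..} (\<lambda>t. W t \<omega>)"
    and normal_increments: "\<And>s t. 0 \<le> s \<Longrightarrow> s < t \<Longrightarrow>
          distributed M lborel (\<lambda>\<omega>. W t \<omega> - W s \<omega>)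
            (\<lambda>x. ennreal (normal_density 0 (sqrt (t - s)) x))"
    and indep_increments: "\<And>(\<tau> :: nat \<Rightarrow> real) n. 0 \<le> \<tau> 0 \<Longrightarrow> mono \<tau> \<Longrightarrow>
          indep_vars (\<lambda>_. borel) (\<lambda>i \<omega>. W (\<tau> (Suc i)) \<omega> - W (\<tau> i) \<omega>) {..<n}"

text \<open>A function on \<open>[0,1]\<close> is represented by its extension to the real line which is constant
  on \<open>{..0}\<close> and on \<open>{1..}\<close>. This embeds \<open>C\<^sub>0[0,1]\<close> isometrically, as a closed subspace, into the
  Banach space of bounded continuous functions (see \<open>norm_C0\<close>, \<open>C0_surj\<close> and \<open>closed_C0\<close>).\<close>

definition C0 :: "(real \<Rightarrow>\<^sub>C real) set" where
  "C0 = {w. apply_bcontfun w 0 = 0 \<and>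
            (\<forall>t. apply_bcontfun w t = apply_bcontfun w (max 0 (min 1 t)))}"

text \<open>As \<open>s\<close> decreases to \<open>e\<close>, the denominator tends to \<open>0\<close> while the paths almost surely do not
  vanish on \<open>[0,e]\<close>. So the set of all \<open>Z W s \<omega>\<close> with \<open>s > e\<close> is almost surely unbounded, and
  relative compactness can only hold for \<open>s\<close> bounded away from \<open>e\<close>.\<close>

definition Z :: "(real \<Rightarrow> 'a \<Rightarrow> real) \<Rightarrow> real \<Rightarrow> 'a \<Rightarrow> (real \<Rightarrow>\<^sub>C real)" where
  "Z W s \<omega> = Bcontfun (\<lambda>t. W (s * max 0 (min 1 t)) \<omega> / sqrt (2 * s * ln (ln s)))"

definition absolutely_continuous_on_Icc :: "real \<Rightarrow> real \<Rightarrow> (real \<Rightarrow> real) \<Rightarrow> bool" where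
  "absolutely_continuous_on_Icc a b f \<longleftrightarrow>
     (\<forall>e>0. \<exists>\<delta>>0. \<forall>n::nat. \<forall>u v :: nat \<Rightarrow> real.
        (\<forall>i<n. a \<le> u i \<and> u i \<le> v i \<and> v i \<le> b) \<and>
        disjoint_family_on (\<lambda>i. {u i<..<v i}) {..<n} \<and>
        (\<Sum>i<n. v i - u i) < \<delta>
        \<longrightarrow> (\<Sum>i<n. \<bar>f (v i) - f (u i)\<bar>) < e)"

text \<open>The energy is an extended nonnegative integral, so the bound includes its finiteness. The
  values of \<^const>\<open>deriv\<close> at the null set of points where \<open>w\<close> is not differentiable are
  immaterial.\<close>

definition K :: "real \<Rightarrow> (real \<Rightarrow>\<^sub>C real) set" where
  "K r = {w \<in> C0. absolutely_continuous_on_Icc 0 1 (apply_bcontfun w) \<and>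
     (\<integral>\<^sup>+ t\<in>{0..1}. ennreal ((deriv (apply_bcontfun w) t)\<^sup>2) \<partial>lebesgue) / 2 \<le> ennreal r}"

definition limit_points :: "(real \<Rightarrow> 'b :: topological_space) \<Rightarrow> 'b set" where
  "limit_points f = {w. \<exists>\<sigma> :: nat \<Rightarrow> real. (\<forall>n. exp 1 < \<sigma> n) \<and>
     filterlim \<sigma> at_top sequentially \<and> (\<lambda>n. f (\<sigma> n)) \<longlonglongrightarrow> w}"

definition zeta :: "real \<Rightarrow> real" where
  "zeta s = (\<Sum>n. 1 / real (Suc n) powr s)"

definition ecard :: "'b set \<Rightarrow> enat" where
  "ecard A = (if finite A then enat (card A) else \<infinity>)"

definition exceed_set :: "(real \<Rightarrow> 'a \<Rightarrow> real) \<Rightarrow> real \<Rightarrow> real \<Rightarrow> real \<Rightarrow> 'a \<Rightarrow> nat set" where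
  "exceed_set W q \<eta> \<epsilon> \<omega> = {n. exp 1 < q ^ n \<and> \<epsilon> < infdist (Z W (q ^ n) \<omega>) (K (1/2 + \<eta>))}"

definition exceed_num :: "(real \<Rightarrow> 'a \<Rightarrow> real) \<Rightarrow> real \<Rightarrow> real \<Rightarrow> real \<Rightarrow> 'a \<Rightarrow> enat" where
  "exceed_num W q \<eta> \<epsilon> \<omega> = ecard (exceed_set W q \<eta> \<epsilon> \<omega>)"

text \<open>The supremum of the empty set in \<^typ>\<open>enat\<close> is \<open>0\<close>.\<close>

definition exceed_sup :: "(real \<Rightarrow> 'a \<Rightarrow> real) \<Rightarrow> real \<Rightarrow> real \<Rightarrow> real \<Rightarrow> 'a \<Rightarrow> enat" where
  "exceed_sup W q \<eta> \<epsilon> \<omega> = Sup (enat ` exceed_set W q \<eta> \<epsilon> \<omega>)"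

definition bconst :: "real \<Rightarrow> real \<Rightarrow> real" where
  "bconst \<eta> \<epsilon> = 2 * exp 2 * exp ((4 + 8 * \<eta>) / \<epsilon>\<^sup>2)"

text \<open>\<open>eps_seq\<close> solves \<open>bconst \<eta> \<epsilon> / (n * ln q) powr (1 + 2 * vartheta) =
  1 / (n * ln (n + 1) powr (1 + \<theta>))\<close> for \<open>\<epsilon>\<close>, wherever \<open>eps_denom\<close> is positive.\<close>

definition eps_denom :: "real \<Rightarrow> real \<Rightarrow> real \<Rightarrow> nat \<Rightarrow> real" where
  "eps_denom vartheta \<theta> q n =
     ln (ln q powr (1 + 2 * vartheta) / (2 * exp 2)) +
     ln (real n powr (2 * vartheta) / ln (real n + 1) powr (1 + \<theta>))"

definition eps_seq :: "real \<Rightarrow> real \<Rightarrow> real \<Rightarrow> real \<Rightarrow> nat \<Rightarrow> real" where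
  "eps_seq \<eta> vartheta \<theta> q n = sqrt ((4 + 8 * \<eta>) / eps_denom vartheta \<theta> q n)"

lemma C0_surj:
  fixes f :: "real \<Rightarrow> real"
  assumes "continuous_on {0..1} f" "f 0 = 0"
  obtains w where "w \<in> C0" "\<And>t. apply_bcontfun w t = f (max 0 (min 1 t))"
proof -
  let ?g = "\<lambda>t::real. f (max 0 (min 1 t))"
  have "continuous_on UNIV ?g"
    by (rule continuous_on_compose2[OF assms(1)]) (auto intro!: continuous_intros)
  moreover have "bounded (range ?g)"
  proof (rule bounded_subset)
    show "bounded (f ` {0..1})"
      using assms(1) compact_continuous_image compact_imp_bounded by blast
  qed auto
  ultimately have *: "apply_bcontfun (Bcontfun ?g) = ?g"
    by (intro Bcontfun_inverse) (auto simp: bcontfun_def)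
  show ?thesis
    by (rule that[of "Bcontfun ?g"]) (auto simp: C0_def * assms)
qed

lemma norm_C0:
  assumes "w \<in> C0"
  shows "norm w = (SUP t\<in>{0..1}. \<bar>apply_bcontfun w t\<bar>)"
proof -
  have "range (\<lambda>t. \<bar>apply_bcontfun w t\<bar>) = (\<lambda>t. \<bar>apply_bcontfun w t\<bar>) ` {0..1}"
  proof
    show "range (\<lambda>t. \<bar>apply_bcontfun w t\<bar>) \<subseteq> (\<lambda>t. \<bar>apply_bcontfun w t\<bar>) ` {0..1}"
    proof safe
      fix t
      have "\<bar>apply_bcontfun w t\<bar> = \<bar>apply_bcontfun w (max 0 (min 1 t))\<bar>"
        using assms unfolding C0_def by fastforce
      then show "\<bar>apply_bcontfun w t\<bar> \<in> (\<lambda>t. \<bar>apply_bcontfun w t\<bar>) ` {0..1}"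
        by (rule image_eqI) auto
    qed
  qed auto
  then show ?thesis
    by (simp add: norm_bcontfun_def dist_bcontfun.rep_eq zero_bcontfun.rep_eq)
qed

lemma closed_C0: "closed C0"
proof -
  have cont: "continuous_on UNIV (\<lambda>w :: real \<Rightarrow>\<^sub>C real. apply_bcontfun w t)" for t
    by (rule continuous_on_subset[OF _ subset_UNIV], unfold continuous_on_iff)
       (meson dist_bounded le_less_trans)
  have "closed {w :: real \<Rightarrow>\<^sub>C real. apply_bcontfun w t = apply_bcontfun w s}" for s t
    by (rule closed_Collect_eq[OF cont cont])
  moreover have "closed {w :: real \<Rightarrow>\<^sub>C real. apply_bcontfun w 0 = 0}"
    by (rule closed_Collect_eq[OF cont continuous_on_const])
  ultimately show ?thesis
    unfolding C0_def by (intro closed_Collect_conj closed_Collect_all)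
qed

context brownian_motion
begin

lemma apply_Z:
  assumes "\<omega> \<in> space M" "0 \<le> s"
  shows "apply_bcontfun (Z W s \<omega>) = (\<lambda>t. W (s * max 0 (min 1 t)) \<omega> / sqrt (2 * s * ln (ln s)))"
    and "Z W s \<omega> \<in> C0"
proof -
  let ?f = "\<lambda>t::real. W (s * t) \<omega> / sqrt (2 * s * ln (ln s))"
  have "continuous_on {0..1} (\<lambda>t. W (s * t) \<omega>)"
    by (rule continuous_on_compose2[OF continuous_W[OF assms(1)]])
       (use assms(2) in \<open>auto intro!: continuous_intros\<close>)
  then have "continuous_on {0..1} ?f"
    unfolding divide_inverse by (intro continuous_intros)
  then obtain w where w: "w \<in> C0" "\<And>t. apply_bcontfun w t = ?f (max 0 (min 1 t))"
    using C0_surj[of ?f] start_W[OF assms(1)] by auto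
  then have "w = Z W s \<omega>"
    unfolding Z_def by (metis (no_types, lifting) apply_bcontfun_inverse ext)
  with w show "apply_bcontfun (Z W s \<omega>) = (\<lambda>t. W (s * max 0 (min 1 t)) \<omega> / sqrt (2 * s * ln (ln s)))"
    and "Z W s \<omega> \<in> C0" by auto
qed

end

end

(* A function w in C0 lies in K r iff all its dyadic energies are at most 2 r. Hence K r is compact,
   and a polygon belongs to it as soon as its increments x satisfy a bound on their sum of squares.
   Let the polygon of y have distance more than eps from K r and let the polygon of x have norm at
   most eps. Then the polygon of y - x is not in K r, so x and y are far apart. For Gaussian x the
   second condition has probability close to 1 (Kolmogorov), and the Prekopa-Leindler inequality
   with a free weight s turns this into concentration. With sigma^2 the variance of Z_s(1), the
   weight 8 sigma^2/eps^2 gives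
     P(d(Z_s, K(1/2 + eta)) > eps) <= b / (ln s)^(1 + 2 eta)
   with exactly the constant b of the theorem. Parts (2) and (3) follow by summing over s = q^n, with
   Markov's inequality for the number of exceedances and partial summation for the last one.

   In part (1), the first Borel-Cantelli lemma along geometric sequences and Brownian scaling in
   between show that Z_s is attracted by the compact set K(1/2). Conversely, let w be in K(1/2) and
   beta < 1. The increments of Z_s at s = m^(n+1) over the grid of mesh 1/m, except for the first
   cell, are independent for different n, and they are close to those of beta w with probability at
   least of order 1/n. By the second Borel-Cantelli lemma this happens infinitely often. *)

theory Submission
  imports Defs "HOL-Complex_Analysis.Great_Picard" "HOL-Real_Asymp.Real_Asymp"
begin

section \<open>Absolutely continuous functions\<close>

text \<open>The tail bound needs one explicit constant for all s, so the concentration inequality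
  must be sharp in the exponent and cheap in the prefactor. With r = 1/2 + \<eta> the two sets of
  standard normal increments have squared distance at least T = 2 r / \<sigma>^2. A weight s
  replaces the ideal exp (- T / 2) by exp (- (1 - s) T / 2), a loss of exp (s T / 2), and costs the
  power - (1 - s) / s of the probability p of the small paths. The weight makes the loss equal to
  exp ((4 + 8 \<eta>) / \<epsilon>^2), free of \<sigma>; as 1 - p <= \<sigma>^2 / \<epsilon>^2, the
  power of p stays below an absolute constant. If the weight is not below 1, the claimed bound is at
  least 1 anyway. Nothing depends on the dyadic level, so finite-dimensional Gaussian measures
  suffice and the path enters through a limit of events.

  K is defined by \<open>deriv\<close> and a Lebesgue integral, while all later steps use dyadic
  energies. The bridge is the differentiability almost everywhere of absolutely continuous functions
  and the fundamental theorem of calculus for them.\<close>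

text \<open>Slopes over intervals that straddle x replace one-sided difference quotients: the set is
  then a countable intersection of open sets for every f, and its points are covered in the Vitali
  sense by intervals of slope above \<beta>. Lower slopes of f are treated as upper slopes of -
  f.\<close>

definition steep_points :: "(real \<Rightarrow> real) \<Rightarrow> real \<Rightarrow> real set" where
  "steep_points f \<beta> = {x. \<forall>d>0. \<exists>u v. u < x \<and> x < v \<and> v - u < d \<and> \<beta> * (v - u) < f v - f u}"

lemma steep_points_borel: "steep_points f \<beta> \<in> sets borel"
proof -
  define U where "U n = (\<Union>(u, v) \<in> {(u, v). v - u < inverse (real (Suc n)) \<and> \<beta> * (v - u) < f v - f u}. {u<..<v})" for n
  have "open (U n)" for n
    unfolding U_def by (intro open_UN) auto
  moreover have "steep_points f \<beta> = (\<Inter>n. U n)"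
  proof (intro equalityI subsetI)
    fix x assume x: "x \<in> (\<Inter>n. U n)"
    show "x \<in> steep_points f \<beta>"
      unfolding steep_points_def
    proof (intro CollectI allI impI)
      fix d :: real assume "0 < d"
      then obtain n where n: "inverse (real (Suc n)) < d"
        using reals_Archimedean by blast
      from x have "x \<in> U n" by auto
      then show "\<exists>u v. u < x \<and> x < v \<and> v - u < d \<and> \<beta> * (v - u) < f v - f u"
        unfolding U_def using n by fastforce
    qed
  next
    fix x assume x: "x \<in> steep_points f \<beta>"
    have "x \<in> U n" for n
    proof -
      from x have "\<exists>u v. u < x \<and> x < v \<and> v - u < inverse (real (Suc n)) \<and> \<beta> * (v - u) < f v - f u"
        unfolding steep_points_def using inverse_positive_iff_positive[of "real (Suc n)"] by simp
      then show ?thesis unfolding U_def by fastforce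
    qed
    then show "x \<in> (\<Inter>n. U n)" by auto
  qed
  ultimately show ?thesis by auto
qed

lemma steep_points_antimono: "\<beta> \<le> \<beta>' \<Longrightarrow> steep_points f \<beta>' \<subseteq> steep_points f \<beta>"
proof
  fix x assume b: "\<beta> \<le> \<beta>'" and x: "x \<in> steep_points f \<beta>'"
  show "x \<in> steep_points f \<beta>"
    unfolding steep_points_def
  proof (intro CollectI allI impI)
    fix d :: real assume "0 < d"
    then obtain u v where uv: "u < x" "x < v" "v - u < d" "\<beta>' * (v - u) < f v - f u"
      using x unfolding steep_points_def by blast
    have "\<beta> * (v - u) \<le> \<beta>' * (v - u)"
      using b uv by (intro mult_right_mono) auto
    then have "\<beta> * (v - u) < f v - f u" using uv(4) by (rule le_less_trans)
    with uv(1-3) show "\<exists>u v. u < x \<and> x < v \<and> v - u < d \<and> \<beta> * (v - u) < f v - f u"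
      by blast
  qed
qed

lemma steep_points_linear_shift:
  "steep_points (\<lambda>x. f x - c * x) \<beta> = steep_points f (\<beta> + c)"
  unfolding steep_points_def by (auto simp: algebra_simps)

text \<open>The intervals are written as balls so that the Vitali covering theorem applies. It
  yields countably many disjoint ones; spheres are null, so the open balls cover E up to a null set,
  and by continuity from above finitely many of them leave out less than e.\<close>

lemma steep_points_Vitali:
  assumes E: "E \<in> lmeasurable" "E \<subseteq> steep_points f \<beta>" and G: "open G" "E \<subseteq> G" and e: "0 < e"
  obtains J where "finite J" "J division_of \<Union>J" "\<Union>J \<subseteq> G"
    "\<And>k. k \<in> J \<Longrightarrow> \<exists>u v. u < v \<and> k = {u..v} \<and> \<beta> * (v - u) < f v - f u"
    "measure lebesgue (E - \<Union>(interior ` J)) < e"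
proof -
  define K where "K = {(c, r). 0 < r \<and> cball c r \<subseteq> G \<and> \<beta> * (2 * r) < f (c + r) - f (c - r)}"
  have cov: "\<exists>i. i \<in> K \<and> x \<in> cball (fst i) (snd i) \<and> snd i < d" if x: "x \<in> E" and d: "0 < d" for x d
  proof -
    obtain t where t: "0 < t" "cball x t \<subseteq> G"
      using G x open_contains_cball by blast
    have "0 < min d t" using d t by simp
    then obtain u v where uv: "u < x" "x < v" "v - u < min d t" "\<beta> * (v - u) < f v - f u"
      using E(2) x unfolding steep_points_def by blast
    define c r where "c = (u + v) / 2" and "r = (v - u) / 2"
    have ur: "u = c - r" "v = c + r" unfolding c_def r_def by (auto simp: field_simps)
    have r: "0 < r" "2 * r < d" "2 * r < t" using uv ur by linarith+
    have "cball c r \<subseteq> cball x t"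
      using uv r ur by (auto simp: cball_eq_atLeastAtMost)
    then have "cball c r \<subseteq> G" using t(2) by blast
    moreover have "\<beta> * (2 * r) < f (c + r) - f (c - r)"
      using uv(4) unfolding ur by simp
    ultimately have "(c, r) \<in> K" using r(1) unfolding K_def by blast
    moreover have "x \<in> cball c r"
      using uv ur by (auto simp: cball_eq_atLeastAtMost)
    ultimately show ?thesis using r by (intro exI[of _ "(c, r)"]) auto
  qed
  obtain C where C: "countable C" "C \<subseteq> K"
     "pairwise (\<lambda>i j. disjnt (cball (fst i) (snd i)) (cball (fst j) (snd j))) C"
     "negligible (E - (\<Union>i \<in> C. cball (fst i) (snd i)))"
    using Vitali_covering_theorem_cballs[of K snd E fst] cov unfolding K_def by (auto simp: case_prod_beta)
  have negl: "negligible (E - (\<Union>i\<in>C. ball (fst i) (snd i)))"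
  proof (rule negligible_subset)
    show "negligible ((E - (\<Union>i \<in> C. cball (fst i) (snd i))) \<union> (\<Union>i\<in>C. sphere (fst i) (snd i)))"
    proof (intro negligible_Un negligible_countable_Union)
      show "negligible S" if "S \<in> (\<lambda>i. sphere (fst i) (snd i)) ` C" for S
        using that negligible_sphere by auto
    qed (use C in auto)
    show "E - (\<Union>i\<in>C. ball (fst i) (snd i)) \<subseteq> (E - (\<Union>i \<in> C. cball (fst i) (snd i))) \<union> (\<Union>i\<in>C. sphere (fst i) (snd i))"
      by (fastforce simp: less_eq_real_def)
  qed
  define F where "F n = {i\<in>C. to_nat_on C i \<le> n}" for n
  have finF: "finite (F n)" for n
    unfolding F_def using C(1) inj_on_to_nat_on[OF C(1)]
    by (intro finite_imageD[of "to_nat_on C"]) (auto intro: finite_subset[of _ "{..n}"] inj_on_subset)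
  define D where "D n = E - (\<Union>i\<in>F n. ball (fst i) (snd i))" for n
  have Dm: "D n \<in> lmeasurable" for n
    unfolding D_def using E finF[of n] by (intro fmeasurable_Diff) auto
  have "(\<lambda>n. measure lebesgue (D n)) \<longlonglongrightarrow> measure lebesgue (\<Inter>n. D n)"
  proof (rule Lim_measure_decseq)
    show "decseq D" unfolding D_def F_def decseq_def by fastforce
    show "emeasure lebesgue (D i) \<noteq> \<infinity>" for i
      using Dm[of i] fmeasurableD2 by (metis infinity_ennreal_def)
  qed (use Dm in auto)
  moreover have "(\<Inter>n. D n) = E - (\<Union>i\<in>C. ball (fst i) (snd i))"
    unfolding D_def F_def by auto
  ultimately have "(\<lambda>n. measure lebesgue (D n)) \<longlonglongrightarrow> 0"
    using negl negligible_imp_measure0 by metis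
  then have "eventually (\<lambda>n. measure lebesgue (D n) < e) sequentially"
    using e order_tendstoD(2) by blast
  then obtain n where n: "measure lebesgue (D n) < e"
    using eventually_happens' sequentially_bot by blast
  define cb where "cb = (\<lambda>i::real\<times>real. cball (fst i) (snd i))"
  show ?thesis
  proof (rule that[of "cb ` F n"])
    show "finite (cb ` F n)" using finF by auto
    have FC: "F n \<subseteq> C" "F n \<subseteq> K" using C unfolding F_def by auto
    have int: "interior (cb i) = ball (fst i) (snd i)" for i
      unfolding cb_def by simp
    show "cb ` F n division_of \<Union>(cb ` F n)"
    proof (rule division_ofI)
      show "finite (cb ` F n)" using finF by auto
    next
      fix k assume "k \<in> cb ` F n"
      then obtain i where i: "i \<in> F n" "k = cb i" by auto
      then have "0 < snd i" using FC unfolding K_def by auto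
      then show "k \<noteq> {}"
        using i unfolding cb_def by auto
      show "\<exists>a b. k = cbox a b"
        using i unfolding cb_def cball_eq_atLeastAtMost box_real(2)[symmetric] by blast
    next
      fix k1 k2 assume "k1 \<in> cb ` F n" "k2 \<in> cb ` F n" "k1 \<noteq> k2"
      then obtain i j where ij: "i \<in> F n" "k1 = cb i" "j \<in> F n" "k2 = cb j" "i \<noteq> j" by auto
      then have "disjnt (cball (fst i) (snd i)) (cball (fst j) (snd j))"
        using C(3) FC unfolding pairwise_def by blast
      then show "interior k1 \<inter> interior k2 = {}"
        using ij interior_subset[of k1] interior_subset[of k2] unfolding disjnt_def cb_def by blast
    qed auto
    show "\<Union>(cb ` F n) \<subseteq> G" using FC(2) unfolding K_def cb_def by fastforce
    show "\<exists>u v. u < v \<and> k = {u..v} \<and> \<beta> * (v - u) < f v - f u" if "k \<in> cb ` F n" for k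
    proof -
      from that obtain i where i: "i \<in> F n" "k = cb i" by auto
      then have "0 < snd i" "\<beta> * (2 * snd i) < f (fst i + snd i) - f (fst i - snd i)" using FC unfolding K_def by auto
      then show ?thesis using i unfolding cb_def cball_eq_atLeastAtMost
        by (intro exI[of _ "fst i - snd i"] exI[of _ "fst i + snd i"]) auto
    qed
    show "measure lebesgue (E - \<Union>(interior ` cb ` F n)) < e"
      using n unfolding D_def by (simp add: int image_image)
  qed
qed

section \<open>Absolute continuity along finite families of intervals and divisions\<close>

text \<open>The definition speaks of families indexed by initial segments of the naturals. Members
  of a division serve as their own indices, and tagged intervals as pairs, hence the free index
  type.\<close>

lemma absolutely_continuous_on_Icc_finite:
  assumes "absolutely_continuous_on_Icc a b f" "0 < e"
  obtains \<delta> where "0 < \<delta>"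
    "\<And>(I :: 'i set) u v. finite I \<Longrightarrow> (\<And>i. i \<in> I \<Longrightarrow> a \<le> u i \<and> u i \<le> v i \<and> v i \<le> b) \<Longrightarrow>
      disjoint_family_on (\<lambda>i. {u i<..<v i}) I \<Longrightarrow> (\<Sum>i\<in>I. v i - u i) < \<delta> \<Longrightarrow>
      (\<Sum>i\<in>I. \<bar>f (v i) - f (u i)\<bar>) < e"
proof -
  have "\<exists>\<delta>>0. \<forall>n u v. (\<forall>i<n::nat. a \<le> u i \<and> u i \<le> v i \<and> v i \<le> b) \<and>
      disjoint_family_on (\<lambda>i. {u i<..<v i}) {..<n} \<and> (\<Sum>i<n. v i - u i) < \<delta>
      \<longrightarrow> (\<Sum>i<n. \<bar>f (v i) - f (u i)\<bar>) < e"
    using assms unfolding absolutely_continuous_on_Icc_def by simp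
  then obtain \<delta> where \<delta>: "0 < \<delta>" and ac: "\<And>n u v.
        (\<forall>i<n::nat. a \<le> u i \<and> u i \<le> v i \<and> v i \<le> b) \<and>
        disjoint_family_on (\<lambda>i. {u i<..<v i}) {..<n} \<and>
        (\<Sum>i<n. v i - u i) < \<delta>
        \<Longrightarrow> (\<Sum>i<n. \<bar>f (v i) - f (u i)\<bar>) < e"
    by auto
  show ?thesis
  proof (rule that[OF \<delta>])
    fix I :: "'i set" and u v :: "'i \<Rightarrow> real"
    assume I: "finite I" and uv: "\<And>i. i \<in> I \<Longrightarrow> a \<le> u i \<and> u i \<le> v i \<and> v i \<le> b"
      and disj: "disjoint_family_on (\<lambda>i. {u i<..<v i}) I" and small: "(\<Sum>i\<in>I. v i - u i) < \<delta>"
    obtain h where "bij_betw h {0..<card I} I"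
      using ex_bij_betw_nat_finite[OF I] by blast
    then have h: "bij_betw h {..<card I} I" by (simp add: lessThan_atLeast0)
    have "(\<Sum>i\<in>I. \<bar>f (v i) - f (u i)\<bar>) = (\<Sum>i<card I. \<bar>f (v (h i)) - f (u (h i))\<bar>)"
      by (rule sum.reindex_bij_betw[OF h, symmetric])
    also have "\<dots> < e"
    proof (rule ac, intro conjI allI impI)
      fix i assume "i < card I"
      then have "h i \<in> I" using h by (auto simp: bij_betw_def)
      then show "a \<le> u (h i)" "u (h i) \<le> v (h i)" "v (h i) \<le> b" using uv by auto
    next
      show "disjoint_family_on (\<lambda>i. {u (h i)<..<v (h i)}) {..<card I}"
        unfolding disjoint_family_on_def
      proof (intro ballI impI)
        fix i j assume ij: "i \<in> {..<card I}" "j \<in> {..<card I}" "i \<noteq> j"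
        then have "h i \<in> I" "h j \<in> I" "h i \<noteq> h j" using h by (auto simp: bij_betw_def inj_on_def)
        then show "{u (h i)<..<v (h i)} \<inter> {u (h j)<..<v (h j)} = {}"
          using disj unfolding disjoint_family_on_def by blast
      qed
      show "(\<Sum>i<card I. v (h i) - u (h i)) < \<delta>"
        using small sum.reindex_bij_betw[OF h, of "\<lambda>i. v i - u i"] by simp
    qed
    finally show "(\<Sum>i\<in>I. \<bar>f (v i) - f (u i)\<bar>) < e" .
  qed
qed

lemma absolutely_continuous_on_Icc_division:
  assumes "absolutely_continuous_on_Icc a b f" "0 < e"
  obtains \<delta> where "0 < \<delta>"
    "\<And>Q. Q division_of \<Union>Q \<Longrightarrow> \<Union>Q \<subseteq> {a..b} \<Longrightarrow> (\<Sum>k\<in>Q. measure lborel k) < \<delta> \<Longrightarrow>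
      (\<Sum>k\<in>Q. \<bar>f (Sup k) - f (Inf k)\<bar>) < e"
proof -
  obtain \<delta> where \<delta>: "0 < \<delta>" and ac: "\<And>(I :: real set set) u v. finite I \<Longrightarrow> (\<And>i. i \<in> I \<Longrightarrow> a \<le> u i \<and> u i \<le> v i \<and> v i \<le> b) \<Longrightarrow>
      disjoint_family_on (\<lambda>i. {u i<..<v i}) I \<Longrightarrow> (\<Sum>i\<in>I. v i - u i) < \<delta> \<Longrightarrow>
      (\<Sum>i\<in>I. \<bar>f (v i) - f (u i)\<bar>) < e"
    using absolutely_continuous_on_Icc_finite[OF assms] by blast
  show ?thesis
  proof (rule that[OF \<delta>])
    fix Q assume Q: "Q division_of \<Union>Q" "\<Union>Q \<subseteq> {a..b}" "(\<Sum>k\<in>Q. measure lborel k) < \<delta>"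
    note D = division_ofD[OF Q(1)]
    have box: "k = {Inf k..Sup k} \<and> Inf k \<le> Sup k \<and> a \<le> Inf k \<and> Sup k \<le> b \<and> measure lborel k = Sup k - Inf k" if kQ: "k \<in> Q" for k
    proof -
      obtain u v where k: "k = {u..v}" using D(4)[OF kQ] by (auto simp: cbox_interval)
      moreover have "u \<le> v" using D(3)[OF kQ] k by auto
      moreover have "k \<subseteq> {a..b}" using kQ Q(2) by auto
      ultimately show ?thesis by (auto simp: subset_iff)
    qed
    show "(\<Sum>k\<in>Q. \<bar>f (Sup k) - f (Inf k)\<bar>) < e"
    proof (rule ac[OF D(1)])
      show "disjoint_family_on (\<lambda>k. {Inf k<..<Sup k}) Q"
        unfolding disjoint_family_on_def
      proof (intro ballI impI)
        fix k l assume kl: "k \<in> Q" "l \<in> Q" "k \<noteq> l"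
        have "interior k = {Inf k<..<Sup k}" "interior l = {Inf l<..<Sup l}"
          using box[OF kl(1)] box[OF kl(2)] interior_atLeastAtMost_real by metis+
        then show "{Inf k<..<Sup k} \<inter> {Inf l<..<Sup l} = {}"
          using D(5)[OF kl] by simp
      qed
      have "(\<Sum>k\<in>Q. Sup k - Inf k) = (\<Sum>k\<in>Q. measure lborel k)" using box by (intro sum.cong) auto
      then show "(\<Sum>k\<in>Q. Sup k - Inf k) < \<delta>" using Q by simp
    qed (use box in auto)
  qed
qed

text \<open>A division carries no tags; an arbitrary choice of them gives access to the telescoping
  sum over tagged divisions.\<close>

lemma division_sum_increments:
  fixes f :: "real \<Rightarrow> real"
  assumes "a \<le> b" "q division_of {a..b}"
  shows "(\<Sum>k\<in>q. f (Sup k) - f (Inf k)) = f b - f a"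
proof -
  have q: "q division_of cbox a b" using assms by (simp add: cbox_interval)
  obtain p where p: "p tagged_division_of cbox a b" "q = snd ` p" "inj_on snd p"
  proof -
    define p where "p = (\<lambda>k. (SOME x. x \<in> k, k)) ` q"
    have "p tagged_division_of cbox a b"
    proof (rule tagged_division_ofI)
      show "finite p" using q by (auto simp: p_def)
      show "\<And>x K. (x, K) \<in> p \<Longrightarrow> x \<in> K" "\<And>x K. (x, K) \<in> p \<Longrightarrow> K \<subseteq> cbox a b"
         "\<And>x K. (x, K) \<in> p \<Longrightarrow> \<exists>a b. K = cbox a b"
        using division_ofD[OF q] by (auto simp: p_def some_in_eq)
      show "interior K1 \<inter> interior K2 = {}" if "(x1, K1) \<in> p" "(x2, K2) \<in> p" "(x1, K1) \<noteq> (x2, K2)" for x1 K1 x2 K2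
        using that division_ofD(5)[OF q] by (auto simp: p_def)
      show "\<Union>{K. \<exists>x. (x, K) \<in> p} = cbox a b"
        using division_ofD(6)[OF q] by (simp add: p_def image_iff)
    qed
    then show ?thesis
      by (rule that) (auto simp: p_def image_image inj_on_def)
  qed
  have "(\<Sum>k\<in>q. f (Sup k) - f (Inf k)) = (\<Sum>(x,k)\<in>p. f (Sup k) - f (Inf k))"
    using p(2,3) by (simp add: sum.reindex case_prod_beta)
  then show ?thesis
    using additive_tagged_division_1[OF assms(1), of p f] p(1) by (simp add: cbox_interval)
qed

section \<open>Differentiability almost everywhere\<close>

text \<open>If the set had measure \<mu> > 0, almost all of it could be packed with intervals P of
  slope below - \<kappa>, and the inside of P again with intervals J on which g increases. What J
  leaves of P is short, so g changes little there by absolute continuity. Hence g hardly decreases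
  over P, although it must drop by \<kappa> times the length of P.\<close>

lemma absolutely_continuous_on_Icc_null_slopes:
  assumes ac: "absolutely_continuous_on_Icc a b g" and \<kappa>: "0 < \<kappa>"
  shows "negligible ({a<..<b} \<inter> steep_points (\<lambda>x. - g x) \<kappa> \<inter> steep_points g 0)"
proof -
  define E where "E = {a<..<b} \<inter> steep_points (\<lambda>x. - g x) \<kappa> \<inter> steep_points g 0"
  have Em: "E \<in> lmeasurable"
    unfolding E_def
    by (intro bounded_set_imp_lmeasurable bounded_Int)
       (auto intro!: sets_completionI_sets sets.Int steep_points_borel)
  have "measure lebesgue E = 0"
  proof (rule ccontr)
    assume "measure lebesgue E \<noteq> 0"
    define \<mu> where "\<mu> = measure lebesgue E"
    have \<mu>: "0 < \<mu>" using \<open>measure lebesgue E \<noteq> 0\<close> unfolding \<mu>_def by (simp add: zero_less_measure_iff)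
    have ab: "a \<le> b" using \<mu> unfolding \<mu>_def E_def by (cases "a \<le> b") auto
    \<comment> \<open>The drop that slope - \<kappa> forces over the length \<mu> / 2, which P will
      be shown to have at least.\<close>
    define e where "e = \<kappa> * \<mu> / 2"
    have "0 < e" using \<mu> \<kappa> unfolding e_def by simp
    then obtain \<delta> where \<delta>: "0 < \<delta>" and var: "\<And>Q. Q division_of \<Union>Q \<Longrightarrow> \<Union>Q \<subseteq> {a..b} \<Longrightarrow> (\<Sum>k\<in>Q. measure lborel k) < \<delta> \<Longrightarrow>
        (\<Sum>k\<in>Q. \<bar>g (Sup k) - g (Inf k)\<bar>) < e"
      using absolutely_continuous_on_Icc_division[OF ac \<open>0 < e\<close>] by blast
    \<comment> \<open>With this t the part of P outside J has length below 3 * t < \<delta>, and J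
      still has length at least \<mu> / 2.\<close>
    define t where "t = min (\<delta> / 4) (\<mu> / 4)"
    have t: "0 < t" "t \<le> \<delta> / 4" "t \<le> \<mu> / 4" unfolding t_def using \<delta> \<mu> by auto
    obtain G0 where G0: "open G0" "E \<subseteq> G0" "(G0 - E) \<in> lmeasurable" "emeasure lebesgue (G0 - E) < ennreal t"
      using sets_lebesgue_outer_open[of E t] Em t by auto
    define G where "G = G0 \<inter> {a<..<b}"
    have G: "open G" "E \<subseteq> G" "G \<subseteq> {a<..<b}" using G0 unfolding G_def E_def by auto
    have Gm: "G \<in> lmeasurable" using G bounded_subset[OF _ G(3)] by (intro lmeasurable_open) auto
    have "measure lebesgue (G - E) \<le> measure lebesgue (G0 - E)"
      using Gm Em G0 by (intro measure_mono_fmeasurable) (auto simp: G_def)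
    also have "\<dots> < t"
      using G0(4) t by (simp add: emeasure_eq_measure2[OF G0(3)] ennreal_less_iff)
    finally have "measure lebesgue (G - E) < t" .
    moreover have "measure lebesgue (G - E) = measure lebesgue G - \<mu>"
      unfolding \<mu>_def using Gm Em G by (simp add: measurable_measure_Diff)
    ultimately have Gle: "measure lebesgue G < \<mu> + t" by simp
    obtain P where P: "finite P" "P division_of \<Union>P" "\<Union>P \<subseteq> G"
      "\<And>k. k \<in> P \<Longrightarrow> \<exists>u v. u < v \<and> k = {u..v} \<and> \<kappa> * (v - u) < - g v - - g u"
      "measure lebesgue (E - \<Union>(interior ` P)) < t"
      using steep_points_Vitali[of E "\<lambda>x. - g x" \<kappa> G t] Em G t unfolding E_def by blast
    define G' where "G' = \<Union>(interior ` P)"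
    have G': "open G'" "G' \<subseteq> \<Union>P" unfolding G'_def using interior_subset by fastforce+
    have G'm: "G' \<in> lmeasurable"
    proof (intro lmeasurable_open G'(1))
      have "G' \<subseteq> {a<..<b}" using G' P(3) G(3) by blast
      then show "bounded G'" by (rule bounded_subset[rotated]) simp
    qed
    obtain J where J: "finite J" "J division_of \<Union>J" "\<Union>J \<subseteq> G'"
      "\<And>k. k \<in> J \<Longrightarrow> \<exists>u v. u < v \<and> k = {u..v} \<and> 0 * (v - u) < g v - g u"
      "measure lebesgue ((E \<inter> G') - \<Union>(interior ` J)) < t"
      using steep_points_Vitali[of "E \<inter> G'" g 0 G' t] Em G' G'm t unfolding E_def by blast
    have PM: "(\<Sum>k\<in>R. measure lborel k) = measure lebesgue (\<Union>R)" if "R division_of \<Union>R" for R :: "real set set"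
    proof -
      note D = division_ofD[OF that]
      have "measure lebesgue (\<Union>R) = (\<Sum>k\<in>R. measure lebesgue k)"
      proof (rule measure_negligible_finite_Union)
        show "k \<in> lmeasurable" if "k \<in> R" for k using D(4)[OF that] by auto
        show "pairwise (\<lambda>S T. negligible (S \<inter> T)) R"
        proof (rule pairwiseI)
          fix k1 k2 assume k: "k1 \<in> R" "k2 \<in> R" "k1 \<noteq> k2"
          then obtain a1 b1 a2 b2 where "k1 = cbox a1 b1" "k2 = cbox a2 b2" using D(4) by metis
          then have "convex (k1 \<inter> k2)" "interior (k1 \<inter> k2) = {}" using D(5)[OF k] by (auto intro: convex_Int)
          then show "negligible (k1 \<inter> k2)" using negligible_convex_interior by blast
        qed
      qed (use D in auto)
      also have "\<dots> = (\<Sum>k\<in>R. measure lborel k)"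
        proof (intro sum.cong refl measure_completion)
        show "k \<in> sets lborel" if "k \<in> R" for k using D(4)[OF that] by auto
      qed
      finally show ?thesis by simp
    qed
    have Pab: "\<Union>P \<subseteq> {a..b}" using P(3) G(3) by force
    \<comment> \<open>P and \<open>R \<union> J\<close> are both extended to divisions of [a, b],
      with the same R outside P. Comparing the telescoping sums over q1 and q2 isolates Q, the part
      of P that J leaves out.\<close>
    obtain q1 where q1: "P \<subseteq> q1" "q1 division_of cbox a b"
      using partial_division_extend_interval[OF P(2)] Pab by (metis cbox_interval)
    define R where "R = q1 - P"
    have RJ: "R \<union> J division_of \<Union>(R \<union> J)"
    proof (rule division_ofI)
      show "finite (R \<union> J)" using J(1) q1 unfolding R_def by auto
      show "k \<noteq> {}" "\<exists>a b. k = cbox a b" if "k \<in> R \<union> J" for k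
        using that division_ofD(3,4)[OF q1(2)] division_ofD(3,4)[OF J(2)] unfolding R_def by blast+
      have *: "interior k1 \<inter> interior k2 = {}" if "k1 \<in> R" "k2 \<in> J" for k1 k2
      proof -
        have "interior k1 \<inter> interior k = {}" if "k \<in> P" for k
          using division_ofD(5)[OF q1(2), of k1 k] that \<open>k1 \<in> R\<close> q1(1) unfolding R_def by auto
        then have "interior k1 \<inter> G' = {}" unfolding G'_def by auto
        moreover have "interior k2 \<subseteq> G'" using that J(3) interior_subset[of k2] by blast
        ultimately show ?thesis by blast
      qed
      show "interior k1 \<inter> interior k2 = {}" if "k1 \<in> R \<union> J" "k2 \<in> R \<union> J" "k1 \<noteq> k2" for k1 k2
        using that *[of k1 k2] *[of k2 k1] division_ofD(5)[OF q1(2), of k1 k2] division_ofD(5)[OF J(2), of k1 k2]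
        unfolding R_def by blast
    qed auto
    have RJab: "\<Union>(R \<union> J) \<subseteq> cbox a b"
      using J(3) G'(2) Pab division_ofD(2)[OF q1(2)] unfolding R_def cbox_interval by blast
    obtain q2 where q2: "R \<union> J \<subseteq> q2" "q2 division_of cbox a b"
      using partial_division_extend_interval[OF RJ RJab] by metis
    define Q where "Q = q2 - (R \<union> J)"
    have disj: "R \<inter> J = {}"
    proof (rule ccontr)
      assume "R \<inter> J \<noteq> {}"
      then obtain k where k: "k \<in> R" "k \<in> J" by auto
      then obtain u v where uv: "u < v" "k = {u..v}" using J(4) by blast
      have "(u + v) / 2 \<in> G'" using J(3) k uv by force
      then obtain k' where k': "k' \<in> P" "(u + v) / 2 \<in> interior k'" unfolding G'_def by auto
      have "(u + v) / 2 \<in> interior k" using uv by simp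
      moreover have "interior k \<inter> interior k' = {}"
        using division_ofD(5)[OF q1(2), of k k'] k k' q1(1) unfolding R_def by auto
      ultimately show False using k' by auto
    qed
    have split1: "(\<Sum>k\<in>q1. h k) = (\<Sum>k\<in>P. h k) + (\<Sum>k\<in>R. h k)" for h :: "real set \<Rightarrow> real"
      unfolding R_def using q1 by (subst sum.subset_diff[OF q1(1)]) auto
    have split2: "(\<Sum>k\<in>q2. h k) = (\<Sum>k\<in>R. h k) + (\<Sum>k\<in>J. h k) + (\<Sum>k\<in>Q. h k)" for h :: "real set \<Rightarrow> real"
    proof -
      have "(\<Sum>k\<in>q2. h k) = (\<Sum>k\<in>Q. h k) + (\<Sum>k\<in>R\<union>J. h k)"
        unfolding Q_def using q2 by (intro sum.subset_diff) auto
      also have "(\<Sum>k\<in>R\<union>J. h k) = (\<Sum>k\<in>R. h k) + (\<Sum>k\<in>J. h k)"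
        using disj J(1) q1(2) unfolding R_def by (intro sum.union_disjoint) auto
      finally show ?thesis by simp
    qed
    have incr: "(\<Sum>k\<in>P. h (Sup k) - h (Inf k)) = (\<Sum>k\<in>J. h (Sup k) - h (Inf k)) + (\<Sum>k\<in>Q. h (Sup k) - h (Inf k))"
      for h :: "real \<Rightarrow> real"
      using division_sum_increments[of a b q1 h] division_sum_increments[of a b q2 h] q1 q2 ab
        split1[of "\<lambda>k. h (Sup k) - h (Inf k)"] split2[of "\<lambda>k. h (Sup k) - h (Inf k)"]
      by (simp add: cbox_interval)
    have len: "measure lborel k = Sup k - Inf k" if kq: "k \<in> q1 \<union> q2" for k
    proof -
      have "(\<exists>u v. k = cbox u v) \<and> k \<noteq> {}"
        using kq
      proof
        assume "k \<in> q1" then show ?thesis using division_ofD(3,4)[OF q1(2)] by simp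
      next
        assume "k \<in> q2" then show ?thesis using division_ofD(3,4)[OF q2(2)] by simp
      qed
      then obtain u v where "k = cbox u v" "k \<noteq> {}" by blast
      then show ?thesis by (auto simp: cbox_interval)
    qed
    have "(\<Sum>k\<in>P. Sup k - Inf k) = (\<Sum>k\<in>P. measure lborel k)"
         "(\<Sum>k\<in>J. Sup k - Inf k) = (\<Sum>k\<in>J. measure lborel k)"
         "(\<Sum>k\<in>Q. Sup k - Inf k) = (\<Sum>k\<in>Q. measure lborel k)"
      using len q1(1) q2(1) unfolding Q_def by (auto intro!: sum.cong)
    then have lens: "measure lebesgue (\<Union>P) = measure lebesgue (\<Union>J) + (\<Sum>k\<in>Q. measure lborel k)"
      using incr[of "\<lambda>x. x"] PM[OF P(2)] PM[OF J(2)] by simp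
    have UPm: "\<Union>P \<in> lmeasurable" "\<Union>J \<in> lmeasurable"
      using P(2) J(2) by (meson lmeasurable_division)+
    have "measure lebesgue (\<Union>P) \<le> measure lebesgue G"
      using P(3) UPm Gm by (intro measure_mono_fmeasurable) auto
    moreover have "measure lebesgue (\<Union>J) > \<mu> - 2 * t"
    proof -
      have IJm: "\<Union>(interior ` J) \<in> lmeasurable"
      proof (intro fmeasurable.finite_UN J(1))
        fix k assume "k \<in> J"
        from J(4)[OF this] obtain u v where "k = {u..v}" by blast
        then show "interior k \<in> lmeasurable" by (simp add: lmeasurable_open)
      qed
      have "\<mu> \<le> measure lebesgue ((E - G') \<union> ((E \<inter> G') - \<Union>(interior ` J)) \<union> \<Union>(interior ` J))"
        unfolding \<mu>_def using Em G'm IJm by (intro measure_mono_fmeasurable) auto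
      also have "\<dots> \<le> measure lebesgue (E - G') + measure lebesgue ((E \<inter> G') - \<Union>(interior ` J)) + measure lebesgue (\<Union>(interior ` J))"
        using Em G'm IJm by (intro order_trans[OF measure_Un_le] add_mono measure_Un_le) auto
      also have "\<dots> \<le> measure lebesgue (E - G') + measure lebesgue ((E \<inter> G') - \<Union>(interior ` J)) + measure lebesgue (\<Union>J)"
        using IJm UPm interior_subset by (intro add_left_mono measure_mono_fmeasurable) blast+
      finally show ?thesis using P(5) J(5) unfolding G'_def by linarith
    qed
    ultimately have small: "(\<Sum>k\<in>Q. measure lborel k) < \<delta>"
      using lens Gle t by linarith
    have "(\<Sum>k\<in>Q. \<bar>g (Sup k) - g (Inf k)\<bar>) < e"
    proof (rule var[OF _ _ small])
      have "q2 division_of \<Union>q2" using q2(2) division_ofD(6)[OF q2(2)] by simp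
      then show "Q division_of \<Union>Q" unfolding Q_def by (rule division_of_subset) auto
      show "\<Union>Q \<subseteq> {a..b}"
        using division_ofD(2)[OF q2(2)] unfolding Q_def cbox_interval by blast
    qed
    then have Qg: "- e < (\<Sum>k\<in>Q. g (Sup k) - g (Inf k))"
      using sum_abs[of "\<lambda>k. g (Sup k) - g (Inf k)" Q] by linarith
    have Jg: "0 \<le> (\<Sum>k\<in>J. g (Sup k) - g (Inf k))"
    proof (rule sum_nonneg)
      fix k assume "k \<in> J"
      from J(4)[OF this] obtain u v where "u < v" "k = {u..v}" "0 * (v - u) < g v - g u" by blast
      then show "0 \<le> g (Sup k) - g (Inf k)" by simp
    qed
    have "(\<Sum>k\<in>P. g (Sup k) - g (Inf k)) \<le> (\<Sum>k\<in>P. - \<kappa> * measure lborel k)"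
    proof (rule sum_mono)
      fix k assume "k \<in> P"
      from P(4)[OF this] obtain u v where "u < v" "k = {u..v}" "\<kappa> * (v - u) < - g v - - g u" by blast
      then show "g (Sup k) - g (Inf k) \<le> - \<kappa> * measure lborel k" by simp
    qed
    also have "\<dots> = - \<kappa> * measure lebesgue (\<Union>P)"
      using PM[OF P(2)] by (simp add: sum_distrib_left[symmetric] sum_negf)
    also have "\<dots> \<le> - \<kappa> * (\<mu> / 2)"
    proof -
      have "\<mu> / 2 \<le> measure lebesgue (\<Union>J)" using \<open>measure lebesgue (\<Union>J) > \<mu> - 2 * t\<close> t by linarith
      also have "\<dots> \<le> measure lebesgue (\<Union>P)" using J(3) G'(2) UPm by (intro measure_mono_fmeasurable) auto
      finally show ?thesis using \<kappa> by simp
    qed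
    also have "- \<kappa> * (\<mu> / 2) = - e" unfolding e_def by simp
    finally have "(\<Sum>k\<in>P. g (Sup k) - g (Inf k)) \<le> - e" .
    then have "(\<Sum>k\<in>J. g (Sup k) - g (Inf k)) + (\<Sum>k\<in>Q. g (Sup k) - g (Inf k)) \<le> - e"
      by (simp only: incr[of g])
    then show False using Qg Jg by linarith
  qed
  then show ?thesis using Em negligible_iff_measure unfolding E_def[symmetric] by blast
qed

lemma absolutely_continuous_on_Icc_subset:
  assumes "absolutely_continuous_on_Icc a b f" "a \<le> c" "d \<le> b"
  shows "absolutely_continuous_on_Icc c d f"
  using assms unfolding absolutely_continuous_on_Icc_def by (meson order.trans)

lemma absolutely_continuous_on_Icc_minus_linear:
  assumes "absolutely_continuous_on_Icc a b f"
  shows "absolutely_continuous_on_Icc a b (\<lambda>x. f x - c * x)"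
  unfolding absolutely_continuous_on_Icc_def
proof (intro allI impI)
  fix e :: real assume e: "0 < e"
  then have "0 < e / 2" by simp
  with assms obtain \<delta> where \<delta>: "0 < \<delta>" and ac: "\<forall>n u v.
        (\<forall>i<n::nat. a \<le> u i \<and> u i \<le> v i \<and> v i \<le> b) \<and>
        disjoint_family_on (\<lambda>i. {u i<..<v i}) {..<n} \<and> (\<Sum>i<n. v i - u i) < \<delta>
        \<longrightarrow> (\<Sum>i<n. \<bar>f (v i) - f (u i)\<bar>) < e / 2"
    unfolding absolutely_continuous_on_Icc_def by meson
  define \<delta>' where "\<delta>' = min \<delta> (e / (2 * (\<bar>c\<bar> + 1)))"
  have "0 < \<delta>'" unfolding \<delta>'_def using \<delta> e by auto
  moreover have "(\<Sum>i<n. \<bar>(f (v i) - c * v i) - (f (u i) - c * u i)\<bar>) < e"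
    if uv: "\<forall>i<n. a \<le> u i \<and> u i \<le> v i \<and> v i \<le> b" "disjoint_family_on (\<lambda>i. {u i<..<v i}) {..<n}"
      and s: "(\<Sum>i<n. v i - u i) < \<delta>'" for n :: nat and u v
  proof -
    have "(\<Sum>i<n. \<bar>(f (v i) - c * v i) - (f (u i) - c * u i)\<bar>) \<le> (\<Sum>i<n. \<bar>f (v i) - f (u i)\<bar> + \<bar>c\<bar> * (v i - u i))"
    proof (rule sum_mono)
      fix i assume "i \<in> {..<n}"
      then have "\<bar>c * (v i - u i)\<bar> = \<bar>c\<bar> * (v i - u i)" using uv by (simp add: abs_mult)
      then show "\<bar>(f (v i) - c * v i) - (f (u i) - c * u i)\<bar> \<le> \<bar>f (v i) - f (u i)\<bar> + \<bar>c\<bar> * (v i - u i)"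
        by (simp add: right_diff_distrib)
    qed
    also have "\<dots> = (\<Sum>i<n. \<bar>f (v i) - f (u i)\<bar>) + \<bar>c\<bar> * (\<Sum>i<n. v i - u i)"
      by (simp add: sum.distrib sum_distrib_left)
    also have "\<dots> < e / 2 + e / 2"
    proof (rule add_less_le_mono)
      show "(\<Sum>i<n. \<bar>f (v i) - f (u i)\<bar>) < e / 2"
        using ac uv s unfolding \<delta>'_def by auto
      have "\<bar>c\<bar> * (\<Sum>i<n. v i - u i) \<le> (\<bar>c\<bar> + 1) * (e / (2 * (\<bar>c\<bar> + 1)))"
        using s uv(1) unfolding \<delta>'_def by (intro mult_mono sum_nonneg) auto
      also have "\<dots> = e / 2" by (simp add: field_simps)
      finally show "\<bar>c\<bar> * (\<Sum>i<n. v i - u i) \<le> e / 2" .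
    qed
    finally show ?thesis by simp
  qed
  ultimately show "\<exists>\<delta>>0. \<forall>n u v. (\<forall>i<n::nat. a \<le> u i \<and> u i \<le> v i \<and> v i \<le> b) \<and>
        disjoint_family_on (\<lambda>i. {u i<..<v i}) {..<n} \<and> (\<Sum>i<n. v i - u i) < \<delta>
        \<longrightarrow> (\<Sum>i<n. \<bar>(f (v i) - c * v i) - (f (u i) - c * u i)\<bar>) < e"
    by blast
qed

lemma absolutely_continuous_on_Icc_uminus:
  "absolutely_continuous_on_Icc a b f \<Longrightarrow> absolutely_continuous_on_Icc a b (\<lambda>x. - f x)"
  unfolding absolutely_continuous_on_Icc_def by (simp add: abs_minus_commute)

lemma absolutely_continuous_on_Icc_single:
  assumes "absolutely_continuous_on_Icc a b f" "0 < e"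
  obtains \<delta> where "0 < \<delta>" "\<And>x y. a \<le> x \<Longrightarrow> x \<le> y \<Longrightarrow> y \<le> b \<Longrightarrow> y - x < \<delta> \<Longrightarrow> \<bar>f y - f x\<bar> < e"
proof -
  obtain \<delta> where "0 < \<delta>" and ac: "\<And>(I :: unit set) u v. finite I \<Longrightarrow> (\<And>i. i \<in> I \<Longrightarrow> a \<le> u i \<and> u i \<le> v i \<and> v i \<le> b) \<Longrightarrow>
      disjoint_family_on (\<lambda>i. {u i<..<v i}) I \<Longrightarrow> (\<Sum>i\<in>I. v i - u i) < \<delta> \<Longrightarrow>
      (\<Sum>i\<in>I. \<bar>f (v i) - f (u i)\<bar>) < e"
    using absolutely_continuous_on_Icc_finite[OF assms] by blast
  then show ?thesis
    using ac[of "{()}" "\<lambda>_. x" "\<lambda>_. y" for x y] by (intro that) (auto simp: disjoint_family_on_def)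
qed

lemma absolutely_continuous_on_Icc_isCont:
  assumes "absolutely_continuous_on_Icc a b f" "a < x" "x < b"
  shows "isCont f x"
  unfolding isCont_def LIM_eq
proof (intro allI impI)
  fix r :: real assume "0 < r"
  from absolutely_continuous_on_Icc_single[OF assms(1) this] obtain \<delta>
    where \<delta>: "0 < \<delta>" "\<And>x y. a \<le> x \<Longrightarrow> x \<le> y \<Longrightarrow> y \<le> b \<Longrightarrow> y - x < \<delta> \<Longrightarrow> \<bar>f y - f x\<bar> < r" by blast
  show "\<exists>s>0. \<forall>y. y \<noteq> x \<and> norm (y - x) < s \<longrightarrow> norm (f y - f x) < r"
  proof (intro exI conjI allI impI)
    show "0 < min \<delta> (min (x - a) (b - x))" using assms \<delta> by auto
    fix y assume y: "y \<noteq> x \<and> norm (y - x) < min \<delta> (min (x - a) (b - x))"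
    show "norm (f y - f x) < r"
      using \<delta>(2)[of x y] \<delta>(2)[of y x] y assms by (cases "x \<le> y") (auto simp: abs_minus_commute)
  qed
qed

lemma negligible_if_local:
  fixes S :: "'a :: euclidean_space set"
  assumes "\<And>x. negligible (S \<inter> ball x r)" "0 < r"
  shows "negligible S"
proof -
  have "\<exists>U. openin (top_of_set S) U \<and> x \<in> U \<and> negligible U" if "x \<in> S" for x
    using that assms openin_open_Int[OF open_ball[of x r], of S] by (intro exI[of _ "S \<inter> ball x r"]) auto
  then show ?thesis
    by (subst locally_negligible_alt) blast
qed

text \<open>Inside a ball of length below \<delta> disjoint intervals have total variation below 1,
  so those of slope above n have total length below 1 / n. A Vitali packing by such intervals bounds
  the measure of the set in the ball by 1 / n for every n.\<close>

lemma absolutely_continuous_on_Icc_infinite_slopes: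
  assumes ac: "absolutely_continuous_on_Icc a b f"
  shows "negligible ({a<..<b} \<inter> (\<Inter>n. steep_points f (real n)))" (is "negligible ?E")
proof -
  obtain \<delta> where \<delta>: "0 < \<delta>" and var: "\<And>Q. Q division_of \<Union>Q \<Longrightarrow> \<Union>Q \<subseteq> {a..b} \<Longrightarrow> (\<Sum>k\<in>Q. measure lborel k) < \<delta> \<Longrightarrow>
      (\<Sum>k\<in>Q. \<bar>f (Sup k) - f (Inf k)\<bar>) < 1"
    using absolutely_continuous_on_Icc_division[OF ac zero_less_one] by blast
  have "negligible (?E \<inter> ball x (\<delta> / 4))" for x
  proof -
    define F where "F = ?E \<inter> ball x (\<delta> / 4)"
    have "F \<in> sets borel" unfolding F_def
      by (intro sets.Int sets.countable_INT'') (auto intro: steep_points_borel)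
    then have Fm: "F \<in> lmeasurable"
      unfolding F_def
      by (intro bounded_set_imp_lmeasurable bounded_Int) (auto intro!: sets_completionI_sets)
    have F0: "measure lebesgue F \<le> 0 + t" if t: "0 < t" for t
    proof -
      obtain n where n: "1 / t < real n" using reals_Archimedean2 by blast
      have n0: "0 < real n" using n t by (meson divide_pos_pos order.strict_trans zero_less_one)
      have G: "open ({a<..<b} \<inter> ball x (\<delta> / 4))" "F \<subseteq> {a<..<b} \<inter> ball x (\<delta> / 4)" "F \<subseteq> steep_points f (real n)"
        unfolding F_def by auto
      have *: "measure lebesgue F < 1 / real n + s" if s: "0 < s" for s
      proof -
      obtain J where J: "finite J" "J division_of \<Union>J" "\<Union>J \<subseteq> {a<..<b} \<inter> ball x (\<delta> / 4)"
        "\<And>k. k \<in> J \<Longrightarrow> \<exists>u v. u < v \<and> k = {u..v} \<and> real n * (v - u) < f v - f u"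
        "measure lebesgue (F - \<Union>(interior ` J)) < s"
        using steep_points_Vitali[OF Fm G(3) G(1) G(2) s] by blast
      have Jm: "\<Union>J \<in> lmeasurable" using J(2) lmeasurable_division by blast
      have IJ: "\<Union>(interior ` J) \<in> lmeasurable"
      proof (intro fmeasurable.finite_UN J(1))
        fix k assume "k \<in> J"
        from J(4)[OF this] obtain u v where "k = {u..v}" by blast
        then show "interior k \<in> lmeasurable" by (simp add: lmeasurable_open)
      qed
      have len: "(\<Sum>k\<in>J. measure lborel k) = measure lebesgue (\<Union>J)"
      proof -
        have "measure lborel k = measure lebesgue k" if "k \<in> J" for k
          using J(4)[OF that] by auto
        then have "(\<Sum>k\<in>J. measure lborel k) = (\<Sum>k\<in>J. measure lebesgue k)" by simp
        also have "\<dots> = measure lebesgue (\<Union>J)" using content_division[OF J(2)] by simp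
        finally show ?thesis .
      qed
      have "measure lebesgue (\<Union>J) \<le> measure lebesgue (ball x (\<delta> / 4))"
        using J(3) Jm by (intro measure_mono_fmeasurable) auto
      also have "\<dots> < \<delta>" using \<delta> by (simp add: ball_eq_greaterThanLessThan)
      finally have small: "(\<Sum>k\<in>J. measure lborel k) < \<delta>" using len by simp
      have "real n * measure lebesgue (\<Union>J) = (\<Sum>k\<in>J. real n * measure lborel k)"
        unfolding len[symmetric] by (rule sum_distrib_left)
      also have "\<dots> \<le> (\<Sum>k\<in>J. \<bar>f (Sup k) - f (Inf k)\<bar>)"
      proof (rule sum_mono)
        fix k assume "k \<in> J"
        from J(4)[OF this] obtain u v where "u < v" "k = {u..v}" "real n * (v - u) < f v - f u" by blast
        then show "real n * measure lborel k \<le> \<bar>f (Sup k) - f (Inf k)\<bar>" by simp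
      qed
      also have "\<dots> < 1"
      proof (rule var[OF J(2) _ small])
        show "\<Union>J \<subseteq> {a..b}" using J(3) by (meson Int_lower1 greaterThanLessThan_subseteq_atLeastAtMost_iff order.trans order_refl)
      qed
      finally have J1: "measure lebesgue (\<Union>J) < 1 / real n" using n0 by (simp add: field_simps)
      have "measure lebesgue F \<le> measure lebesgue ((F - \<Union>(interior ` J)) \<union> \<Union>(interior ` J))"
        using Fm IJ by (intro measure_mono_fmeasurable) auto
      also have "\<dots> \<le> measure lebesgue (F - \<Union>(interior ` J)) + measure lebesgue (\<Union>(interior ` J))"
        using Fm IJ by (intro measure_Un_le) auto
      also have "measure lebesgue (\<Union>(interior ` J)) \<le> measure lebesgue (\<Union>J)"
        using IJ Jm interior_subset by (intro measure_mono_fmeasurable) blast+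
      finally show ?thesis using J(5) J1 by linarith
      qed
      have "1 / real n < t" using n n0 t by (simp add: field_simps)
      then show ?thesis using *[of "t - 1 / real n"] by simp
    qed
    have "measure lebesgue F \<le> 0" by (rule field_le_epsilon) (rule F0)
    then have "measure lebesgue F = 0" using measure_nonneg[of lebesgue F] by (rule order_antisym)
    then have "negligible F" using Fm negligible_iff_measure by blast
    then show ?thesis unfolding F_def .
  qed
  then show ?thesis
    using negligible_if_local[of ?E "\<delta> / 4"] \<delta> by simp
qed

text \<open>Steep points speak of intervals with x strictly inside, a difference quotient at x has x
  as an endpoint. Continuity closes the gap by widening the interval a little.\<close>

lemma straddle_le_limit:
  fixes f :: "real \<Rightarrow> real"
  assumes "\<And>u v. u < x \<Longrightarrow> x < v \<Longrightarrow> v - u < d \<Longrightarrow> f v - f u \<le> C * (v - u)"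
    and "u \<le> x" "x \<le> v" "v - u < d" "isCont f u" "isCont f v"
  shows "f v - f u \<le> C * (v - u)"
proof -
  have "((\<lambda>t. v + t) \<longlongrightarrow> v + 0) (at_right 0)" "((\<lambda>t. u - t) \<longlongrightarrow> u - 0) (at_right 0)"
    by (rule tendsto_add[OF tendsto_const tendsto_ident_at], rule tendsto_diff[OF tendsto_const tendsto_ident_at])
  then have vu: "((\<lambda>t. v + t) \<longlongrightarrow> v) (at_right 0)" "((\<lambda>t. u - t) \<longlongrightarrow> u) (at_right 0)"
    by (simp_all only: add_0_right diff_0_right)
  have 1: "((\<lambda>t. f (v + t) - f (u - t)) \<longlongrightarrow> f v - f u) (at_right 0)"
    by (rule tendsto_diff[OF isCont_tendsto_compose[OF assms(6) vu(1)] isCont_tendsto_compose[OF assms(5) vu(2)]])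
  have 2: "((\<lambda>t. C * ((v + t) - (u - t))) \<longlongrightarrow> C * (v - u)) (at_right 0)"
    by (rule tendsto_mult_left[OF tendsto_diff[OF vu]])
  have "eventually (\<lambda>t. t \<in> {0<..<(d - (v - u)) / 2}) (at_right (0::real))"
    using assms(4) by (intro eventually_at_right_real) simp
  then have 3: "\<forall>\<^sub>F t in at_right 0. f (v + t) - f (u - t) \<le> C * ((v + t) - (u - t))"
  proof eventually_elim
    case (elim t)
    then show ?case using assms(2-4) by (intro assms(1)) (auto simp: field_simps)
  qed
  show ?thesis by (rule tendsto_le[OF _ 2 1 3]) (rule trivial_limit_at_right_real)
qed

text \<open>Subtracting the line of slope s moves the two levels to s - r > 0 and 0, the case
  already treated.\<close>

lemma negligible_slope_gap:
  assumes ac: "absolutely_continuous_on_Icc a b f" and "r < s"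
  shows "negligible ({a<..<b} \<inter> steep_points (\<lambda>x. - f x) (- r) \<inter> steep_points f s)"
proof -
  have e1: "steep_points (\<lambda>x. f x - s * x) 0 = steep_points f s"
    by (rule trans[OF steep_points_linear_shift[of f s 0]]) simp
  have e2: "steep_points (\<lambda>x. - (f x - s * x)) (s - r) = steep_points (\<lambda>x. - f x) (- r)"
  proof -
      have "(\<lambda>x. - (f x - s * x)) = (\<lambda>x. - f x - (- s) * x)" by (rule ext) (simp only: mult_minus_left minus_diff_eq diff_minus_eq_add add_uminus_conv_diff uminus_add_conv_diff)
      then have "steep_points (\<lambda>x. - (f x - s * x)) (s - r) = steep_points (\<lambda>x. - f x - (- s) * x) (s - r)"
        by (rule arg_cong)
      also have "\<dots> = steep_points (\<lambda>x. - f x) (- r)"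
        by (rule trans[OF steep_points_linear_shift[of "\<lambda>x. - f x" "- s" "s - r"]]) simp
      finally show ?thesis .
  qed
  have "0 < s - r" using assms(2) by simp
  from absolutely_continuous_on_Icc_null_slopes[OF absolutely_continuous_on_Icc_minus_linear[OF ac, of s] this]
  show ?thesis by (simp only: e1 e2)
qed

text \<open>Outside countably many null sets, one for each pair of rationals r < s and two for
  infinite slopes, the upper and lower slopes of straddling intervals agree and are finite. Their
  common value is the derivative.\<close>

lemma absolutely_continuous_on_Icc_differentiable_ae:
  assumes ac: "absolutely_continuous_on_Icc a b f"
  obtains N where "negligible N" "\<And>x. a < x \<Longrightarrow> x < b \<Longrightarrow> x \<notin> N \<Longrightarrow> f differentiable (at x)"
proof -
  let ?S = "steep_points f" and ?T = "steep_points (\<lambda>x. - f x)"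
  define N where "N = (\<Union>r\<in>\<rat>. \<Union>s\<in>\<rat>. if r < s then {a<..<b} \<inter> ?T (- r) \<inter> ?S s else {})
      \<union> ({a<..<b} \<inter> (\<Inter>n. ?S (real n))) \<union> ({a<..<b} \<inter> (\<Inter>n. ?T (real n)))"
  have rs: "negligible (if r < s then {a<..<b} \<inter> ?T (- r) \<inter> ?S s else {})" for r s
    using negligible_slope_gap[OF ac, of r s] negligible_empty by (cases "r < s") (simp_all only: if_True if_False)
  have UN: "negligible (\<Union>r\<in>\<rat>. A r)" if "\<And>r. negligible (A r)" for A :: "real \<Rightarrow> real set"
  proof (rule negligible_countable_Union)
    show "countable (A ` \<rat>)" by (intro countable_image countable_rat)
    show "negligible S" if "S \<in> A ` \<rat>" for S
      using that \<open>\<And>r. negligible (A r)\<close> by (elim imageE) (simp only:)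
  qed
  have N: "negligible N"
    unfolding N_def
  proof (intro negligible_Un)
    show "negligible (\<Union>r\<in>\<rat>. \<Union>s\<in>\<rat>. if r < s then {a<..<b} \<inter> ?T (- r) \<inter> ?S s else {})"
      by (rule UN, rule UN, rule rs)
    show "negligible ({a<..<b} \<inter> (\<Inter>n. ?S (real n)))"
      by (rule absolutely_continuous_on_Icc_infinite_slopes[OF ac])
    show "negligible ({a<..<b} \<inter> (\<Inter>n. ?T (real n)))"
      by (rule absolutely_continuous_on_Icc_infinite_slopes[OF absolutely_continuous_on_Icc_uminus[OF ac]])
  qed
  show ?thesis
  proof (rule that[OF N])
    fix x assume x: "a < x" "x < b" "x \<notin> N"
    have notT: "\<exists>d>0. \<forall>u v. u < x \<longrightarrow> x < v \<longrightarrow> v - u < d \<longrightarrow> f v - f u \<ge> - \<beta> * (v - u)" if "x \<notin> ?T \<beta>" for \<beta>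
      using that unfolding steep_points_def by (force simp: not_less)
    have notS: "\<exists>d>0. \<forall>u v. u < x \<longrightarrow> x < v \<longrightarrow> v - u < d \<longrightarrow> f v - f u \<le> \<beta> * (v - u)" if "x \<notin> ?S \<beta>" for \<beta>
      using that unfolding steep_points_def by (force simp: not_less)
    \<comment> \<open>The derivative will be the supremum of the levels at which x is steep for
      f.\<close>
    define B where "B = {\<beta>. x \<in> ?S \<beta>}"
    obtain m where m: "x \<notin> ?S (real m)" using x unfolding N_def by auto
    have bdd: "\<beta> \<le> real m" if "\<beta> \<in> B" for \<beta>
      using m that steep_points_antimono[of "real m" \<beta> f] unfolding B_def by (metis linear mem_Collect_eq subsetD)
    obtain m' where m': "x \<notin> ?T (real m')" using x unfolding N_def by auto
    \<comment> \<open>As x is not steep for - f at m', short straddling intervals have slope at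
      least - m', hence above - m' - 1.\<close>
    have ne: "- real m' - 1 \<in> B"
    proof -
      obtain d where d: "0 < d" "\<And>u v. u < x \<Longrightarrow> x < v \<Longrightarrow> v - u < d \<Longrightarrow> f v - f u \<ge> - real m' * (v - u)"
        using notT[OF m'] by blast
      show ?thesis
        unfolding B_def steep_points_def mem_Collect_eq
      proof (intro allI impI)
        fix d' :: real assume d': "0 < d'"
        define t where "t = min d d' / 4"
        have t: "0 < t" "2 * t < d" "2 * t < d'" unfolding t_def using d d' by auto
        have "- real m' * ((x + t) - (x - t)) \<le> f (x + t) - f (x - t)"
          using t by (intro d(2)) auto
        then have "(- real m' - 1) * ((x + t) - (x - t)) < f (x + t) - f (x - t)"
          using t by (auto simp: algebra_simps)
        then show "\<exists>u v. u < x \<and> x < v \<and> v - u < d' \<and> (- real m' - 1) * (v - u) < f v - f u"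
          using t by (intro exI[of _ "x - t"] exI[of _ "x + t"]) auto
      qed
    qed
    define D where "D = Sup B"
    have bddB: "bdd_above B" using bdd by (rule bdd_aboveI)
    have cont: "isCont f y" if "a < y" "y < b" for y
      using absolutely_continuous_on_Icc_isCont[OF ac that] .
    have "(f has_real_derivative D) (at x)"
      unfolding DERIV_def LIM_eq
    proof (intro allI impI)
      fix e :: real assume e: "0 < e"
      have "D + e / 2 \<notin> B"
        using cSup_upper[OF _ bddB, of "D + e / 2"] e unfolding D_def by auto
      then obtain d1 where d1: "0 < d1" "\<And>u v. u < x \<Longrightarrow> x < v \<Longrightarrow> v - u < d1 \<Longrightarrow> f v - f u \<le> (D + e / 2) * (v - u)"
        using notS[of "D + e / 2"] unfolding B_def by blast
      \<comment> \<open>Two rationals r < s just below D: x is steep for f at s, so outside N it is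
        not steep for - f at - r, and r bounds the short slopes from below.\<close>
      obtain r where r: "r \<in> \<rat>" "D - e / 2 < r" "r < D - e / 4"
        using Rats_dense_in_real[of "D - e / 2" "D - e / 4"] e by auto
      obtain s where s: "s \<in> \<rat>" "r < s" "s < D"
        using Rats_dense_in_real[of r D] r e by auto
      obtain \<beta> where "\<beta> \<in> B" "s < \<beta>"
        using less_cSupD[of B s] ne s unfolding D_def by auto
      then have "x \<in> ?S s" using steep_points_antimono[of s \<beta> f] unfolding B_def by auto
      then have "x \<notin> ?T (- r)"
        using x r s unfolding N_def by fastforce
      then obtain d2 where d2: "0 < d2" "\<And>u v. u < x \<Longrightarrow> x < v \<Longrightarrow> v - u < d2 \<Longrightarrow> f v - f u \<ge> r * (v - u)"
        using notT[of "- r"] by auto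
      define d where "d = min (min d1 d2) (min (x - a) (b - x))"
      have d: "0 < d" "d \<le> d1" "d \<le> d2" "d \<le> x - a" "d \<le> b - x" unfolding d_def using d1 d2 x by auto
      have up: "f v - f u \<le> (D + e / 2) * (v - u)" if "u \<le> x" "x \<le> v" "v - u < d" for u v
        by (rule straddle_le_limit[of x d]) (use that d1 d cont in auto)
      have lo: "f v - f u \<ge> r * (v - u)" if "u \<le> x" "x \<le> v" "v - u < d" for u v
        using straddle_le_limit[of x d "\<lambda>y. - f y" "- r" u v] that d2 d cont by force
      show "\<exists>s>0. \<forall>h. h \<noteq> 0 \<and> norm (h - 0 :: real) < s \<longrightarrow> norm ((f (x + h) - f x) / h - D) < e"
      proof (intro exI[of _ d] conjI allI impI d(1))
        fix h :: real assume h: "h \<noteq> 0 \<and> norm (h - 0) < d"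
        have b: "r \<le> (f (x + h) - f x) / h" "(f (x + h) - f x) / h \<le> D + e / 2"
        proof -
          have "r \<le> (f (x + h) - f x) / h \<and> (f (x + h) - f x) / h \<le> D + e / 2"
          proof (cases "0 < h")
            case True
            then show ?thesis using up[of x "x + h"] lo[of x "x + h"] h by (auto simp: field_simps)
          next
            case False
            then have "h < 0" using h by auto
            then show ?thesis using up[of "x + h" x] lo[of "x + h" x] h by (auto simp: field_simps)
          qed
          then show "r \<le> (f (x + h) - f x) / h" "(f (x + h) - f x) / h \<le> D + e / 2" by auto
        qed
        show "norm ((f (x + h) - f x) / h - D) < e"
          using b r e by (simp add: abs_less_iff)
      qed
    qed
    then show "f differentiable (at x)" by (auto simp: real_differentiable_def)
  qed
qed

section \<open>The fundamental theorem of calculus for absolutely continuous functions\<close>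

text \<open>A gauge argument in which either kind of tag uses up half of e. At tags outside N the
  increment is close to the derivative times the length. Tags in N contribute 0 to the Riemann sum,
  and the gauge confines their intervals to an open set of measure below \<delta>, so the increments
  over them are small by absolute continuity.\<close>

lemma absolutely_continuous_on_Icc_FTC:
  fixes f :: "real \<Rightarrow> real"
  assumes ac: "absolutely_continuous_on_Icc a b f" and ab: "a \<le> b" and N: "negligible N"
    and f': "\<And>x. x \<in> {a..b} - N \<Longrightarrow> (f has_real_derivative f' x) (at x)"
  shows "((\<lambda>x. if x \<in> N then 0 else f' x) has_integral (f b - f a)) {a..b}"
proof (cases "a = b")
  case True
  have "((\<lambda>x. if x \<in> N then 0 else f' x) has_integral 0) {b}"
    by (rule has_integral_negligible[of "{b}"]) auto
  then show ?thesis using True by (simp del: has_integral_refl)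
next
  case False
  with ab have ab': "a < b" by simp
  define F where "F = (\<lambda>x. if x \<in> N then 0 else f' x)"
  show ?thesis
    unfolding F_def[symmetric] has_integral_factor_content_real
  proof (intro allI impI)
    fix e :: real assume e: "0 < e"
    define e' where "e' = e * (b - a) / 2"
    have e': "0 < e'" unfolding e'_def using e ab' by simp
    obtain \<delta> where \<delta>: "0 < \<delta>" and var: "\<And>(I :: (real \<times> real set) set) u v. finite I \<Longrightarrow> (\<And>i. i \<in> I \<Longrightarrow> a \<le> u i \<and> u i \<le> v i \<and> v i \<le> b) \<Longrightarrow>
      disjoint_family_on (\<lambda>i. {u i<..<v i}) I \<Longrightarrow> (\<Sum>i\<in>I. v i - u i) < \<delta> \<Longrightarrow>
      (\<Sum>i\<in>I. \<bar>f (v i) - f (u i)\<bar>) < e'"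
      using absolutely_continuous_on_Icc_finite[OF ac e'] by blast
    have Nnull: "N \<in> null_sets lebesgue" using N negligible_iff_null_sets by blast
    then have Ns: "N \<in> sets lebesgue" by (rule null_setsD2)
    obtain U where U: "open U" "N \<subseteq> U" "(U - N) \<in> lmeasurable" "emeasure lebesgue (U - N) < ennreal \<delta>"
      using sets_lebesgue_outer_open[OF Ns \<delta>] by blast
    have Um: "U \<in> sets lebesgue" using U(1) by auto
    have emU: "emeasure lebesgue U < ennreal \<delta>"
    proof -
      have "emeasure lebesgue U \<le> emeasure lebesgue ((U - N) \<union> N)"
        using Um Ns by (intro emeasure_mono) auto
      also have "\<dots> \<le> emeasure lebesgue (U - N) + emeasure lebesgue N"
        using Um Ns by (intro emeasure_subadditive) auto
      also have "emeasure lebesgue N = 0" using Nnull by (rule null_setsD1)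
      finally show ?thesis using U(4) by simp
    qed
    have "\<exists>d>0. \<forall>y. \<bar>y - x\<bar> < d \<longrightarrow> \<bar>f y - f x - (y - x) * f' x\<bar> \<le> (e / 2) * \<bar>y - x\<bar>" if "x \<in> {a..b} - N" for x
    proof -
      have "(f has_derivative (\<lambda>h. f' x * h)) (at x)"
        using f'[OF that] by (simp add: has_field_derivative_def)
      then have "\<exists>d>0. \<forall>y. norm (y - x) < d \<longrightarrow> norm (f y - f x - f' x * (y - x)) \<le> (e / 2) * norm (y - x)"
        unfolding has_derivative_at_alt using half_gt_zero[OF e] by blast
      then show ?thesis by (simp add: mult.commute)
    qed
    then obtain d where d: "\<And>x. x \<in> {a..b} - N \<Longrightarrow> 0 < d x"
      "\<And>x y. x \<in> {a..b} - N \<Longrightarrow> \<bar>y - x\<bar> < d x \<Longrightarrow> \<bar>f y - f x - (y - x) * f' x\<bar> \<le> (e / 2) * \<bar>y - x\<bar>"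
      by metis
    define \<gamma> where "\<gamma> x = (if x \<in> N then U else if x \<in> {a..b} then ball x (d x) else UNIV)" for x
    have "gauge \<gamma>"
      unfolding gauge_def \<gamma>_def using U(1,2) d(1) by auto
    moreover have "norm ((\<Sum>(x, k)\<in>p. measure lborel k *\<^sub>R F x) - (f b - f a)) \<le> e * measure lborel {a..b}"
      if p: "p tagged_division_of {a..b}" and fine: "\<gamma> fine p" for p
    proof -
      note D = tagged_division_ofD[OF p]
      have box: "k = {Inf k..Sup k} \<and> Inf k \<le> x \<and> x \<le> Sup k \<and> a \<le> Inf k \<and> Sup k \<le> b \<and> measure lborel k = Sup k - Inf k" if xk: "(x, k) \<in> p" for x k
      proof -
        obtain u v where k: "k = {u..v}" using D(4)[OF xk] by (auto simp: cbox_interval)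
        moreover have "x \<in> k" "k \<subseteq> {a..b}" using D(2,3)[OF xk] by auto
        ultimately show ?thesis by (auto simp: subset_iff)
      qed
      define p1 where "p1 = {i \<in> p. fst i \<in> N}"
      define p2 where "p2 = {i \<in> p. fst i \<notin> N}"
      have fin: "finite p" "finite p1" "finite p2" using D(1) unfolding p1_def p2_def by auto
      have split: "(\<Sum>i\<in>p. h i) = (\<Sum>i\<in>p1. h i) + (\<Sum>i\<in>p2. h i)" for h :: "real \<times> real set \<Rightarrow> real"
      proof -
        have "p = p1 \<union> p2" "p1 \<inter> p2 = {}" unfolding p1_def p2_def by auto
        then show ?thesis using fin sum.union_disjoint by metis
      qed
      have tot: "f b - f a = (\<Sum>(x, k)\<in>p. f (Sup k) - f (Inf k))" "b - a = (\<Sum>(x, k)\<in>p. Sup k - Inf k)"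
        using additive_tagged_division_1[OF ab p, of f] additive_tagged_division_1[OF ab p, of "\<lambda>x. x"] by auto
      have "(\<Sum>(x, k)\<in>p. measure lborel k *\<^sub>R F x) - (f b - f a) =
        (\<Sum>i\<in>p. measure lborel (snd i) * F (fst i) - (f (Sup (snd i)) - f (Inf (snd i))))"
        unfolding tot by (simp add: sum_subtractf case_prod_beta)
      also have "\<dots> = (\<Sum>i\<in>p1. measure lborel (snd i) * F (fst i) - (f (Sup (snd i)) - f (Inf (snd i))))
         + (\<Sum>i\<in>p2. measure lborel (snd i) * F (fst i) - (f (Sup (snd i)) - f (Inf (snd i))))" (is "_ = ?s1 + ?s2")
        by (rule split)
      finally have eq: "(\<Sum>(x, k)\<in>p. measure lborel k *\<^sub>R F x) - (f b - f a) = ?s1 + ?s2" .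
      have "\<bar>?s2\<bar> \<le> (\<Sum>i\<in>p2. (e / 2) * (Sup (snd i) - Inf (snd i)))"
      proof (rule order_trans[OF sum_abs], rule sum_mono)
        fix i assume i: "i \<in> p2"
        obtain x k where xk: "i = (x, k)" by (cases i)
        then have ip: "(x, k) \<in> p" "x \<notin> N" using i unfolding p2_def by auto
        note b = box[OF ip(1)]
        define u v where "u = Inf k" and "v = Sup k"
        have uv: "u \<le> x" "x \<le> v" "a \<le> u" "v \<le> b" "k = {u..v}" "measure lborel k = v - u"
          using b unfolding u_def v_def by auto
        have xN: "x \<in> {a..b} - N" using ip uv by auto
        have "k \<subseteq> \<gamma> x" by (rule fineD[OF fine ip(1)])
        also have "\<gamma> x = ball x (d x)" using xN unfolding \<gamma>_def by simp
        finally have kb: "k \<subseteq> ball x (d x)" .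
        have "u \<in> k" "v \<in> k" using uv by auto
        then have "u \<in> ball x (d x)" "v \<in> ball x (d x)" using kb by (simp_all only: subset_iff)
        then have "\<bar>u - x\<bar> < d x" "\<bar>v - x\<bar> < d x" by (auto simp: dist_real_def)
        from d(2)[OF xN this(1)] d(2)[OF xN this(2)]
        have 1: "\<bar>f u - f x - (u - x) * f' x\<bar> \<le> (e / 2) * (x - u)" "\<bar>f v - f x - (v - x) * f' x\<bar> \<le> (e / 2) * (v - x)"
          using uv by auto
        have "(v - u) * f' x - (f v - f u) = (f u - f x - (u - x) * f' x) - (f v - f x - (v - x) * f' x)"
          by (simp add: algebra_simps)
        then have "\<bar>(v - u) * f' x - (f v - f u)\<bar> \<le> (e / 2) * (x - u) + (e / 2) * (v - x)"
          using 1 by linarith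
        also have "\<dots> = (e / 2) * (v - u)" unfolding distrib_left[symmetric] by simp
        finally show "\<bar>measure lborel (snd i) * F (fst i) - (f (Sup (snd i)) - f (Inf (snd i)))\<bar> \<le> (e / 2) * (Sup (snd i) - Inf (snd i))"
          using ip uv(6) unfolding xk F_def by (simp add: u_def v_def)
      qed
      also have "\<dots> \<le> (\<Sum>i\<in>p. (e / 2) * (Sup (snd i) - Inf (snd i)))"
      proof (rule sum_mono2[OF fin(1)])
        fix i assume "i \<in> p - p2"
        then have "(fst i, snd i) \<in> p" by auto
        from box[OF this] show "0 \<le> (e / 2) * (Sup (snd i) - Inf (snd i))" using e by auto
      qed (auto simp: p2_def)
      also have "\<dots> = e / 2 * (b - a)"
        unfolding tot(2) by (simp add: sum_distrib_left case_prod_beta)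
      finally have s2: "\<bar>?s2\<bar> \<le> e / 2 * (b - a)" .
      have "\<bar>?s1\<bar> = \<bar>\<Sum>i\<in>p1. f (Sup (snd i)) - f (Inf (snd i))\<bar>"
      proof -
        have "?s1 = (\<Sum>i\<in>p1. - (f (Sup (snd i)) - f (Inf (snd i))))"
          by (intro sum.cong) (auto simp: p1_def F_def)
        then show ?thesis by (simp only: sum_negf abs_minus_cancel)
      qed
      also have "\<dots> \<le> (\<Sum>i\<in>p1. \<bar>f (Sup (snd i)) - f (Inf (snd i))\<bar>)" by (rule sum_abs)
      also have "\<dots> < e'"
      proof (rule var[OF fin(2)])
        fix i assume "i \<in> p1"
        then have "(fst i, snd i) \<in> p" unfolding p1_def by auto
        from box[OF this] show "a \<le> Inf (snd i) \<and> Inf (snd i) \<le> Sup (snd i) \<and> Sup (snd i) \<le> b" by auto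
      next
        have dis: "interior (snd i) \<inter> interior (snd j) = {}" if "i \<in> p1" "j \<in> p1" "i \<noteq> j" for i j
          using D(5)[of "fst i" "snd i" "fst j" "snd j"] that unfolding p1_def by auto
        show "disjoint_family_on (\<lambda>i. {Inf (snd i)<..<Sup (snd i)}) p1"
          unfolding disjoint_family_on_def
        proof (intro ballI impI)
          fix i j assume ij: "i \<in> p1" "j \<in> p1" "i \<noteq> j"
          have "interior (snd i) = {Inf (snd i)<..<Sup (snd i)}" if "i \<in> p1" for i
          proof -
            have "(fst i, snd i) \<in> p" using that unfolding p1_def by auto
            from box[OF this] show ?thesis using interior_atLeastAtMost_real by metis
          qed
          then show "{Inf (snd i)<..<Sup (snd i)} \<inter> {Inf (snd j)<..<Sup (snd j)} = {}"
            using dis ij by metis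
        qed
        have "(\<Sum>i\<in>p1. Sup (snd i) - Inf (snd i)) = (\<Sum>i\<in>p1. measure lebesgue (snd i))"
        proof (rule sum.cong[OF refl])
          fix i assume "i \<in> p1"
          then have "(fst i, snd i) \<in> p" unfolding p1_def by auto
          from box[OF this] show "Sup (snd i) - Inf (snd i) = measure lebesgue (snd i)"
            by (metis measure_completion sets_lborel closed_atLeastAtMost borel_closed)
        qed
        also have "\<dots> = measure lebesgue (\<Union>(snd ` p1))"
        proof (rule measure_negligible_finite_Union_image[OF fin(2), symmetric])
          show "snd i \<in> lmeasurable" if "i \<in> p1" for i
          proof -
            have "(fst i, snd i) \<in> p" using that unfolding p1_def by auto
            from D(4)[OF this] show ?thesis by auto
          qed
          show "pairwise (\<lambda>i j. negligible (snd i \<inter> snd j)) p1"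
          proof (rule pairwiseI)
            fix i j assume ij: "i \<in> p1" "j \<in> p1" "i \<noteq> j"
            have cv: "convex (snd i)" if "i \<in> p1" for i
            proof -
              have "(fst i, snd i) \<in> p" using that unfolding p1_def by auto
              from D(4)[OF this] show ?thesis by auto
            qed
            have "interior (snd i \<inter> snd j) = {}" using dis[OF ij] by simp
            then show "negligible (snd i \<inter> snd j)"
              using negligible_convex_interior[OF convex_Int[OF cv[OF ij(1)] cv[OF ij(2)]]] by blast
          qed
        qed
        also have "\<dots> < \<delta>"
        proof -
          have "\<Union>(snd ` p1) \<subseteq> U"
          proof
            fix y assume "y \<in> \<Union>(snd ` p1)"
            then obtain x k where xk: "(x, k) \<in> p" "x \<in> N" "y \<in> k" unfolding p1_def by auto
            have "k \<subseteq> \<gamma> x" by (rule fineD[OF fine xk(1)])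
            then show "y \<in> U" using xk unfolding \<gamma>_def by auto
          qed
          then have "emeasure lebesgue (\<Union>(snd ` p1)) \<le> emeasure lebesgue U"
            using Um by (rule emeasure_mono)
          also note emU
          finally have lt: "emeasure lebesgue (\<Union>(snd ` p1)) < ennreal \<delta>" .
          then have "emeasure lebesgue (\<Union>(snd ` p1)) \<noteq> \<top>" by auto
          then have "emeasure lebesgue (\<Union>(snd ` p1)) = ennreal (measure lebesgue (\<Union>(snd ` p1)))"
            by (rule emeasure_eq_ennreal_measure)
          then show ?thesis using lt by (simp add: ennreal_less_iff)
        qed
        finally show "(\<Sum>i\<in>p1. Sup (snd i) - Inf (snd i)) < \<delta>" .
      qed
      finally have s1: "\<bar>?s1\<bar> < e * (b - a) / 2" unfolding e'_def .
      have "\<bar>?s1 + ?s2\<bar> \<le> \<bar>?s1\<bar> + \<bar>?s2\<bar>" by (rule abs_triangle_ineq)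
      also have "\<dots> \<le> e * (b - a) / 2 + e / 2 * (b - a)" using less_imp_le[OF s1] s2 by (rule add_mono)
      also have "\<dots> = e * measure lborel {a..b}" using ab by simp
      finally show ?thesis unfolding eq real_norm_def .
    qed
    ultimately show "\<exists>d. gauge d \<and> (\<forall>p. p tagged_division_of {a..b} \<and> d fine p \<longrightarrow>
        norm ((\<Sum>(x, k)\<in>p. measure lborel k *\<^sub>R F x) - (f b - f a)) \<le> e * measure lborel {a..b})"
      by (intro exI[of _ \<gamma>] conjI allI impI) (simp_all only: simp_thms)
  qed
qed

section \<open>Energy and the sets K\<close>

text \<open>The integral of the squared slope of the interpolation of w at the points i / 2^n. It
  depends on finitely many values of w, so bounds on it survive pointwise limits.\<close>

definition energy :: "nat \<Rightarrow> (real \<Rightarrow> real) \<Rightarrow> real" where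
  "energy n w = 2 ^ n * (\<Sum>i<2 ^ n. (w (real (Suc i) / 2 ^ n) - w (real i / 2 ^ n))\<^sup>2)"

text \<open>The fundamental theorem writes every increment as an integral of the derivative; on each
  cell the squared increment is then at most the length times the integral of the squared
  derivative, and the cells add up.\<close>

lemma K_imp_energy_le:
  assumes w: "w \<in> K r" and r: "0 \<le> r"
  shows "energy n (apply_bcontfun w) \<le> 2 * r"
proof -
  let ?w = "apply_bcontfun w"
  have ac: "absolutely_continuous_on_Icc 0 1 ?w" using w unfolding K_def by auto
  have en: "(\<integral>\<^sup>+ t\<in>{0..1}. ennreal ((deriv ?w t)\<^sup>2) \<partial>lebesgue) / 2 \<le> ennreal r" using w unfolding K_def by auto
  obtain N0 where N0: "negligible N0" "\<And>x. 0 < x \<Longrightarrow> x < 1 \<Longrightarrow> x \<notin> N0 \<Longrightarrow> ?w differentiable (at x)"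
    using absolutely_continuous_on_Icc_differentiable_ae[OF ac] by blast
  \<comment> \<open>Differentiability is known inside the interval, so the endpoints join the
    exceptional set.\<close>
  define N where "N = N0 \<union> {0, 1}"
  have N: "negligible N" unfolding N_def using N0 by simp
  define F where "F = (\<lambda>x. if x \<in> N then 0 else deriv ?w x)"
  have der: "(?w has_real_derivative deriv ?w x) (at x)" if "x \<in> {0..1} - N" for x
  proof -
    have "?w differentiable (at x)" using N0(2)[of x] that unfolding N_def by auto
    then show ?thesis by (simp add: DERIV_deriv_iff_real_differentiable)
  qed
  have FTC: "(F has_integral (?w v - ?w u)) {u..v}" if "0 \<le> u" "u \<le> v" "v \<le> 1" for u v
    unfolding F_def
    by (rule absolutely_continuous_on_Icc_FTC[OF absolutely_continuous_on_Icc_subset[OF ac that(1,3)] that(2) N])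
       (use that in \<open>auto intro!: der\<close>)
  have Fint: "F integrable_on {0..1}" using FTC[of 0 1] by auto
  have Fm: "F \<in> borel_measurable (lebesgue_on {0..1})"
    by (rule integrable_imp_measurable[OF Fint])
  have "(\<integral>\<^sup>+ t. ennreal ((F t)\<^sup>2) \<partial>lebesgue_on {0..1}) = (\<integral>\<^sup>+ t\<in>{0..1}. ennreal ((F t)\<^sup>2) \<partial>lebesgue)"
    by (subst nn_integral_restrict_space) auto
  also have "\<dots> = (\<integral>\<^sup>+ t\<in>{0..1}. ennreal ((deriv ?w t)\<^sup>2) \<partial>lebesgue)"
  proof (rule nn_integral_cong_AE)
    have "AE t in lebesgue. t \<notin> N"
      using N negligible_iff_null_sets AE_not_in by blast
    then show "AE t in lebesgue. ennreal ((F t)\<^sup>2) * indicator {0..1} t = ennreal ((deriv ?w t)\<^sup>2) * indicator {0..1} t"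
      by eventually_elim (simp add: F_def)
  qed
  also have "\<dots> \<le> ennreal (2 * r)"
  proof -
    have "2 * ((\<integral>\<^sup>+ t\<in>{0..1}. ennreal ((deriv ?w t)\<^sup>2) \<partial>lebesgue) / 2) \<le> 2 * ennreal r"
      using en by (intro mult_left_mono) auto
    moreover have "2 * (x / 2) = x" for x :: ennreal
      by (simp add: ennreal_times_divide mult.commute[of 2] ennreal_mult_divide_eq)
    ultimately show ?thesis using r by (simp add: ennreal_mult)
  qed
  finally have nn: "(\<integral>\<^sup>+ t. ennreal ((F t)\<^sup>2) \<partial>lebesgue_on {0..1}) \<le> ennreal (2 * r)" .
  have F2: "integrable (lebesgue_on {0..1}) (\<lambda>t. (F t)\<^sup>2)"
    using Fm nn by (intro integrableI_bounded) (auto intro: le_less_trans)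
  have "(\<integral>t. (F t)\<^sup>2 \<partial>lebesgue_on {0..1}) \<le> 2 * r"
    using nn r Fm by (subst integral_eq_nn_integral) (auto intro!: enn2real_leI)
  then have G: "(\<lambda>t. (F t)\<^sup>2) integrable_on {0..1}" "integral {0..1} (\<lambda>t. (F t)\<^sup>2) \<le> 2 * r"
    using has_integral_integral_lebesgue_on[OF F2] by (auto simp: integral_unique)
  have Gsub: "(\<lambda>t. (F t)\<^sup>2) integrable_on {u..v}" if "0 \<le> u" "v \<le> 1" for u v
    using integrable_on_subinterval[OF G(1), of u v] that by (auto simp: cbox_interval)
  have cell: "(?w v - ?w u)\<^sup>2 / (v - u) \<le> integral {u..v} (\<lambda>t. (F t)\<^sup>2)" if uv: "0 \<le> u" "u < v" "v \<le> 1" for u v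
  proof -
    \<comment> \<open>The Cauchy-Schwarz inequality on the cell, obtained from the fact that (F -
      c)^2 has a nonnegative integral when c is the mean slope.\<close>
    define c where "c = (?w v - ?w u) / (v - u)"
    define I where "I = integral {u..v} (\<lambda>t. (F t)\<^sup>2)"
    have 1: "((\<lambda>t. (F t)\<^sup>2) has_integral I) {u..v}"
      unfolding I_def using Gsub uv by (intro integrable_integral) auto
    have 2: "((\<lambda>t. 2 * c * F t) has_integral 2 * c * (?w v - ?w u)) {u..v}"
      using FTC[of u v] uv by (intro has_integral_mult_right) auto
    have 3: "((\<lambda>t. c\<^sup>2) has_integral (v - u) * c\<^sup>2) {u..v}"
      using has_integral_const_real[of "c\<^sup>2" u v] uv by simp
    have "((\<lambda>t. (F t)\<^sup>2 - 2 * c * F t + c\<^sup>2) has_integral I - 2 * c * (?w v - ?w u) + (v - u) * c\<^sup>2) {u..v}"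
      by (intro has_integral_add has_integral_diff 1 2 3)
    then have "0 \<le> I - 2 * c * (?w v - ?w u) + (v - u) * c\<^sup>2"
    proof (rule has_integral_nonneg)
      fix t
      have "(F t)\<^sup>2 - 2 * c * F t + c\<^sup>2 = (F t - c)\<^sup>2" by (simp add: power2_eq_square algebra_simps)
      then show "0 \<le> (F t)\<^sup>2 - 2 * c * F t + c\<^sup>2" by simp
    qed
    moreover have "2 * c * (?w v - ?w u) - (v - u) * c\<^sup>2 = (?w v - ?w u)\<^sup>2 / (v - u)"
      using uv unfolding c_def by (simp add: power2_eq_square divide_simps)
    ultimately show ?thesis unfolding I_def by linarith
  qed
  have sum_le: "(\<Sum>i<m. 2 ^ n * (?w (real (Suc i) / 2 ^ n) - ?w (real i / 2 ^ n))\<^sup>2) \<le> integral {0..real m / 2 ^ n} (\<lambda>t. (F t)\<^sup>2)"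
    if "m \<le> 2 ^ n" for m
    using that
  proof (induction m)
    case 0
    then show ?case by simp
  next
    case (Suc m)
    define u v :: real where "u = real m / 2 ^ n" and "v = real (Suc m) / 2 ^ n"
    have "real (Suc m) \<le> 2 ^ n" using Suc.prems by (metis of_nat_le_iff of_nat_numeral of_nat_power)
    then have uv: "0 \<le> u" "u < v" "v \<le> 1" unfolding u_def v_def by (auto simp: divide_strict_right_mono)
    have "v - u = 1 / 2 ^ n" unfolding u_def v_def by (simp add: field_simps)
    then have "2 ^ n * (?w v - ?w u)\<^sup>2 \<le> integral {u..v} (\<lambda>t. (F t)\<^sup>2)"
      using cell[OF uv] by (simp add: mult.commute)
    moreover have "integral {0..u} (\<lambda>t. (F t)\<^sup>2) + integral {u..v} (\<lambda>t. (F t)\<^sup>2) = integral {0..v} (\<lambda>t. (F t)\<^sup>2)"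
      using uv Gsub[of 0 v] by (intro Henstock_Kurzweil_Integration.integral_combine) auto
    ultimately show ?case using Suc unfolding u_def v_def by simp
  qed
  have "energy n ?w \<le> integral {0..1} (\<lambda>t. (F t)\<^sup>2)"
    using sum_le[of "2 ^ n"] unfolding energy_def by (simp add: sum_distrib_left)
  with G(2) show ?thesis by simp
qed

section \<open>Bounded dyadic energies imply membership in K\<close>

lemma sum_abs_squared_le_card:
  fixes g :: "'i \<Rightarrow> real"
  shows "(\<Sum>j\<in>J. \<bar>g j\<bar>)\<^sup>2 \<le> real (card J) * (\<Sum>j\<in>J. (g j)\<^sup>2)"
  using Cauchy_Schwarz_ineq_sum[of "\<lambda>_. 1" "\<lambda>j. \<bar>g j\<bar>" J] by simp

text \<open>Approximating the endpoints by dyadic numbers reduces this to the Cauchy--Schwarz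
  inequality on a dyadic grid.\<close>

lemma energy_bound_variation:
  assumes en: "\<And>n. energy n w \<le> c" and cont: "continuous_on {0..1} w"
    and I: "finite I" and uv: "\<And>i. i \<in> I \<Longrightarrow> 0 \<le> u i \<and> u i \<le> v i \<and> v i \<le> 1"
    and disj: "disjoint_family_on (\<lambda>i. {u i<..<v i}) I"
  shows "(\<Sum>i\<in>I. \<bar>w (v i) - w (u i)\<bar>)\<^sup>2 \<le> c * (\<Sum>i\<in>I. v i - u i)"
proof -
  have c0: "0 \<le> c" using en[of 0] unfolding energy_def by (auto intro: order_trans[OF zero_le_power2])
  define fl :: "nat \<Rightarrow> real \<Rightarrow> nat" where "fl n x = nat \<lfloor>2 ^ n * x\<rfloor>" for n x
  define D where "D n x = real (fl n x) / 2 ^ n" for n x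
  have flr: "real (fl n x) \<le> 2 ^ n * x" "2 ^ n * x < real (fl n x) + 1" if "0 \<le> x" for n x
    using that unfolding fl_def by (auto simp: of_nat_nat zero_le_mult_iff)
  have Dlim: "(\<lambda>n. D n x) \<longlonglongrightarrow> x" if "0 \<le> x" for x
  proof (rule real_tendsto_sandwich)
    have "(\<lambda>n. x - (1/2) ^ n) \<longlonglongrightarrow> x - 0"
      by (intro tendsto_diff tendsto_const LIMSEQ_power_zero) simp
    then show "(\<lambda>n. x - (1/2) ^ n) \<longlonglongrightarrow> x" by simp
    show "\<forall>\<^sub>F n in sequentially. x - (1/2) ^ n \<le> D n x"
    proof (intro always_eventually allI)
      fix n
      have "x - (1/2) ^ n = (2 ^ n * x - 1) / 2 ^ n" by (simp add: diff_divide_distrib power_one_over)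
      also have "\<dots> \<le> D n x"
        unfolding D_def using flr(2)[OF that, of n] by (intro divide_right_mono) auto
      finally show "x - (1/2) ^ n \<le> D n x" .
    qed
    show "\<forall>\<^sub>F n in sequentially. D n x \<le> x"
      using flr[OF that] unfolding D_def by (intro always_eventually allI) (simp add: field_simps)
  qed simp
  have D01: "D n x \<in> {0..1}" if "0 \<le> x" "x \<le> 1" for n x
  proof -
    have "real (fl n x) \<le> 2 ^ n * 1" using flr(1)[OF that(1), of n] that(2) by (meson mult_left_mono order_trans zero_le_numeral zero_le_power)
    then show ?thesis unfolding D_def by simp
  qed
  have wlim: "(\<lambda>n. w (D n x)) \<longlonglongrightarrow> w x" if "0 \<le> x" "x \<le> 1" for x
    by (rule continuous_on_tendsto_compose[OF cont Dlim[OF that(1)]]) (use that D01[OF that] in auto)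
  have "(\<Sum>i\<in>I. \<bar>w (D n (v i)) - w (D n (u i))\<bar>)\<^sup>2 \<le> c * (\<Sum>i\<in>I. D n (v i) - D n (u i))" for n
  proof -
    define g where "g j = w (real (Suc j) / 2 ^ n) - w (real j / 2 ^ n)" for j :: nat
    define J where "J i = {fl n (u i)..<fl n (v i)}" for i
    have mono: "fl n x \<le> fl n y" if "x \<le> y" for x y
      unfolding fl_def using that by (intro nat_mono floor_mono mult_left_mono) auto
    \<comment> \<open>Rounding down is monotone, so disjoint intervals keep disjoint blocks of
      cells. An interval with equal endpoints has an empty block.\<close>
    have disJ: "J i \<inter> J j = {}" if "i \<in> I" "j \<in> I" "i \<noteq> j" for i j
    proof -
      have d: "{u i<..<v i} \<inter> {u j<..<v j} = {}" using disj that unfolding disjoint_family_on_def by blast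
      consider "u i = v i" | "u j = v j" | "v i \<le> u j" | "v j \<le> u i"
      proof -
        have "max (u i) (u j) < min (v i) (v j) \<Longrightarrow> (max (u i) (u j) + min (v i) (v j)) / 2 \<in> {u i<..<v i} \<inter> {u j<..<v j}"
          by auto
        then have "min (v i) (v j) \<le> max (u i) (u j)" using d by force
        then show thesis using that uv[OF \<open>i \<in> I\<close>] uv[OF \<open>j \<in> I\<close>] by linarith
      qed
      then show ?thesis
        by cases (use mono[of "v i" "u j"] mono[of "v j" "u i"] in \<open>auto simp: J_def\<close>)
    qed
    have J2: "(\<Union>i\<in>I. J i) \<subseteq> {..<2 ^ n}"
    proof -
      have "fl n (v i) \<le> 2 ^ n" if "i \<in> I" for i
      proof -
        have "0 \<le> v i" "v i \<le> 1" using uv[OF that] by auto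
        then have "real (fl n (v i)) / 2 ^ n \<le> 1" using D01[of "v i" n] unfolding D_def by auto
        then have "real (fl n (v i)) \<le> real (2 ^ n)" by (simp add: divide_le_eq)
        then show ?thesis by (simp only: of_nat_le_iff)
      qed
      then show ?thesis unfolding J_def by fastforce
    qed
    have tele: "\<bar>w (D n (v i)) - w (D n (u i))\<bar> \<le> (\<Sum>j\<in>J i. \<bar>g j\<bar>)" if "i \<in> I" for i
    proof -
      have "fl n (u i) \<le> fl n (v i)" using uv[OF that] by (intro mono) auto
      then have "w (D n (v i)) - w (D n (u i)) = (\<Sum>j\<in>J i. g j)"
        using sum_Suc_diff'[of "fl n (u i)" "fl n (v i)" "\<lambda>j. w (real j / 2 ^ n)"]
        unfolding J_def D_def g_def by simp
      then show ?thesis by (simp add: sum_abs)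
    qed
    have "(\<Sum>i\<in>I. \<bar>w (D n (v i)) - w (D n (u i))\<bar>) \<le> (\<Sum>i\<in>I. \<Sum>j\<in>J i. \<bar>g j\<bar>)"
      by (intro sum_mono tele)
    also have "\<dots> = (\<Sum>j\<in>(\<Union>i\<in>I. J i). \<bar>g j\<bar>)"
      by (intro sum.UNION_disjoint[symmetric] I ballI impI disJ) (auto simp: J_def)
    finally have "(\<Sum>i\<in>I. \<bar>w (D n (v i)) - w (D n (u i))\<bar>)\<^sup>2 \<le> (\<Sum>j\<in>(\<Union>i\<in>I. J i). \<bar>g j\<bar>)\<^sup>2"
      by (intro power_mono sum_nonneg) auto
    also have "\<dots> \<le> real (card (\<Union>i\<in>I. J i)) * (\<Sum>j\<in>(\<Union>i\<in>I. J i). (g j)\<^sup>2)"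
      by (rule sum_abs_squared_le_card)
    also have "\<dots> \<le> real (card (\<Union>i\<in>I. J i)) * (c / 2 ^ n)"
    proof (rule mult_left_mono)
      have "(\<Sum>j\<in>(\<Union>i\<in>I. J i). (g j)\<^sup>2) \<le> (\<Sum>j<2 ^ n. (g j)\<^sup>2)"
        using J2 by (intro sum_mono2) auto
      also have "\<dots> \<le> c / 2 ^ n" using en[of n] unfolding energy_def g_def by (simp add: field_simps)
      finally show "(\<Sum>j\<in>(\<Union>i\<in>I. J i). (g j)\<^sup>2) \<le> c / 2 ^ n" .
    qed simp
    also have "card (\<Union>i\<in>I. J i) = (\<Sum>i\<in>I. card (J i))"
      by (intro card_UN_disjoint I ballI impI disJ) (auto simp: J_def)
    also have "real (\<Sum>i\<in>I. card (J i)) * (c / 2 ^ n) = c * (\<Sum>i\<in>I. D n (v i) - D n (u i))"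
    proof -
      have "real (card (J i)) = real (fl n (v i)) - real (fl n (u i))" if "i \<in> I" for i
        using mono[of "u i" "v i"] uv[OF that] unfolding J_def by (simp add: of_nat_diff)
      then have "real (\<Sum>i\<in>I. card (J i)) = (\<Sum>i\<in>I. real (fl n (v i)) - real (fl n (u i)))"
        by simp
      then show ?thesis unfolding D_def by (simp add: sum_divide_distrib diff_divide_distrib[symmetric] flip: sum_divide_distrib)
    qed
    finally show ?thesis .
  qed
  then show ?thesis
  proof (intro LIMSEQ_le)
    show "(\<lambda>n. (\<Sum>i\<in>I. \<bar>w (D n (v i)) - w (D n (u i))\<bar>)\<^sup>2) \<longlonglongrightarrow> (\<Sum>i\<in>I. \<bar>w (v i) - w (u i)\<bar>)\<^sup>2"
      by (intro tendsto_power tendsto_sum tendsto_rabs tendsto_diff wlim) (use uv in force)+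
    show "(\<lambda>n. c * (\<Sum>i\<in>I. D n (v i) - D n (u i))) \<longlonglongrightarrow> c * (\<Sum>i\<in>I. v i - u i)"
      by (intro tendsto_mult_left tendsto_sum tendsto_diff Dlim) (use uv in force)+
  qed blast
qed

lemma energy_bound_Holder:
  assumes en: "\<And>n. energy n w \<le> c" and cont: "continuous_on {0..1} w"
    and "0 \<le> x" "x \<le> y" "y \<le> 1"
  shows "\<bar>w y - w x\<bar> \<le> sqrt (c * (y - x))"
  using energy_bound_variation[OF en cont, of "{()}" "\<lambda>_. x" "\<lambda>_. y"] assms(3-)
  by (intro real_le_rsqrt) (auto simp: disjoint_family_on_def)

text \<open>Both endpoints of the dyadic cell around t move. The errors at the endpoints are at most
  e / 2 times their distances to t, and these distances add up to the length of the cell.\<close>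

lemma straddle_quotient_tendsto:
  fixes w :: "real \<Rightarrow> real"
  assumes "(w has_real_derivative D) (at t)" and "\<And>n. u n \<le> t" "\<And>n. t \<le> v n" "\<And>n. u n < v n"
    and lim: "(\<lambda>n. v n - u n) \<longlonglongrightarrow> 0"
  shows "(\<lambda>n. (w (v n) - w (u n)) / (v n - u n)) \<longlonglongrightarrow> D"
proof (rule LIMSEQ_I)
  fix e :: real assume e: "0 < e"
  have "(w has_derivative (\<lambda>h. D * h)) (at t)"
    using assms(1) by (simp add: has_field_derivative_def)
  then obtain d where d: "0 < d" "\<And>y. norm (y - t) < d \<Longrightarrow> norm (w y - w t - D * (y - t)) \<le> (e / 2) * norm (y - t)"
    unfolding has_derivative_at_alt using half_gt_zero[OF e] by blast
  obtain N where N: "\<And>n. N \<le> n \<Longrightarrow> norm (v n - u n - 0) < d"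
    using LIMSEQ_D[OF lim d(1)] by blast
  show "\<exists>N. \<forall>n\<ge>N. norm ((w (v n) - w (u n)) / (v n - u n) - D) < e"
  proof (intro exI allI impI)
    fix n assume n: "N \<le> n"
    have l: "0 < v n - u n" "v n - u n < d" using assms(4)[of n] N[OF n] by auto
    have "norm (v n - t) < d" "norm (u n - t) < d" using l assms(2,3)[of n] by auto
    from d(2)[OF this(1)] d(2)[OF this(2)]
    have 1: "\<bar>w (v n) - w t - D * (v n - t)\<bar> \<le> (e / 2) * (v n - t)" "\<bar>w (u n) - w t - D * (u n - t)\<bar> \<le> (e / 2) * (t - u n)"
      using assms(2,3)[of n] by auto
    have "\<bar>w (v n) - w (u n) - D * (v n - u n)\<bar> = \<bar>(w (v n) - w t - D * (v n - t)) - (w (u n) - w t - D * (u n - t))\<bar>"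
      by (simp add: algebra_simps)
    also have "\<dots> \<le> (e / 2) * (v n - t) + (e / 2) * (t - u n)" using 1 by linarith
    also have "\<dots> = (e / 2) * (v n - u n)" unfolding distrib_left[symmetric] by simp
    also have "\<dots> < e * (v n - u n)" using l e by simp
    finally have 2: "\<bar>w (v n) - w (u n) - D * (v n - u n)\<bar> < e * (v n - u n)" .
    have "(w (v n) - w (u n)) / (v n - u n) - D = (w (v n) - w (u n) - D * (v n - u n)) / (v n - u n)"
      using l by (simp add: diff_divide_distrib)
    then show "norm ((w (v n) - w (u n)) / (v n - u n) - D) < e"
      using 2 l by (simp add: divide_less_eq)
  qed
qed

text \<open>The variation bound gives absolute continuity. Almost everywhere the derivative is the
  limit of the slopes over the dyadic cells around the point; the squared slope function of level n
  has integral \<open>energy n\<close>, and Fatou's lemma carries the bound to the limit.\<close>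

lemma energy_le_imp_K:
  assumes w: "w \<in> C0" and en: "\<And>n. energy n (apply_bcontfun w) \<le> 2 * r" and r: "0 \<le> r"
  shows "w \<in> K r"
proof -
  let ?w = "apply_bcontfun w"
  have cont: "continuous_on {0..1} ?w" by simp
  have ac: "absolutely_continuous_on_Icc 0 1 ?w"
    unfolding absolutely_continuous_on_Icc_def
  proof (intro allI impI)
    fix e :: real assume e: "0 < e"
    \<comment> \<open>The summand 1 keeps the denominator positive for r = 0.\<close>
    define \<delta> where "\<delta> = e\<^sup>2 / (2 * r + 1)"
    have \<delta>: "0 < \<delta>" unfolding \<delta>_def using e r by simp
    have "(\<Sum>i<n. \<bar>?w (v i) - ?w (u i)\<bar>) < e"
      if uv: "\<forall>i<n. 0 \<le> u i \<and> u i \<le> v i \<and> v i \<le> 1" "disjoint_family_on (\<lambda>i. {u i<..<v i}) {..<n}"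
        and s: "(\<Sum>i<n. v i - u i) < \<delta>" for n :: nat and u v
    proof -
      have "(\<Sum>i<n. \<bar>?w (v i) - ?w (u i)\<bar>)\<^sup>2 \<le> 2 * r * (\<Sum>i<n. v i - u i)"
        by (rule energy_bound_variation[OF en cont]) (use uv in auto)
      also have "\<dots> \<le> 2 * r * \<delta>" using s r by (intro mult_left_mono) auto
      also have "\<dots> < (2 * r + 1) * \<delta>" using \<delta> by (simp add: distrib_right)
      also have "\<dots> = e\<^sup>2" unfolding \<delta>_def using r by simp
      finally show ?thesis using e by (intro power2_less_imp_less[of _ e]) auto
    qed
    then show "\<exists>\<delta>>0. \<forall>n u v. (\<forall>i<n::nat. 0 \<le> u i \<and> u i \<le> v i \<and> v i \<le> 1) \<and>
        disjoint_family_on (\<lambda>i. {u i<..<v i}) {..<n} \<and> (\<Sum>i<n. v i - u i) < \<delta>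
        \<longrightarrow> (\<Sum>i<n. \<bar>?w (v i) - ?w (u i)\<bar>) < e"
      using \<delta> by (intro exI[of _ \<delta>]) blast
  qed
  obtain N0 where N0: "negligible N0" "\<And>x. 0 < x \<Longrightarrow> x < 1 \<Longrightarrow> x \<notin> N0 \<Longrightarrow> ?w differentiable (at x)"
    using absolutely_continuous_on_Icc_differentiable_ae[OF ac] by blast
  define N where "N = N0 \<union> {0, 1}"
  have N: "negligible N" unfolding N_def using N0 by simp
  define c where "c n i = (2 ^ n * (?w (real (Suc i) / 2 ^ n) - ?w (real i / 2 ^ n)))\<^sup>2" for n and i :: nat
  define Q where "Q n t = (\<Sum>i<2 ^ n. ennreal (c n i) * indicator {real i / 2 ^ n..<real (Suc i) / 2 ^ n} t)" for n and t :: real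
  have Qm: "Q n \<in> borel_measurable lebesgue" for n
    unfolding Q_def by (intro borel_measurable_sum borel_measurable_times_ennreal borel_measurable_const borel_measurable_indicator) auto
  have Qint: "(\<integral>\<^sup>+ t. Q n t \<partial>lebesgue) \<le> ennreal (2 * r)" for n
  proof -
    have "(\<integral>\<^sup>+ t. Q n t \<partial>lebesgue) = (\<Sum>i<2 ^ n. ennreal (c n i) * emeasure lebesgue {real i / 2 ^ n..<real (Suc i) / 2 ^ n})"
      unfolding Q_def
    proof (subst nn_integral_sum)
      show "(\<lambda>t. ennreal (c n i) * indicator {real i / 2 ^ n..<real (Suc i) / 2 ^ n} t) \<in> borel_measurable lebesgue" for i
        by (intro borel_measurable_times_ennreal borel_measurable_const borel_measurable_indicator) auto
    qed (intro sum.cong refl nn_integral_cmult_indicator, auto)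
    also have "\<dots> = (\<Sum>i<2 ^ n. ennreal (c n i / 2 ^ n))"
    proof (intro sum.cong refl)
      fix i
      have "emeasure lebesgue {real i / 2 ^ n..<real (Suc i) / 2 ^ n} = ennreal (1 / 2 ^ n)"
        by (simp add: divide_right_mono diff_divide_distrib[symmetric])
      then show "ennreal (c n i) * emeasure lebesgue {real i / 2 ^ n..<real (Suc i) / 2 ^ n} = ennreal (c n i / 2 ^ n)"
        by (simp add: c_def flip: ennreal_mult)
    qed
    also have "\<dots> = ennreal (\<Sum>i<2 ^ n. c n i / 2 ^ n)"
      by (intro sum_ennreal) (simp add: c_def)
    also have "(\<Sum>i<2 ^ n. c n i / 2 ^ n) = energy n ?w"
      unfolding c_def energy_def sum_distrib_left by (intro sum.cong refl) (simp add: power2_eq_square)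
    finally show ?thesis using en[of n] by (simp add: ennreal_leI)
  qed
  have Qlim: "(\<lambda>n. Q n t) \<longlonglongrightarrow> ennreal ((deriv ?w t)\<^sup>2)" if t: "t \<in> {0..1} - N" for t
  proof -
    have t01: "0 < t" "t < 1" "t \<notin> N0" using t unfolding N_def by auto
    define j where "j n = nat \<lfloor>2 ^ n * t\<rfloor>" for n :: nat
    define u v where "u n = real (j n) / 2 ^ n" and "v n = real (Suc (j n)) / 2 ^ n" for n
    have jn: "real (j n) \<le> 2 ^ n * t" "2 ^ n * t < real (j n) + 1" for n
      using t01 unfolding j_def by (auto simp: of_nat_nat zero_le_mult_iff)
    have uv: "u n \<le> t" "t < v n" "v n - u n = (1/2) ^ n" for n
      using jn[of n] unfolding u_def v_def by (auto simp: field_simps power_one_over)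
    have j2: "j n < 2 ^ n" for n
    proof -
      have "real (j n) < real (2 ^ n)" using t01 by (intro le_less_trans[OF jn(1)]) simp
      then show ?thesis by (simp only: of_nat_less_iff)
    qed
    have Qeq: "Q n t = ennreal (((?w (v n) - ?w (u n)) / (v n - u n))\<^sup>2)" for n
    proof -
      have ind: "indicator {real i / 2 ^ n..<real (Suc i) / 2 ^ n} t = (if i = j n then 1 else 0 :: ennreal)" for i
      proof (cases "i = j n")
        case True
        then show ?thesis using uv(1,2)[of n] unfolding u_def v_def by simp
      next
        case False
        have "\<not> (real i / 2 ^ n \<le> t \<and> t < real (Suc i) / 2 ^ n)"
        proof
          assume a: "real i / 2 ^ n \<le> t \<and> t < real (Suc i) / 2 ^ n"
          then have "real i \<le> 2 ^ n * t" "2 ^ n * t < real i + 1" by (auto simp: field_simps)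
          with jn[of n] have "real i < real (j n) + 1" "real (j n) < real i + 1" by linarith+
          then show False using False by linarith
        qed
        then show ?thesis using False by simp
      qed
      have "Q n t = ennreal (c n (j n))"
        unfolding Q_def ind using j2[of n] by (simp add: sum.delta' if_distrib cong: if_cong)
      also have "c n (j n) = ((?w (v n) - ?w (u n)) / (v n - u n))\<^sup>2"
        unfolding c_def uv(3) unfolding u_def v_def by (simp add: power_one_over mult.commute)
      finally show ?thesis .
    qed
    have "?w differentiable (at t)" using N0(2) t01 by auto
    then have D: "(?w has_real_derivative deriv ?w t) (at t)" by (simp add: DERIV_deriv_iff_real_differentiable)
    have "(\<lambda>n. (?w (v n) - ?w (u n)) / (v n - u n)) \<longlonglongrightarrow> deriv ?w t"
    proof (rule straddle_quotient_tendsto[OF D])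
      show "u n \<le> t" "t \<le> v n" "u n < v n" for n using uv(1,2)[of n] by auto
      show "(\<lambda>n. v n - u n) \<longlonglongrightarrow> 0" unfolding uv(3) by (rule LIMSEQ_power_zero) simp
    qed
    then show ?thesis unfolding Qeq by (intro tendsto_ennrealI tendsto_power)
  qed
  have "(\<integral>\<^sup>+ t\<in>{0..1}. ennreal ((deriv ?w t)\<^sup>2) \<partial>lebesgue) \<le> (\<integral>\<^sup>+ t. liminf (\<lambda>n. Q n t) \<partial>lebesgue)"
  proof (rule nn_integral_mono_AE)
    have "AE t in lebesgue. t \<notin> N"
      using N negligible_iff_null_sets AE_not_in by blast
    then show "AE t in lebesgue. ennreal ((deriv ?w t)\<^sup>2) * indicator {0..1} t \<le> liminf (\<lambda>n. Q n t)"
    proof eventually_elim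
      case (elim t)
      show ?case
      proof (cases "t \<in> {0..1}")
        case True
        then have "liminf (\<lambda>n. Q n t) = ennreal ((deriv ?w t)\<^sup>2)"
          using Qlim[of t] elim by (intro lim_imp_Liminf) auto
        then show ?thesis using True by simp
      qed simp
    qed
  qed
  also have "\<dots> \<le> liminf (\<lambda>n. \<integral>\<^sup>+ t. Q n t \<partial>lebesgue)"
    by (rule nn_integral_liminf) (rule Qm)
  also have "\<dots> \<le> ennreal (2 * r)"
    using Qint by (intro Liminf_le always_eventually) auto
  finally have "(\<integral>\<^sup>+ t\<in>{0..1}. ennreal ((deriv ?w t)\<^sup>2) \<partial>lebesgue) / 2 \<le> ennreal (2 * r) / 2"
    by (rule divide_right_mono_ennreal)
  also have "ennreal (2 * r) / 2 = ennreal r"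
    using divide_ennreal[of "2 * r" 2] r by simp
  finally show ?thesis unfolding K_def using w ac by simp
qed

section \<open>Compactness of K\<close>

lemma K_subset_C0: "K r \<subseteq> C0"
  unfolding K_def by (rule Collect_subset)

lemma dist_C0_le:
  assumes "f \<in> C0" "g \<in> C0" "\<And>t. 0 \<le> t \<Longrightarrow> t \<le> 1 \<Longrightarrow> \<bar>apply_bcontfun f t - apply_bcontfun g t\<bar> \<le> e"
  shows "dist f g \<le> e"
proof (rule dist_bound)
  fix t
  have "apply_bcontfun f t = apply_bcontfun f (max 0 (min 1 t))" "apply_bcontfun g t = apply_bcontfun g (max 0 (min 1 t))"
    using assms(1,2) unfolding C0_def by auto
  then have "dist (apply_bcontfun f t) (apply_bcontfun g t) =
      dist (apply_bcontfun f (max 0 (min 1 t))) (apply_bcontfun g (max 0 (min 1 t)))"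
    by (rule arg_cong2)
  also have "\<dots> \<le> e"
    unfolding dist_real_def by (rule assms(3)) simp_all
  finally show "dist (apply_bcontfun f t) (apply_bcontfun g t) \<le> e" .
qed

lemma K_Holder:
  assumes "w \<in> K r" "0 \<le> r" "0 \<le> x" "x \<le> y" "y \<le> 1"
  shows "\<bar>apply_bcontfun w y - apply_bcontfun w x\<bar> \<le> sqrt (2 * r * (y - x))"
  using assms by (intro energy_bound_Holder K_imp_energy_le) auto

text \<open>Hoelder continuity of exponent 1/2 with a common constant gives boundedness and
  equicontinuity, so a subsequence converges uniformly by Arzela-Ascoli. Each dyadic energy passes
  to the limit, which therefore stays in the set.\<close>

lemma compact_K:
  assumes r: "0 \<le> r"
  shows "compact (K r)"
  unfolding compact_eq_seq_compact_metric seq_compact_def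
proof (intro allI impI)
  fix f :: "nat \<Rightarrow> real \<Rightarrow>\<^sub>C real" assume "\<forall>n. f n \<in> K r"
  then have f: "f n \<in> K r" for n by blast
  define F where "F n t = apply_bcontfun (f n) t" for n t
  have C0: "f n \<in> C0" "F n 0 = 0" for n using f[of n] unfolding K_def F_def C0_def by auto
  have H: "\<bar>F n y - F n x\<bar> \<le> sqrt (2 * r * \<bar>y - x\<bar>)" if "x \<in> {0..1}" "y \<in> {0..1}" for n x y
    using K_Holder[OF f r, of x y n] K_Holder[OF f r, of y x n] that unfolding F_def
    by (cases "x \<le> y") (auto simp: abs_minus_commute)
  have bnd: "norm (F n x) \<le> sqrt (2 * r)" if x: "x \<in> {0..1}" for n x
  proof -
    have "\<bar>F n x - F n 0\<bar> \<le> sqrt (2 * r * \<bar>x - 0\<bar>)" by (rule H) (use x in simp_all)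
    also have "\<dots> \<le> sqrt (2 * r)"
      by (intro real_sqrt_le_mono mult_right_le_one_le) (use x r in simp_all)
    finally show ?thesis using C0(2)[of n] by simp
  qed
  have pos: "0 < 2 * r + 1" using r by linarith
  have equi: "norm (F n x - F n y) < e"
    if "x \<in> {0..1}" "0 < e" and y: "y \<in> {0..1} \<and> norm (x - y) < e\<^sup>2 / (2 * r + 1)" for x e n y
  proof -
    have "2 * r * \<bar>x - y\<bar> \<le> (2 * r + 1) * \<bar>x - y\<bar>" by (rule mult_right_mono) simp_all
    also have "\<dots> = \<bar>x - y\<bar> * (2 * r + 1)" by (rule mult.commute)
    also have "\<dots> < e\<^sup>2"
      using conjunct2[OF y] unfolding real_norm_def by (simp only: pos_less_divide_eq[OF pos])
    finally have "sqrt (2 * r * \<bar>x - y\<bar>) < sqrt (e\<^sup>2)" by (rule real_sqrt_less_mono)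
    also have "sqrt (e\<^sup>2) = e" using that(2) by (intro real_sqrt_unique) simp_all
    finally show ?thesis using H[OF conjunct1[OF y] that(1), of n] by simp
  qed
  obtain g k where gk: "continuous_on {0..1} g" "strict_mono (k :: nat \<Rightarrow> nat)"
      "\<And>e. 0 < e \<Longrightarrow> \<exists>N. \<forall>n x. n \<ge> N \<and> x \<in> {0..1} \<longrightarrow> norm (F (k n) x - g x) < e"
  proof (rule Arzela_Ascoli[of "{0..1::real}" F "sqrt (2 * r)"])
    fix x e :: real assume xe: "x \<in> {0..1}" "0 < e"
    have "0 < e\<^sup>2 / (2 * r + 1)" using xe(2) pos by (intro divide_pos_pos zero_less_power)
    then show "\<exists>d>0. \<forall>n y. y \<in> {0..1} \<and> norm (x - y) < d \<longrightarrow> norm (F n x - F n y) < e"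
      using equi[OF xe] by (intro exI[of _ "e\<^sup>2 / (2 * r + 1)"] conjI allI impI) simp_all
  next
    fix g and k :: "nat \<Rightarrow> nat"
    assume "continuous_on {0..1} g" "strict_mono k"
      "\<And>e. 0 < e \<Longrightarrow> \<exists>N. \<forall>n x. n \<ge> N \<and> x \<in> {0..1} \<longrightarrow> norm (F (k n) x - g x) < e"
    then show thesis by (rule that)
  qed (simp_all only: bnd compact_Icc)
  have "g 0 = 0"
  proof -
    have "(\<lambda>n. F (k n) 0) \<longlonglongrightarrow> g 0"
    proof (rule LIMSEQ_I)
      fix e :: real assume "0 < e"
      from gk(3)[OF this] show "\<exists>N. \<forall>n\<ge>N. norm (F (k n) 0 - g 0) < e" by force
    qed
    then show ?thesis using C0(2) by (simp add: LIMSEQ_const_iff)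
  qed
  then obtain w where w: "w \<in> C0" "\<And>t. apply_bcontfun w t = g (max 0 (min 1 t))"
    using C0_surj[OF gk(1)] by blast
  have wlim: "(f \<circ> k) \<longlonglongrightarrow> w"
  proof (rule metric_LIMSEQ_I)
    fix e :: real assume "0 < e"
    then obtain N where N: "\<forall>n x. n \<ge> N \<and> x \<in> {0..1} \<longrightarrow> norm (F (k n) x - g x) < e / 2"
      using gk(3)[of "e / 2"] by auto
    show "\<exists>N. \<forall>n\<ge>N. dist ((f \<circ> k) n) w < e"
    proof (intro exI allI impI)
      fix n assume "N \<le> n"
      then have "dist (f (k n)) w \<le> e / 2"
        using N w C0 unfolding F_def by (intro dist_C0_le) (auto intro: less_imp_le)
      then show "dist ((f \<circ> k) n) w < e" using \<open>0 < e\<close> by simp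
    qed
  qed
  have pt: "(\<lambda>n. F (k n) t) \<longlonglongrightarrow> apply_bcontfun w t" for t
  proof (rule metric_LIMSEQ_I)
    fix e :: real assume "0 < e"
    then show "\<exists>N. \<forall>n\<ge>N. dist (F (k n) t) (apply_bcontfun w t) < e"
      using metric_LIMSEQ_D[OF wlim \<open>0 < e\<close>] unfolding F_def by (auto intro: dist_fun_lt_imp_dist_val_lt)
  qed
  have "energy n (apply_bcontfun w) \<le> 2 * r" for n
  proof (rule LIMSEQ_le_const2)
    show "(\<lambda>m. energy n (F (k m))) \<longlonglongrightarrow> energy n (apply_bcontfun w)"
      unfolding energy_def by (intro tendsto_mult_left tendsto_sum tendsto_power tendsto_diff pt)
    show "\<exists>N. \<forall>m\<ge>N. energy n (F (k m)) \<le> 2 * r"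
      using K_imp_energy_le[OF f r] unfolding F_def by blast
  qed
  then have "w \<in> K r" using w(1) r by (intro energy_le_imp_K)
  then show "\<exists>l\<in>K r. \<exists>r. strict_mono r \<and> (f \<circ> r) \<longlonglongrightarrow> l"
    using gk(2) wlim by blast
qed

section \<open>Gaussian concentration\<close>

text \<open>The interval S contains everything between two convex combinations, so its length bounds
  (1 - s) * (a' - a) + s * (b' - b). Replacing the four points one after the other by suprema and
  infima gives the diameters of A and B, which dominate their measures.\<close>

lemma emeasure_convex_combination:
  fixes A B S :: "real set"
  assumes s: "0 < s" "s < 1" and ne: "A \<noteq> {}" "B \<noteq> {}"
    and S: "S \<in> sets borel" "is_interval S" and sub: "\<And>a b. a \<in> A \<Longrightarrow> b \<in> B \<Longrightarrow> (1 - s) * a + s * b \<in> S"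
  shows "ennreal (1 - s) * emeasure lborel A + ennreal s * emeasure lborel B \<le> emeasure lborel S"
proof (cases "emeasure lborel S = \<top>")
  case False
  define L where "L = measure lborel S"
  have SL: "emeasure lborel S = ennreal L"
    unfolding L_def using False by (rule emeasure_eq_ennreal_measure)
  have diff: "(1 - s) * (a' - a) + s * (b' - b) \<le> L" if "a \<in> A" "a' \<in> A" "b \<in> B" "b' \<in> B" for a a' b b'
  proof -
    define z z' where "z = (1 - s) * a + s * b" and "z' = (1 - s) * a' + s * b'"
    have zS: "z \<in> S" "z' \<in> S" unfolding z_def z'_def using sub that by auto
    have eq: "(1 - s) * (a' - a) + s * (b' - b) = z' - z" unfolding z_def z'_def by (simp add: algebra_simps)
    show ?thesis
    proof (cases "z \<le> z'")
      case True
      have "{z..z'} \<subseteq> S" using S(2) zS unfolding is_interval_1 subset_iff atLeastAtMost_iff by blast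
      then have "emeasure lborel {z..z'} \<le> emeasure lborel S" using S(1) by (intro emeasure_mono) auto
      then have "ennreal (z' - z) \<le> ennreal L" using True SL by simp
      then show ?thesis unfolding eq L_def by (simp add: ennreal_le_iff)
    next
      case False
      then show ?thesis unfolding eq L_def by (smt (verit) measure_nonneg)
    qed
  qed
  obtain a0 b0 where ab0: "a0 \<in> A" "b0 \<in> B" using ne by auto
  have "a \<le> a0 + L / (1 - s)" "a \<ge> a0 - L / (1 - s)" if "a \<in> A" for a
    using diff[OF ab0(1) that ab0(2) ab0(2)] diff[OF that ab0(1) ab0(2) ab0(2)] s by (auto simp: field_simps)
  then have bA: "bdd_above A" "bdd_below A" by (meson bdd_aboveI bdd_belowI)+
  have "b \<le> b0 + L / s" "b \<ge> b0 - L / s" if "b \<in> B" for b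
    using diff[OF ab0(1) ab0(1) ab0(2) that] diff[OF ab0(1) ab0(1) that ab0(2)] s by (auto simp: field_simps)
  then have bB: "bdd_above B" "bdd_below B" by (meson bdd_aboveI bdd_belowI)+
  have IS: "Inf A \<le> Sup A" "Inf B \<le> Sup B" using bA bB ne by (auto intro: cInf_le_cSup)
  have 1: "(1 - s) * (Sup A - a) + s * (b' - b) \<le> L" if "a \<in> A" "b \<in> B" "b' \<in> B" for a b b'
  proof -
    have "Sup A \<le> a + (L - s * (b' - b)) / (1 - s)"
      using diff[OF that(1) _ that(2,3)] s by (intro cSup_least ne) (simp add: field_simps)
    then show ?thesis using s by (simp add: field_simps)
  qed
  have 2: "(1 - s) * (Sup A - Inf A) + s * (b' - b) \<le> L" if "b \<in> B" "b' \<in> B" for b b'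
  proof -
    have "Sup A - (L - s * (b' - b)) / (1 - s) \<le> Inf A"
      using 1[OF _ that] s by (intro cInf_greatest ne) (simp add: field_simps)
    then show ?thesis using s by (simp add: field_simps)
  qed
  have 3: "(1 - s) * (Sup A - Inf A) + s * (Sup B - b) \<le> L" if "b \<in> B" for b
  proof -
    have "Sup B \<le> b + (L - (1 - s) * (Sup A - Inf A)) / s"
      using 2[OF that] s by (intro cSup_least ne) (simp add: field_simps)
    then show ?thesis using s by (simp add: field_simps)
  qed
  have 4: "(1 - s) * (Sup A - Inf A) + s * (Sup B - Inf B) \<le> L"
  proof -
    have "Sup B - (L - (1 - s) * (Sup A - Inf A)) / s \<le> Inf B"
      using 3 s by (intro cInf_greatest ne) (simp add: field_simps)
    then show ?thesis using s by (simp add: field_simps)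
  qed
  have len: "emeasure lborel X \<le> ennreal (Sup X - Inf X)" if "bdd_above X" "bdd_below X" "Inf X \<le> Sup X" for X :: "real set"
  proof -
    have "X \<subseteq> {Inf X..Sup X}" using that by (auto intro: cInf_lower cSup_upper)
    then have "emeasure lborel X \<le> emeasure lborel {Inf X..Sup X}" by (intro emeasure_mono) auto
    then show ?thesis using that by simp
  qed
  have "ennreal (1 - s) * emeasure lborel A + ennreal s * emeasure lborel B
      \<le> ennreal (1 - s) * ennreal (Sup A - Inf A) + ennreal s * ennreal (Sup B - Inf B)"
    by (intro add_mono mult_left_mono len bA bB IS) auto
  also have "\<dots> = ennreal ((1 - s) * (Sup A - Inf A) + s * (Sup B - Inf B))"
    using s IS by (simp add: ennreal_mult ennreal_plus)
  also have "\<dots> \<le> emeasure lborel S" unfolding SL by (intro ennreal_leI 4)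
  finally show ?thesis .
qed simp

text \<open>The layer cake formula by Tonelli, over the levels below 1; hence the truncation of f at
  1.\<close>

lemma nn_integral_unit_layers:
  fixes f :: "real \<Rightarrow> real"
  assumes [measurable]: "f \<in> borel_measurable borel"
  shows "(\<integral>\<^sup>+ t\<in>{0<..<1}. emeasure lborel {x. t < f x} \<partial>lborel) = (\<integral>\<^sup>+ x. ennreal (min 1 (max 0 (f x))) \<partial>lborel)"
proof -
  have "(\<integral>\<^sup>+ t\<in>{0<..<1}. emeasure lborel {x. t < f x} \<partial>lborel)
      = (\<integral>\<^sup>+ t. (\<integral>\<^sup>+ x. indicator {0<..<1} t * indicator {y. t < f y} x \<partial>lborel) \<partial>lborel)"
  proof (intro nn_integral_cong)
    fix t :: real
    have "(\<integral>\<^sup>+ x. indicator {0<..<1} t * indicator {y. t < f y} x \<partial>lborel) = indicator {0<..<1} t * (\<integral>\<^sup>+ x. indicator {y. t < f y} x \<partial>lborel)"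
      by (intro nn_integral_cmult) simp
    then show "emeasure lborel {x. t < f x} * indicator {0<..<1} t = (\<integral>\<^sup>+ x. indicator {0<..<1} t * indicator {y. t < f y} x \<partial>lborel)"
      by (simp add: mult.commute)
  qed
  also have "\<dots> = (\<integral>\<^sup>+ x. (\<integral>\<^sup>+ t. indicator {0<..<1} t * indicator {y. t < f y} x \<partial>lborel) \<partial>lborel)"
    by (rule lborel_pair.Fubini') (simp add: indicator_def[abs_def] split_beta')
  also have "\<dots> = (\<integral>\<^sup>+ x. ennreal (min 1 (max 0 (f x))) \<partial>lborel)"
  proof (intro nn_integral_cong)
    fix x
    have "(\<integral>\<^sup>+ t. indicator {0<..<1} t * indicator {y. t < f y} x \<partial>lborel)
        = (\<integral>\<^sup>+ t. indicator {0<..<min 1 (max 0 (f x))} t \<partial>lborel)"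
      by (intro nn_integral_cong) (auto simp: indicator_def)
    also have "\<dots> = ennreal (min 1 (max 0 (f x)))" by simp
    finally show "(\<integral>\<^sup>+ t. indicator {0<..<1} t * indicator {y. t < f y} x \<partial>lborel) = ennreal (min 1 (max 0 (f x)))" .
  qed
  finally show ?thesis .
qed

text \<open>The superlevel sets of the majorant are intervals, so the one-dimensional Brunn--Minkowski
  inequality is needed only in the form of \<open>emeasure_convex_combination\<close>.\<close>

lemma Prekopa_Leindler_unimodal:
  fixes U V w :: "real \<Rightarrow> real"
  assumes s: "0 < s" "s < 1"
    and [measurable]: "U \<in> borel_measurable borel" "V \<in> borel_measurable borel" "w \<in> borel_measurable borel"
    and U: "\<And>x. 0 \<le> U x" "\<And>x. U x \<le> B" and V: "\<And>x. 0 \<le> V x" "\<And>x. V x \<le> B" and w: "\<And>x. 0 \<le> w x"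
    and unimodal: "\<And>t. is_interval {x. t < w x}"
    and le: "\<And>x y. U x powr (1 - s) * V y powr s \<le> w ((1 - s) * x + s * y)"
    and IU: "(\<integral>\<^sup>+ x. ennreal (U x) \<partial>lborel) = ennreal I" "0 \<le> I"
    and IV: "(\<integral>\<^sup>+ x. ennreal (V x) \<partial>lborel) = ennreal J" "0 \<le> J"
    and Iw: "(\<integral>\<^sup>+ x. ennreal (w x) \<partial>lborel) = ennreal H" "0 \<le> H"
  shows "I powr (1 - s) * J powr s \<le> H"
proof (cases "I = 0 \<or> J = 0")
  case True
  then show ?thesis using Iw(2) s by auto
next
  case False
  then have IJ: "0 < I" "0 < J" using IU IV by auto
  define m where "m = (SUP x. U x)"
  define n where "n = (SUP x. V x)"
  have bdd: "bdd_above (range U)" "bdd_above (range V)" using U(2) V(2) by (auto intro!: bdd_aboveI[of _ B])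
  have Um: "U x \<le> m" "V x \<le> n" for x unfolding m_def n_def using bdd by (auto intro: cSUP_upper)
  have pos: "0 < m" "0 < n"
  proof -
    have "\<exists>x. 0 < U x"
    proof (rule ccontr)
      assume "\<not> (\<exists>x. 0 < U x)"
      then have "U x = 0" for x using U(1)[of x] by (auto simp: not_less intro: order_antisym)
      then show False using IU IJ by simp
    qed
    then show "0 < m" using Um(1) by (auto intro: less_le_trans)
    have "\<exists>x. 0 < V x"
    proof (rule ccontr)
      assume "\<not> (\<exists>x. 0 < V x)"
      then have "V x = 0" for x using V(1)[of x] by (auto simp: not_less intro: order_antisym)
      then show False using IV IJ by simp
    qed
    then show "0 < n" using Um(2) by (auto intro: less_le_trans)
  qed
  \<comment> \<open>Dividing U and V by their suprema makes the superlevel sets of both nonempty for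
    every t < 1, as the length inequality requires; k is the matching scale of w.\<close>
  define k where "k = m powr (1 - s) * n powr s"
  have k: "0 < k" unfolding k_def using pos by simp
  have level: "ennreal (1 - s) * emeasure lborel {x. t < U x / m} + ennreal s * emeasure lborel {x. t < V x / n}
      \<le> emeasure lborel {x. t < w x / k}" if t: "0 < t" "t < 1" for t
  proof (rule emeasure_convex_combination[OF s])
    have "t * m < m" using t pos by simp
    then obtain x where "t * m < U x" unfolding m_def using bdd by (metis UNIV_not_empty less_cSUP_iff rangeI)
    then show "{x. t < U x / m} \<noteq> {}" using pos by (auto simp: pos_less_divide_eq)
    have "t * n < n" using t pos by simp
    then obtain x where "t * n < V x" unfolding n_def using bdd by (metis UNIV_not_empty less_cSUP_iff rangeI)
    then show "{x. t < V x / n} \<noteq> {}" using pos by (auto simp: pos_less_divide_eq)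
    show "{x. t < w x / k} \<in> sets borel" by measurable
    have "{x. t < w x / k} = {x. t * k < w x}" using k by (simp add: pos_less_divide_eq)
    then show "is_interval {x. t < w x / k}" using unimodal by simp
    fix a b assume "a \<in> {x. t < U x / m}" "b \<in> {x. t < V x / n}"
    then have ab: "t < U a / m" "t < V b / n" by auto
    have "t * k = (t powr (1 - s) * t powr s) * k" using t by (simp flip: powr_add)
    also have "\<dots> = (t * m) powr (1 - s) * (t * n) powr s"
      unfolding k_def using t pos by (simp add: powr_mult)
    also have "\<dots> < U a powr (1 - s) * V b powr s"
    proof -
      have tmn: "0 < t * m" "0 < t * n" "t * m < U a" "t * n < V b"
        using ab t pos by (simp_all add: pos_less_divide_eq)
      have "(t * m) powr (1 - s) < U a powr (1 - s)" "(t * n) powr s < V b powr s"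
        using tmn s by (simp_all add: powr_less_mono2)
      moreover have "U a \<noteq> 0" using tmn by linarith
      ultimately show ?thesis by (intro mult_strict_mono) simp_all
    qed
    also have "\<dots> \<le> w ((1 - s) * a + s * b)" by (rule le)
    finally show "(1 - s) * a + s * b \<in> {x. t < w x / k}" using k by (simp add: pos_less_divide_eq)
  qed
  have layers: "(\<integral>\<^sup>+ t\<in>{0<..<1}. emeasure lborel {x. t < f x / c} \<partial>lborel) = ennreal (E / c)"
    if [measurable]: "f \<in> borel_measurable borel" and f: "\<And>x. 0 \<le> f x" "\<And>x. f x \<le> c" and c: "0 < c"
      and E: "(\<integral>\<^sup>+ x. ennreal (f x) \<partial>lborel) = ennreal E" "0 \<le> E" for f :: "real \<Rightarrow> real" and c E
  proof -
    have "(\<integral>\<^sup>+ t\<in>{0<..<1}. emeasure lborel {x. t < f x / c} \<partial>lborel) = (\<integral>\<^sup>+ x. ennreal (min 1 (max 0 (f x / c))) \<partial>lborel)"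
      by (intro nn_integral_unit_layers) simp
    also have "\<dots> = (\<integral>\<^sup>+ x. ennreal (1 / c) * ennreal (f x) \<partial>lborel)"
      using f c by (intro nn_integral_cong) (simp flip: ennreal_mult)
    also have "\<dots> = ennreal (1 / c) * ennreal E" by (subst nn_integral_cmult) (simp_all add: E)
    finally show ?thesis using E c by (simp flip: ennreal_mult)
  qed
  have meas: "(\<lambda>t. emeasure lborel {x. t < f x}) \<in> borel_measurable lborel" if [measurable]: "f \<in> borel_measurable borel" for f :: "real \<Rightarrow> real"
  proof -
    have "{p \<in> space (lborel \<Otimes>\<^sub>M lborel). fst p < f (snd p)} \<in> sets (lborel \<Otimes>\<^sub>M lborel)"
      by measurable
    from lborel.measurable_emeasure_Pair[OF this] show ?thesis
      by (simp add: vimage_def space_pair_measure)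
  qed
  have "ennreal ((1 - s) * (I / m) + s * (J / n)) = ennreal (1 - s) * ennreal (I / m) + ennreal s * ennreal (J / n)"
  proof -
    have "0 \<le> (1 - s) * (I / m)" "0 \<le> s * (J / n)" using s IJ pos by simp_all
    moreover have "ennreal ((1 - s) * (I / m)) = ennreal (1 - s) * ennreal (I / m)" "ennreal (s * (J / n)) = ennreal s * ennreal (J / n)"
      using s IJ pos by (intro ennreal_mult; simp)+
    ultimately show ?thesis by (simp only: ennreal_plus)
  qed
  also have "\<dots> = ennreal (1 - s) * (\<integral>\<^sup>+ t\<in>{0<..<1}. emeasure lborel {x. t < U x / m} \<partial>lborel)
      + ennreal s * (\<integral>\<^sup>+ t\<in>{0<..<1}. emeasure lborel {x. t < V x / n} \<partial>lborel)"
    using layers[of U m I] layers[of V n J] U V Um pos IU IV by simp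
  also have "\<dots> = (\<integral>\<^sup>+ t. ennreal (1 - s) * (emeasure lborel {x. t < U x / m} * indicator {0<..<1} t)
      + ennreal s * (emeasure lborel {x. t < V x / n} * indicator {0<..<1} t) \<partial>lborel)"
  proof -
    define \<alpha> \<beta> :: "real \<Rightarrow> ennreal" where
      "\<alpha> t = emeasure lborel {x. t < U x / m} * indicator {0<..<1} t" and
      "\<beta> t = emeasure lborel {x. t < V x / n} * indicator {0<..<1} t" for t
    have [measurable]: "\<alpha> \<in> borel_measurable lborel" "\<beta> \<in> borel_measurable lborel"
      unfolding \<alpha>_def \<beta>_def using meas[of "\<lambda>x. U x / m"] meas[of "\<lambda>x. V x / n"] by simp_all
    have "ennreal (1 - s) * integral\<^sup>N lborel \<alpha> + ennreal s * integral\<^sup>N lborel \<beta>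
        = (\<integral>\<^sup>+ t. ennreal (1 - s) * \<alpha> t + ennreal s * \<beta> t \<partial>lborel)"
      by (simp add: nn_integral_add nn_integral_cmult)
    then show ?thesis unfolding \<alpha>_def \<beta>_def .
  qed
  also have "\<dots> \<le> (\<integral>\<^sup>+ t\<in>{0<..<1}. emeasure lborel {x. t < w x / k} \<partial>lborel)"
  proof (rule nn_integral_mono)
    fix t
    show "ennreal (1 - s) * (emeasure lborel {x. t < U x / m} * indicator {0<..<1} t)
      + ennreal s * (emeasure lborel {x. t < V x / n} * indicator {0<..<1} t)
      \<le> emeasure lborel {x. t < w x / k} * indicator {0<..<1} t"
    proof (cases "t \<in> {0<..<1}")
      case True
      then have "indicator {0<..<1} t = (1 :: ennreal)" by simp
      then show ?thesis using level[of t] True unfolding greaterThanLessThan_iff by (simp only: mult_1_right)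
    next
      case False
      then have "indicator {0<..<1} t = (0 :: ennreal)" by simp
      then show ?thesis by (simp only: mult_zero_right add_0_right)
    qed
  qed
  also have "\<dots> = (\<integral>\<^sup>+ x. ennreal (min 1 (max 0 (w x / k))) \<partial>lborel)"
    by (intro nn_integral_unit_layers) simp
  also have "\<dots> \<le> (\<integral>\<^sup>+ x. ennreal (1 / k) * ennreal (w x) \<partial>lborel)"
    using w k by (intro nn_integral_mono) (auto simp flip: ennreal_mult intro!: ennreal_leI)
  also have "\<dots> = ennreal (1 / k) * ennreal H" by (subst nn_integral_cmult) (simp_all add: Iw)
  also have "\<dots> = ennreal (H / k)" using Iw k by (simp flip: ennreal_mult)
  finally have "(1 - s) * (I / m) + s * (J / n) \<le> H / k"
    using Iw k by (simp add: ennreal_le_iff)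
  \<comment> \<open>The weighted inequality of the arithmetic and geometric means turns the additive
    estimate into the multiplicative one; the scales m, n and k then cancel.\<close>
  moreover have "(I / m) powr (1 - s) * (J / n) powr s \<le> (1 - s) * (I / m) + s * (J / n)"
    using s IJ pos by (intro Youngs_inequality_0) auto
  ultimately have "(I / m) powr (1 - s) * (J / n) powr s \<le> H / k" by (rule order_trans[rotated])
  moreover have "(I / m) powr (1 - s) * (J / n) powr s = I powr (1 - s) * J powr s / k"
    unfolding k_def using IJ pos by (simp add: powr_divide)
  ultimately have "I powr (1 - s) * J powr s / k \<le> H / k" by (simp only:)
  then show ?thesis using k by (simp only: divide_le_cancel)
qed

section \<open>Gaussian measures in one and in finitely many dimensions\<close>

definition std_gauss :: "real measure" where
  "std_gauss = density lborel (\<lambda>x. ennreal (std_normal_density x))"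

lemma sets_std_gauss [measurable_cong, simp]: "sets std_gauss = sets borel"
  unfolding std_gauss_def by simp

lemma space_std_gauss [simp]: "space std_gauss = UNIV"
  unfolding std_gauss_def by simp

lemma prob_space_std_gauss: "prob_space std_gauss"
  unfolding std_gauss_def by (rule prob_space_normal_density) simp

lemma nn_integral_std_gauss:
  assumes "f \<in> borel_measurable borel"
  shows "(\<integral>\<^sup>+ x. f x \<partial>std_gauss) = (\<integral>\<^sup>+ x. ennreal (std_normal_density x) * f x \<partial>lborel)"
  unfolding std_gauss_def using assms by (subst nn_integral_density) auto

text \<open>In the exponent this is (1 - s) x^2 + s y^2 - s (1 - s) (x - y)^2 = ((1 - s) x + s y)^2.
  The last square on the left is the gain that becomes the Gaussian cost of separation.\<close>

lemma std_normal_density_convex_combination: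
  assumes "0 \<le> s" "s \<le> 1"
  shows "std_normal_density x powr (1 - s) * std_normal_density y powr s * exp (s * (1 - s) * (x - y)\<^sup>2 / 2)
    = std_normal_density ((1 - s) * x + s * y)"
proof -
  have c: "(1 / sqrt (2 * pi)) powr (1 - s) * (1 / sqrt (2 * pi)) powr s = 1 / sqrt (2 * pi)"
    by (simp flip: powr_add)
  have e: "std_normal_density z powr r = (1 / sqrt (2 * pi)) powr r * exp (- z\<^sup>2 / 2) powr r" for z r
    unfolding std_normal_density_def by (intro powr_mult; simp)
  have p: "exp a powr r = exp (r * a)" for a r :: real by (simp add: powr_def)
  have "std_normal_density x powr (1 - s) * std_normal_density y powr s * exp (s * (1 - s) * (x - y)\<^sup>2 / 2)
     = ((1 / sqrt (2 * pi)) powr (1 - s) * (1 / sqrt (2 * pi)) powr s) *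
       (exp (- x\<^sup>2 / 2) powr (1 - s) * exp (- y\<^sup>2 / 2) powr s * exp (s * (1 - s) * (x - y)\<^sup>2 / 2))"
    unfolding e by (simp only: mult_ac)
  also have "\<dots> = 1 / sqrt (2 * pi) * exp ((1 - s) * (- x\<^sup>2 / 2) + s * (- y\<^sup>2 / 2) + s * (1 - s) * (x - y)\<^sup>2 / 2)"
    unfolding c p by (simp only: exp_add)
  also have "(1 - s) * (- x\<^sup>2 / 2) + s * (- y\<^sup>2 / 2) + s * (1 - s) * (x - y)\<^sup>2 / 2 = - ((1 - s) * x + s * y)\<^sup>2 / 2"
    by (simp add: power2_eq_square field_simps)
  finally show ?thesis unfolding std_normal_density_def by simp
qed

text \<open>The Lebesgue inequality for u and v times the normal density. The majorant is C times
  that density, which is unimodal, so the restricted form applies.\<close>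

lemma std_gauss_Prekopa_Leindler:
  fixes u v :: "real \<Rightarrow> real"
  assumes s: "0 < s" "s < 1"
    and [measurable]: "u \<in> borel_measurable borel" "v \<in> borel_measurable borel"
    and u: "\<And>x. 0 \<le> u x" "\<And>x. u x \<le> B" and v: "\<And>x. 0 \<le> v x" "\<And>x. v x \<le> B" and C: "0 \<le> C"
    and le: "\<And>x y. u x powr (1 - s) * v y powr s \<le> C * exp (s * (1 - s) * (x - y)\<^sup>2 / 2)"
    and I: "(\<integral>\<^sup>+ x. ennreal (u x) \<partial>std_gauss) = ennreal I" "0 \<le> I"
    and J: "(\<integral>\<^sup>+ x. ennreal (v x) \<partial>std_gauss) = ennreal J" "0 \<le> J"
  shows "I powr (1 - s) * J powr s \<le> C"
proof -
  have B: "0 \<le> B" using u order_trans by blast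
  have d1: "std_normal_density x \<le> 1" for x
  proof -
    have "1 \<le> sqrt (2 * pi)" using pi_ge_two by (simp add: real_le_rsqrt)
    then have "1 / sqrt (2 * pi) * exp (- x\<^sup>2 / 2) \<le> 1 * 1" by (intro mult_mono) auto
    then show ?thesis unfolding std_normal_density_def by simp
  qed
  have d0: "0 \<le> std_normal_density x" for x by simp
  show ?thesis
  proof (rule Prekopa_Leindler_unimodal[OF s, where U = "\<lambda>x. std_normal_density x * u x"
        and V = "\<lambda>x. std_normal_density x * v x" and w = "\<lambda>z. C * std_normal_density z" and B = B])
    show "0 \<le> std_normal_density x * u x" "0 \<le> std_normal_density x * v x" "0 \<le> C * std_normal_density x" for x
      using u v C by simp_all
    show "std_normal_density x * u x \<le> B" "std_normal_density x * v x \<le> B" for x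
      using mult_mono[OF d1[of x] u(2)[of x] _ u(1)] mult_mono[OF d1[of x] v(2)[of x] _ v(1)] by simp_all
    show "is_interval {x. t < C * std_normal_density x}" for t
      unfolding is_interval_1
    proof (intro ballI allI impI)
      fix a b x assume ab: "a \<in> {x. t < C * std_normal_density x}" "b \<in> {x. t < C * std_normal_density x}" and x: "a \<le> x \<and> x \<le> b"
      have mono: "C * std_normal_density y \<le> C * std_normal_density x" if "\<bar>x\<bar> \<le> \<bar>y\<bar>" for x y :: real
      proof -
        have "x\<^sup>2 \<le> y\<^sup>2" using that by (simp add: abs_le_square_iff)
        then show ?thesis using C unfolding std_normal_density_def by (intro mult_left_mono) auto
      qed
      have "\<bar>x\<bar> \<le> \<bar>a\<bar> \<or> \<bar>x\<bar> \<le> \<bar>b\<bar>" using x by linarith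
      then show "x \<in> {x. t < C * std_normal_density x}"
        using mono[of x a] mono[of x b] ab by auto
    qed
    show "(std_normal_density x * u x) powr (1 - s) * (std_normal_density y * v y) powr s \<le> C * std_normal_density ((1 - s) * x + s * y)" for x y
    proof -
      have "(std_normal_density x * u x) powr (1 - s) * (std_normal_density y * v y) powr s
          = (std_normal_density x powr (1 - s) * std_normal_density y powr s) * (u x powr (1 - s) * v y powr s)"
        using u v by (simp add: powr_mult)
      also have "\<dots> \<le> (std_normal_density x powr (1 - s) * std_normal_density y powr s) * (C * exp (s * (1 - s) * (x - y)\<^sup>2 / 2))"
        by (intro mult_left_mono le) simp
      also have "\<dots> = C * std_normal_density ((1 - s) * x + s * y)"
        using std_normal_density_convex_combination[of s x y] s by (simp add: mult_ac)
      finally show ?thesis .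
    qed
    show "(\<integral>\<^sup>+ x. ennreal (std_normal_density x * u x) \<partial>lborel) = ennreal I" "(\<integral>\<^sup>+ x. ennreal (std_normal_density x * v x) \<partial>lborel) = ennreal J"
      using I(1) J(1) u v by (simp_all add: nn_integral_std_gauss ennreal_mult)
    have "(\<integral>\<^sup>+ x. ennreal (C * std_normal_density x) \<partial>lborel) = ennreal C * (\<integral>\<^sup>+ x. ennreal (std_normal_density x) * 1 \<partial>lborel)"
      using C by (simp add: ennreal_mult nn_integral_cmult)
    also have "(\<integral>\<^sup>+ x. ennreal (std_normal_density x) * 1 \<partial>lborel) = (\<integral>\<^sup>+ x. 1 \<partial>std_gauss)"
      by (rule nn_integral_std_gauss[symmetric]) simp
    also have "\<dots> = 1" using prob_space.emeasure_space_1[OF prob_space_std_gauss] by simp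
    finally show "(\<integral>\<^sup>+ x. ennreal (C * std_normal_density x) \<partial>lborel) = ennreal C" by simp
  qed (use I J C in simp_all)
qed

interpretation gauss_prod: product_prob_space "\<lambda>_::nat. std_gauss" UNIV
  by (intro product_prob_spaceI prob_space_std_gauss)

abbreviation gauss_vec :: "nat \<Rightarrow> (nat \<Rightarrow> real) measure" where
  "gauss_vec n \<equiv> PiM {..<n} (\<lambda>_. std_gauss)"

lemma prob_space_gauss_vec: "prob_space (gauss_vec n)"
  by (intro prob_space_PiM prob_space_std_gauss)

lemma nn_integral_gauss_vec_Suc:
  assumes "f \<in> borel_measurable (gauss_vec (Suc n))"
  shows "(\<integral>\<^sup>+ x. f x \<partial>gauss_vec (Suc n)) = (\<integral>\<^sup>+ x. (\<integral>\<^sup>+ y. f (x(n := y)) \<partial>std_gauss) \<partial>gauss_vec n)"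
  using gauss_prod.product_nn_integral_insert[of "{..<n}" n f] assms unfolding lessThan_Suc by simp

lemma gauss_vec_upd:
  assumes "x \<in> space (gauss_vec n)"
  shows "x(n := y) \<in> space (gauss_vec (Suc n))"
  using assms by (auto simp: space_PiM PiE_iff extensional_def)

lemma gauss_vec_component: "i < n \<Longrightarrow> (\<lambda>x. x i) \<in> borel_measurable (gauss_vec n)"
  using measurable_component_singleton[of i "{..<n}" "\<lambda>_. std_gauss"]
  by (simp add: measurable_cong_sets[OF refl sets_std_gauss])

text \<open>Tensorisation. For fixed first coordinates x and y the one-dimensional inequality
  applies to the last coordinate, with C times the exponential of the first n squares as constant;
  so the functions with the last coordinate integrated out satisfy the hypothesis again. The bound B
  keeps their integrals finite.\<close>

lemma gauss_vec_Prekopa_Leindler: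
  assumes s: "0 < s" "s < 1" and C: "0 \<le> C"
  shows "\<lbrakk>u \<in> borel_measurable (gauss_vec n); v \<in> borel_measurable (gauss_vec n);
     \<And>x. 0 \<le> u x; \<And>x. u x \<le> B; \<And>x. 0 \<le> v x; \<And>x. v x \<le> B;
     \<And>x y. x \<in> space (gauss_vec n) \<Longrightarrow> y \<in> space (gauss_vec n) \<Longrightarrow>
       u x powr (1 - s) * v y powr s \<le> C * exp (s * (1 - s) * (\<Sum>i<n. (x i - y i)\<^sup>2) / 2);
     (\<integral>\<^sup>+ x. ennreal (u x) \<partial>gauss_vec n) = ennreal I; 0 \<le> I;
     (\<integral>\<^sup>+ x. ennreal (v x) \<partial>gauss_vec n) = ennreal J; 0 \<le> J\<rbrakk>
    \<Longrightarrow> I powr (1 - s) * J powr s \<le> C"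
proof (induction n arbitrary: u v I J)
  case 0
  have sp: "space (gauss_vec 0) = {\<lambda>_. undefined}" by (simp add: space_PiM_empty)
  have val: "(\<integral>\<^sup>+ x. ennreal (f x) \<partial>gauss_vec 0) = ennreal (f (\<lambda>_. undefined))" for f
  proof -
    have "(\<integral>\<^sup>+ x. ennreal (f x) \<partial>gauss_vec 0) = (\<integral>\<^sup>+ x. ennreal (f (\<lambda>_. undefined)) \<partial>gauss_vec 0)"
      by (intro nn_integral_cong) (simp only: sp singleton_iff)
    also have "\<dots> = ennreal (f (\<lambda>_. undefined))"
      using prob_space.emeasure_space_1[OF prob_space_gauss_vec[of 0]] by simp
    finally show ?thesis .
  qed
  have "I = u (\<lambda>_. undefined)" "J = v (\<lambda>_. undefined)"
    using 0(3,5,8-) val[of u] val[of v] by simp_all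
  then show ?case using 0(7)[of "\<lambda>_. undefined" "\<lambda>_. undefined"] sp by simp
next
  case (Suc n)
  note m = Suc.prems(1,2)
  have upd: "(\<lambda>y. f (x(n := y))) \<in> borel_measurable borel" if "f \<in> borel_measurable (gauss_vec (Suc n))" "x \<in> space (gauss_vec n)"
    for f :: "(nat \<Rightarrow> real) \<Rightarrow> real" and x
  proof -
    have "(\<lambda>y. x(n := y)) \<in> measurable std_gauss (gauss_vec (Suc n))"
      unfolding lessThan_Suc by (rule measurable_fun_upd[where J = "{..<n}"]) (use that(2) in auto)
    from measurable_compose[OF this that(1)] show ?thesis by (simp cong: measurable_cong_sets)
  qed
  define U where "U x = enn2real (\<integral>\<^sup>+ y. ennreal (u (x(n := y))) \<partial>std_gauss)" for x
  define V where "V x = enn2real (\<integral>\<^sup>+ y. ennreal (v (x(n := y))) \<partial>std_gauss)" for x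
  have B: "0 \<le> B" using Suc.prems(3,4) order_trans by blast
  have le: "(\<integral>\<^sup>+ y. ennreal (f (x(n := y))) \<partial>std_gauss) \<le> ennreal B" if "\<And>x. f x \<le> B" for f :: "(nat \<Rightarrow> real) \<Rightarrow> real" and x
  proof -
    have "(\<integral>\<^sup>+ y. ennreal (f (x(n := y))) \<partial>std_gauss) \<le> (\<integral>\<^sup>+ y. ennreal B \<partial>std_gauss)"
      using that by (intro nn_integral_mono ennreal_leI)
    also have "\<dots> = ennreal B" using prob_space.emeasure_space_1[OF prob_space_std_gauss] by simp
    finally show ?thesis .
  qed
  have Ueq: "(\<integral>\<^sup>+ y. ennreal (u (x(n := y))) \<partial>std_gauss) = ennreal (U x)" for x
    unfolding U_def by (intro ennreal_enn2real[symmetric] le_less_trans[OF le[of u, OF Suc.prems(4)]]) simp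
  have Veq: "(\<integral>\<^sup>+ y. ennreal (v (x(n := y))) \<partial>std_gauss) = ennreal (V x)" for x
    unfolding V_def by (intro ennreal_enn2real[symmetric] le_less_trans[OF le[of v, OF Suc.prems(6)]]) simp
  have meas: "(\<lambda>x. \<integral>\<^sup>+ y. ennreal (f (x(n := y))) \<partial>std_gauss) \<in> borel_measurable (gauss_vec n)"
    if "f \<in> borel_measurable (gauss_vec (Suc n))" for f :: "(nat \<Rightarrow> real) \<Rightarrow> real"
  proof -
    interpret sigma_finite_measure std_gauss using prob_space_std_gauss by (simp add: prob_space_imp_sigma_finite)
    have "(\<lambda>(x, y). x(n := y)) \<in> measurable (gauss_vec n \<Otimes>\<^sub>M std_gauss) (gauss_vec (Suc n))"
      unfolding lessThan_Suc using measurable_add_dim[of n "{..<n}" "\<lambda>_. std_gauss"] by simp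
    from measurable_compose[OF this that]
    have [measurable]: "(\<lambda>p. f ((fst p)(n := snd p))) \<in> borel_measurable (gauss_vec n \<Otimes>\<^sub>M std_gauss)" by (simp add: split_beta')
    show ?thesis by measurable
  qed
  show ?case
  proof (rule Suc.IH[of U V])
    show "U \<in> borel_measurable (gauss_vec n)" "V \<in> borel_measurable (gauss_vec n)"
      unfolding U_def V_def by (intro borel_measurable_enn2real meas m)+
    show "0 \<le> U x" "0 \<le> V x" for x unfolding U_def V_def by simp_all
    show "U x \<le> B" "V x \<le> B" for x
      using le[of u, OF Suc.prems(4)] le[of v, OF Suc.prems(6)] B unfolding U_def V_def by (simp_all add: enn2real_leI)
    show "(\<integral>\<^sup>+ x. ennreal (U x) \<partial>gauss_vec n) = ennreal I" "(\<integral>\<^sup>+ x. ennreal (V x) \<partial>gauss_vec n) = ennreal J"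
      using Suc.prems(8,10) m by (simp_all add: nn_integral_gauss_vec_Suc Ueq Veq)
    show "0 \<le> I" "0 \<le> J" by fact+
    fix x y assume xy: "x \<in> space (gauss_vec n)" "y \<in> space (gauss_vec n)"
    show "U x powr (1 - s) * V y powr s \<le> C * exp (s * (1 - s) * (\<Sum>i<n. (x i - y i)\<^sup>2) / 2)"
    proof (rule std_gauss_Prekopa_Leindler[OF s, where u = "\<lambda>a. u (x(n := a))" and v = "\<lambda>b. v (y(n := b))" and B = B])
      show "(\<lambda>a. u (x(n := a))) \<in> borel_measurable borel" "(\<lambda>b. v (y(n := b))) \<in> borel_measurable borel"
        by (rule upd[OF m(1) xy(1)], rule upd[OF m(2) xy(2)])
      show "u (x(n := a)) powr (1 - s) * v (y(n := b)) powr s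
          \<le> C * exp (s * (1 - s) * (\<Sum>i<n. (x i - y i)\<^sup>2) / 2) * exp (s * (1 - s) * (a - b)\<^sup>2 / 2)" for a b
      proof -
        have sum: "(\<Sum>i<Suc n. ((x(n := a)) i - (y(n := b)) i)\<^sup>2) = (\<Sum>i<n. (x i - y i)\<^sup>2) + (a - b)\<^sup>2"
          by simp
        have e: "exp (s * (1 - s) * (S + d) / 2) = exp (s * (1 - s) * S / 2) * exp (s * (1 - s) * d / 2)" for S d
          by (simp add: exp_add[symmetric] distrib_left add_divide_distrib)
        show ?thesis
          using Suc.prems(7)[OF gauss_vec_upd[OF xy(1), of a] gauss_vec_upd[OF xy(2), of b]]
          unfolding sum e mult.assoc[of C] .
      qed
      show "0 \<le> U x" "0 \<le> V y" unfolding U_def V_def by simp_all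
    qed (use Suc.prems C Ueq Veq in simp_all)
  qed
qed

text \<open>The exponent loses only the factor \<open>1 - s\<close>, at the price of a negative power of the
  measure of \<open>A\<close>; letting \<open>s\<close> tend to \<open>0\<close> gives the exact Gaussian rate.\<close>

lemma gauss_vec_concentration:
  assumes s: "0 < s" "s < 1" and A: "A \<in> sets (gauss_vec n)" and D: "D \<in> sets (gauss_vec n)"
    and sep: "\<And>x y. x \<in> A \<Longrightarrow> y \<in> D \<Longrightarrow> T \<le> (\<Sum>i<n. (x i - y i)\<^sup>2)"
    and pos: "0 < measure (gauss_vec n) A"
  shows "measure (gauss_vec n) D \<le> measure (gauss_vec n) A powr (- ((1 - s) / s)) * exp (- ((1 - s) * T / 2))"
proof -
  interpret G: prob_space "gauss_vec n" by (rule prob_space_gauss_vec)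
  define p where "p = measure (gauss_vec n) A"
  define d where "d = measure (gauss_vec n) D"
  \<comment> \<open>The weight put on D: \<open>e powr s\<close> is exactly the exponential
    available for pairs at squared distance T.\<close>
  define e where "e = exp ((1 - s) * T / 2)"
  have "p powr (1 - s) * (e * d) powr s \<le> 1"
  proof (rule gauss_vec_Prekopa_Leindler[OF s, where u = "indicator A" and v = "\<lambda>x. e * indicator D x" and B = "max 1 e" and n = n])
    show "(indicator A :: _ \<Rightarrow> real) \<in> borel_measurable (gauss_vec n)" using A by simp
    show "(\<lambda>x. e * indicator D x :: real) \<in> borel_measurable (gauss_vec n)" using D by simp
    show "(indicator A x :: real) \<le> max 1 e" "e * indicator D x \<le> max 1 e" for x by (auto simp: indicator_def)
    show "0 \<le> (indicator A x :: real)" "0 \<le> e * indicator D x" for x by (auto simp: indicator_def e_def)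
    show "(\<integral>\<^sup>+ x. ennreal (indicator A x) \<partial>gauss_vec n) = ennreal p"
      unfolding p_def using A by (simp add: ennreal_indicator G.emeasure_eq_measure)
    show "(\<integral>\<^sup>+ x. ennreal (e * indicator D x) \<partial>gauss_vec n) = ennreal (e * d)"
      unfolding d_def using D by (simp add: ennreal_mult ennreal_indicator nn_integral_cmult G.emeasure_eq_measure e_def)
    show "indicator A x powr (1 - s) * (e * indicator D y) powr s \<le> 1 * exp (s * (1 - s) * (\<Sum>i<n. (x i - y i)\<^sup>2) / 2)" for x y
    proof (cases "x \<in> A \<and> y \<in> D")
      case True
      then have "T \<le> (\<Sum>i<n. (x i - y i)\<^sup>2)" using sep by blast
      then have "s * (1 - s) * T / 2 \<le> s * (1 - s) * (\<Sum>i<n. (x i - y i)\<^sup>2) / 2"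
        using s by (intro divide_right_mono mult_left_mono) auto
      moreover have "e powr s = exp (s * (1 - s) * T / 2)" unfolding e_def by (simp add: powr_def mult_ac)
      ultimately show ?thesis using True by simp
    next
      case False
      then have "(indicator A x :: real) = 0 \<or> e * indicator D y = 0" by (auto simp: indicator_def)
      then show ?thesis by auto
    qed
  qed (auto simp: p_def d_def e_def)
  moreover have "(e * d) powr s = ((e * d) powr s)" ..
  ultimately have le: "(e * d) powr s \<le> p powr (- (1 - s))"
    using pos unfolding p_def[symmetric] powr_minus_divide by (simp add: pos_le_divide_eq mult.commute)
  have "0 \<le> e * d" unfolding e_def d_def by simp
  then have "e * d = ((e * d) powr s) powr (1 / s)" using s by (simp add: powr_powr)
  also have "\<dots> \<le> (p powr (- (1 - s))) powr (1 / s)" using le s by (intro powr_mono2) auto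
  also have "\<dots> = p powr (- ((1 - s) / s))"
    unfolding powr_powr using s by (intro arg_cong[where f = "\<lambda>z. p powr z"]) (simp add: field_simps)
  finally have "e * d \<le> p powr (- ((1 - s) / s))" .
  then have "d \<le> p powr (- ((1 - s) / s)) * inverse e" by (simp add: e_def field_simps)
  then show ?thesis unfolding d_def p_def e_def by (simp add: exp_minus)
qed

section \<open>Kolmogorov's maximal inequality\<close>

lemma std_gauss_second_moment: "(\<integral>\<^sup>+ y. ennreal ((c + y)\<^sup>2) \<partial>std_gauss) = ennreal (c\<^sup>2 + 1)"
proof -
  have 0: "has_bochner_integral lborel (\<lambda>y. std_normal_density y * 1) 1"
    using normal_moment_even[of 1 0 0] by simp
  have 1: "has_bochner_integral lborel (\<lambda>y. std_normal_density y * y) 0"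
    using normal_moment_nz_1[of 1 0] by simp
  have 2: "has_bochner_integral lborel (\<lambda>y. std_normal_density y * y\<^sup>2) 1"
    using normal_moment_even[of 1 0 1] by simp
  have "has_bochner_integral lborel (\<lambda>y. c\<^sup>2 * (std_normal_density y * 1) + 2 * c * (std_normal_density y * y) + std_normal_density y * y\<^sup>2) (c\<^sup>2 * 1 + 2 * c * 0 + 1)"
    by (intro has_bochner_integral_add has_bochner_integral_mult_right 0 1 2)
  then have "has_bochner_integral lborel (\<lambda>y. c\<^sup>2 * (std_normal_density y * 1) + 2 * c * (std_normal_density y * y) + std_normal_density y * y\<^sup>2) (c\<^sup>2 + 1)"
    by simp
  then have hb: "has_bochner_integral lborel (\<lambda>y. std_normal_density y * (c + y)\<^sup>2) (c\<^sup>2 + 1)"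
    by (rule back_subst[of "\<lambda>f. has_bochner_integral lborel f (c\<^sup>2 + 1)"]) (simp_all add: fun_eq_iff power2_sum algebra_simps)
  have "(\<integral>\<^sup>+ y. ennreal ((c + y)\<^sup>2) \<partial>std_gauss) = (\<integral>\<^sup>+ y. ennreal (std_normal_density y * (c + y)\<^sup>2) \<partial>lborel)"
    by (simp add: nn_integral_std_gauss ennreal_mult)
  also have "\<dots> = ennreal (\<integral>y. std_normal_density y * (c + y)\<^sup>2 \<partial>lborel)"
    using hb unfolding has_bochner_integral_iff by (intro nn_integral_eq_integral) auto
  also have "(\<integral>y. std_normal_density y * (c + y)\<^sup>2 \<partial>lborel) = c\<^sup>2 + 1"
    using hb by (rule has_bochner_integral_integral_eq)
  finally show ?thesis .
qed

text \<open>In place of a stopping time, \<open>T\<close> is frozen at 1 once a partial sum has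
  exceeded a, and is the scaled square of the sum before that. It dominates the indicator of the
  event, and one more coordinate raises its integral by at most 1 / a^2.\<close>

lemma gauss_vec_Kolmogorov:
  assumes a: "0 < a"
  shows "measure (gauss_vec n) {x \<in> space (gauss_vec n). \<exists>j\<le>n. a < \<bar>\<Sum>i<j. x i\<bar>} \<le> real n / a\<^sup>2"
proof -
  define T where "T m x = (if \<exists>j\<le>m. a < \<bar>\<Sum>i<j. x i\<bar> then 1 else (\<Sum>i<m. x i)\<^sup>2 / a\<^sup>2)" for m :: nat and x :: "nat \<Rightarrow> real"
  have Tm: "T m \<in> borel_measurable (gauss_vec m)" for m
  proof -
    have [measurable]: "(\<lambda>x. \<Sum>i<j. x i) \<in> borel_measurable (gauss_vec m)" if "j \<le> m" for j
      using that by (intro borel_measurable_sum gauss_vec_component) simp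
    have P: "Measurable.pred (gauss_vec m) (\<lambda>x. \<exists>j\<in>{..m}. a < \<bar>\<Sum>i<j. x i\<bar>)"
      by (intro pred_intros_finite) auto
    have "(\<lambda>x. if \<exists>j\<in>{..m}. a < \<bar>\<Sum>i<j. x i\<bar> then 1 else (\<Sum>i<m. x i)\<^sup>2 / a\<^sup>2) \<in> borel_measurable (gauss_vec m)"
      using P by (intro measurable_If) auto
    then show ?thesis unfolding T_def[abs_def] by simp
  qed
  have T0: "0 \<le> T m x" for m x unfolding T_def by simp
  have int: "(\<integral>\<^sup>+ x. ennreal (T m x) \<partial>gauss_vec m) \<le> ennreal (real m / a\<^sup>2)" for m
  proof (induction m)
    case 0
    have "T 0 x = 0" for x unfolding T_def using a by simp
    then show ?case by simp
  next
    case (Suc m)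
    have step: "(\<integral>\<^sup>+ y. ennreal (T (Suc m) (x(m := y))) \<partial>std_gauss) \<le> ennreal (T m x) + ennreal (1 / a\<^sup>2)" for x
    proof (cases "\<exists>j\<le>m. a < \<bar>\<Sum>i<j. x i\<bar>")
      case True
      then have "T m x = 1" unfolding T_def by simp
      have "T (Suc m) (x(m := y)) = 1" for y
      proof -
        from True obtain j where "j \<le> m" "a < \<bar>\<Sum>i<j. x i\<bar>" by auto
        moreover have "(\<Sum>i<j. (x(m := y)) i) = (\<Sum>i<j. x i)" using \<open>j \<le> m\<close> by (intro sum.cong) auto
        ultimately have "\<exists>j\<le>Suc m. a < \<bar>\<Sum>i<j. (x(m := y)) i\<bar>" by (intro exI[of _ j]) auto
        then show ?thesis unfolding T_def by simp
      qed
      then have "(\<integral>\<^sup>+ y. ennreal (T (Suc m) (x(m := y))) \<partial>std_gauss) = 1"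
        using prob_space.emeasure_space_1[OF prob_space_std_gauss] by simp
      then show ?thesis using \<open>T m x = 1\<close> by simp
    next
      case False
      define c where "c = (\<Sum>i<m. x i)"
      have "T (Suc m) (x(m := y)) \<le> (c + y)\<^sup>2 / a\<^sup>2" for y
      proof -
        have old: "(\<Sum>i<j. (x(m := y)) i) = (\<Sum>i<j. x i)" if "j \<le> m" for j using that by (intro sum.cong) auto
        have new: "(\<Sum>i<Suc m. (x(m := y)) i) = c + y" using old[of m] unfolding c_def by simp
        show ?thesis
        proof (cases "a < \<bar>c + y\<bar>")
          case True
          then have "a\<^sup>2 \<le> (c + y)\<^sup>2" using a by (simp add: abs_le_square_iff[symmetric])
          then have "1 \<le> (c + y)\<^sup>2 / a\<^sup>2" using a by simp
          then show ?thesis unfolding T_def new by auto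
        next
          case F: False
          have "\<not> (\<exists>j\<le>Suc m. a < \<bar>\<Sum>i<j. (x(m := y)) i\<bar>)"
          proof
            assume "\<exists>j\<le>Suc m. a < \<bar>\<Sum>i<j. (x(m := y)) i\<bar>"
            then obtain j where j: "j \<le> Suc m" "a < \<bar>\<Sum>i<j. (x(m := y)) i\<bar>" by auto
            then show False using False F old[of j] new by (cases "j = Suc m") (auto simp: le_Suc_eq)
          qed
          then have "T (Suc m) (x(m := y)) = (\<Sum>i<Suc m. (x(m := y)) i)\<^sup>2 / a\<^sup>2"
            unfolding T_def by (simp only: if_False)
          then show ?thesis unfolding new by simp
        qed
      qed
      note Tle = this
      have "(\<integral>\<^sup>+ y. ennreal (T (Suc m) (x(m := y))) \<partial>std_gauss) \<le> (\<integral>\<^sup>+ y. ennreal (1 / a\<^sup>2) * ennreal ((c + y)\<^sup>2) \<partial>std_gauss)"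
      proof (rule nn_integral_mono)
        fix y
        have "ennreal (1 / a\<^sup>2) * ennreal ((c + y)\<^sup>2) = ennreal ((c + y)\<^sup>2 / a\<^sup>2)"
          by (subst ennreal_mult[symmetric]) simp_all
        then show "ennreal (T (Suc m) (x(m := y))) \<le> ennreal (1 / a\<^sup>2) * ennreal ((c + y)\<^sup>2)"
          using Tle[of y] by (simp only: ennreal_leI)
      qed
      also have "\<dots> = ennreal (1 / a\<^sup>2) * ennreal (c\<^sup>2 + 1)"
        by (subst nn_integral_cmult) (simp_all add: std_gauss_second_moment)
      also have "\<dots> = ennreal (T m x) + ennreal (1 / a\<^sup>2)"
      proof -
        have "T m x = c\<^sup>2 / a\<^sup>2" using False unfolding T_def c_def by (simp only: if_False)
        then have "ennreal (T m x) + ennreal (1 / a\<^sup>2) = ennreal (c\<^sup>2 / a\<^sup>2 + 1 / a\<^sup>2)"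
          by (simp only: ennreal_plus zero_le_divide_iff zero_le_power2 zero_le_one simp_thms)
        moreover have "ennreal (1 / a\<^sup>2) * ennreal (c\<^sup>2 + 1) = ennreal (1 / a\<^sup>2 * (c\<^sup>2 + 1))"
          by (subst ennreal_mult) simp_all
        moreover have "1 / a\<^sup>2 * (c\<^sup>2 + 1) = c\<^sup>2 / a\<^sup>2 + 1 / a\<^sup>2" by (simp add: distrib_left)
        ultimately show ?thesis by (simp only:)
      qed
      finally show ?thesis .
    qed
    have "(\<integral>\<^sup>+ x. ennreal (T (Suc m) x) \<partial>gauss_vec (Suc m)) = (\<integral>\<^sup>+ x. (\<integral>\<^sup>+ y. ennreal (T (Suc m) (x(m := y))) \<partial>std_gauss) \<partial>gauss_vec m)"
      using Tm[of "Suc m"] by (intro nn_integral_gauss_vec_Suc) simp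
    also have "\<dots> \<le> (\<integral>\<^sup>+ x. ennreal (T m x) + ennreal (1 / a\<^sup>2) \<partial>gauss_vec m)"
      by (intro nn_integral_mono step)
    also have "\<dots> = (\<integral>\<^sup>+ x. ennreal (T m x) \<partial>gauss_vec m) + ennreal (1 / a\<^sup>2)"
      using Tm[of m] prob_space.emeasure_space_1[OF prob_space_gauss_vec[of m]] by (subst nn_integral_add) simp_all
    also have "\<dots> \<le> ennreal (real m / a\<^sup>2) + ennreal (1 / a\<^sup>2)"
      by (intro add_right_mono Suc.IH)
    also have "\<dots> = ennreal (real (Suc m) / a\<^sup>2)"
      by (simp add: add_divide_distrib flip: ennreal_plus)
    finally show ?case .
  qed
  define E where "E = {x \<in> space (gauss_vec n). \<exists>j\<le>n. a < \<bar>\<Sum>i<j. x i\<bar>}"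
  interpret G: prob_space "gauss_vec n" by (rule prob_space_gauss_vec)
  show ?thesis
  proof (cases "E \<in> sets (gauss_vec n)")
    case True
    have "ennreal (measure (gauss_vec n) E) = (\<integral>\<^sup>+ x. indicator E x \<partial>gauss_vec n)"
      using True by (simp add: G.emeasure_eq_measure)
    also have "\<dots> \<le> (\<integral>\<^sup>+ x. ennreal (T n x) \<partial>gauss_vec n)"
      by (intro nn_integral_mono) (auto simp: E_def T_def indicator_def)
    also note int[of n]
    finally show ?thesis unfolding E_def using a by (simp add: ennreal_le_iff)
  next
    \<comment> \<open>A set that is not measurable has measure 0 by convention.\<close>
    case False
    then show ?thesis unfolding E_def[symmetric] by (simp add: measure_notin_sets)
  qed
qed

section \<open>Polygonal approximation and the tail of the distance\<close>

abbreviation clamp01 :: "real \<Rightarrow> real" where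
  "clamp01 y \<equiv> max 0 (min 1 y)"

text \<open>Combinations of ramps make a polygon linear, hence continuous, in its
  increments.\<close>

definition ramp :: "nat \<Rightarrow> nat \<Rightarrow> (real \<Rightarrow>\<^sub>C real)" where
  "ramp n i = Bcontfun (\<lambda>t. clamp01 (2 ^ n * t - real i))"

text \<open>The path with values \<open>\<Sum>i<j. x i\<close> at the dyadic points \<open>j / 2 ^ n\<close>, linear in between.\<close>

definition polygon :: "nat \<Rightarrow> (nat \<Rightarrow> real) \<Rightarrow> (real \<Rightarrow>\<^sub>C real)" where
  "polygon n x = (\<Sum>i<2 ^ n. x i *\<^sub>R ramp n i)"

lemma apply_ramp: "apply_bcontfun (ramp n i) t = clamp01 (2 ^ n * t - real i)"
proof -
  have "(\<lambda>t. clamp01 (2 ^ n * t - real i)) \<in> bcontfun"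
    by (rule bcontfun_normI[of _ 1]) (auto intro!: continuous_intros)
  then show ?thesis unfolding ramp_def by (simp add: Bcontfun_inverse)
qed

lemma apply_bcontfun_sum:
  "apply_bcontfun (\<Sum>i\<in>I. f i) t = (\<Sum>i\<in>I. apply_bcontfun (f i) t)"
  for f :: "'i \<Rightarrow> (real \<Rightarrow>\<^sub>C real)"
  by (induction I rule: infinite_finite_induct) (simp_all add: plus_bcontfun.rep_eq zero_bcontfun.rep_eq)

lemma apply_polygon: "apply_bcontfun (polygon n x) t = (\<Sum>i<2 ^ n. x i * clamp01 (2 ^ n * t - real i))"
  unfolding polygon_def apply_bcontfun_sum by (simp add: scaleR_bcontfun.rep_eq apply_ramp)

lemma polygon_C0: "polygon n x \<in> C0"
proof -
  have "clamp01 (2 ^ n * t - real i) = clamp01 (2 ^ n * clamp01 t - real i)" if "i < 2 ^ n" for i t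
  proof -
    have "real (Suc i) \<le> real (2 ^ n)" using that by (simp only: of_nat_le_iff Suc_le_eq)
    then have i: "real i + 1 \<le> 2 ^ n" by simp
    consider "t < 0" | "0 \<le> t" "t \<le> 1" | "1 < t" by linarith
    then show ?thesis
    proof cases
      case 1
      then have "2 ^ n * t \<le> 0" by (simp add: mult_le_0_iff)
      then show ?thesis using 1 by (simp add: max_def min_def)
    next
      case 2
      then show ?thesis by simp
    next
      case 3
      then have "2 ^ n * 1 \<le> 2 ^ n * t" by (intro mult_left_mono) auto
      then have "1 \<le> 2 ^ n * t - real i" using i by linarith
      then show ?thesis using 3 i by simp
    qed
  qed
  note clamp = this
  have z: "clamp01 (0 - real i) = 0" for i by simp
  show ?thesis
    unfolding C0_def mem_Collect_eq apply_polygon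
  proof (intro conjI allI)
    show "(\<Sum>i<2 ^ n. x i * clamp01 (2 ^ n * 0 - real i)) = 0"
      by (simp only: z mult_zero_right sum.neutral_const)
    fix t
    show "(\<Sum>i<2 ^ n. x i * clamp01 (2 ^ n * t - real i)) = (\<Sum>i<2 ^ n. x i * clamp01 (2 ^ n * clamp01 t - real i))"
      by (rule sum.cong[OF refl], rule arg_cong2[where f = "(*)", OF refl], rule clamp, simp only: lessThan_iff)
  qed
qed

lemma polygon_diff: "polygon n (\<lambda>i. x i - y i) = polygon n x - polygon n y"
  unfolding polygon_def by (simp add: scaleR_diff_left sum_subtractf)

lemma sum_clamp01: "(\<Sum>i<m. clamp01 (y - real i)) = max 0 (min (real m) y)"
  by (induction m) (auto simp: max_def min_def)

text \<open>At most one summand is fractional: the ramps before the cell of y are complete, those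
  after it have not started.\<close>

lemma sum_mult_clamp01:
  assumes "real j \<le> y" "y \<le> real j + 1" "j < m"
  shows "(\<Sum>i<m. x i * clamp01 (y - real i)) = (\<Sum>i<j. x i) + (y - real j) * x j"
proof -
  have "Suc j \<le> m" using assms by simp
  then show ?thesis
  proof (induction m rule: dec_induct)
    case base
    have "(\<Sum>i<j. x i * clamp01 (y - real i)) = (\<Sum>i<j. x i)"
    proof (rule sum.cong[OF refl])
      fix i assume "i \<in> {..<j}"
      then have "real i + 1 \<le> real j" by simp
      then have "clamp01 (y - real i) = 1" using assms by simp
      then show "x i * clamp01 (y - real i) = x i" by (simp only: mult_1_right)
    qed
    then show ?case using assms by (simp add: mult.commute)
  next
    case (step m)
    then have "clamp01 (y - real m) = 0" using assms by simp
    then show ?case using step.IH by simp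
  qed
qed

text \<open>For t = 1 the floor would give the index 2^n, one too large; the last cell is taken
  there.\<close>

lemma grid_cell:
  assumes "0 \<le> t" "t \<le> 1"
  obtains j where "j < 2 ^ n" "real j \<le> 2 ^ n * t" "2 ^ n * t \<le> real j + 1"
proof (cases "t = 1")
  case True
  show ?thesis by (rule that[of "2 ^ n - 1"]) (use True in \<open>auto simp: of_nat_diff\<close>)
next
  case False
  define j where "j = nat \<lfloor>2 ^ n * t\<rfloor>"
  have j: "real j \<le> 2 ^ n * t" "2 ^ n * t < real j + 1"
    using assms unfolding j_def by (auto simp: of_nat_nat zero_le_mult_iff)
  have "2 ^ n * t < 2 ^ n" using False assms by simp
  with j(1) have "real j < 2 ^ n" by (rule le_less_trans)
  then have "real j < real (2 ^ n)" by (simp only: of_nat_power of_nat_numeral)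
  then have "j < 2 ^ n" by (simp only: of_nat_less_iff)
  then show ?thesis using j by (intro that[of j]) auto
qed

text \<open>On each cell the polygon is a convex combination of two neighbouring partial
  sums.\<close>

lemma norm_polygon_le:
  assumes "\<And>j. j \<le> 2 ^ n \<Longrightarrow> \<bar>\<Sum>i<j. x i\<bar> \<le> a"
  shows "norm (polygon n x) \<le> a"
proof -
  have "dist (polygon n x) 0 \<le> a"
  proof (rule dist_C0_le[OF polygon_C0])
    show "(0 :: real \<Rightarrow>\<^sub>C real) \<in> C0" unfolding C0_def by (simp add: zero_bcontfun.rep_eq)
    fix t :: real assume t: "0 \<le> t" "t \<le> 1"
    obtain j where j: "j < 2 ^ n" "real j \<le> 2 ^ n * t" "2 ^ n * t \<le> real j + 1" using grid_cell[OF t] .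
    define \<theta> where "\<theta> = 2 ^ n * t - real j"
    have \<theta>: "0 \<le> \<theta>" "\<theta> \<le> 1" unfolding \<theta>_def using j by auto
    have "apply_bcontfun (polygon n x) t = (\<Sum>i<j. x i) + \<theta> * x j"
      unfolding apply_polygon \<theta>_def by (rule sum_mult_clamp01[OF j(2,3,1)])
    also have "\<dots> = (1 - \<theta>) * (\<Sum>i<j. x i) + \<theta> * (\<Sum>i<Suc j. x i)" by (simp add: algebra_simps)
    finally have "\<bar>apply_bcontfun (polygon n x) t\<bar> \<le> \<bar>(1 - \<theta>) * (\<Sum>i<j. x i)\<bar> + \<bar>\<theta> * (\<Sum>i<Suc j. x i)\<bar>"
      by (simp only: abs_triangle_ineq)
    also have "\<dots> = (1 - \<theta>) * \<bar>\<Sum>i<j. x i\<bar> + \<theta> * \<bar>\<Sum>i<Suc j. x i\<bar>" using \<theta> by (simp add: abs_mult)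
    also have "\<dots> \<le> (1 - \<theta>) * a + \<theta> * a"
      using \<theta> j(1) by (intro add_mono mult_left_mono assms) auto
    also have "\<dots> = a" by (simp add: algebra_simps)
    finally show "\<bar>apply_bcontfun (polygon n x) t - apply_bcontfun 0 t\<bar> \<le> a" by (simp add: zero_bcontfun.rep_eq)
  qed
  then show ?thesis by simp
qed

text \<open>The hypothesis is the energy of level n, but membership needs every level m. G is the
  energy accumulated up to time t. A squared increment is at most the increment of time times that
  of G, so the energy of each level is bounded by the telescoping sum G 1 - G 0.\<close>

lemma polygon_in_K:
  assumes "2 ^ n * (\<Sum>i<2 ^ n. (x i)\<^sup>2) \<le> 2 * r" "0 \<le> r"
  shows "polygon n x \<in> K r"
proof (rule energy_le_imp_K[OF polygon_C0 _ assms(2)])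
  let ?w = "apply_bcontfun (polygon n x)"
  define G where "G t = 2 ^ n * (\<Sum>i<2 ^ n. (x i)\<^sup>2 * clamp01 (2 ^ n * t - real i))" for t
  have inc: "(?w v - ?w u)\<^sup>2 \<le> (v - u) * (G v - G u)" if "u \<le> v" for u v
  proof -
    define d where "d i = clamp01 (2 ^ n * v - real i) - clamp01 (2 ^ n * u - real i)" for i
    have uv: "2 ^ n * u \<le> 2 ^ n * v" using that by simp
    have "clamp01 a \<le> clamp01 b" if "a \<le> b" for a b :: real using that by auto
    from this[OF diff_right_mono[OF uv]] have d0: "0 \<le> d i" for i unfolding d_def by simp
    have "(\<Sum>i<2 ^ n. d i) = max 0 (min (2 ^ n) (2 ^ n * v)) - max 0 (min (2 ^ n) (2 ^ n * u))"
      unfolding d_def using sum_clamp01[of "2 ^ n * v" "2 ^ n"] sum_clamp01[of "2 ^ n * u" "2 ^ n"] by (simp add: sum_subtractf)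
    also have "\<dots> \<le> 2 ^ n * v - 2 ^ n * u"
    proof -
      have "max 0 (min R P) - max 0 (min R Q) \<le> P - Q" if "Q \<le> P" for P Q R :: real
        using that by (auto simp: max_def min_def)
      then show ?thesis using uv .
    qed
    finally have ds: "(\<Sum>i<2 ^ n. d i) \<le> 2 ^ n * (v - u)" by (simp add: right_diff_distrib)
    have "?w v - ?w u = (\<Sum>i<2 ^ n. x i * d i)"
      unfolding apply_polygon d_def by (simp add: sum_subtractf right_diff_distrib)
    also have "\<dots> = (\<Sum>i<2 ^ n. sqrt (d i) * (x i * sqrt (d i)))"
      using d0 by (intro sum.cong refl) (simp add: mult.left_commute)
    finally have "(?w v - ?w u)\<^sup>2 = (\<Sum>i<2 ^ n. sqrt (d i) * (x i * sqrt (d i)))\<^sup>2" by simp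
    also have "\<dots> \<le> (\<Sum>i<2 ^ n. (sqrt (d i))\<^sup>2) * (\<Sum>i<2 ^ n. (x i * sqrt (d i))\<^sup>2)"
      by (rule Cauchy_Schwarz_ineq_sum)
    also have "\<dots> = (\<Sum>i<2 ^ n. d i) * (\<Sum>i<2 ^ n. (x i)\<^sup>2 * d i)"
      using d0 by (simp add: power_mult_distrib)
    also have "\<dots> \<le> (2 ^ n * (v - u)) * (\<Sum>i<2 ^ n. (x i)\<^sup>2 * d i)"
      using d0 by (intro mult_right_mono ds sum_nonneg) simp
    also have "(\<Sum>i<2 ^ n. (x i)\<^sup>2 * d i) = (G v - G u) / 2 ^ n"
      unfolding G_def d_def by (simp add: sum_subtractf right_diff_distrib diff_divide_distrib)
    finally show ?thesis by simp
  qed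
  fix m
  have "energy m ?w \<le> 2 ^ m * (\<Sum>i<2 ^ m. (1 / 2 ^ m) * (G (real (Suc i) / 2 ^ m) - G (real i / 2 ^ m)))"
    unfolding energy_def
  proof (intro mult_left_mono sum_mono)
    fix i :: nat
    have "real (Suc i) / 2 ^ m - real i / 2 ^ m = 1 / 2 ^ m" by (simp add: diff_divide_distrib[symmetric])
    moreover have "real i / 2 ^ m \<le> real (Suc i) / 2 ^ m" by (intro divide_right_mono) auto
    ultimately show "(?w (real (Suc i) / 2 ^ m) - ?w (real i / 2 ^ m))\<^sup>2 \<le> (1 / 2 ^ m) * (G (real (Suc i) / 2 ^ m) - G (real i / 2 ^ m))"
      using inc[of "real i / 2 ^ m" "real (Suc i) / 2 ^ m"] by simp
  qed simp
  also have "\<dots> = (\<Sum>i<2 ^ m. G (real (Suc i) / 2 ^ m) - G (real i / 2 ^ m))"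
    by (simp flip: sum_divide_distrib)
  also have "\<dots> = G 1 - G 0"
    using sum_lessThan_telescope[of "\<lambda>i. G (real i / 2 ^ m)" "2 ^ m"] by simp
  also have "G 0 = 0"
  proof -
    have "clamp01 (2 ^ n * 0 - real i) = 0" for i by simp
    then show ?thesis unfolding G_def by (simp only: mult_zero_right sum.neutral_const)
  qed
  also have "G 1 = 2 ^ n * (\<Sum>i<2 ^ n. (x i)\<^sup>2)"
  proof -
    have "clamp01 (2 ^ n * 1 - real i) = 1" if "i < 2 ^ n" for i
    proof -
      have "real (Suc i) \<le> real (2 ^ n)" using that by (simp only: of_nat_le_iff Suc_le_eq)
      then show ?thesis by simp
    qed
    then show ?thesis unfolding G_def by simp
  qed
  finally show "energy m ?w \<le> 2 * r" using assms(1) by simp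
qed

lemma dist_polygon_le:
  assumes f: "f \<in> C0" and e: "\<And>s t. 0 \<le> s \<Longrightarrow> s \<le> 1 \<Longrightarrow> 0 \<le> t \<Longrightarrow> t \<le> 1 \<Longrightarrow> \<bar>s - t\<bar> \<le> 1 / 2 ^ n \<Longrightarrow>
     \<bar>apply_bcontfun f s - apply_bcontfun f t\<bar> \<le> e"
  shows "dist (polygon n (\<lambda>i. apply_bcontfun f (real (Suc i) / 2 ^ n) - apply_bcontfun f (real i / 2 ^ n))) f \<le> e"
proof (rule dist_C0_le[OF polygon_C0 f])
  let ?f = "apply_bcontfun f"
  let ?x = "\<lambda>i. ?f (real (Suc i) / 2 ^ n) - ?f (real i / 2 ^ n)"
  fix t :: real assume t: "0 \<le> t" "t \<le> 1"
  obtain j where j: "j < 2 ^ n" "real j \<le> 2 ^ n * t" "2 ^ n * t \<le> real j + 1" using grid_cell[OF t] .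
  define \<theta> where "\<theta> = 2 ^ n * t - real j"
  have \<theta>: "0 \<le> \<theta>" "\<theta> \<le> 1" unfolding \<theta>_def using j by auto
  have f0: "?f 0 = 0" using f unfolding C0_def by auto
  have "apply_bcontfun (polygon n ?x) t = (\<Sum>i<j. ?x i) + \<theta> * ?x j"
    unfolding apply_polygon \<theta>_def by (rule sum_mult_clamp01[OF j(2,3,1)])
  also have "(\<Sum>i<j. ?x i) = ?f (real j / 2 ^ n)"
    using sum_lessThan_telescope[of "\<lambda>i. ?f (real i / 2 ^ n)" j] f0 by simp
  finally have "apply_bcontfun (polygon n ?x) t - ?f t
      = (1 - \<theta>) * (?f (real j / 2 ^ n) - ?f t) + \<theta> * (?f (real (Suc j) / 2 ^ n) - ?f t)"
    by (simp add: algebra_simps)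
  then have "\<bar>apply_bcontfun (polygon n ?x) t - ?f t\<bar>
      \<le> \<bar>(1 - \<theta>) * (?f (real j / 2 ^ n) - ?f t)\<bar> + \<bar>\<theta> * (?f (real (Suc j) / 2 ^ n) - ?f t)\<bar>"
    by (simp only: abs_triangle_ineq)
  also have "\<dots> = (1 - \<theta>) * \<bar>?f (real j / 2 ^ n) - ?f t\<bar> + \<theta> * \<bar>?f (real (Suc j) / 2 ^ n) - ?f t\<bar>"
    using \<theta> by (simp add: abs_mult)
  also have "\<dots> \<le> (1 - \<theta>) * e + \<theta> * e"
  proof (intro add_mono mult_left_mono e)
    have "real (Suc j) \<le> real (2 ^ n)" using j(1) by (simp only: of_nat_le_iff Suc_le_eq)
    then have Sj: "real j + 1 \<le> 2 ^ n" by simp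
    have "real j \<le> 2 ^ n" "real (Suc j) \<le> 2 ^ n" using Sj unfolding of_nat_Suc by linarith+
    then have "real j / 2 ^ n \<le> 2 ^ n / 2 ^ n" "real (Suc j) / 2 ^ n \<le> 2 ^ n / 2 ^ n"
      by (simp_all only: divide_right_mono zero_le_power zero_le_numeral)
    then show "real j / 2 ^ n \<le> 1" "real (Suc j) / 2 ^ n \<le> 1" by simp_all
    have 1: "real j / 2 ^ n \<le> t" "t \<le> real (Suc j) / 2 ^ n" "real (Suc j) / 2 ^ n = real j / 2 ^ n + 1 / 2 ^ n"
      using j by (simp_all add: field_simps)
    show "\<bar>real j / 2 ^ n - t\<bar> \<le> 1 / 2 ^ n" using 1 by (subst abs_le_iff) auto
    show "\<bar>real (Suc j) / 2 ^ n - t\<bar> \<le> 1 / 2 ^ n" using 1 by (subst abs_le_iff) auto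
  qed (use t \<theta> in simp_all)
  also have "\<dots> = e" by (simp add: algebra_simps)
  finally show "\<bar>apply_bcontfun (polygon n ?x) t - ?f t\<bar> \<le> e" .
qed

lemma polygon_tendsto:
  assumes f: "f \<in> C0"
  shows "(\<lambda>n. polygon n (\<lambda>i. apply_bcontfun f (real (Suc i) / 2 ^ n) - apply_bcontfun f (real i / 2 ^ n))) \<longlonglongrightarrow> f"
proof (rule metric_LIMSEQ_I)
  fix e :: real assume e: "0 < e"
  have "uniformly_continuous_on {0..1} (apply_bcontfun f)"
    by (intro compact_uniformly_continuous) auto
  then have "\<exists>d>0. \<forall>x\<in>{0..1}. \<forall>x'\<in>{0..1}. dist x' x < d \<longrightarrow> dist (apply_bcontfun f x') (apply_bcontfun f x) < e / 2"
    unfolding uniformly_continuous_on_def using half_gt_zero[OF e] by (elim allE[of _ "e / 2"] impE)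
  then obtain d where d: "0 < d" "\<forall>x\<in>{0..1}. \<forall>x'\<in>{0..1}. dist x' x < d \<longrightarrow> dist (apply_bcontfun f x') (apply_bcontfun f x) < e / 2"
    by (elim exE conjE)
  obtain N where N: "(1/2) ^ N < d" using real_arch_pow_inv[OF d(1), of "1/2"] by auto
  show "\<exists>N. \<forall>n\<ge>N. dist (polygon n (\<lambda>i. apply_bcontfun f (real (Suc i) / 2 ^ n) - apply_bcontfun f (real i / 2 ^ n))) f < e"
  proof (intro exI[of _ N] allI impI)
    fix n assume n: "N \<le> n"
    have "(1/2 :: real) ^ n \<le> (1/2) ^ N" using n by (intro power_decreasing) auto
    then have nd: "1 / 2 ^ n < d" using N by (simp add: power_one_over)
    have "dist (polygon n (\<lambda>i. apply_bcontfun f (real (Suc i) / 2 ^ n) - apply_bcontfun f (real i / 2 ^ n))) f \<le> e / 2"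
    proof (rule dist_polygon_le[OF f])
      fix s t :: real assume "0 \<le> s" "s \<le> 1" "0 \<le> t" "t \<le> 1" "\<bar>s - t\<bar> \<le> 1 / 2 ^ n"
      then show "\<bar>apply_bcontfun f s - apply_bcontfun f t\<bar> \<le> e / 2"
        using d(2)[rule_format, of t s] nd by (simp add: dist_real_def)
    qed
    then show "dist (polygon n (\<lambda>i. apply_bcontfun f (real (Suc i) / 2 ^ n) - apply_bcontfun f (real i / 2 ^ n))) f < e"
      using e by simp
  qed
qed

text \<open>The polygon depends continuously on its coordinates, and the distance to any set A is a
  continuous function of the path.\<close>

lemma infdist_polygon_measurable:
  assumes "\<And>i. X i \<in> borel_measurable M"
  shows "(\<lambda>\<omega>. infdist (polygon n (\<lambda>i. X i \<omega>)) A) \<in> borel_measurable M"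
proof -
  have 1: "(\<lambda>\<omega> i. X i \<omega>) \<in> measurable M borel"
    using assms by (intro measurable_coordinatewise_then_product) auto
  have "continuous_on UNIV (\<lambda>x. infdist (polygon n x) A)"
    unfolding polygon_def
    by (intro continuous_on_infdist continuous_on_sum continuous_on_scaleR continuous_on_product_coordinates continuous_on_const)
  then have 2: "(\<lambda>x. infdist (polygon n x) A) \<in> borel_measurable borel"
    by (rule borel_measurable_continuous_onI)
  show ?thesis using measurable_compose[OF 1 2] by simp
qed

section \<open>The tail of the distance for Gaussian polygons\<close>

text \<open>The scaled coordinates are the increments of a Brownian path with variance \<sigma>^2 at
  time 1. The level n does not enter the bound, so the bound will survive the limit of
  polygons.\<close>

lemma gauss_vec_polygon_bound:
  fixes \<sigma> \<epsilon> r :: real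
  assumes r: "0 < r" and \<epsilon>: "0 < \<epsilon>" and \<sigma>: "0 < \<sigma>" and large: "8 < \<epsilon>\<^sup>2 / \<sigma>\<^sup>2"
  shows "measure (gauss_vec (2 ^ n)) {x \<in> space (gauss_vec (2 ^ n)). \<epsilon> < infdist (polygon n (\<lambda>i. \<sigma> / sqrt (2 ^ n) * x i)) (K r)}
    \<le> 2 * exp 2 * exp (8 * r / \<epsilon>\<^sup>2) * exp (- r / \<sigma>\<^sup>2)"
proof -
  let ?G = "gauss_vec (2 ^ n)"
  interpret G: prob_space ?G by (rule prob_space_gauss_vec)
  define a where "a = \<epsilon> / \<sigma>"
  have a: "0 < a" "8 < a\<^sup>2" unfolding a_def using \<epsilon> \<sigma> large by (simp_all add: power_divide)
  define T where "T = 2 * r / \<sigma>\<^sup>2"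
  \<comment> \<open>This makes s * T / 2 equal to 8 * r / \<epsilon>^2; the assumption
    \<open>large\<close> is s < 1.\<close>
  define s where "s = 8 / a\<^sup>2"
  have s: "0 < s" "s < 1" unfolding s_def using a by simp_all
  define D where "D = {x \<in> space ?G. \<epsilon> < infdist (polygon n (\<lambda>i. \<sigma> / sqrt (2 ^ n) * x i)) (K r)}"
  define A where "A = {x \<in> space ?G. \<forall>j\<in>{..2 ^ n}. \<bar>\<Sum>i<j. x i\<bar> \<le> a * sqrt (2 ^ n)}"
  have comp: "(\<lambda>x. x i) \<in> borel_measurable ?G" if "i < 2 ^ n" for i
    using that by (rule gauss_vec_component)
  have Dm: "D \<in> sets ?G"
  proof -
    \<comment> \<open>The polygon reads the first 2^n coordinates; the others are replaced by 0 to
      obtain a measurable function for every index.\<close>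
    have "polygon n (\<lambda>i. \<sigma> / sqrt (2 ^ n) * x i) = polygon n (\<lambda>i. if i < 2 ^ n then \<sigma> / sqrt (2 ^ n) * x i else 0)" for x
      unfolding polygon_def by (intro sum.cong) auto
    moreover have "(\<lambda>x. infdist (polygon n (\<lambda>i. if i < 2 ^ n then \<sigma> / sqrt (2 ^ n) * x i else 0)) (K r)) \<in> borel_measurable ?G"
    proof (rule infdist_polygon_measurable)
      fix i show "(\<lambda>x. if i < 2 ^ n then \<sigma> / sqrt (2 ^ n) * x i else 0) \<in> borel_measurable ?G"
        using comp[of i] by (cases "i < 2 ^ n") simp_all
    qed
    ultimately have "(\<lambda>x. infdist (polygon n (\<lambda>i. \<sigma> / sqrt (2 ^ n) * x i)) (K r)) \<in> borel_measurable ?G" by simp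
    then show ?thesis unfolding D_def by measurable
  qed
  have Sm: "(\<lambda>x. \<Sum>i<j. x i) \<in> borel_measurable ?G" if "j \<le> 2 ^ n" for j
    using that by (intro borel_measurable_sum comp) auto
  have Am: "A \<in> sets ?G"
    unfolding A_def
  proof (rule sets.sets_Collect_finite_All')
    fix j :: nat assume "j \<in> {..2 ^ n}"
    then have [measurable]: "(\<lambda>x. \<Sum>i<j. x i) \<in> borel_measurable ?G" using Sm by simp
    show "{x \<in> space ?G. \<bar>\<Sum>i<j. x i\<bar> \<le> a * sqrt (2 ^ n)} \<in> sets ?G" by measurable
  qed auto
  have PA: "1 - 1 / a\<^sup>2 \<le> measure ?G A"
  proof -
    define E where "E = {x \<in> space ?G. \<exists>j\<le>2 ^ n. a * sqrt (2 ^ n) < \<bar>\<Sum>i<j. x i\<bar>}"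
    have "measure ?G E \<le> real (2 ^ n) / (a * sqrt (2 ^ n))\<^sup>2"
      unfolding E_def using a by (intro gauss_vec_Kolmogorov) simp
    also have "\<dots> = 1 / a\<^sup>2" using a by (simp add: power_mult_distrib)
    finally have "measure ?G E \<le> 1 / a\<^sup>2" .
    moreover have "E = space ?G - A" unfolding A_def E_def Ball_def atMost_iff not_less[symmetric] by blast
    then have "measure ?G E = 1 - measure ?G A" using G.prob_compl[OF Am] by (simp only:)
    ultimately show ?thesis by linarith
  qed
  have inva: "1 / a\<^sup>2 < 1 / 8" using a by (intro divide_strict_left_mono) auto
  then have p7: "7 / 8 < measure ?G A" using PA by linarith
  have sep: "T \<le> (\<Sum>i<2 ^ n. (x i - y i)\<^sup>2)" if x: "x \<in> A" and y: "y \<in> D" for x y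
  proof (rule ccontr)
    assume "\<not> T \<le> (\<Sum>i<2 ^ n. (x i - y i)\<^sup>2)"
    then have lt: "(\<Sum>i<2 ^ n. (x i - y i)\<^sup>2) \<le> T" by simp
    define c where "c = \<sigma> / sqrt (2 ^ n)"
    have c: "0 < c" "c\<^sup>2 = \<sigma>\<^sup>2 / 2 ^ n" unfolding c_def using \<sigma> by (simp_all add: power_divide)
    define v where "v = polygon n (\<lambda>i. c * y i - c * x i)"
    have "v \<in> K r"
      unfolding v_def
    proof (rule polygon_in_K)
      have "(\<Sum>i<2 ^ n. (c * y i - c * x i)\<^sup>2) = c\<^sup>2 * (\<Sum>i<2 ^ n. (x i - y i)\<^sup>2)"
        unfolding sum_distrib_left
        by (intro sum.cong refl) (simp add: power2_eq_square algebra_simps)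
      then have "2 ^ n * (\<Sum>i<2 ^ n. (c * y i - c * x i)\<^sup>2) = \<sigma>\<^sup>2 * (\<Sum>i<2 ^ n. (x i - y i)\<^sup>2)"
        using c by simp
      also have "\<dots> \<le> \<sigma>\<^sup>2 * T" using lt by (intro mult_left_mono) auto
      also have "\<dots> = 2 * r" unfolding T_def using \<sigma> by simp
      finally show "2 ^ n * (\<Sum>i<2 ^ n. (c * y i - c * x i)\<^sup>2) \<le> 2 * r" .
    qed (use r in simp)
    then have "infdist (polygon n (\<lambda>i. c * y i)) (K r) \<le> dist (polygon n (\<lambda>i. c * y i)) v"
      by (rule infdist_le)
    also have "dist (polygon n (\<lambda>i. c * y i)) v = norm (polygon n (\<lambda>i. c * x i))"
      unfolding v_def polygon_diff by (simp add: dist_norm)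
    also have "\<dots> \<le> \<epsilon>"
    proof (rule norm_polygon_le)
      fix j :: nat assume "j \<le> 2 ^ n"
      then have "\<bar>\<Sum>i<j. x i\<bar> \<le> a * sqrt (2 ^ n)" using x unfolding A_def by auto
      then have "c * \<bar>\<Sum>i<j. x i\<bar> \<le> c * (a * sqrt (2 ^ n))" using c by (intro mult_left_mono) auto
      also have "\<dots> = \<epsilon>" unfolding c_def a_def using \<sigma> by simp
      finally show "\<bar>\<Sum>i<j. c * x i\<bar> \<le> \<epsilon>" using c by (simp add: sum_distrib_left[symmetric] abs_mult)
    qed
    finally show False using y unfolding D_def c_def by simp
  qed
  have conc: "measure ?G D \<le> measure ?G A powr (- ((1 - s) / s)) * exp (- ((1 - s) * T / 2))"
    using p7 by (intro gauss_vec_concentration[OF s Am Dm sep]) auto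
  \<comment> \<open>From 1 - p <= 1 / a^2 and p > 7/8 follows - ln p <= 8 / (7 * a^2), while (1 - s)
    / s <= a^2 / 8. So the power of p is at most exp (1 / 7), well below the constant of the
    statement.\<close>
  have "measure ?G A powr (- ((1 - s) / s)) \<le> 2 * exp 2"
  proof -
    define p where "p = measure ?G A"
    have p: "0 < p" "p \<le> 1" "7 / 8 < p" "1 - p \<le> 1 / a\<^sup>2" unfolding p_def using p7 PA by auto
    have "ln (1 / p) \<le> 1 / p - 1" using p by (intro ln_le_minus_one) simp
    also have "\<dots> = (1 - p) / p" using p by (simp add: diff_divide_distrib)
    also have "\<dots> \<le> (1 / a\<^sup>2) / (7 / 8)" using p by (intro frac_le) auto
    finally have l: "- ln p \<le> 8 / 7 * (1 / a\<^sup>2)" using p by (simp add: ln_div)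
    have "(1 - s) / s = 1 / s - 1" using s by (simp add: diff_divide_distrib)
    also have "1 / s = a\<^sup>2 / 8" unfolding s_def by simp
    finally have z: "0 \<le> (1 - s) / s" "(1 - s) / s \<le> a\<^sup>2 / 8" using s a by simp_all
    have "((1 - s) / s) * (- ln p) \<le> (a\<^sup>2 / 8) * (8 / 7 * (1 / a\<^sup>2))"
      using z l p by (intro mult_mono) auto
    also have "\<dots> = 1 / 7" using a by simp
    finally have "- ((1 - s) / s) * ln p \<le> 2" by simp
    then have e: "exp (- ((1 - s) / s) * ln p) \<le> exp 2" by (simp only: exp_le_cancel_iff)
    have "p powr (- ((1 - s) / s)) = exp (- ((1 - s) / s) * ln p)"
      by (subst powr_def) (use p in auto)
    also note e
    also have "exp 2 \<le> 2 * exp (2 :: real)" by simp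
    finally show ?thesis unfolding p_def .
  qed
  then have "measure ?G D \<le> 2 * exp 2 * exp (- ((1 - s) * T / 2))"
    by (intro order_trans[OF conc] mult_right_mono) auto
  also have "- ((1 - s) * T / 2) = 8 * r / \<epsilon>\<^sup>2 + - r / \<sigma>\<^sup>2"
    unfolding s_def T_def a_def using \<epsilon> \<sigma> by (simp add: field_simps)
  also have "2 * exp 2 * exp (8 * r / \<epsilon>\<^sup>2 + - r / \<sigma>\<^sup>2) = 2 * exp 2 * exp (8 * r / \<epsilon>\<^sup>2) * exp (- r / \<sigma>\<^sup>2)"
    by (simp only: exp_add mult.assoc)
  finally show ?thesis unfolding D_def .
qed

section \<open>The tail of the distance for Brownian motion\<close>

context brownian_motion
begin

lemma normal_increment_distr:
  assumes "0 \<le> s" "s < t"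
  shows "distr M borel (\<lambda>\<omega>. (W t \<omega> - W s \<omega>) / sqrt (t - s)) = std_gauss"
proof -
  have "distributed M lborel (\<lambda>\<omega>. ((W t \<omega> - W s \<omega>) - 0) / sqrt (t - s)) std_normal_density"
    using normal_increments[OF assms] assms by (subst normal_standard_normal_convert[symmetric]) auto
  then have "distr M lborel (\<lambda>\<omega>. (W t \<omega> - W s \<omega>) / sqrt (t - s)) = std_gauss"
    unfolding std_gauss_def by (simp add: distributed_distr_eq_density)
  then show ?thesis by (simp cong: distr_cong)
qed

lemma increments_distr:
  assumes \<tau>: "0 \<le> \<tau> 0" "strict_mono \<tau>" and n: "0 < n"
  shows "distr M (gauss_vec n) (\<lambda>\<omega>. \<lambda>i\<in>{..<n}. (W (\<tau> (Suc i)) \<omega> - W (\<tau> i) \<omega>) / sqrt (\<tau> (Suc i) - \<tau> i)) = gauss_vec n"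
proof -
  let ?X = "\<lambda>i \<omega>. (W (\<tau> (Suc i)) \<omega> - W (\<tau> i) \<omega>) / sqrt (\<tau> (Suc i) - \<tau> i)"
  have pos: "0 \<le> \<tau> i" "\<tau> i < \<tau> (Suc i)" for i
    using \<tau> strict_mono_mono[OF \<tau>(2)] by (auto simp: strict_mono_less dest: monoD[of \<tau> 0 i])
  have "indep_vars (\<lambda>_. borel) (\<lambda>i \<omega>. W (\<tau> (Suc i)) \<omega> - W (\<tau> i) \<omega>) {..<n}"
    using \<tau> by (intro indep_increments strict_mono_mono)
  from indep_vars_compose2[OF this, of "\<lambda>i x. x / sqrt (\<tau> (Suc i) - \<tau> i)" "\<lambda>_. borel"]
  have ind: "indep_vars (\<lambda>_. borel) ?X {..<n}" by simp
  have rv: "random_variable borel (?X i)" for i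
    using measurable_W[OF pos(1)[of i]] measurable_W[OF pos(1)[of "Suc i"]] by simp
  have "distr M (PiM {..<n} (\<lambda>_. borel)) (\<lambda>\<omega>. \<lambda>i\<in>{..<n}. ?X i \<omega>) = PiM {..<n} (\<lambda>i. distr M borel (?X i))"
    using iffD1[OF indep_vars_iff_distr_eq_PiM'[of "{..<n}" ?X "\<lambda>_. borel"] ind] n rv by auto
  also have "(\<lambda>i. distr M borel (?X i)) = (\<lambda>_. std_gauss)"
    using normal_increment_distr pos by auto
  finally have eq: "distr M (PiM {..<n} (\<lambda>_. borel)) (\<lambda>\<omega>. \<lambda>i\<in>{..<n}. ?X i \<omega>) = gauss_vec n" .
  have "distr M (gauss_vec n) (\<lambda>\<omega>. \<lambda>i\<in>{..<n}. ?X i \<omega>) = distr M (PiM {..<n} (\<lambda>_. borel)) (\<lambda>\<omega>. \<lambda>i\<in>{..<n}. ?X i \<omega>)"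
    by (intro distr_cong refl sets_PiM_cong) simp
  then show ?thesis unfolding eq .
qed

lemma Z_as_increments:
  assumes \<omega>: "\<omega> \<in> space M" and s: "0 \<le> s" and ab: "a \<in> {0..1}" "b \<in> {0..1}"
  shows "apply_bcontfun (Z W s \<omega>) b - apply_bcontfun (Z W s \<omega>) a = (W (s * b) \<omega> - W (s * a) \<omega>) / sqrt (2 * s * ln (ln s))"
  using ab by (simp add: apply_Z[OF \<omega> s] diff_divide_distrib)

text \<open>Written through increments of W, whose joint law is known; on every sample path it is
  the dyadic interpolation of \<open>Z W s \<omega>\<close>.\<close>

definition Zpoly :: "nat \<Rightarrow> real \<Rightarrow> 'a \<Rightarrow> (real \<Rightarrow>\<^sub>C real)" where
  "Zpoly n s \<omega> = polygon n (\<lambda>i. (W (s * (real (Suc i) / 2 ^ n)) \<omega> - W (s * (real i / 2 ^ n)) \<omega>) / sqrt (2 * s * ln (ln s)))"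

lemma Zpoly_tendsto:
  assumes \<omega>: "\<omega> \<in> space M" and s: "0 \<le> s"
  shows "(\<lambda>n. Zpoly n s \<omega>) \<longlonglongrightarrow> Z W s \<omega>"
proof -
  let ?f = "apply_bcontfun (Z W s \<omega>)"
  have "Zpoly n s \<omega> = polygon n (\<lambda>i. ?f (real (Suc i) / 2 ^ n) - ?f (real i / 2 ^ n))" for n
    unfolding Zpoly_def polygon_def
  proof (intro sum.cong refl)
    fix i :: nat assume "i \<in> {..<2 ^ n}"
    then have "real (Suc i) \<le> real (2 ^ n)" by (simp only: of_nat_le_iff Suc_le_eq lessThan_iff)
    then have "real i + 1 \<le> 2 ^ n" by simp
    then have "real i \<le> 2 ^ n" "real (Suc i) \<le> 2 ^ n" unfolding of_nat_Suc by linarith+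
    then have "real i / 2 ^ n \<le> 2 ^ n / 2 ^ n" "real (Suc i) / 2 ^ n \<le> 2 ^ n / 2 ^ n"
      by (simp_all only: divide_right_mono zero_le_power zero_le_numeral)
    then have "real i / 2 ^ n \<in> {0..1}" "real (Suc i) / 2 ^ n \<in> {0..1}" by simp_all
    from Z_as_increments[OF \<omega> s this]
    show "((W (s * (real (Suc i) / 2 ^ n)) \<omega> - W (s * (real i / 2 ^ n)) \<omega>) / sqrt (2 * s * ln (ln s))) *\<^sub>R ramp n i
      = (?f (real (Suc i) / 2 ^ n) - ?f (real i / 2 ^ n)) *\<^sub>R ramp n i" by (simp only:)
  qed
  then show ?thesis using polygon_tendsto[OF apply_Z(2)[OF \<omega> s]] by simp
qed

lemma infdist_Zpoly_measurable:
  assumes "0 \<le> s"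
  shows "(\<lambda>\<omega>. infdist (Zpoly n s \<omega>) A) \<in> borel_measurable M"
  unfolding Zpoly_def
proof (rule infdist_polygon_measurable)
  fix i
  have [measurable]: "W (s * (real i / 2 ^ n)) \<in> borel_measurable M" for i
    using assms by (intro measurable_W) simp
  show "(\<lambda>\<omega>. (W (s * (real (Suc i) / 2 ^ n)) \<omega> - W (s * (real i / 2 ^ n)) \<omega>) / sqrt (2 * s * ln (ln s))) \<in> borel_measurable M"
    by measurable
qed

text \<open>As a pointwise limit of distances of polygons the distance is measurable, without any
  measurable structure on the space of paths.\<close>

lemma infdist_Z_measurable [measurable]:
  assumes "0 \<le> s"
  shows "(\<lambda>\<omega>. infdist (Z W s \<omega>) A) \<in> borel_measurable M"
proof (rule borel_measurable_LIMSEQ_real)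
  show "(\<lambda>\<omega>. infdist (Zpoly n s \<omega>) A) \<in> borel_measurable M" for n
    using assms by (rule infdist_Zpoly_measurable)
  show "(\<lambda>n. infdist (Zpoly n s \<omega>) A) \<longlonglongrightarrow> infdist (Z W s \<omega>) A" if "\<omega> \<in> space M" for \<omega>
    by (intro tendsto_infdist Zpoly_tendsto that assms)
qed

text \<open>Here \<sigma>^2 = 1 / (2 * ln (ln s)) is the variance of Z at time 1, so exp (- (1/2 +
  \<eta>) / \<sigma>^2) is exactly the power - (1 + 2 * \<eta>) of ln s.\<close>

lemma Zpoly_tail:
  assumes s: "exp 1 < s" and \<eta>: "0 < \<eta>" and \<epsilon>: "0 < \<epsilon>" and large: "8 < \<epsilon>\<^sup>2 * (2 * ln (ln s))"
  shows "prob {\<omega> \<in> space M. \<epsilon> < infdist (Zpoly n s \<omega>) (K (1/2 + \<eta>))} \<le> bconst \<eta> \<epsilon> / ln s powr (1 + 2 * \<eta>)"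
proof -
  have s0: "0 < s" using s by (rule less_trans[OF exp_gt_zero])
  then have "ln (exp 1) < ln s" using s by (subst ln_less_cancel_iff) auto
  then have ls: "1 < ln s" by simp
  define L where "L = ln (ln s)"
  have L: "0 < L" unfolding L_def using ls by simp
  define \<sigma> where "\<sigma> = sqrt (1 / (2 * L))"
  have \<sigma>: "0 < \<sigma>" "\<sigma>\<^sup>2 = 1 / (2 * L)" unfolding \<sigma>_def using L by simp_all
  define \<tau> where "\<tau> i = s * (real i / 2 ^ n)" for i
  have \<tau>: "0 \<le> \<tau> 0" "strict_mono \<tau>"
    unfolding \<tau>_def strict_mono_def using s0 by (auto intro!: mult_strict_left_mono divide_strict_right_mono)
  have \<tau>d: "\<tau> (Suc i) - \<tau> i = s / 2 ^ n" for i
    unfolding \<tau>_def by (simp add: field_simps)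
  let ?G = "gauss_vec (2 ^ n)"
  let ?X = "\<lambda>\<omega>. \<lambda>i\<in>{..<2 ^ n}. (W (\<tau> (Suc i)) \<omega> - W (\<tau> i) \<omega>) / sqrt (\<tau> (Suc i) - \<tau> i)"
  define D where "D = {x \<in> space ?G. \<epsilon> < infdist (polygon n (\<lambda>i. \<sigma> / sqrt (2 ^ n) * x i)) (K (1/2 + \<eta>))}"
  have Zp: "polygon n (\<lambda>i. \<sigma> / sqrt (2 ^ n) * ?X \<omega> i) = Zpoly n s \<omega>" for \<omega>
    unfolding Zpoly_def polygon_def
  proof (intro sum.cong refl)
    fix i :: nat assume i: "i \<in> {..<2 ^ n}"
    have "\<sigma> / sqrt (2 ^ n) * (x / sqrt (s / 2 ^ n)) = x / sqrt (2 * s * L)" for x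
      unfolding \<sigma>_def using s0 L by (simp add: real_sqrt_divide real_sqrt_mult field_simps)
    then show "(\<sigma> / sqrt (2 ^ n) * ?X \<omega> i) *\<^sub>R ramp n i
      = ((W (s * (real (Suc i) / 2 ^ n)) \<omega> - W (s * (real i / 2 ^ n)) \<omega>) / sqrt (2 * s * ln (ln s))) *\<^sub>R ramp n i"
      using i \<tau>d[of i] unfolding L_def \<tau>_def by simp
  qed
  have Xm: "?X \<in> measurable M ?G"
  proof (rule measurable_restrict)
    fix i
    have "0 \<le> \<tau> i" for i unfolding \<tau>_def using s0 by simp
    then have "W (\<tau> i) \<in> borel_measurable M" for i by (rule measurable_W)
    then have "(\<lambda>\<omega>. (W (\<tau> (Suc i)) \<omega> - W (\<tau> i) \<omega>) / sqrt (\<tau> (Suc i) - \<tau> i)) \<in> borel_measurable M" by simp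
    then show "(\<lambda>\<omega>. (W (\<tau> (Suc i)) \<omega> - W (\<tau> i) \<omega>) / sqrt (\<tau> (Suc i) - \<tau> i)) \<in> measurable M std_gauss"
      by (simp add: measurable_cong_sets[OF refl sets_std_gauss])
  qed
  have bound: "measure ?G D \<le> 2 * exp 2 * exp (8 * (1/2 + \<eta>) / \<epsilon>\<^sup>2) * exp (- (1/2 + \<eta>) / \<sigma>\<^sup>2)"
    unfolding D_def using \<eta> \<epsilon> \<sigma> large by (intro gauss_vec_polygon_bound) (simp_all add: L_def)
  also have "2 * exp 2 * exp (8 * (1/2 + \<eta>) / \<epsilon>\<^sup>2) = bconst \<eta> \<epsilon>"
    unfolding bconst_def by (simp add: distrib_left add.commute)
  also have "exp (- (1/2 + \<eta>) / \<sigma>\<^sup>2) = 1 / ln s powr (1 + 2 * \<eta>)"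
    unfolding \<sigma> powr_minus_divide[symmetric] using ls L unfolding L_def by (simp add: powr_def algebra_simps)
  finally have bd: "measure ?G D \<le> bconst \<eta> \<epsilon> / ln s powr (1 + 2 * \<eta>)" by simp
  show ?thesis
  proof (cases "D \<in> sets ?G")
    case True
    have "measure ?G D = measure (distr M ?G ?X) D"
      by (subst increments_distr[OF \<tau>]) simp_all
    also have "\<dots> = prob (?X -` D \<inter> space M)" by (rule measure_distr[OF Xm True])
    also have "?X -` D \<inter> space M = {\<omega> \<in> space M. \<epsilon> < infdist (Zpoly n s \<omega>) (K (1/2 + \<eta>))}"
      using measurable_space[OF Xm] unfolding D_def by (auto simp only: Zp vimage_def Int_def mem_Collect_eq)
    finally show ?thesis using bd by simp
  next
    \<comment> \<open>This case is contradictory, since D is measurable.\<close>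
    case False
    have "(\<lambda>x. infdist (polygon n (\<lambda>i. if i < 2 ^ n then \<sigma> / sqrt (2 ^ n) * x i else 0)) (K (1/2 + \<eta>))) \<in> borel_measurable ?G"
    proof (rule infdist_polygon_measurable)
      fix i show "(\<lambda>x. if i < 2 ^ n then \<sigma> / sqrt (2 ^ n) * x i else 0) \<in> borel_measurable ?G"
        using gauss_vec_component[of i "2 ^ n"] by (cases "i < 2 ^ n") simp_all
    qed
    moreover have "polygon n (\<lambda>i. \<sigma> / sqrt (2 ^ n) * x i) = polygon n (\<lambda>i. if i < 2 ^ n then \<sigma> / sqrt (2 ^ n) * x i else 0)" for x
      unfolding polygon_def by (intro sum.cong) auto
    ultimately have "(\<lambda>x. infdist (polygon n (\<lambda>i. \<sigma> / sqrt (2 ^ n) * x i)) (K (1/2 + \<eta>))) \<in> borel_measurable ?G" by simp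
    then have "D \<in> sets ?G" unfolding D_def by measurable
    with False show ?thesis by simp
  qed
qed

text \<open>To exceed \<epsilon> is an open condition, so the event lies in the increasing union of
  the F m, where all polygons of level at least m exceed \<epsilon>; the bound for polygons passes
  to this union. If ln (ln s) is too small for that bound, the right-hand side is at least
  1.\<close>

theorem Z_tail:
  assumes s: "exp 1 < s" and \<eta>: "0 < \<eta>" and \<epsilon>: "0 < \<epsilon>"
  shows "prob {\<omega> \<in> space M. \<epsilon> < infdist (Z W s \<omega>) (K (1/2 + \<eta>))} \<le> bconst \<eta> \<epsilon> / ln s powr (1 + 2 * \<eta>)"
proof (cases "8 < \<epsilon>\<^sup>2 * (2 * ln (ln s))")
  case False
  have s0: "0 < s" using s by (rule less_trans[OF exp_gt_zero])
  then have "ln (exp 1) < ln s" using s by (subst ln_less_cancel_iff) auto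
  then have ls: "1 < ln s" by simp
  have "ln (ln s) * (1 + 2 * \<eta>) \<le> (4 / \<epsilon>\<^sup>2) * (1 + 2 * \<eta>)"
    using False \<epsilon> \<eta> by (intro mult_right_mono) (auto simp: field_simps)
  also have "\<dots> = (4 + 8 * \<eta>) / \<epsilon>\<^sup>2" by (simp add: field_simps)
  finally have "ln s powr (1 + 2 * \<eta>) \<le> exp ((4 + 8 * \<eta>) / \<epsilon>\<^sup>2)"
    using ls by (simp add: powr_def mult.commute)
  also have "\<dots> \<le> bconst \<eta> \<epsilon>"
  proof -
    have "(1::real) \<le> 2 * exp 2" using exp_ge_add_one_self[of 2] by linarith
    from mult_right_mono[OF this, of "exp ((4 + 8 * \<eta>) / \<epsilon>\<^sup>2)"] show ?thesis unfolding bconst_def by simp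
  qed
  finally have "1 \<le> bconst \<eta> \<epsilon> / ln s powr (1 + 2 * \<eta>)" using ls by simp
  then show ?thesis using prob_le_1 order_trans by blast
next
  case True
  have s0: "0 \<le> s" using s by (meson exp_gt_zero less_imp_le less_trans)
  define B where "B = bconst \<eta> \<epsilon> / ln s powr (1 + 2 * \<eta>)"
  define E where "E n = {\<omega> \<in> space M. \<epsilon> < infdist (Zpoly n s \<omega>) (K (1/2 + \<eta>))}" for n
  have Em: "E n \<in> sets M" for n
    unfolding E_def using infdist_Zpoly_measurable[OF s0, of n "K (1/2 + \<eta>)"] by measurable
  define F where "F m = (\<Inter>n\<in>{m..}. E n)" for m
  have Fm: "F m \<in> sets M" for m
    unfolding F_def using Em by (intro sets.countable_INT') auto
  have FE: "prob (F m) \<le> B" for m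
  proof -
    have "prob (F m) \<le> prob (E m)" using Em by (intro finite_measure_mono) (auto simp: F_def)
    also have "\<dots> \<le> B" unfolding E_def B_def by (rule Zpoly_tail[OF s \<eta> \<epsilon> True])
    finally show ?thesis .
  qed
  have "(\<lambda>m. prob (F m)) \<longlonglongrightarrow> prob (\<Union>m. F m)"
    using Fm by (intro finite_Lim_measure_incseq) (auto simp: F_def incseq_def)
  then have "prob (\<Union>m. F m) \<le> B"
    by (rule LIMSEQ_le_const2) (use FE in auto)
  moreover have "{\<omega> \<in> space M. \<epsilon> < infdist (Z W s \<omega>) (K (1/2 + \<eta>))} \<subseteq> (\<Union>m. F m)"
  proof safe
    fix \<omega> assume \<omega>: "\<omega> \<in> space M" "\<epsilon> < infdist (Z W s \<omega>) (K (1/2 + \<eta>))"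
    have "(\<lambda>n. infdist (Zpoly n s \<omega>) (K (1/2 + \<eta>))) \<longlonglongrightarrow> infdist (Z W s \<omega>) (K (1/2 + \<eta>))"
      by (intro tendsto_infdist Zpoly_tendsto \<omega> s0)
    from order_tendstoD(1)[OF this \<omega>(2)] obtain m where "\<And>n. m \<le> n \<Longrightarrow> \<epsilon> < infdist (Zpoly n s \<omega>) (K (1/2 + \<eta>))"
      unfolding eventually_sequentially by blast
    then have "\<omega> \<in> F m" unfolding F_def E_def using \<omega>(1) by auto
    then show "\<omega> \<in> (\<Union>m. F m)" by blast
  qed
  ultimately show ?thesis
    unfolding B_def[symmetric] using Fm by (meson finite_measure_mono order_trans sets.countable_UN' sets.countable_nat_UN range_subsetD image_subset_iff)
qed

end

section \<open>Exceedances along geometric sequences\<close>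

text \<open>The quotient is the integral of t powr (- b) over [x, x + 1]; the mean value theorem
  equates it with the value at an inner point.\<close>

lemma powr_neg_difference_bounds:
  fixes x b :: real
  assumes x: "0 < x" and b: "1 < b"
  shows "(x + 1) powr (- b) \<le> (x powr (1 - b) - (x + 1) powr (1 - b)) / (b - 1)"
    and "(x powr (1 - b) - (x + 1) powr (1 - b)) / (b - 1) \<le> x powr (- b)"
proof -
  have "\<exists>z. x < z \<and> z < x + 1 \<and> (x + 1) powr (1 - b) - x powr (1 - b) = (x + 1 - x) * ((1 - b) * z powr (1 - b - 1))"
    using x by (intro MVT2) (auto intro!: derivative_eq_intros)
  then obtain z where z: "x < z" "z < x + 1" "(x + 1) powr (1 - b) - x powr (1 - b) = (1 - b) * z powr (- b)"
    by auto
  then have eq: "(x powr (1 - b) - (x + 1) powr (1 - b)) / (b - 1) = z powr (- b)"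
    using b by (simp add: field_simps)
  have "(x + 1) powr (- b) \<le> z powr (- b)" "z powr (- b) \<le> x powr (- b)"
    using x z b by (auto intro!: powr_mono2')
  then show "(x + 1) powr (- b) \<le> (x powr (1 - b) - (x + 1) powr (1 - b)) / (b - 1)"
    and "(x powr (1 - b) - (x + 1) powr (1 - b)) / (b - 1) \<le> x powr (- b)"
    unfolding eq by simp_all
qed

lemma powr_neg_telescope_sums:
  assumes "1 < b" "0 < k"
  shows "(\<lambda>n. (real (n + k) powr (1 - b) - real (Suc n + k) powr (1 - b)) / (b - 1)) sums (real k powr (1 - b) / (b - 1))"
proof -
  have "(\<lambda>n. real (n + k) powr (1 - b)) \<longlonglongrightarrow> 0"
  proof (rule tendsto_neg_powr)
    show "filterlim (\<lambda>n. real (n + k)) at_top sequentially"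
      by (rule filterlim_compose[OF filterlim_real_sequentially filterlim_add_const_nat_at_top])
  qed (use assms in simp)
  from telescope_sums'[OF this] have "(\<lambda>n. real (n + k) powr (1 - b) - real (Suc n + k) powr (1 - b)) sums (real k powr (1 - b))" by simp
  from sums_divide[OF this, of "b - 1"] show ?thesis .
qed

lemma summable_powr_neg_shift:
  assumes "1 < b"
  shows "summable (\<lambda>n. real (n + k) powr (- b))"
  using summable_real_powr_iff[of "- b"] assms by (subst summable_iff_shift) auto

text \<open>Integral comparison for all terms but the first, which is at most k powr (1 -
  b).\<close>

lemma suminf_powr_neg_shift_le:
  assumes b: "1 < b" and k: "0 < k"
  shows "(\<Sum>n. real (n + k) powr (- b)) \<le> b / (b - 1) * real k powr (1 - b)"
proof -
  have "(\<Sum>n. real (Suc n + k) powr (- b)) \<le> real k powr (1 - b) / (b - 1)"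
  proof (rule sums_le[OF _ summable_sums powr_neg_telescope_sums[OF b k]])
    show "summable (\<lambda>n. real (Suc n + k) powr (- b))"
      using summable_powr_neg_shift[OF b, of "Suc k"] by simp
    show "real (Suc n + k) powr (- b) \<le> (real (n + k) powr (1 - b) - real (Suc n + k) powr (1 - b)) / (b - 1)" for n
      using powr_neg_difference_bounds(1)[of "real (n + k)" b] b k by (simp add: add_ac)
  qed
  moreover have "(\<Sum>n. real (n + k) powr (- b)) = (\<Sum>n. real (Suc n + k) powr (- b)) + real k powr (- b)"
    using suminf_split_head[OF summable_powr_neg_shift[OF b, of k]] by simp
  moreover have "real k powr (- b) \<le> real k powr (1 - b)" using k by (intro powr_mono) auto
  moreover have "real k powr (1 - b) / (b - 1) + real k powr (1 - b) = b / (b - 1) * real k powr (1 - b)"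
    using b by (simp add: field_simps)
  ultimately show ?thesis by linarith
qed

lemma zeta_alt: "zeta s = (\<Sum>n. real (n + 1) powr (- s))"
  unfolding zeta_def by (simp add: powr_minus_divide)

lemma zeta_pos: "1 < s \<Longrightarrow> 0 < zeta s"
  unfolding zeta_alt using summable_powr_neg_shift[of s 1] by (intro suminf_pos) auto

lemma sum_le_zeta:
  assumes "1 < s"
  shows "(\<Sum>j<k. real (j + 1) powr (- s)) \<le> zeta s"
  unfolding zeta_alt by (rule sum_le_suminf[OF summable_powr_neg_shift[OF assms]]) auto

lemma zeta_lower: "0 < d \<Longrightarrow> 1 / d \<le> zeta (1 + d)"
proof -
  assume d: "0 < d"
  then have b: "1 < 1 + d" by simp
  have "real 1 powr (1 - (1 + d)) / (1 + d - 1) \<le> (\<Sum>n. real (n + 1) powr (- (1 + d)))"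
  proof (rule sums_le[OF _ powr_neg_telescope_sums[OF b] summable_sums[OF summable_powr_neg_shift[OF b]]])
    show "(real (n + 1) powr (1 - (1 + d)) - real (Suc n + 1) powr (1 - (1 + d))) / (1 + d - 1) \<le> real (n + 1) powr (- (1 + d))" for n
      using powr_neg_difference_bounds(2)[of "real (n + 1)" "1 + d"] d by (simp add: add_ac)
  qed simp
  then show ?thesis unfolding zeta_alt by simp
qed

text \<open>The first term of the series is kept exactly; the bound 1 / d would be too weak for the
  numerical estimate at k = 2.\<close>

lemma zeta_lower2: "0 < d \<Longrightarrow> 1 + 2 powr (- d) / d \<le> zeta (1 + d)"
proof -
  assume d: "0 < d"
  then have b: "1 < 1 + d" by simp
  have "real 2 powr (1 - (1 + d)) / (1 + d - 1) \<le> (\<Sum>n. real (n + 2) powr (- (1 + d)))"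
  proof (rule sums_le[OF _ powr_neg_telescope_sums[OF b] summable_sums[OF summable_powr_neg_shift[OF b]]])
    show "(real (n + 2) powr (1 - (1 + d)) - real (Suc n + 2) powr (1 - (1 + d))) / (1 + d - 1) \<le> real (n + 2) powr (- (1 + d))" for n
      using powr_neg_difference_bounds(2)[of "real (n + 2)" "1 + d"] d by (simp add: add_ac)
  qed simp
  moreover have "(\<Sum>n. real (n + 1) powr (- (1 + d))) = (\<Sum>n. real (n + 2) powr (- (1 + d))) + 1"
    using suminf_split_head[OF summable_powr_neg_shift[OF b, of 1]] by simp
  ultimately show ?thesis unfolding zeta_alt by simp
qed

lemma zeta_upper: "0 < d \<Longrightarrow> zeta (1 + d) \<le> 1 + 1 / d"
  using suminf_powr_neg_shift_le[of "1 + d" 1] unfolding zeta_alt by (simp add: field_simps)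

section \<open>From moments to tails\<close>

text \<open>The derivative of t powr (1 + p) on [j, j + 1] is largest at the right end for p >= 0
  and at the left end for p < 0.\<close>

lemma powr_increment_le:
  fixes p :: real
  assumes p: "-1 < p"
  shows "0 \<le> p \<Longrightarrow> real (j + 1) powr (1 + p) - real j powr (1 + p) \<le> (1 + p) * real (j + 1) powr p"
    and "p < 0 \<Longrightarrow> 0 < j \<Longrightarrow> real (j + 1) powr (1 + p) - real j powr (1 + p) \<le> (1 + p) * real j powr p"
proof -
  have mvt: "\<exists>z. real j < z \<and> z < real j + 1 \<and> real (j + 1) powr (1 + p) - real j powr (1 + p) = (1 + p) * z powr p" if "0 < j"
  proof -
    have "\<exists>z. real j < z \<and> z < real j + 1 \<and> (real j + 1) powr (1 + p) - real j powr (1 + p) = (real j + 1 - real j) * ((1 + p) * z powr (1 + p - 1))"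
      using that by (intro MVT2) (auto intro!: derivative_eq_intros)
    then show ?thesis by (simp add: add.commute)
  qed
  show "real (j + 1) powr (1 + p) - real j powr (1 + p) \<le> (1 + p) * real (j + 1) powr p" if "0 \<le> p"
  proof (cases "j = 0")
    case True
    then show ?thesis using that by simp
  next
    case False
    then have "0 < j" by simp
    from mvt[OF this] obtain z where z: "real j < z" "z < real j + 1" "real (j + 1) powr (1 + p) - real j powr (1 + p) = (1 + p) * z powr p"
      by (elim exE conjE)
    have "z powr p \<le> real (j + 1) powr p" using z that by (intro powr_mono2) auto
    then show ?thesis using z(3) that by (simp add: mult_left_mono)
  qed
  show "real (j + 1) powr (1 + p) - real j powr (1 + p) \<le> (1 + p) * real j powr p" if "p < 0" "0 < j"
  proof -
    from mvt[OF that(2)] obtain z where z: "real j < z" "z < real j + 1" "real (j + 1) powr (1 + p) - real j powr (1 + p) = (1 + p) * z powr p"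
      by (elim exE conjE)
    have "z powr p \<le> real j powr p" using z that by (intro powr_mono2') auto
    then show ?thesis using z(3) p by (simp add: mult_left_mono)
  qed
qed

text \<open>Markov's inequality for the moment of order \<open>1 + p\<close> of a random variable with values in
  \<open>\<nat>\<close> and tail function \<open>Q\<close>, the moment being estimated by partial summation.\<close>

lemma moment_tail_bound:
  fixes Q :: "nat \<Rightarrow> real"
  assumes anti: "\<And>i j. 1 \<le> i \<Longrightarrow> i \<le> j \<Longrightarrow> Q j \<le> Q i" and Q1: "\<And>j. Q j \<le> 1" and Q0: "\<And>j. 0 \<le> Q j"
    and tail: "\<And>j. 1 \<le> j \<Longrightarrow> Q j \<le> D * real j powr (1 - b)" and D: "0 \<le> D"
    and p: "-1 < p" "p < b - 2" and k: "1 \<le> k"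
  shows "Q k \<le> real k powr (- (1 + p)) * ((1 + p) * D * zeta (b - 1 - p)) + real k powr (- (1 + p)) * of_bool (p < 0)"
proof -
  have s: "1 < b - 1 - p" using p by simp
  define \<Delta> where "\<Delta> j = real (j + 1) powr (1 + p) - real j powr (1 + p)" for j :: nat
  have \<Delta>0: "0 \<le> \<Delta> j" for j
    unfolding \<Delta>_def using p by (simp add: powr_mono2)
  \<comment> \<open>k powr (1 + p) is the telescoping sum of \<Delta>, and Q k is at most each Q (j
    + 1) with j < k.\<close>
  have "real k powr (1 + p) * Q k = (\<Sum>j<k. \<Delta> j * Q k)"
    using sum_lessThan_telescope[of "\<lambda>j. real j powr (1 + p)" k] p
    unfolding \<Delta>_def by (simp add: sum_distrib_right[symmetric])
  also have "\<dots> \<le> (\<Sum>j<k. \<Delta> j * Q (j + 1))"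
    using \<Delta>0 by (intro sum_mono mult_left_mono anti) auto
  also have "\<dots> \<le> (1 + p) * D * zeta (b - 1 - p) + of_bool (p < 0)"
  proof (cases "p < 0")
    case False
    have "(\<Sum>j<k. \<Delta> j * Q (j + 1)) \<le> (\<Sum>j<k. (1 + p) * D * real (j + 1) powr (- (b - 1 - p)))"
    proof (rule sum_mono)
      fix j
      have "\<Delta> j * Q (j + 1) \<le> ((1 + p) * real (j + 1) powr p) * (D * real (j + 1) powr (1 - b))"
        using False powr_increment_le(1)[OF p(1), of j] \<Delta>0[of j] Q0[of "j + 1"] tail[of "j + 1"] p
        unfolding \<Delta>_def by (intro mult_mono) auto
      also have "\<dots> = (1 + p) * D * (real (j + 1) powr p * real (j + 1) powr (1 - b))" by (simp only: mult_ac)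
      also have "real (j + 1) powr p * real (j + 1) powr (1 - b) = real (j + 1) powr (- (b - 1 - p))"
        unfolding powr_add[symmetric] by (simp add: algebra_simps)
      finally show "\<Delta> j * Q (j + 1) \<le> (1 + p) * D * real (j + 1) powr (- (b - 1 - p))" .
    qed
    also have "\<dots> = (1 + p) * D * (\<Sum>j<k. real (j + 1) powr (- (b - 1 - p)))" by (simp only: sum_distrib_left)
    also have "\<dots> \<le> (1 + p) * D * zeta (b - 1 - p)"
      using p D by (intro mult_left_mono sum_le_zeta[OF s]) auto
    finally show ?thesis using False by simp
  next
    case True
    \<comment> \<open>For p < 0 the derivative at the left end cannot bound the increment at j = 0.
      That increment is 1 and produces the indicator term. The others are paired with the tail bound
      one index below the argument of Q, which monotonicity permits.\<close>
    obtain k' where k': "k = Suc k'" using k by (cases k) auto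
    have "(\<Sum>j<k. \<Delta> j * Q (j + 1)) = \<Delta> 0 * Q 1 + (\<Sum>j<k'. \<Delta> (Suc j) * Q (Suc j + 1))"
      unfolding k' by (subst sum.lessThan_Suc_shift) simp
    also have "\<Delta> 0 * Q 1 \<le> 1" unfolding \<Delta>_def using p Q1[of 1] by simp
    also have "(\<Sum>j<k'. \<Delta> (Suc j) * Q (Suc j + 1)) \<le> (\<Sum>j<k'. (1 + p) * D * real (j + 1) powr (- (b - 1 - p)))"
    proof (rule sum_mono)
      fix j
      have "Q (Suc j + 1) \<le> D * real (j + 1) powr (1 - b)"
        using anti[of "j + 1" "Suc j + 1"] tail[of "j + 1"] by simp
      then have "\<Delta> (Suc j) * Q (Suc j + 1) \<le> ((1 + p) * real (j + 1) powr p) * (D * real (j + 1) powr (1 - b))"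
        using True powr_increment_le(2)[OF p(1), of "Suc j"] \<Delta>0[of "Suc j"] Q0[of "Suc j + 1"] p
        unfolding \<Delta>_def by (intro mult_mono) auto
      also have "\<dots> = (1 + p) * D * (real (j + 1) powr p * real (j + 1) powr (1 - b))" by (simp only: mult_ac)
      also have "real (j + 1) powr p * real (j + 1) powr (1 - b) = real (j + 1) powr (- (b - 1 - p))"
        unfolding powr_add[symmetric] by (simp add: algebra_simps)
      finally show "\<Delta> (Suc j) * Q (Suc j + 1) \<le> (1 + p) * D * real (j + 1) powr (- (b - 1 - p))" .
    qed
    also have "\<dots> = (1 + p) * D * (\<Sum>j<k'. real (j + 1) powr (- (b - 1 - p)))" by (simp only: sum_distrib_left)
    also have "\<dots> \<le> (1 + p) * D * zeta (b - 1 - p)"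
      using p D by (intro mult_left_mono sum_le_zeta[OF s]) auto
    finally show ?thesis using True by simp
  qed
  finally have "real k powr (1 + p) * Q k \<le> (1 + p) * D * zeta (b - 1 - p) + of_bool (p < 0)" .
  then have "real k powr (- (1 + p)) * (real k powr (1 + p) * Q k) \<le> real k powr (- (1 + p)) * ((1 + p) * D * zeta (b - 1 - p) + of_bool (p < 0))"
    by (intro mult_left_mono) auto
  also have "real k powr (- (1 + p)) * (real k powr (1 + p) * Q k) = Q k"
  proof -
    have "real k powr (- (1 + p)) * real k powr (1 + p) = 1"
      by (subst powr_add[symmetric]) (use k in simp)
    then show ?thesis by (simp only: mult.assoc[symmetric] mult_1_left)
  qed
  finally show ?thesis by (simp only: distrib_left)
qed

text \<open>zeta (1 + d) >= 1 / d reduces the factor to k powr d * ((z - d) / d). For k >= 3 this is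
  at least (1 + 16/25) * (62/100) > 1, by the bounds 19/33 < \<gamma> < 13/22 and ln 3 >=
  19/18.\<close>

lemma zeta_factor_ge_1:
  assumes k: "3 \<le> k" and z: "1 < z" and d: "d = 1 / (ln (real k) + euler_mascheroni)"
  shows "1 \<le> zeta (1 + d) * real k powr d * (z - d)"
proof -
  define g where "g = (euler_mascheroni :: real)"
  define l where "l = ln (real k)"
  have g: "19 / 33 < g" "g < 13 / 22"
    unfolding g_def using euler_mascheroni_gt_19_over_33 euler_mascheroni_less_13_over_22 by auto
  \<comment> \<open>A lower bound for ln 3 from the one for ln 2, through 9 = 8 * (9/8).\<close>
  have "2 * ln 3 = ln (9 :: real)" using ln_realpow[of 3 2] by simp
  also have "\<dots> = ln (8 * (9 / 8) :: real)" by simp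
  also have "\<dots> = 3 * ln 2 + ln (9 / 8 :: real)"
    using ln_realpow[of 2 3] by (subst ln_mult) auto
  finally have "2 * ln 3 = 3 * ln 2 + ln (9 / 8 :: real)" .
  moreover have "1 / 9 \<le> ln (9 / 8 :: real)"
    using ln_le_minus_one[of "8 / 9 :: real"] by (simp add: ln_div)
  ultimately have "19 / 18 \<le> ln (3 :: real)" using ln2_ge_two_thirds by linarith
  moreover have "ln 3 \<le> l" unfolding l_def using k by simp
  ultimately have l: "19 / 18 \<le> l" by linarith
  have lg: "0 < l + g" using l g by linarith
  have d': "d = 1 / (l + g)" "0 < d" unfolding d l_def[symmetric] g_def[symmetric] using lg by simp_all
  have "16 / 25 \<le> l / (l + g)" using lg l g by (simp add: field_simps)
  moreover have "1 + l / (l + g) \<le> exp (l / (l + g))" by simp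
  moreover have kd: "real k powr d = exp (l / (l + g))"
    using k unfolding d'(1) l_def by (simp add: powr_def)
  ultimately have A: "41 / 25 \<le> real k powr d" by linarith
  have "(62 / 100) \<le> (l + g - 1)" using l g by linarith
  moreover have "l + g - 1 \<le> (z - d) / d"
  proof -
    have "(1 - d) / d = l + g - 1" using d'(2) lg unfolding d'(1) by (simp add: field_simps)
    moreover have "(1 - d) / d \<le> (z - d) / d" using d' z by (intro divide_right_mono) auto
    ultimately show ?thesis by simp
  qed
  ultimately have B: "62 / 100 \<le> (z - d) / d" by linarith
  have zd: "0 < z - d"   proof -
    have "0 < (z - d) / d" using B by linarith
    then show ?thesis using d'(2) by (simp add: zero_less_divide_iff)
  qed
  have "1 \<le> (41 / 25) * (62 / 100 :: real)" by simp
  also have "\<dots> \<le> real k powr d * ((z - d) / d)" using A B by (intro mult_mono) auto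
  also have "\<dots> = (1 / d) * real k powr d * (z - d)" by simp
  also have "\<dots> \<le> zeta (1 + d) * real k powr d * (z - d)"
    using zd zeta_lower[OF d'(2)] by (intro mult_right_mono) auto
  finally show ?thesis .
qed

text \<open>What k = 2 requires when the factor may be below 1. On [1, 2] the function 2 powr z lies
  below its chord 2 * z, which leaves a quadratic inequality in z; 29/10 is a lower bound for zeta
  (1 + d) * 2 powr d, and 161/200 an upper bound for d.\<close>

lemma zeta_factor_at_2:
  assumes z: "1 < z" "z < 1 + d" and d: "d = 1 / (ln 2 + euler_mascheroni)"
  shows "2 powr z * (1 - zeta (1 + d) * 2 powr d * (z - d)) \<le> 1"
proof -
  define g where "g = (euler_mascheroni :: real)"
  define l where "l = ln (2 :: real)"
  have g: "19 / 33 < g" "g < 13 / 22"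
    unfolding g_def using euler_mascheroni_gt_19_over_33 euler_mascheroni_less_13_over_22 by auto
  have l: "2 / 3 \<le> l" "l \<le> 25 / 36" unfolding l_def using ln2_ge_two_thirds ln2_le_25_over_36 by auto
  have lg: "0 < l + g" using l g by linarith
  have d': "d = 1 / (l + g)" "0 < d" unfolding d l_def[symmetric] g_def[symmetric] using lg by simp_all
  have dl: "d \<le> 161 / 200" using lg l g unfolding d'(1) by (simp add: field_simps)
  have "53 / 100 \<le> l / (l + g)" using lg l g by (simp add: field_simps)
  then have "1 + 53 / 100 + (53 / 100)\<^sup>2 / 2 \<le> exp (53 / 100 :: real)"
    using exp_lower_Taylor_quadratic[of "53 / 100 :: real"] by simp
  also have "\<dots> \<le> exp (l / (l + g))" using \<open>53 / 100 \<le> l / (l + g)\<close> by simp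
  also have "\<dots> = 2 powr d" unfolding d'(1) l_def by (simp add: powr_def)
  finally have p: "167 / 100 \<le> 2 powr d" by (simp add: power2_eq_square)
  have "(1 + 2 powr (- d) / d) * 2 powr d = 2 powr d + 1 / d"
    by (simp add: distrib_right powr_minus field_simps)
  moreover have "1 / d = l + g" using lg unfolding d'(1) by simp
  ultimately have "29 / 10 \<le> (1 + 2 powr (- d) / d) * 2 powr d" using p l g by linarith
  also have "\<dots> \<le> zeta (1 + d) * 2 powr d"
    using zeta_lower2[OF d'(2)] by (intro mult_right_mono) auto
  finally have "29 / 10 * (z - 161 / 200) \<le> zeta (1 + d) * 2 powr d * (z - d)"
    using z dl by (intro mult_mono) auto
  then have y: "1 - zeta (1 + d) * 2 powr d * (z - d) \<le> 1 - 29 / 10 * (z - 161 / 200)" by linarith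
  have z2: "z < 2" using z dl by linarith
  have "2 powr (z - 1) * 1 powr (2 - z) \<le> (z - 1) * 2 + (2 - z) * (1::real)"
    using z z2 by (intro Youngs_inequality_0) auto
  then have pz: "2 powr z \<le> 2 * z" by (simp add: powr_diff)
  show ?thesis
  proof (cases "0 \<le> 1 - zeta (1 + d) * 2 powr d * (z - d)")
    case True
    have "2 powr z * (1 - zeta (1 + d) * 2 powr d * (z - d)) \<le> 2 * z * (1 - 29 / 10 * (z - 161 / 200))"
      using True y pz z by (intro mult_mono) auto
    also have "\<dots> = 1 - (z - 1) * (58 / 10 * z - 869 / 1000) - 131 / 1000" by (simp add: field_simps)
    also have "\<dots> \<le> 1"
    proof -
      have "0 \<le> (z - 1) * (58 / 10 * z - 869 / 1000)" using z by (intro mult_nonneg_nonneg) auto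
      then show ?thesis by linarith
    qed
    finally show ?thesis .
  next
    case False
    then have "2 powr z * (1 - zeta (1 + d) * 2 powr d * (z - d)) \<le> 0" by (intro mult_nonneg_nonpos) auto
    then show ?thesis by linarith
  qed
qed

text \<open>The order of the moment is 1 + p with p = z - 1 - d. For p >= 0 this is
  \<open>moment_tail_bound\<close>. For p < 0 that lemma would attach k powr (- (1 + p)) to the
  indicator, more than the k powr (- z) allowed here. Then k = 1 is covered by the indicator term
  alone, k >= 3 by the first term alone, and k = 2 needs both.\<close>

lemma moment_tail_bound_optimized:
  fixes Q :: "nat \<Rightarrow> real"
  assumes anti: "\<And>i j. 1 \<le> i \<Longrightarrow> i \<le> j \<Longrightarrow> Q j \<le> Q i" and Q1: "\<And>j. Q j \<le> 1" and Q0: "\<And>j. 0 \<le> Q j"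
    and tail: "\<And>j. 1 \<le> j \<Longrightarrow> Q j \<le> D * real j powr (- z)" and D: "0 \<le> D"
    and z: "1 < z" and k: "1 \<le> k" and d: "d = 1 / (ln (real k) + euler_mascheroni)" and dz: "d \<le> z"
  shows "Q k \<le> real k powr (- z) * (zeta (1 + d) * real k powr d * D * (z - d)) + real k powr (- z) * of_bool (z - 1 < d)"
proof (cases "z - 1 < d")
  case False
  have tail': "\<And>j. 1 \<le> j \<Longrightarrow> Q j \<le> D * real j powr (1 - (z + 1))" using tail by simp
  have lk: "0 \<le> ln (real k)" using k by simp
  have d0: "0 < d" unfolding d using lk euler_mascheroni_gt_19_over_33 by (intro divide_pos_pos) auto
  have "Q k \<le> real k powr (- (1 + (z - 1 - d))) * ((1 + (z - 1 - d)) * D * zeta (z + 1 - 1 - (z - 1 - d)))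
       + real k powr (- (1 + (z - 1 - d))) * of_bool (z - 1 - d < 0)"
    by (rule moment_tail_bound[OF anti Q1 Q0 tail' D _ _ k]) (use False d0 in auto)
  also have "\<dots> = real k powr (- z) * (zeta (1 + d) * real k powr d * D * (z - d)) + real k powr (- z) * of_bool (z - 1 < d)"
  proof -
    have "real k powr (- (1 + (z - 1 - d))) = real k powr (- z) * real k powr d" by (simp flip: powr_add)
    moreover have "z + 1 - 1 - (z - 1 - d) = 1 + d" "1 + (z - 1 - d) = z - d" by simp_all
    ultimately show ?thesis using False by (simp add: mult_ac)
  qed
  finally show ?thesis .
next
  case True
  have lk: "0 \<le> ln (real k)" using k by simp
  have d0: "0 < d" unfolding d using lk euler_mascheroni_gt_19_over_33 by (intro divide_pos_pos) auto
  define y where "y = zeta (1 + d) * real k powr d * (z - d)"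
  have y0: "0 \<le> y" unfolding y_def using zeta_pos[of "1 + d"] d0 dz by (intro mult_nonneg_nonneg) auto
  have goal: "Q k \<le> real k powr (- z) * (y * D + 1)"
  proof -
    have "k = 1 \<or> k = 2 \<or> 3 \<le> k" using k by linarith
    then consider "k = 1" | "k = 2" | "3 \<le> k" by blast
    then show ?thesis
    proof cases
      case 1
      then show ?thesis using Q1[of k] mult_nonneg_nonneg[OF y0 D] by simp
    next
      case 3
      then have "1 \<le> y" unfolding y_def using zeta_factor_ge_1[OF _ z d] by simp
      then have "1 * D \<le> y * D" using D by (intro mult_right_mono)
      then have "D \<le> y * D + 1" by linarith
      then have "real k powr (- z) * D \<le> real k powr (- z) * (y * D + 1)" by (intro mult_left_mono) auto
      then show ?thesis using tail[OF k] by (simp add: mult.commute)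
    next
      case 2
      have c: "2 powr z * (1 - y) \<le> 1"
        using zeta_factor_at_2[OF z _ d[unfolded 2 of_nat_numeral]] True unfolding y_def 2 by simp
      have inv: "2 powr (- z) = 1 / 2 powr z" by (rule powr_minus_divide)
      have pos: "(0 :: real) < 2 powr z" by simp
      \<comment> \<open>The two bounds 1 and D * 2 powr (- z) for Q cross at D = 2 powr z. This is
        the worst case, and there the claim is c.\<close>
      show ?thesis
      proof (cases "D \<le> 2 powr z")
        case True
        have "D \<le> y * D + 1"
        proof (cases "y \<le> 1")
          case yle: True
          have "D * (1 - y) \<le> 2 powr z * (1 - y)" using True yle by (intro mult_right_mono) auto
          then show ?thesis using c by (simp add: algebra_simps)
        next
          case False
          then have "1 * D \<le> y * D" using D by (intro mult_right_mono) auto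
          then show ?thesis by linarith
        qed
        then have "real k powr (- z) * D \<le> real k powr (- z) * (y * D + 1)" by (intro mult_left_mono) auto
        then show ?thesis using tail[OF k] by (simp add: mult.commute)
      next
        case False
        have "2 powr z \<le> y * 2 powr z + 1" using c by (simp add: algebra_simps)
        also have "\<dots> \<le> y * D + 1" using False y0 by (intro add_right_mono mult_left_mono) auto
        finally have "1 \<le> (y * D + 1) / 2 powr z" by simp
        with Q1[of k] have "Q k \<le> (y * D + 1) / 2 powr z" by (rule order_trans)
        then show ?thesis unfolding 2 of_nat_numeral inv by (simp only: times_divide_eq_left mult_1_left)
      qed
    qed
  qed
  have "real k powr (- z) * (y * D + 1) = real k powr (- z) * (zeta (1 + d) * real k powr d * D * (z - d)) + real k powr (- z) * of_bool (z - 1 < d)"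
  proof -
    have o: "of_bool (z - 1 < d) = (1 :: real)" using True by simp
    have "y * D = zeta (1 + d) * real k powr d * D * (z - d)" unfolding y_def by (simp only: mult_ac)
    then show ?thesis unfolding o by (simp only: distrib_left)
  qed
  with goal show ?thesis by (simp only:)
qed

section \<open>Counting exceedances and the last exceedance\<close>

lemma ecard_ge_iff_subset:
  assumes "enat k \<le> ecard A"
  obtains B where "B \<subseteq> A" "finite B" "card B = k"
proof (cases "finite A")
  case True
  then have "k \<le> card A" using assms unfolding ecard_def by simp
  then show ?thesis using obtain_subset_with_card_n that by metis
next
  case False
  then show ?thesis using infinite_arbitrarily_large that by metis
qed

text \<open>If all elements are below k, then k - 1 bounds the supremum. \<open>1 \<le> k\<close>
  matters because the supremum of the empty set is 0.\<close>

lemma enat_le_Sup_iff: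
  assumes "1 \<le> k"
  shows "enat k \<le> Sup (enat ` A) \<longleftrightarrow> (\<exists>n\<in>A. k \<le> n)"
proof
  assume "\<exists>n\<in>A. k \<le> n"
  then obtain n where "n \<in> A" "k \<le> n" by blast
  then show "enat k \<le> Sup (enat ` A)"
    by (intro order_trans[OF _ Sup_upper[of "enat n"]]) auto
next
  assume a: "enat k \<le> Sup (enat ` A)"
  show "\<exists>n\<in>A. k \<le> n"
  proof (rule ccontr)
    assume "\<not> (\<exists>n\<in>A. k \<le> n)"
    then have "x \<le> enat (k - 1)" if "x \<in> enat ` A" for x using that by force
    then have "Sup (enat ` A) \<le> enat (k - 1)" by (intro Sup_least)
    with a have "enat k \<le> enat (k - 1)" by (rule order_trans)
    then show False using assms by simp
  qed
qed

context prob_space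
begin

text \<open>A set outside \<open>events\<close> has \<open>prob\<close> 0, so it is covered as well.
  Counting events are estimated in this way through measurable supersets.\<close>

lemma prob_le_superset: "A \<subseteq> B \<Longrightarrow> B \<in> events \<Longrightarrow> prob A \<le> prob B"
  by (cases "A \<in> events") (auto intro: finite_measure_mono simp: measure_notin_sets)

text \<open>Markov's inequality for the sum of the indicators, taken in \<open>ennreal\<close> so
  that infinitely many occurrences are included.\<close>

lemma prob_ecard_ge_le:
  assumes S: "\<And>n::nat. S n \<in> events" and p: "\<And>n. prob (S n) \<le> p n" and sum: "summable p" and k: "1 \<le> k"
  shows "prob {\<omega> \<in> space M. enat k \<le> ecard {n. \<omega> \<in> S n}} \<le> 1 / real k * (\<Sum>n. p n)"
proof -
  define N where "N \<omega> = (\<Sum>n. indicator (S n) \<omega> :: ennreal)" for \<omega>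
  have Nm: "N \<in> borel_measurable M" unfolding N_def using S by measurable
  have p0: "0 \<le> p n" for n using p[of n] measure_nonneg order_trans by blast
  define E where "E = {\<omega> \<in> space M. 1 \<le> ennreal (1 / real k) * N \<omega>}"
  have Em: "E \<in> events" unfolding E_def using Nm by measurable
  have sub: "{\<omega> \<in> space M. enat k \<le> ecard {n. \<omega> \<in> S n}} \<subseteq> E"
  proof safe
    fix \<omega> assume \<omega>: "\<omega> \<in> space M" "enat k \<le> ecard {n. \<omega> \<in> S n}"
    obtain B where B: "B \<subseteq> {n. \<omega> \<in> S n}" "finite B" "card B = k" using ecard_ge_iff_subset[OF \<omega>(2)] .
    have "ennreal (real k) = (\<Sum>n\<in>B. indicator (S n) \<omega>)"
    proof -
      have "(\<Sum>n\<in>B. indicator (S n) \<omega> :: ennreal) = (\<Sum>n\<in>B. 1)" using B(1) by (intro sum.cong) auto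
      then show ?thesis using B(3) by (simp add: ennreal_of_nat_eq_real_of_nat)
    qed
    also have "\<dots> \<le> N \<omega>" unfolding N_def by (intro sum_le_suminf B) auto
    finally have "ennreal (1 / real k) * ennreal (real k) \<le> ennreal (1 / real k) * N \<omega>" by (intro mult_left_mono) auto
    moreover have "ennreal (1 / real k) * ennreal (real k) = 1" using k by (simp add: ennreal_mult[symmetric])
    ultimately show "\<omega> \<in> E" unfolding E_def using \<omega>(1) by simp
  qed
  have "emeasure M E \<le> ennreal (1 / real k) * (\<integral>\<^sup>+ \<omega>. N \<omega> * indicator (space M) \<omega> \<partial>M)"
    unfolding E_def using Nm by (intro nn_integral_Markov_inequality) auto
  also have "(\<integral>\<^sup>+ \<omega>. N \<omega> * indicator (space M) \<omega> \<partial>M) = (\<integral>\<^sup>+ \<omega>. N \<omega> \<partial>M)"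
    by (intro nn_integral_cong) simp
  also have "(\<integral>\<^sup>+ \<omega>. N \<omega> \<partial>M) = (\<Sum>n. emeasure M (S n))"
    unfolding N_def using S by (subst nn_integral_suminf) auto
  also have "\<dots> \<le> (\<Sum>n. ennreal (p n))"
    using p by (intro suminf_le) (auto simp: emeasure_eq_measure intro!: ennreal_leI)
  also have "\<dots> = ennreal (\<Sum>n. p n)"
    using p0 sum by (intro suminf_ennreal2) auto
  finally have "emeasure M E \<le> ennreal (1 / real k) * ennreal (\<Sum>n. p n)"
    by (simp add: mult_left_mono)
  then have "ennreal (prob E) \<le> ennreal (1 / real k * (\<Sum>n. p n))"
    using p0 sum by (simp add: emeasure_eq_measure ennreal_mult[symmetric] suminf_nonneg)
  then have "prob E \<le> 1 / real k * (\<Sum>n. p n)"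
    using p0 sum by (subst (asm) ennreal_le_iff) (auto intro!: divide_nonneg_nonneg suminf_nonneg)
  with prob_le_superset[OF sub Em] show ?thesis by linarith
qed

lemma prob_Union_shift_le:
  assumes S: "\<And>n::nat. S n \<in> events" and p: "\<And>n. prob (S n) \<le> p n" and sum: "summable p"
  shows "prob (\<Union>n\<in>{k..}. S n) \<le> (\<Sum>n. p (n + k))"
proof -
  have p0: "0 \<le> p n" for n using p[of n] measure_nonneg order_trans by blast
  have sk: "summable (\<lambda>n. p (n + k))" using sum by (subst summable_iff_shift)
  have sp: "summable (\<lambda>n. prob (S (n + k)))"
    by (rule summable_comparison_test'[OF sk, of 0]) (use p in auto)
  have "(\<Union>n\<in>{k..}. S n) = (\<Union>n. S (n + k))"
  proof (intro equalityI subsetI)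
    fix \<omega> assume "\<omega> \<in> (\<Union>n\<in>{k..}. S n)"
    then obtain n where "k \<le> n" "\<omega> \<in> S n" by auto
    then have "\<omega> \<in> S ((n - k) + k)" by simp
    then show "\<omega> \<in> (\<Union>n. S (n + k))" by (rule UN_I[OF UNIV_I])
  qed auto
  also have "prob \<dots> \<le> (\<Sum>n. prob (S (n + k)))"
    using S sp by (intro finite_measure_subadditive_countably) auto
  also have "\<dots> \<le> (\<Sum>n. p (n + k))" by (intro suminf_le p sp sk)
  finally show ?thesis .
qed

end

lemma q_power_ln:
  assumes "exp 1 < (q::real) ^ n" "1 < q"
  shows "1 \<le> n" "1 < real n * ln q" "ln (q ^ n) = real n * ln q"
proof -
  have "n \<noteq> 0" using assms(1) by (intro notI) (simp add: one_less_exp_iff less_le_not_le)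
  then show "1 \<le> n" by simp
  show l: "ln (q ^ n) = real n * ln q" using assms by (simp add: ln_realpow)
  have "ln (exp 1) < ln (q ^ n)" using assms by (subst ln_less_cancel_iff) auto
  then show "1 < real n * ln q" unfolding l by simp
qed

section \<open>Parts (2), (3a) and (3b)\<close>

context brownian_motion
begin

definition exceed_event :: "real \<Rightarrow> real \<Rightarrow> real \<Rightarrow> nat \<Rightarrow> 'a set" where
  "exceed_event q \<eta> \<epsilon> n = {\<omega> \<in> space M. exp 1 < q ^ n \<and> \<epsilon> < infdist (Z W (q ^ n) \<omega>) (K (1/2 + \<eta>))}"

lemma exceed_event_measurable: "1 < q \<Longrightarrow> exceed_event q \<eta> \<epsilon> n \<in> events"
  unfolding exceed_event_def using infdist_Z_measurable[of "q ^ n" "K (1/2 + \<eta>)"] by measurable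

lemma exceed_event_iff: "\<omega> \<in> space M \<Longrightarrow> \<omega> \<in> exceed_event q \<eta> \<epsilon> n \<longleftrightarrow> n \<in> exceed_set W q \<eta> \<epsilon> \<omega>"
  unfolding exceed_event_def exceed_set_def by simp

lemma bconst_pos: "0 < bconst \<eta> \<epsilon>"
  unfolding bconst_def by simp

text \<open>Since n * ln q > 1, lowering the exponent from \<eta> to v weakens the bound. The event
  is empty for indices with q^n <= e.\<close>

lemma exceed_event_prob_le:
  assumes q: "1 < q" and \<eta>: "0 < \<eta>" and \<epsilon>: "0 < \<epsilon>" and v: "v \<le> \<eta>"
  shows "prob (exceed_event q \<eta> \<epsilon> n) \<le> bconst \<eta> \<epsilon> / ln q powr (1 + 2 * v) * real n powr (- (1 + 2 * v))"
proof (cases "exp 1 < q ^ n")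
  case True
  note qn = q_power_ln[OF True q]
  have "prob (exceed_event q \<eta> \<epsilon> n) \<le> bconst \<eta> \<epsilon> / ln (q ^ n) powr (1 + 2 * \<eta>)"
    unfolding exceed_event_def using Z_tail[OF True \<eta> \<epsilon>] True by simp
  also have "\<dots> \<le> bconst \<eta> \<epsilon> / ln (q ^ n) powr (1 + 2 * v)"
    using qn v bconst_pos[of \<eta> \<epsilon>] by (intro divide_left_mono powr_mono mult_pos_pos) auto
  also have "\<dots> = bconst \<eta> \<epsilon> / ln q powr (1 + 2 * v) * real n powr (- (1 + 2 * v))"
    using q qn(1) unfolding qn(3) powr_minus_divide by (simp add: powr_mult mult.commute)
  finally show ?thesis .
next
  case False
  then have "exceed_event q \<eta> \<epsilon> n = {}" unfolding exceed_event_def by simp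
  then show ?thesis using bconst_pos[of \<eta> \<epsilon>] by simp
qed

lemma summable_const_powr: "1 < b \<Longrightarrow> summable (\<lambda>n. c * real n powr (- b))"
  using summable_powr_neg_shift[of b 0] by (intro summable_mult) simp

lemma exceed_num_event:
  "{\<omega> \<in> space M. enat k \<le> exceed_num W q \<eta> \<epsilon> \<omega>} = {\<omega> \<in> space M. enat k \<le> ecard {n. \<omega> \<in> exceed_event q \<eta> \<epsilon> n}}"
  unfolding exceed_num_def by (auto simp: exceed_event_iff)

lemma exceed_sup_event:
  assumes "1 \<le> k"
  shows "{\<omega> \<in> space M. enat k \<le> exceed_sup W q \<eta> \<epsilon> \<omega>} = (\<Union>n\<in>{k..}. exceed_event q \<eta> \<epsilon> n)"
  unfolding exceed_sup_def enat_le_Sup_iff[OF assms] exceed_event_def exceed_set_def by auto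

text \<open>The index 0 never occurs because q^0 < e, so k exceedances sit at k distinct positive
  indices, one of which is at least k.\<close>

lemma exceed_num_le_sup:
  assumes q: "1 < q" and k: "1 \<le> k"
  shows "prob {\<omega> \<in> space M. enat k \<le> exceed_num W q \<eta> \<epsilon> \<omega>} \<le> prob {\<omega> \<in> space M. enat k \<le> exceed_sup W q \<eta> \<epsilon> \<omega>}"
proof (rule prob_le_superset)
  show "{\<omega> \<in> space M. enat k \<le> exceed_sup W q \<eta> \<epsilon> \<omega>} \<in> events"
    unfolding exceed_sup_event[OF k] using exceed_event_measurable[OF q] by (intro sets.countable_UN) auto
  show "{\<omega> \<in> space M. enat k \<le> exceed_num W q \<eta> \<epsilon> \<omega>} \<subseteq> {\<omega> \<in> space M. enat k \<le> exceed_sup W q \<eta> \<epsilon> \<omega>}"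
  proof safe
    fix \<omega> assume \<omega>: "\<omega> \<in> space M" "enat k \<le> exceed_num W q \<eta> \<epsilon> \<omega>"
    obtain B where B: "B \<subseteq> exceed_set W q \<eta> \<epsilon> \<omega>" "finite B" "card B = k"
      using ecard_ge_iff_subset \<omega>(2) unfolding exceed_num_def by metis
    have "0 \<notin> B" using B(1) q_power_ln(1)[of q 0] q unfolding exceed_set_def by auto
    have "\<exists>n\<in>B. k \<le> n"
    proof (rule ccontr)
      assume "\<not> (\<exists>n\<in>B. k \<le> n)"
      then have "B \<subseteq> {1..<k}" using \<open>0 \<notin> B\<close> by (force simp: not_le Suc_le_eq intro: gr0I)
      then have "card B \<le> card {1..<k}" by (intro card_mono) auto
      then show False using B(3) k by simp
    qed
    then show "enat k \<le> exceed_sup W q \<eta> \<epsilon> \<omega>"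
      unfolding exceed_sup_def enat_le_Sup_iff[OF k] using B(1) by blast
  qed
qed

lemma part_2:
  assumes \<eta>: "0 < \<eta>" and \<epsilon>: "0 < \<epsilon>" and q: "1 < q" and v: "0 < v" "v < \<eta>"
  shows "\<exists>a>0. \<forall>k::nat. 1 \<le> k \<longrightarrow>
     prob {\<omega> \<in> space M. enat k \<le> exceed_num W q \<eta> \<epsilon> \<omega>} \<le> 1 / real k * (a * zeta (1 + 2 * v) / ln q powr (1 + 2 * v))"
proof (intro exI[of _ "bconst \<eta> \<epsilon>"] conjI allI impI bconst_pos)
  fix k :: nat assume k: "1 \<le> k"
  define p where "p n = bconst \<eta> \<epsilon> / ln q powr (1 + 2 * v) * real n powr (- (1 + 2 * v))" for n :: nat
  have sp: "summable p" unfolding p_def using v by (intro summable_const_powr) simp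
  have "prob {\<omega> \<in> space M. enat k \<le> exceed_num W q \<eta> \<epsilon> \<omega>} \<le> 1 / real k * (\<Sum>n. p n)"
    unfolding exceed_num_event
  proof (rule prob_ecard_ge_le[OF exceed_event_measurable[OF q] _ sp k])
    show "prob (exceed_event q \<eta> \<epsilon> n) \<le> p n" for n
      unfolding p_def by (rule exceed_event_prob_le[OF q \<eta> \<epsilon> less_imp_le[OF v(2)]])
  qed
  also have "(\<Sum>n. p n) = bconst \<eta> \<epsilon> * zeta (1 + 2 * v) / ln q powr (1 + 2 * v)"
  proof -
    \<comment> \<open>\<open>0 powr _\<close> is 0, so the series effectively starts at n = 1, as
      the zeta series does.\<close>
    have "p 0 = 0" unfolding p_def by simp
    then have "(\<Sum>n. p n) = (\<Sum>n. p (n + 1))" using suminf_split_head[OF sp] by simp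
    also have "\<dots> = bconst \<eta> \<epsilon> / ln q powr (1 + 2 * v) * zeta (1 + 2 * v)"
      unfolding p_def zeta_alt using v by (intro suminf_mult summable_powr_neg_shift) simp
    finally show ?thesis by simp
  qed
  finally show "prob {\<omega> \<in> space M. enat k \<le> exceed_num W q \<eta> \<epsilon> \<omega>} \<le> 1 / real k * (bconst \<eta> \<epsilon> * zeta (1 + 2 * v) / ln q powr (1 + 2 * v))" .
qed

text \<open>The supremum reaches j iff some exceedance occurs from j on. The union bound and the
  estimate of the tail of the series give the factor (1 + 2 * v) / (2 * v).\<close>

lemma exceed_sup_tail:
  assumes \<eta>: "0 < \<eta>" and \<epsilon>: "0 < \<epsilon>" and q: "1 < q" and v: "0 < v" "v \<le> \<eta>" and j: "1 \<le> j"
  shows "prob {\<omega> \<in> space M. enat j \<le> exceed_sup W q \<eta> \<epsilon> \<omega>}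
     \<le> bconst \<eta> \<epsilon> / ln q powr (1 + 2 * v) * ((1 + 2 * v) / (2 * v)) * real j powr (- (2 * v))"
proof -
  define c where "c = bconst \<eta> \<epsilon> / ln q powr (1 + 2 * v)"
  have c: "0 \<le> c" unfolding c_def using bconst_pos[of \<eta> \<epsilon>] by simp
  have "prob {\<omega> \<in> space M. enat j \<le> exceed_sup W q \<eta> \<epsilon> \<omega>} \<le> (\<Sum>n. c * real (n + j) powr (- (1 + 2 * v)))"
    unfolding exceed_sup_event[OF j]
  proof (rule prob_Union_shift_le)
    show "exceed_event q \<eta> \<epsilon> n \<in> events" for n by (rule exceed_event_measurable[OF q])
    show "prob (exceed_event q \<eta> \<epsilon> n) \<le> c * real n powr (- (1 + 2 * v))" for n
      unfolding c_def by (rule exceed_event_prob_le[OF q \<eta> \<epsilon> v(2)])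
    show "summable (\<lambda>n. c * real n powr (- (1 + 2 * v)))" using v by (intro summable_const_powr) simp
  qed
  also have "\<dots> = c * (\<Sum>n. real (n + j) powr (- (1 + 2 * v)))"
    using v by (intro suminf_mult summable_powr_neg_shift) simp
  also have "\<dots> \<le> c * ((1 + 2 * v) / (1 + 2 * v - 1) * real j powr (1 - (1 + 2 * v)))"
    using v j c by (intro mult_left_mono suminf_powr_neg_shift_le) auto
  finally show ?thesis unfolding c_def by (simp add: mult.assoc)
qed

lemma exceed_sup_antimono:
  assumes q: "1 < q" and "1 \<le> i" "i \<le> j"
  shows "prob {\<omega> \<in> space M. enat j \<le> exceed_sup W q \<eta> \<epsilon> \<omega>} \<le> prob {\<omega> \<in> space M. enat i \<le> exceed_sup W q \<eta> \<epsilon> \<omega>}"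
proof (rule prob_le_superset)
  show "{\<omega> \<in> space M. enat i \<le> exceed_sup W q \<eta> \<epsilon> \<omega>} \<in> events"
    unfolding exceed_sup_event[OF assms(2)] using exceed_event_measurable[OF q] by (intro sets.countable_UN) auto
  show "{\<omega> \<in> space M. enat j \<le> exceed_sup W q \<eta> \<epsilon> \<omega>} \<subseteq> {\<omega> \<in> space M. enat i \<le> exceed_sup W q \<eta> \<epsilon> \<omega>}"
    using assms(3) by (auto intro: order_trans[of "enat i" "enat j"])
qed

text \<open>The moment estimate for the tail exponent 2 * v. The second inequality amounts to p + 1
  < 2 * v.\<close>

lemma part_3a:
  assumes \<eta>: "1/2 < \<eta>" and \<epsilon>: "0 < \<epsilon>" and q: "1 < q" and v: "1/2 < v" "v < \<eta>" and p: "-1 < p" "p < 2 * v - 1" and k: "1 \<le> k"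
  shows "prob {\<omega> \<in> space M. enat k \<le> exceed_sup W q \<eta> \<epsilon> \<omega>}
      \<le> real k powr (- (1 + p)) * ((p + 1) * (1 + 2 * v) / (2 * v)) * (bconst \<eta> \<epsilon> * zeta (2 * v - p) / ln q powr (1 + 2 * v))
         + real k powr (- (1 + p)) * of_bool (p < 0)" (is "?P \<le> ?R1")
    and "real k powr (- (1 + p)) * ((p + 1) * (1 + 2 * v) / (2 * v)) * (bconst \<eta> \<epsilon> * zeta (2 * v - p) / ln q powr (1 + 2 * v))
         + real k powr (- (1 + p)) * of_bool (p < 0)
      \<le> real k powr (- (1 + p)) * (1 + 2 * v) * (bconst \<eta> \<epsilon> * zeta (2 * v - p) / ln q powr (1 + 2 * v))
         + real k powr (- (1 + p)) * of_bool (p < 0)"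
proof -
  define Q where "Q j = prob {\<omega> \<in> space M. enat j \<le> exceed_sup W q \<eta> \<epsilon> \<omega>}" for j :: nat
  define D where "D = bconst \<eta> \<epsilon> / ln q powr (1 + 2 * v) * ((1 + 2 * v) / (2 * v))"
  have D: "0 \<le> D" unfolding D_def using bconst_pos[of \<eta> \<epsilon>] v by simp
  have "Q k \<le> real k powr (- (1 + p)) * ((1 + p) * D * zeta ((1 + 2 * v) - 1 - p)) + real k powr (- (1 + p)) * of_bool (p < 0)"
  proof (rule moment_tail_bound[OF _ _ _ _ D p(1) _ k])
    show "Q j \<le> Q i" if "1 \<le> i" "i \<le> j" for i j unfolding Q_def by (rule exceed_sup_antimono[OF q that])
    show "Q j \<le> 1" "0 \<le> Q j" for j unfolding Q_def by simp_all
    show "Q j \<le> D * real j powr (1 - (1 + 2 * v))" if "1 \<le> j" for j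
      using exceed_sup_tail[OF _ \<epsilon> q _ _ that, of \<eta> v] \<eta> v unfolding Q_def D_def by simp
  qed (use p in simp)
  also have "(1 + p) * D * zeta ((1 + 2 * v) - 1 - p) = ((p + 1) * (1 + 2 * v) / (2 * v)) * (bconst \<eta> \<epsilon> * zeta (2 * v - p) / ln q powr (1 + 2 * v))"
  proof -
    have e: "(1 + 2 * v) - 1 - p = 2 * v - p" by simp
    show ?thesis unfolding D_def e by (simp add: add.commute mult.commute mult.left_commute)
  qed
  finally show "?P \<le> ?R1" unfolding Q_def by (simp only: mult.assoc)
  have "(p + 1) * (1 + 2 * v) / (2 * v) \<le> 1 + 2 * v"
    using p v by (simp add: divide_le_eq mult.commute)
  moreover have "0 \<le> bconst \<eta> \<epsilon> * zeta (2 * v - p) / ln q powr (1 + 2 * v)"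
    using bconst_pos[of \<eta> \<epsilon>] zeta_pos[of "2 * v - p"] p by simp
  ultimately show "?R1 \<le> real k powr (- (1 + p)) * (1 + 2 * v) * (bconst \<eta> \<epsilon> * zeta (2 * v - p) / ln q powr (1 + 2 * v))
         + real k powr (- (1 + p)) * of_bool (p < 0)"
    by (intro add_right_mono mult_right_mono mult_left_mono) auto
qed

text \<open>The tail exponent 2 * \<eta> itself is used, and p = 2 * \<eta> - 1 - d with d = 1 / (ln
  k + \<gamma>): then k powr d stays below e, while zeta (1 + d) grows like ln k. The lower bound
  exp (1 / (2 * \<eta>) - \<gamma>) on k says d <= 2 * \<eta>, and the indicator condition says p <
  0.\<close>

lemma part_3b:
  assumes \<eta>: "1/2 < \<eta>" and \<epsilon>: "0 < \<epsilon>" and q: "1 < q"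
    and k: "max (1 / ln q) (exp (1 / (2 * \<eta>) - euler_mascheroni)) \<le> real k"
  shows "1 \<le> k" and "prob {\<omega> \<in> space M. enat k \<le> exceed_sup W q \<eta> \<epsilon> \<omega>}
      \<le> real k powr (- (2 * \<eta>)) * zeta (1 + 1 / (ln (real k) + euler_mascheroni)) *
                 real k powr (1 / (ln (real k) + euler_mascheroni)) *
                 (bconst \<eta> \<epsilon> / ln q powr (1 + 2 * \<eta>)) *
                 (2 * \<eta> - 1 / (ln (real k) + euler_mascheroni)) *
                 (1 + 1 / (2 * \<eta>))
               + real k powr (- (2 * \<eta>)) *
                 of_bool (real k < exp (1 / (2 * \<eta> - 1) - euler_mascheroni))"
proof -
  have "0 < real k" using k by (intro less_le_trans[OF exp_gt_zero max.cobounded2[THEN order_trans]])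
  then show k1: "1 \<le> k" by simp
  define d where "d = 1 / (ln (real k) + euler_mascheroni)"
  have lk: "0 \<le> ln (real k)" using k1 by simp
  have lg: "0 < ln (real k) + euler_mascheroni" using lk euler_mascheroni_gt_19_over_33 by linarith
  have "ln (exp (1 / (2 * \<eta>) - euler_mascheroni)) \<le> ln (real k)"
    using k k1 by (subst ln_le_cancel_iff) auto
  then have "1 / (2 * \<eta>) \<le> ln (real k) + euler_mascheroni" by simp
  then have dz: "d \<le> 2 * \<eta>" unfolding d_def using lg \<eta> by (simp add: field_simps)
  have ind: "2 * \<eta> - 1 < d \<longleftrightarrow> real k < exp (1 / (2 * \<eta> - 1) - euler_mascheroni)"
  proof -
    have "2 * \<eta> - 1 < d \<longleftrightarrow> ln (real k) + euler_mascheroni < 1 / (2 * \<eta> - 1)"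
      unfolding d_def using lg \<eta> by (simp add: field_simps)
    also have "\<dots> \<longleftrightarrow> ln (real k) < ln (exp (1 / (2 * \<eta> - 1) - euler_mascheroni))"
      by (simp add: less_diff_eq)
    also have "\<dots> \<longleftrightarrow> real k < exp (1 / (2 * \<eta> - 1) - euler_mascheroni)"
      using k1 by (subst ln_less_cancel_iff) auto
    finally show ?thesis .
  qed
  define Q where "Q j = prob {\<omega> \<in> space M. enat j \<le> exceed_sup W q \<eta> \<epsilon> \<omega>}" for j :: nat
  define D where "D = bconst \<eta> \<epsilon> / ln q powr (1 + 2 * \<eta>) * ((1 + 2 * \<eta>) / (2 * \<eta>))"
  have D: "0 \<le> D" unfolding D_def using bconst_pos[of \<eta> \<epsilon>] \<eta> by simp
  have "Q k \<le> real k powr (- (2 * \<eta>)) * (zeta (1 + d) * real k powr d * D * (2 * \<eta> - d)) + real k powr (- (2 * \<eta>)) * of_bool (2 * \<eta> - 1 < d)"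
  proof (rule moment_tail_bound_optimized[OF _ _ _ _ D _ k1 d_def dz])
    show "Q j \<le> Q i" if "1 \<le> i" "i \<le> j" for i j unfolding Q_def by (rule exceed_sup_antimono[OF q that])
    show "Q j \<le> 1" "0 \<le> Q j" for j unfolding Q_def by simp_all
    show "Q j \<le> D * real j powr (- (2 * \<eta>))" if "1 \<le> j" for j
      using exceed_sup_tail[OF _ \<epsilon> q _ _ that, of \<eta> \<eta>] \<eta> unfolding Q_def D_def by simp
  qed (use \<eta> in simp)
  also have "zeta (1 + d) * real k powr d * D * (2 * \<eta> - d) = zeta (1 + d) * real k powr d * (bconst \<eta> \<epsilon> / ln q powr (1 + 2 * \<eta>)) * (2 * \<eta> - d) * (1 + 1 / (2 * \<eta>))"
  proof -
    have "(1 + 2 * \<eta>) / (2 * \<eta>) = 1 + 1 / (2 * \<eta>)" using \<eta> by (simp add: add_divide_distrib)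
    then show ?thesis unfolding D_def by (simp only: mult_ac)
  qed
  finally show "prob {\<omega> \<in> space M. enat k \<le> exceed_sup W q \<eta> \<epsilon> \<omega>}
      \<le> real k powr (- (2 * \<eta>)) * zeta (1 + 1 / (ln (real k) + euler_mascheroni)) *
                 real k powr (1 / (ln (real k) + euler_mascheroni)) *
                 (bconst \<eta> \<epsilon> / ln q powr (1 + 2 * \<eta>)) *
                 (2 * \<eta> - 1 / (ln (real k) + euler_mascheroni)) *
                 (1 + 1 / (2 * \<eta>))
               + real k powr (- (2 * \<eta>)) *
                 of_bool (real k < exp (1 / (2 * \<eta> - 1) - euler_mascheroni))"
    unfolding Q_def ind unfolding d_def by (simp only: mult.assoc)
qed

end

section \<open>Asymptotics of the bound in (3b)\<close>

text \<open>The simple pole of zeta at 1, from 1 / d <= zeta (1 + d) <= 1 + 1 / d.\<close>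

lemma zeta_times_tendsto: "((\<lambda>d. zeta (1 + d) * d) \<longlongrightarrow> 1) (at_right 0)"
proof (rule tendsto_sandwich)
  have pos: "eventually (\<lambda>d::real. 0 < d) (at_right 0)" by (simp add: eventually_at_right_less)
  show "eventually (\<lambda>d. 1 \<le> zeta (1 + d) * d) (at_right 0)"
    using pos by eventually_elim (use zeta_lower in \<open>simp add: field_simps\<close>)
  show "eventually (\<lambda>d. zeta (1 + d) * d \<le> 1 + d) (at_right 0)"
    using pos
  proof eventually_elim
    case (elim d)
    then have "zeta (1 + d) * d \<le> (1 + 1 / d) * d" by (intro mult_right_mono zeta_upper) auto
    also have "\<dots> = 1 + d" using elim by (simp add: distrib_right)
    finally show ?case .
  qed
  show "((\<lambda>d::real. 1 + d) \<longlongrightarrow> 1) (at_right 0)" by real_asymp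
qed simp

text \<open>With d = 1 / (ln k + g), zeta (1 + d) is asymptotic to ln k + g and so to ln k + 2 * g,
  k powr d tends to e, and 2 * \<eta> - d tends to 2 * \<eta>. The indicator vanishes for large
  k.\<close>

lemma part_3b_asymp:
  fixes \<eta> C g :: real
  assumes \<eta>: "1/2 < \<eta>" and C: "0 < C" and g: "0 < g"
  shows "(\<lambda>k::nat. real k powr (- (2 * \<eta>)) * zeta (1 + 1 / (ln (real k) + g)) * real k powr (1 / (ln (real k) + g)) * C *
                 (2 * \<eta> - 1 / (ln (real k) + g)) * (1 + 1 / (2 * \<eta>))
               + real k powr (- (2 * \<eta>)) * of_bool (real k < E))
     \<sim>[sequentially] (\<lambda>k. real k powr (- (2 * \<eta>)) * (2 * g + ln (real k)) * (exp 1 * C * (2 * \<eta> + 1)))"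
proof (rule asymp_equivI')
  define d where "d k = 1 / (ln (real k) + g)" for k :: nat
  have dlim: "filterlim d (at_right 0) sequentially"
    unfolding d_def using g by real_asymp
  have "(\<lambda>k. (zeta (1 + d k) * d k) * (real k powr d k / exp 1) * ((2 * \<eta> - d k) / (2 * \<eta>)) * ((ln (real k) + g) / (2 * g + ln (real k)))) \<longlonglongrightarrow> 1 * 1 * 1 * 1"
  proof (intro tendsto_mult)
    show "(\<lambda>k. zeta (1 + d k) * d k) \<longlonglongrightarrow> 1"
      using filterlim_compose[OF zeta_times_tendsto dlim] by simp
    have "(\<lambda>k. real k powr d k) \<longlonglongrightarrow> exp 1" unfolding d_def using g by real_asymp
    from tendsto_divide[OF this tendsto_const[of "exp 1"]] show "(\<lambda>k. real k powr d k / exp 1) \<longlonglongrightarrow> 1" by simp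
    show "(\<lambda>k. (ln (real k) + g) / (2 * g + ln (real k))) \<longlonglongrightarrow> 1" using g by real_asymp
    have "d \<longlonglongrightarrow> 0" using dlim filterlim_at by blast
    from tendsto_divide[OF tendsto_diff[OF tendsto_const[of "2 * \<eta>"] this] tendsto_const[of "2 * \<eta>"]]
    show "(\<lambda>k. (2 * \<eta> - d k) / (2 * \<eta>)) \<longlonglongrightarrow> 1" using \<eta> by simp
  qed
  then have lim: "(\<lambda>k. (zeta (1 + d k) * d k) * (real k powr d k / exp 1) * ((2 * \<eta> - d k) / (2 * \<eta>)) * ((ln (real k) + g) / (2 * g + ln (real k)))) \<longlonglongrightarrow> 1" by simp
  have ev: "eventually (\<lambda>k. E \<le> real k \<and> 1 \<le> k) sequentially"
    using filterlim_at_top[THEN iffD1, OF filterlim_real_sequentially, rule_format, of E] eventually_ge_at_top[of 1]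
    by eventually_elim auto
  show "(\<lambda>k. (real k powr (- (2 * \<eta>)) * zeta (1 + 1 / (ln (real k) + g)) * real k powr (1 / (ln (real k) + g)) * C *
                 (2 * \<eta> - 1 / (ln (real k) + g)) * (1 + 1 / (2 * \<eta>))
               + real k powr (- (2 * \<eta>)) * of_bool (real k < E)) /
       (real k powr (- (2 * \<eta>)) * (2 * g + ln (real k)) * (exp 1 * C * (2 * \<eta> + 1)))) \<longlonglongrightarrow> 1"
  proof (rule Lim_transform_eventually[OF lim])
    show "\<forall>\<^sub>F k in sequentially. (zeta (1 + d k) * d k) * (real k powr d k / exp 1) * ((2 * \<eta> - d k) / (2 * \<eta>)) * ((ln (real k) + g) / (2 * g + ln (real k))) =
      (real k powr (- (2 * \<eta>)) * zeta (1 + 1 / (ln (real k) + g)) * real k powr (1 / (ln (real k) + g)) * C *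
                 (2 * \<eta> - 1 / (ln (real k) + g)) * (1 + 1 / (2 * \<eta>))
               + real k powr (- (2 * \<eta>)) * of_bool (real k < E)) /
       (real k powr (- (2 * \<eta>)) * (2 * g + ln (real k)) * (exp 1 * C * (2 * \<eta> + 1)))"
      using ev
    proof eventually_elim
      case (elim k)
      have ob: "of_bool (real k < E) = (0::real)" using elim by simp
      have lg: "0 < ln (real k) + g" "0 < 2 * g + ln (real k)" using elim g by (auto intro: add_nonneg_pos add_pos_nonneg)
      have dd: "d k * (ln (real k) + g) = 1" unfolding d_def using lg by simp
      define x where "x = real k powr (- (2 * \<eta>))"
      define y where "y = real k powr d k"
      define zz where "zz = zeta (1 + d k)"
      have x: "0 < x" unfolding x_def using elim by simp
      have c: "1 + 1 / (2 * \<eta>) = (2 * \<eta> + 1) / (2 * \<eta>)" using \<eta> by (simp add: add_divide_distrib)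
      have "(zz * d k) * (y / exp 1) * ((2 * \<eta> - d k) / (2 * \<eta>)) * ((ln (real k) + g) / (2 * g + ln (real k)))
        = (d k * (ln (real k) + g)) * (zz * y * (2 * \<eta> - d k) / (exp 1 * (2 * \<eta>) * (2 * g + ln (real k))))"
        by simp
      also have "\<dots> = zz * y * (2 * \<eta> - d k) / (exp 1 * (2 * \<eta>) * (2 * g + ln (real k)))" unfolding dd by simp
      also have "\<dots> = (x * zz * y * C * (2 * \<eta> - d k) * ((2 * \<eta> + 1) / (2 * \<eta>)) + x * 0) / (x * (2 * g + ln (real k)) * (exp 1 * C * (2 * \<eta> + 1)))"
        using x C \<eta> lg by (simp add: divide_simps)
      finally show ?case unfolding ob c x_def y_def zz_def d_def[symmetric] .
    qed
  qed
qed

section \<open>Part (3c)\<close>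

text \<open>Up to the factor 2 the terms are bounded by differences of ln n powr (- \<theta>) /
  \<theta>, whose derivative is the negative of a comparable function. The factor 2 pays for 1 / n
  <= 2 / z with z < n + 1.\<close>

lemma summable_inverse_n_ln_powr:
  fixes \<theta> :: real
  assumes \<theta>: "0 < \<theta>"
  shows "summable (\<lambda>n. 1 / (real n * ln (real n + 1) powr (1 + \<theta>)))"
proof (rule summable_comparison_test')
  define F where "F n = 2 / \<theta> * ln (real n) powr (- \<theta>)" for n :: nat
  have "F \<longlonglongrightarrow> 0" unfolding F_def using \<theta> by real_asymp
  from telescope_summable'[OF this] show "summable (\<lambda>n. F n - F (Suc n))" .
  fix n :: nat assume n: "3 \<le> n"
  have "\<exists>z. real n < z \<and> z < real n + 1 \<and> ln (real n + 1) powr (- \<theta>) - ln (real n) powr (- \<theta>) = (real n + 1 - real n) * (- \<theta> * ln z powr (- \<theta> - 1) * (1 / z))"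
    using n by (intro MVT2) (auto intro!: derivative_eq_intros)
  then obtain z where z: "real n < z" "z < real n + 1" "ln (real n + 1) powr (- \<theta>) - ln (real n) powr (- \<theta>) = - \<theta> * ln z powr (- \<theta> - 1) * (1 / z)"
    by auto
  have lz: "0 < ln z" "ln z \<le> ln (real n + 1)" using z n by auto
  have "F n - F (Suc n) = - (2 / \<theta>) * (ln (real n + 1) powr (- \<theta>) - ln (real n) powr (- \<theta>))"
    unfolding F_def by (simp add: algebra_simps)
  also have "\<dots> = 2 * ln z powr (- \<theta> - 1) * (1 / z)" unfolding z(3) using \<theta> by simp
  finally have eq: "F n - F (Suc n) = 2 * ln z powr (- \<theta> - 1) * (1 / z)" .
  have "1 / (real n * ln (real n + 1) powr (1 + \<theta>)) = ln (real n + 1) powr (- \<theta> - 1) * (1 / real n)"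
  proof -
    have "- \<theta> - 1 = - (1 + \<theta>)" by simp
    then show ?thesis by (simp only: powr_minus_divide) simp
  qed
  also have "\<dots> \<le> ln z powr (- \<theta> - 1) * (2 * (1 / z))"
  proof (rule mult_mono)
    show "ln (real n + 1) powr (- \<theta> - 1) \<le> ln z powr (- \<theta> - 1)" using lz \<theta> by (intro powr_mono2') auto
    show "1 / real n \<le> 2 * (1 / z)" using z n by (simp add: field_simps)
  qed auto
  finally have "1 / (real n * ln (real n + 1) powr (1 + \<theta>)) \<le> F n - F (Suc n)" unfolding eq by (simp only: mult_ac)
  then show "norm (1 / (real n * ln (real n + 1) powr (1 + \<theta>))) \<le> F n - F (Suc n)" by simp
qed

lemma eps_denom_at_top:
  assumes "0 < v"
  shows "filterlim (eps_denom v \<theta> q) at_top sequentially"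
  unfolding eps_denom_def using assms by real_asymp

text \<open>For n >= 1 \<open>eps_denom\<close> is exactly a constant plus 2 * v times the logarithm
  on the right-hand side.\<close>

lemma eps_seq_bigtheta:
  assumes v: "0 < v" and \<eta>: "0 < \<eta>"
  shows "eps_seq \<eta> v \<theta> q \<in> \<Theta>[sequentially](\<lambda>n. ln (real n / ln (real n + 1) powr ((1 + \<theta>) / (2 * v))) powr (- (1/2)))"
proof (rule bigthetaI_tendsto)
  define A where "A = 4 + 8 * \<eta>"
  define c where "c = ln (ln q powr (1 + 2 * v) / (2 * exp 2))"
  define \<kappa> where "\<kappa> = (1 + \<theta>) / (2 * v)"
  define l where "l n = ln (real n / ln (real n + 1) powr \<kappa>)" for n :: nat
  have A: "0 < A" unfolding A_def using \<eta> by simp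
  have llim: "filterlim l at_top sequentially" unfolding l_def by real_asymp
  have "((\<lambda>x. sqrt (A / (c + 2 * v * x)) / x powr (- (1/2))) \<longlongrightarrow> (A * inverse v / 2) powr (1 / 2)) at_top"
    using A v by real_asymp
  moreover have "(A * inverse v / 2) powr (1 / 2) = sqrt (A / (2 * v))"
    using A v by (simp add: powr_half_sqrt inverse_eq_divide)
  ultimately have "((\<lambda>x. sqrt (A / (c + 2 * v * x)) / x powr (- (1/2))) \<longlongrightarrow> sqrt (A / (2 * v))) at_top"
    by (simp only:)
  from filterlim_compose[OF this llim]
  have lim: "(\<lambda>n. sqrt (A / (c + 2 * v * l n)) / l n powr (- (1/2))) \<longlonglongrightarrow> sqrt (A / (2 * v))" .
  show "(\<lambda>n. eps_seq \<eta> v \<theta> q n / ln (real n / ln (real n + 1) powr ((1 + \<theta>) / (2 * v))) powr (- (1/2))) \<longlonglongrightarrow> sqrt (A / (2 * v))"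
  proof (rule Lim_transform_eventually[OF lim])
    show "\<forall>\<^sub>F n in sequentially. sqrt (A / (c + 2 * v * l n)) / l n powr (- (1/2)) =
        eps_seq \<eta> v \<theta> q n / ln (real n / ln (real n + 1) powr ((1 + \<theta>) / (2 * v))) powr (- (1/2))"
      using eventually_ge_at_top[of 1]
    proof eventually_elim
      case (elim n)
      have ln0: "0 < ln (real n + 1)" using elim by simp
      have "ln (real n powr (2 * v) / ln (real n + 1) powr (1 + \<theta>)) = 2 * v * ln (real n) - (1 + \<theta>) * ln (ln (real n + 1))"
        using elim ln0 by (subst ln_div) (auto simp: ln_powr)
      also have "\<dots> = 2 * v * (ln (real n) - \<kappa> * ln (ln (real n + 1)))" unfolding \<kappa>_def using v by (simp add: field_simps)
      also have "ln (real n) - \<kappa> * ln (ln (real n + 1)) = l n"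
        unfolding l_def using elim ln0 by (subst ln_div) (auto simp: ln_powr)
      finally have "eps_denom v \<theta> q n = c + 2 * v * l n" unfolding eps_denom_def c_def by simp
      then show ?case unfolding eps_seq_def A_def l_def \<kappa>_def by simp
    qed
  qed
  show "sqrt (A / (2 * v)) \<noteq> 0" using A v by simp
qed

context brownian_motion
begin

definition eps_event :: "real \<Rightarrow> real \<Rightarrow> real \<Rightarrow> real \<Rightarrow> nat \<Rightarrow> 'a set" where
  "eps_event \<eta> v \<theta> q n = {\<omega> \<in> space M. exp 1 < q ^ n \<and> 0 < eps_denom v \<theta> q n \<and> eps_seq \<eta> v \<theta> q n < infdist (Z W (q ^ n) \<omega>) (K (1/2 + \<eta>))}"

lemma eps_event_measurable: "1 < q \<Longrightarrow> eps_event \<eta> v \<theta> q n \<in> events"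
  unfolding eps_event_def using infdist_Z_measurable[of "q ^ n" "K (1/2 + \<eta>)"] by measurable

text \<open>At \<epsilon> = \<open>eps_seq\<close> the exponential in \<open>bconst\<close> is exp
  of \<open>eps_denom\<close>. With the exponent lowered from \<eta> to v, the tail bound then
  equals the summand exactly.\<close>

lemma eps_event_prob_le:
  assumes q: "1 < q" and \<eta>: "0 < \<eta>" and v: "v \<le> \<eta>"
  shows "prob (eps_event \<eta> v \<theta> q n) \<le> 1 / (real n * ln (real n + 1) powr (1 + \<theta>))"
proof (cases "exp 1 < q ^ n \<and> 0 < eps_denom v \<theta> q n")
  case True
  note qn = q_power_ln[OF conjunct1[OF True] q]
  define d where "d = eps_denom v \<theta> q n"
  define e where "e = eps_seq \<eta> v \<theta> q n"
  have d: "0 < d" unfolding d_def using True by simp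
  have e2: "e\<^sup>2 = (4 + 8 * \<eta>) / d" and e: "0 < e"
    unfolding e_def eps_seq_def d_def[symmetric] using d \<eta> by simp_all
  have lq: "0 < ln q" using q by simp
  have lnn: "0 < ln (real n + 1)" using qn(1) by simp
  have "(4 + 8 * \<eta>) / e\<^sup>2 = d" unfolding e2 using d \<eta> by simp
  then have "bconst \<eta> e = 2 * exp 2 * exp d" unfolding bconst_def by simp
  also have "exp d = (ln q powr (1 + 2 * v) / (2 * exp 2)) * (real n powr (2 * v) / ln (real n + 1) powr (1 + \<theta>))"
    unfolding d_def eps_denom_def exp_add using qn(1) lq lnn by (subst (1 2) exp_ln) auto
  finally have b: "bconst \<eta> e = ln q powr (1 + 2 * v) * real n powr (2 * v) / ln (real n + 1) powr (1 + \<theta>)"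
    by simp
  have "prob (eps_event \<eta> v \<theta> q n) = prob {\<omega> \<in> space M. e < infdist (Z W (q ^ n) \<omega>) (K (1/2 + \<eta>))}"
    unfolding eps_event_def e_def using True by simp
  also have "\<dots> \<le> bconst \<eta> e / ln (q ^ n) powr (1 + 2 * \<eta>)"
    using Z_tail[OF conjunct1[OF True] \<eta> e] .
  also have "\<dots> \<le> bconst \<eta> e / ln (q ^ n) powr (1 + 2 * v)"
    using qn v bconst_pos[of \<eta> e] by (intro divide_left_mono powr_mono mult_pos_pos) auto
  also have "\<dots> = 1 / (real n * ln (real n + 1) powr (1 + \<theta>))"
  proof -
    have "ln (q ^ n) powr (1 + 2 * v) = real n * real n powr (2 * v) * ln q powr (1 + 2 * v)"
      unfolding qn(3) using qn(1) lq by (simp add: powr_mult powr_add)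
    then show ?thesis unfolding b using qn(1) lq lnn by simp
  qed
  finally show ?thesis .
next
  case False
  then have "eps_event \<eta> v \<theta> q n = {}" unfolding eps_event_def by auto
  then show ?thesis by simp
qed

lemma part_3c_limsup:
  assumes q: "1 < q" and \<eta>: "0 < \<eta>" and v: "0 < v" "v \<le> \<eta>" and \<theta>: "0 < \<theta>"
  shows "AE \<omega> in M. limsup (\<lambda>n. ereal (infdist (Z W (q ^ n) \<omega>) (K (1/2 + \<eta>)) * inverse (eps_seq \<eta> v \<theta> q n))) \<le> 1"
proof -
  have "AE \<omega> in M. eventually (\<lambda>n. \<omega> \<in> space M - eps_event \<eta> v \<theta> q n) sequentially"
  proof (rule borel_cantelli_AE1)
    show "eps_event \<eta> v \<theta> q n \<in> events" for n by (rule eps_event_measurable[OF q])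
    show "summable (\<lambda>n. prob (eps_event \<eta> v \<theta> q n))"
      by (rule summable_comparison_test'[OF summable_inverse_n_ln_powr[OF \<theta>], of 0])
        (use eps_event_prob_le[OF q \<eta> v(2)] in auto)
    show "emeasure M (eps_event \<eta> v \<theta> q n) < \<infinity>" for n by (simp add: emeasure_eq_measure)
  qed
  then show ?thesis
  proof eventually_elim
    case (elim \<omega>)
    have 1: "eventually (\<lambda>n. 0 < eps_denom v \<theta> q n) sequentially"
      using eps_denom_at_top[OF v(1)] unfolding filterlim_at_top_dense by blast
    have "filterlim (\<lambda>n. q ^ n) at_top sequentially" using q by real_asymp
    then have 2: "eventually (\<lambda>n. exp 1 < q ^ n) sequentially" unfolding filterlim_at_top_dense by blast
    show ?case
    proof (rule Limsup_bounded)
      show "\<forall>\<^sub>F n in sequentially. ereal (infdist (Z W (q ^ n) \<omega>) (K (1/2 + \<eta>)) * inverse (eps_seq \<eta> v \<theta> q n)) \<le> 1"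
        using 1 2 elim
      proof eventually_elim
        case (elim n)
        then have le: "infdist (Z W (q ^ n) \<omega>) (K (1/2 + \<eta>)) \<le> eps_seq \<eta> v \<theta> q n" unfolding eps_event_def by auto
        have "0 < eps_seq \<eta> v \<theta> q n" unfolding eps_seq_def using elim \<eta> by simp
        with le have "infdist (Z W (q ^ n) \<omega>) (K (1/2 + \<eta>)) * inverse (eps_seq \<eta> v \<theta> q n) \<le> 1"
          by (simp add: field_simps)
        then show ?case by (simp add: one_ereal_def)
      qed
    qed
  qed
qed

lemma part_3c_count:
  assumes q: "1 < q" and \<eta>: "0 < \<eta>" and v: "0 < v" "v \<le> \<eta>" and \<theta>: "0 < \<theta>" and k: "1 \<le> k"
  shows "prob {\<omega> \<in> space M. enat k \<le> ecard {n. exp 1 < q ^ n \<and> 0 < eps_denom v \<theta> q n \<and>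
                   eps_seq \<eta> v \<theta> q n < infdist (Z W (q ^ n) \<omega>) (K (1/2 + \<eta>))}}
    \<le> 1 / real k * (\<Sum>n. 1 / (real (Suc n) * ln (real (Suc n) + 1) powr (1 + \<theta>)))"
proof -
  let ?p = "\<lambda>n. 1 / (real n * ln (real n + 1) powr (1 + \<theta>))"
  have "{\<omega> \<in> space M. enat k \<le> ecard {n. exp 1 < q ^ n \<and> 0 < eps_denom v \<theta> q n \<and>
                   eps_seq \<eta> v \<theta> q n < infdist (Z W (q ^ n) \<omega>) (K (1/2 + \<eta>))}}
     = {\<omega> \<in> space M. enat k \<le> ecard {n. \<omega> \<in> eps_event \<eta> v \<theta> q n}}"
    unfolding eps_event_def by auto
  also have "prob \<dots> \<le> 1 / real k * (\<Sum>n. ?p n)"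
    by (rule prob_ecard_ge_le[OF eps_event_measurable[OF q] eps_event_prob_le[OF q \<eta> v(2)] summable_inverse_n_ln_powr[OF \<theta>] k])
  \<comment> \<open>The term at n = 0 is a division by 0 and hence 0.\<close>
  also have "(\<Sum>n. ?p n) = (\<Sum>n. ?p (Suc n))"
    using suminf_split_head[OF summable_inverse_n_ln_powr[OF \<theta>]] by simp
  finally show ?thesis .
qed

end

section \<open>The functional law of the iterated logarithm\<close>

lemma energy_scale: "energy n (\<lambda>t. c * w t) = c\<^sup>2 * energy n w"
  unfolding energy_def
  by (simp add: right_diff_distrib[symmetric] power_mult_distrib sum_distrib_left[symmetric] mult.left_commute)

lemma C0_scaleR: "w \<in> C0 \<Longrightarrow> c *\<^sub>R w \<in> C0"
  unfolding C0_def by (auto simp: scaleR_bcontfun.rep_eq)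

lemma K_scaleR:
  assumes "w \<in> K r" "0 \<le> r"
  shows "c *\<^sub>R w \<in> K (c\<^sup>2 * r)"
proof (rule energy_le_imp_K)
  show "c *\<^sub>R w \<in> C0" using assms K_subset_C0 by (intro C0_scaleR) auto
  show "energy n (apply_bcontfun (c *\<^sub>R w)) \<le> 2 * (c\<^sup>2 * r)" for n
  proof -
    have "apply_bcontfun (c *\<^sub>R w) = (\<lambda>t. c * apply_bcontfun w t)" by (auto simp: scaleR_bcontfun.rep_eq)
    then show ?thesis using mult_left_mono[OF K_imp_energy_le[OF assms, of n] zero_le_power2[of c]]
      by (simp add: energy_scale mult.left_commute)
  qed
qed (use assms in simp)

lemma zero_in_K: "0 \<le> r \<Longrightarrow> 0 \<in> K r"
  by (rule energy_le_imp_K) (auto simp: C0_def energy_def zero_bcontfun.rep_eq)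

lemma K_norm_le:
  assumes "w \<in> K r" "0 \<le> r"
  shows "norm w \<le> sqrt (2 * r)"
proof -
  have "dist w 0 \<le> sqrt (2 * r)"
  proof (rule dist_C0_le)
    show "w \<in> C0" "0 \<in> C0" using assms zero_in_K K_subset_C0 by auto
    fix t :: real assume t: "0 \<le> t" "t \<le> 1"
    have "apply_bcontfun w 0 = 0" using assms(1) K_subset_C0 unfolding C0_def by auto
    then have "\<bar>apply_bcontfun w t\<bar> \<le> sqrt (2 * r * (t - 0))"
      using K_Holder[OF assms _ t(1) t(2)] by simp
    also have "\<dots> \<le> sqrt (2 * r)" using t assms by (intro real_sqrt_le_mono) (simp add: mult_left_le)
    finally show "\<bar>apply_bcontfun w t - apply_bcontfun 0 t\<bar> \<le> sqrt (2 * r)" by (simp add: zero_bcontfun.rep_eq)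
  qed
  then show ?thesis by simp
qed

text \<open>Division by sqrt (1 + 2 * \<eta>) maps the larger set into the smaller one and moves its
  points by at most sqrt (1 + 2 * \<eta>) - 1 <= \<eta>.\<close>

lemma infdist_K_half_le:
  assumes \<eta>: "0 \<le> \<eta>"
  shows "infdist f (K (1/2)) \<le> infdist f (K (1/2 + \<eta>)) + \<eta>"
proof -
  define c where "c = sqrt (1 + 2 * \<eta>)"
  have c: "1 \<le> c" "c\<^sup>2 = 1 + 2 * \<eta>" unfolding c_def using \<eta> by simp_all
  have c1: "c - 1 \<le> \<eta>"
    using zero_le_power2[of "c - 1"] c(2) by (simp add: power2_diff)
  have ne: "K (1/2 + \<eta>) \<noteq> {}" using zero_in_K[of "1/2 + \<eta>"] \<eta> by auto
  have "infdist f (K (1/2)) - \<eta> \<le> dist f v" if v: "v \<in> K (1/2 + \<eta>)" for v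
  proof -
    have "(1 / c) *\<^sub>R v \<in> K ((1 / c)\<^sup>2 * (1/2 + \<eta>))" using v \<eta> by (intro K_scaleR) auto
    also have "(1 / c)\<^sup>2 * (1/2 + \<eta>) = 1/2" using c \<eta> by (simp add: power_divide field_simps)
    finally have "infdist f (K (1/2)) \<le> dist f ((1 / c) *\<^sub>R v)" by (rule infdist_le)
    also have "\<dots> \<le> dist f v + dist v ((1 / c) *\<^sub>R v)" by (rule dist_triangle)
    also have "dist v ((1 / c) *\<^sub>R v) = (1 - 1 / c) * norm v"
    proof -
      have "v - (1 / c) *\<^sub>R v = (1 - 1 / c) *\<^sub>R v" by (simp add: scaleR_diff_left)
      then show ?thesis using c by (simp add: dist_norm)
    qed
    also have "\<dots> \<le> (1 - 1 / c) * c"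
    proof (rule mult_left_mono)
      have "norm v \<le> sqrt (2 * (1/2 + \<eta>))" using v \<eta> by (intro K_norm_le) auto
      then show "norm v \<le> c" unfolding c_def by (simp add: distrib_left)
    qed (use c in simp)
    also have "\<dots> = c - 1" using c by (simp add: left_diff_distrib)
    finally show ?thesis using c1 by linarith
  qed
  then have "infdist f (K (1/2)) - \<eta> \<le> infdist f (K (1/2 + \<eta>))"
    unfolding infdist_notempty[OF ne] by (intro cINF_greatest ne)
  then show ?thesis by simp
qed

lemma infdist_lt_obtain:
  assumes "infdist x A < e" "A \<noteq> {}"
  obtains a where "a \<in> A" "dist x a < e"
proof -
  have "(INF a\<in>A. dist x a) < e" using assms by (simp add: infdist_notempty)
  then show ?thesis using assms that by (subst (asm) cINF_less_iff) auto
qed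

text \<open>Up to a time S the image is compact, after it the image is close to C. Finite nets of
  the two pieces combine to one of the whole; closed balls of half the radius carry it over to the
  closure.\<close>

lemma compact_closure_image_if_attracted:
  fixes f :: "real \<Rightarrow> 'b :: {complete_space}"
  assumes cont: "continuous_on {a..} f" and C: "compact C" "C \<noteq> {}"
    and lim: "((\<lambda>s. infdist (f s) C) \<longlongrightarrow> 0) at_top"
  shows "compact (closure (f ` {a..}))"
  unfolding compact_eq_totally_bounded
proof (intro conjI allI impI)
  fix e :: real assume e: "0 < e"
  have tb: "\<exists>k. finite k \<and> s \<subseteq> (\<Union>x\<in>k. ball x d)" if "compact s" "0 < d" for s :: "'b set" and d
    using that unfolding compact_eq_totally_bounded by blast
  have "eventually (\<lambda>s. infdist (f s) C < e / 4) at_top"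
    using e by (intro order_tendstoD(2)[OF lim]) auto
  then obtain S where S: "\<And>s. S \<le> s \<Longrightarrow> infdist (f s) C < e / 4"
    unfolding eventually_at_top_linorder by blast
  have "compact (f ` {a..S})"
    by (intro compact_continuous_image continuous_on_subset[OF cont]) auto
  from tb[OF this half_gt_zero[OF e]]
  obtain k1 where k1: "finite k1" "f ` {a..S} \<subseteq> (\<Union>x\<in>k1. ball x (e / 2))" by blast
  obtain k2 where k2: "finite k2" "C \<subseteq> (\<Union>x\<in>k2. ball x (e / 4))" using tb[OF C(1), of "e / 4"] e by auto
  have "f ` {a..} \<subseteq> (\<Union>x\<in>k1 \<union> k2. cball x (e / 2))"
  proof (rule image_subsetI)
    fix s assume s: "s \<in> {a..}"
    show "f s \<in> (\<Union>x\<in>k1 \<union> k2. cball x (e / 2))"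
    proof (cases "s \<le> S")
      case True
      then have "f s \<in> f ` {a..S}" using s by simp
      then have "f s \<in> (\<Union>x\<in>k1. ball x (e / 2))" using k1(2) by blast
      then obtain x where x: "x \<in> k1" "dist x (f s) < e / 2" by auto
      then have "dist x (f s) \<le> e / 2" by linarith
      then show ?thesis using x(1) by auto
    next
      case False
      then have "infdist (f s) C < e / 4" using S by simp
      then obtain v where v: "v \<in> C" "dist (f s) v < e / 4" using C(2) by (rule infdist_lt_obtain)
      then obtain x where x: "x \<in> k2" "dist x v < e / 4" using k2(2) by auto
      have "dist x (f s) \<le> dist x v + dist (f s) v" by (rule dist_triangle2)
      then have "dist x (f s) \<le> e / 2" using v x by linarith
      then show ?thesis using x by auto
    qed
  qed
  moreover have "closed (\<Union>x\<in>k1 \<union> k2. cball x (e / 2))" using k1 k2 by (intro closed_UN) auto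
  ultimately have "closure (f ` {a..}) \<subseteq> (\<Union>x\<in>k1 \<union> k2. cball x (e / 2))" by (rule closure_minimal)
  also have "\<dots> \<subseteq> (\<Union>x\<in>k1 \<union> k2. ball x e)" using e by (intro UN_mono) auto
  finally show "\<exists>k. finite k \<and> closure (f ` {a..}) \<subseteq> (\<Union>x\<in>k. ball x e)"
    using k1 k2 by (intro exI[of _ "k1 \<union> k2"]) auto
qed (simp add: complete_eq_closed)

lemma lnln_pos:
  fixes s :: real
  assumes "exp 1 < s"
  shows "0 < s" "1 < ln s" "0 < ln (ln s)"
proof -
  show s: "0 < s" using assms by (rule less_trans[OF exp_gt_zero])
  have "ln (exp 1) < ln s" using s assms by (subst ln_less_cancel_iff) auto
  then show "1 < ln s" by simp
  then show "0 < ln (ln s)" by simp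
qed

context brownian_motion
begin

text \<open>Without the norming factor the path is t -> W (s * t). Uniform continuity of W on a
  compact interval controls its dependence on s uniformly in t.\<close>

lemma Z_continuous:
  assumes \<omega>: "\<omega> \<in> space M" and a: "exp 1 < a"
  shows "continuous_on {a..} (\<lambda>s. Z W s \<omega>)"
proof -
  define c where "c s = sqrt (2 * s * ln (ln s))" for s :: real
  define Y where "Y s = c s *\<^sub>R Z W s \<omega>" for s
  have cpos: "0 < c s" if "a \<le> s" for s
    unfolding c_def using lnln_pos[of s] a that by simp
  have Yap: "apply_bcontfun (Y s) t = W (s * t) \<omega>" if "a \<le> s" "0 \<le> t" "t \<le> 1" for s t
  proof -
    have "exp 1 < s" using a that by simp
    from lnln_pos[OF this] that show ?thesis
      unfolding Y_def c_def by (simp add: scaleR_bcontfun.rep_eq apply_Z(1)[OF \<omega>])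
  qed
  have YC0: "Y s \<in> C0" if "a \<le> s" for s
    unfolding Y_def using lnln_pos(1)[of s] a that by (intro C0_scaleR apply_Z(2)[OF \<omega>]) auto
  have "continuous_on {a..} Y"
    unfolding continuous_on_iff
  proof (intro ballI allI impI)
    fix s e :: real assume s: "s \<in> {a..}" and e: "0 < e"
    have "continuous_on {0..s + 1} (\<lambda>t. W t \<omega>)"
      by (rule continuous_on_subset[OF continuous_W[OF \<omega>]]) auto
    then have "uniformly_continuous_on {0..s + 1} (\<lambda>t. W t \<omega>)" by (rule compact_uniformly_continuous) simp
    then have "\<exists>d>0. \<forall>x\<in>{0..s + 1}. \<forall>x'\<in>{0..s + 1}. dist x' x < d \<longrightarrow> dist (W x' \<omega>) (W x \<omega>) < e / 2"
      unfolding uniformly_continuous_on_def using half_gt_zero[OF e] by (elim allE[of _ "e / 2"] impE)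
    then obtain d where d: "0 < d" "\<forall>x\<in>{0..s + 1}. \<forall>x'\<in>{0..s + 1}. dist x' x < d \<longrightarrow> dist (W x' \<omega>) (W x \<omega>) < e / 2"
      by (elim exE conjE)
    have s0: "0 < s" using s lnln_pos(1)[OF a] by simp
    show "\<exists>d>0. \<forall>s'\<in>{a..}. dist s' s < d \<longrightarrow> dist (Y s') (Y s) < e"
    proof (intro exI[of _ "min d 1"] conjI ballI impI)
      fix s' assume s': "s' \<in> {a..}" "dist s' s < min d 1"
      have s'0: "0 < s'" using s' lnln_pos(1)[OF a] by simp
      have "dist (Y s') (Y s) \<le> e / 2"
      proof (rule dist_C0_le)
        show "Y s' \<in> C0" "Y s \<in> C0" using YC0 s s' by auto
        fix t :: real assume t: "0 \<le> t" "t \<le> 1"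
        have ds: "\<bar>s' - s\<bar> < d" "s' \<le> s + 1" using s'(2) by (auto simp: dist_real_def)
        have "s' * t \<le> s' * 1" "s * t \<le> s * 1" using t s0 s'0 by (intro mult_left_mono; simp)+
        then have 1: "s' * t \<in> {0..s + 1}" "s * t \<in> {0..s + 1}"
        proof -
          have "0 \<le> s' * t" "0 \<le> s * t" using t s0 s'0 by simp_all
          moreover have "s' * t \<le> s + 1" "s * t \<le> s + 1"
            using \<open>s' * t \<le> s' * 1\<close> \<open>s * t \<le> s * 1\<close> ds by linarith+
          ultimately show "s' * t \<in> {0..s + 1}" "s * t \<in> {0..s + 1}" by simp_all
        qed
        have "\<bar>s' * t - s * t\<bar> = \<bar>s' - s\<bar> * t" using t by (simp add: left_diff_distrib[symmetric] abs_mult)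
        also have "\<dots> \<le> \<bar>s' - s\<bar> * 1" using t by (intro mult_left_mono) auto
        finally have "dist (s' * t) (s * t) < d" using ds by (simp add: dist_real_def)
        with d(2) 1 have "dist (W (s' * t) \<omega>) (W (s * t) \<omega>) < e / 2" by blast
        then show "\<bar>apply_bcontfun (Y s') t - apply_bcontfun (Y s) t\<bar> \<le> e / 2"
          using Yap[of s' t] Yap[of s t] s s' t by (simp add: dist_real_def)
      qed
      then show "dist (Y s') (Y s) < e" using e by simp
    qed (use d in simp)
  qed
  moreover have "continuous_on {a..} (\<lambda>s. 1 / c s)"
    unfolding c_def
  proof (intro continuous_on_divide continuous_on_const continuous_on_real_sqrt continuous_on_mult continuous_on_id continuous_on_ln ballI)
    fix s assume s: "s \<in> {a..}"
    then have "exp 1 < s" using a by simp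
    from lnln_pos[OF this] show "s \<noteq> 0" "ln s \<noteq> 0" "sqrt (2 * s * ln (ln s)) \<noteq> 0" by auto
  qed
  ultimately have "continuous_on {a..} (\<lambda>s. (1 / c s) *\<^sub>R Y s)" by (intro continuous_on_scaleR)
  then show ?thesis
  proof (rule continuous_on_cong[THEN iffD1, rotated -1])
    fix s assume "s \<in> {a..}"
    then show "(1 / c s) *\<^sub>R Y s = Z W s \<omega>" unfolding Y_def using cpos[of s] by simp
  qed simp
qed

section \<open>Attraction by K (1/2)\<close>

text \<open>Along q^n the tail bounds are summable for every \<eta> > 0. The choice \<eta> =
  \<epsilon> = 1 / (i + 1) needs countably many null sets and brings both parameters to 0.\<close>

lemma Z_geometric_attracted:
  assumes q: "1 < q"
  shows "AE \<omega> in M. (\<lambda>n. infdist (Z W (q ^ n) \<omega>) (K (1/2))) \<longlonglongrightarrow> 0"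
proof -
  define x where "x i = 1 / real (Suc i)" for i
  have x: "0 < x i" for i unfolding x_def by simp
  have "AE \<omega> in M. \<forall>i. eventually (\<lambda>n. \<omega> \<in> space M - exceed_event q (x i) (x i) n) sequentially"
    unfolding AE_all_countable
  proof
    fix i
    show "AE \<omega> in M. eventually (\<lambda>n. \<omega> \<in> space M - exceed_event q (x i) (x i) n) sequentially"
    proof (rule borel_cantelli_AE1)
      show "exceed_event q (x i) (x i) n \<in> events" for n by (rule exceed_event_measurable[OF q])
      show "summable (\<lambda>n. prob (exceed_event q (x i) (x i) n))"
        by (rule summable_comparison_test'[OF summable_const_powr[of "1 + 2 * x i" "bconst (x i) (x i) / ln q powr (1 + 2 * x i)"], of 0])
          (use exceed_event_prob_le[OF q x x order_refl] x in auto)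
      show "emeasure M (exceed_event q (x i) (x i) n) < \<infinity>" for n by (simp add: emeasure_eq_measure)
    qed
  qed
  then show ?thesis
  proof eventually_elim
    case (elim \<omega>)
    show ?case
    proof (rule LIMSEQ_I)
      fix e :: real assume e: "0 < e"
      obtain i where i: "inverse (real (Suc i)) < e / 2" using reals_Archimedean[of "e / 2"] e by auto
      have "filterlim (\<lambda>n. q ^ n) at_top sequentially" using q by real_asymp
      then have "eventually (\<lambda>n. exp 1 < q ^ n) sequentially" unfolding filterlim_at_top_dense by blast
      moreover have "eventually (\<lambda>n. \<omega> \<in> space M - exceed_event q (x i) (x i) n) sequentially" using elim by blast
      ultimately have "eventually (\<lambda>n. norm (infdist (Z W (q ^ n) \<omega>) (K (1/2)) - 0) < e) sequentially"
      proof eventually_elim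
        case (elim n)
        then have "infdist (Z W (q ^ n) \<omega>) (K (1/2 + x i)) \<le> x i" unfolding exceed_event_def by auto
        then have "infdist (Z W (q ^ n) \<omega>) (K (1/2)) \<le> x i + x i"
          using infdist_K_half_le[of "x i" "Z W (q ^ n) \<omega>"] x[of i] by linarith
        also have "\<dots> < e" using i unfolding x_def by (simp add: inverse_eq_divide)
        finally show ?case by (simp add: infdist_nonneg)
      qed
      then show "\<exists>N. \<forall>n\<ge>N. norm (infdist (Z W (q ^ n) \<omega>) (K (1/2)) - 0) < e"
        unfolding eventually_sequentially .
    qed
  qed
qed

text \<open>Brownian scaling expresses \<open>Z W s\<close> through \<open>Z W S\<close> for a slightly larger \<open>S\<close>.\<close>

lemma infdist_Z_interpolate:
  assumes \<omega>: "\<omega> \<in> space M" and q: "1 < q" and s: "exp 1 < s" "s \<le> S" "S \<le> q * s"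
    and ratio: "ln (ln S) \<le> q * ln (ln s)" and e: "infdist (Z W S \<omega>) (K (1/2)) < e"
  shows "infdist (Z W s \<omega>) (K (1/2)) \<le> (q - 1) * (1 + e) + e + sqrt (q - 1)"
proof -
  have ne: "K (1/2) \<noteq> {}" using zero_in_K[of "1/2"] by auto
  obtain v where v: "v \<in> K (1/2)" "dist (Z W S \<omega>) v < e" using infdist_lt_obtain[OF e ne] .
  note ps = lnln_pos[OF s(1)]
  have S: "exp 1 < S" using s by simp
  note pS = lnln_pos[OF S]
  define \<rho> where "\<rho> = sqrt (2 * S * ln (ln S)) / sqrt (2 * s * ln (ln s))"
  have mono: "2 * s * ln (ln s) \<le> 2 * S * ln (ln S)"
  proof (rule mult_mono)
    have "ln s \<le> ln S" using s(2) ps pS by (subst ln_le_cancel_iff)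
    then show "ln (ln s) \<le> ln (ln S)" using ps pS by (subst ln_le_cancel_iff) linarith+
  qed (use s ps pS in auto)
  have \<rho>1: "1 \<le> \<rho>" unfolding \<rho>_def using mono ps by simp
  have "2 * S * ln (ln S) \<le> (2 * (q * s)) * (q * ln (ln s))"
    using s ratio ps pS q by (intro mult_mono) auto
  then have "sqrt (2 * S * ln (ln S)) \<le> sqrt (q\<^sup>2 * (2 * s * ln (ln s)))"
    by (intro real_sqrt_le_mono) (simp add: power2_eq_square mult_ac)
  also have "\<dots> = q * sqrt (2 * s * ln (ln s))" using q by (simp add: real_sqrt_mult)
  finally have \<rho>q: "\<rho> \<le> q" unfolding \<rho>_def using ps by (simp add: divide_le_eq)
  have "dist (Z W s \<omega>) v \<le> (q - 1) * (1 + e) + e + sqrt (q - 1)"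
  proof (rule dist_C0_le)
    show "Z W s \<omega> \<in> C0" using apply_Z(2)[OF \<omega>] ps by simp
    show "v \<in> C0" using v K_subset_C0 by auto
    fix t :: real assume t: "0 \<le> t" "t \<le> 1"
    define c where "c = s / S"
    have c: "0 < c" "c \<le> 1" "S * c = s" unfolding c_def using ps s S pS by simp_all
    have ct: "0 \<le> c * t" "c * t \<le> 1" "c * t \<le> t" using c t by (simp_all add: mult_le_one mult_left_le_one_le)
    have Zs: "apply_bcontfun (Z W s \<omega>) t = \<rho> * apply_bcontfun (Z W S \<omega>) (c * t)"
    proof -
      have "apply_bcontfun (Z W s \<omega>) t = W (s * t) \<omega> / sqrt (2 * s * ln (ln s))"
        using t ps by (simp add: apply_Z(1)[OF \<omega>])
      moreover have "apply_bcontfun (Z W S \<omega>) (c * t) = W (s * t) \<omega> / sqrt (2 * S * ln (ln S))"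
        using ct pS c(3) by (simp add: apply_Z(1)[OF \<omega>] mult.assoc[symmetric])
      ultimately show ?thesis unfolding \<rho>_def using pS by simp
    qed
    define z where "z = apply_bcontfun (Z W S \<omega>) (c * t)"
    define y where "y = apply_bcontfun v (c * t)"
    define y' where "y' = apply_bcontfun v t"
    have zy: "\<bar>z - y\<bar> \<le> e"
      using dist_bounded[of "Z W S \<omega>" "c * t" v] v(2) unfolding z_def y_def by (simp add: dist_real_def)
    have "norm v \<le> 1" using K_norm_le[OF v(1)] by simp
    then have y1: "\<bar>y\<bar> \<le> 1" using norm_bounded[of v "c * t"] unfolding y_def by simp
    have yy: "\<bar>y' - y\<bar> \<le> sqrt (q - 1)"
    proof -
      have "\<bar>y' - y\<bar> \<le> sqrt (2 * (1/2) * (t - c * t))"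
        unfolding y_def y'_def using v ct t by (intro K_Holder) auto
      also have "\<dots> \<le> sqrt (q - 1)"
      proof (rule real_sqrt_le_mono)
        have "1 \<le> q * c" using s(3) pS unfolding c_def by (simp add: field_simps)
        then have "1 - c \<le> (q - 1) * c" by (simp add: left_diff_distrib)
        also have "\<dots> \<le> (q - 1) * 1" using c q by (intro mult_left_mono) auto
        finally have "1 - c \<le> q - 1" by simp
        then have "(1 - c) * t \<le> (q - 1) * 1" using t c q by (intro mult_mono) auto
        then show "2 * (1/2) * (t - c * t) \<le> q - 1" by (simp add: left_diff_distrib)
      qed
      finally show ?thesis .
    qed
    have "\<bar>(\<rho> - 1) * z\<bar> \<le> (q - 1) * (1 + e)"
      unfolding abs_mult using \<rho>1 \<rho>q zy y1 by (intro mult_mono) auto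
    \<comment> \<open>The three summands are the change of the norming factor, the distance of
      \<open>Z W S \<omega>\<close> from v, and the change of time, which v tolerates by its Hoelder
      bound.\<close>
    moreover have "\<rho> * z - y' = (\<rho> - 1) * z + (z - y) - (y' - y)" by (simp add: algebra_simps)
    ultimately have "\<bar>\<rho> * z - y'\<bar> \<le> (q - 1) * (1 + e) + e + sqrt (q - 1)" using zy yy by linarith
    then show "\<bar>apply_bcontfun (Z W s \<omega>) t - apply_bcontfun v t\<bar> \<le> (q - 1) * (1 + e) + e + sqrt (q - 1)"
      unfolding Zs z_def y'_def .
  qed
  with infdist_le[OF v(1), of "Z W s \<omega>"] show ?thesis by linarith
qed

lemma geometric_cell:
  fixes q s :: real
  assumes "1 < q" "1 \<le> s"
  obtains n where "q ^ n \<le> s" "s \<le> q ^ Suc n"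
proof -
  define n where "n = nat \<lfloor>ln s / ln q\<rfloor>"
  have lq: "0 < ln q" using assms by simp
  have "0 \<le> ln s / ln q" using assms lq by simp
  then have "real n \<le> ln s / ln q" "ln s / ln q < real n + 1" unfolding n_def by (auto simp: of_nat_nat)
  then have "real n * ln q \<le> ln s" "ln s \<le> real (Suc n) * ln q" using lq by (simp_all add: field_simps)
  then have "ln (q ^ n) \<le> ln s" "ln s \<le> ln (q ^ Suc n)" using assms by (simp_all only: ln_realpow)
  moreover have "0 < q ^ n" "0 < q ^ Suc n" "0 < s" using assms by simp_all
  ultimately show ?thesis using that by (simp only: ln_le_cancel_iff)
qed

text \<open>For s in [p^n, p^(n + 1)] the later grid point serves as S. The ratio of the iterated
  logarithms tends to 1 and is eventually below p; as p runs through the \<open>q i\<close>, which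
  decrease to 1, the interpolation error vanishes.\<close>

lemma Z_attracted: "AE \<omega> in M. ((\<lambda>s. infdist (Z W s \<omega>) (K (1/2))) \<longlongrightarrow> 0) at_top"
proof -
  define q where "q i = 1 + 1 / real (Suc i)" for i :: nat
  have q: "1 < q i" for i unfolding q_def by simp
  have qlim: "(\<lambda>i. (q i - 1) * (1 + (q i - 1)) + (q i - 1) + sqrt (q i - 1)) \<longlonglongrightarrow> 0"
    unfolding q_def by real_asymp
  have "AE \<omega> in M. \<forall>i. (\<lambda>n. infdist (Z W (q i ^ n) \<omega>) (K (1/2))) \<longlonglongrightarrow> 0"
    unfolding AE_all_countable using Z_geometric_attracted[OF q] by blast
  moreover have "AE \<omega> in M. \<omega> \<in> space M" by (rule AE_space)
  ultimately show ?thesis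
  proof eventually_elim
    case (elim \<omega>)
    show ?case
    proof (rule tendstoI)
      fix e :: real assume "0 < e"
      from order_tendstoD(2)[OF qlim this] obtain i where i: "(q i - 1) * (1 + (q i - 1)) + (q i - 1) + sqrt (q i - 1) < e"
        unfolding eventually_sequentially by blast
      define p where "p = q i"
      have p: "1 < p" unfolding p_def by (rule q)
      have "filterlim (\<lambda>n. p ^ n) at_top sequentially" using p by real_asymp
      then have 1: "eventually (\<lambda>n. exp 1 < p ^ n) sequentially" unfolding filterlim_at_top_dense by blast
      have "(\<lambda>n. infdist (Z W (p ^ n) \<omega>) (K (1/2))) \<longlonglongrightarrow> 0" unfolding p_def using elim by blast
      then have "(\<lambda>n. infdist (Z W (p ^ Suc n) \<omega>) (K (1/2))) \<longlonglongrightarrow> 0" by (rule LIMSEQ_Suc)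
      then have 2: "eventually (\<lambda>n. infdist (Z W (p ^ Suc n) \<omega>) (K (1/2)) < p - 1) sequentially"
        using p by (intro order_tendstoD(2)) auto
      have lp: "0 < ln p" using p by simp
      have "(\<lambda>n. ln ((real n + 1) * ln p) / ln (real n * ln p)) \<longlonglongrightarrow> 1" using lp by real_asymp
      then have 3: "eventually (\<lambda>n. ln ((real n + 1) * ln p) / ln (real n * ln p) < p) sequentially"
        using p by (intro order_tendstoD(2))
      from eventually_conj[OF 1 eventually_conj[OF 2 3]] obtain N where N: "\<And>n. N \<le> n \<Longrightarrow> exp 1 < p ^ n \<and>
          infdist (Z W (p ^ Suc n) \<omega>) (K (1/2)) < p - 1 \<and> ln ((real n + 1) * ln p) / ln (real n * ln p) < p"
        unfolding eventually_sequentially by blast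
      have "dist (infdist (Z W s \<omega>) (K (1/2))) 0 < e" if s: "p ^ Suc N \<le> s" for s
      proof -
        have "1 \<le> p ^ Suc N" using p by (intro one_le_power) simp
        then have "1 \<le> s" using s by simp
        then obtain n where n: "p ^ n \<le> s" "s \<le> p ^ Suc n" using geometric_cell[OF p] by blast
        have "N \<le> n"
        proof (rule ccontr)
          assume "\<not> N \<le> n"
          then have "p ^ Suc n < p ^ Suc N" using p by (intro power_strict_increasing) auto
          then show False using n s by linarith
        qed
        note Nn = N[OF this]
        have es: "exp 1 < s" using Nn n by linarith
        note ps = lnln_pos[OF es]
        note pn = lnln_pos[OF conjunct1[OF Nn]]
        have "infdist (Z W s \<omega>) (K (1/2)) \<le> (p - 1) * (1 + (p - 1)) + (p - 1) + sqrt (p - 1)"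
        proof (rule infdist_Z_interpolate[OF elim(2) p es n(2)])
          show "p ^ Suc n \<le> p * s" using n(1) p by simp
          show "infdist (Z W (p ^ Suc n) \<omega>) (K (1/2)) < p - 1" using Nn by blast
          have l1: "ln (p ^ n) = real n * ln p" "ln (p ^ Suc n) = (real n + 1) * ln p"
            using p by (simp_all add: ln_realpow ln_mult algebra_simps)
          have "ln (ln (p ^ Suc n)) / ln (ln (p ^ n)) < p" unfolding l1 using Nn by blast
          then have "ln (ln (p ^ Suc n)) \<le> p * ln (ln (p ^ n))" using pn by (simp add: divide_less_eq)
          also have "\<dots> \<le> p * ln (ln s)"
          proof (rule mult_left_mono)
            have "ln (p ^ n) \<le> ln s" using n(1) pn(1) ps(1) by (subst ln_le_cancel_iff)
            then show "ln (ln (p ^ n)) \<le> ln (ln s)" using pn(2) ps(2) by (subst ln_le_cancel_iff) linarith+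
          qed (use p in simp)
          finally show "ln (ln (p ^ Suc n)) \<le> p * ln (ln s)" .
        qed
        then show ?thesis using i unfolding p_def by (simp add: infdist_nonneg)
      qed
      then show "eventually (\<lambda>s. dist (infdist (Z W s \<omega>) (K (1/2))) 0 < e) at_top"
        unfolding eventually_at_top_linorder by blast
    qed
  qed
qed

lemma Z_relatively_compact:
  assumes "\<omega> \<in> space M" "((\<lambda>s. infdist (Z W s \<omega>) (K (1/2))) \<longlongrightarrow> 0) at_top" "exp 1 < a"
  shows "compact (closure {Z W s \<omega> | s. a \<le> s})"
proof -
  have "{Z W s \<omega> | s. a \<le> s} = (\<lambda>s. Z W s \<omega>) ` {a..}" by auto
  moreover have "K (1/2) \<noteq> {}" using zero_in_K[of "1/2"] by auto
  ultimately show ?thesis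
    using compact_closure_image_if_attracted[OF Z_continuous[OF assms(1,3)] compact_K[of "1/2"] _ assms(2)] by simp
qed

end

section \<open>The second Borel-Cantelli lemma and independent blocks\<close>

context prob_space
begin

text \<open>None of G a, ..., G b occurs with probability the product of 1 - prob (G n) <= exp (-
  prob (G n)), which tends to 0 as b grows because the series diverges.\<close>

lemma AE_infinitely_often_if_indep_events:
  assumes ind: "indep_events G UNIV" and ns: "\<not> summable (\<lambda>n :: nat. prob (G n))"
  shows "AE \<omega> in M. \<forall>a. \<exists>n\<ge>a. \<omega> \<in> G n"
  unfolding AE_all_countable
proof
  fix a
  have ev: "G n \<in> events" for n using ind unfolding indep_events_def by auto
  define H where "H n = space M - G n" for n
  have evH: "H n \<in> events" for n unfolding H_def using ev by simp
  have "indep_sets (\<lambda>n. {G n}) UNIV" using ind unfolding indep_events_def_alt .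
  then have "indep_sets (\<lambda>n. sigma_sets (space M) {G n}) UNIV"
    by (rule indep_sets_sigma) (simp add: Int_stable_def)
  then have prod: "prob (\<Inter>n\<in>J. H n) = (\<Prod>n\<in>J. prob (H n))" if "J \<noteq> {}" "finite J" for J
  proof (rule indep_setsD)
    show "\<forall>n\<in>J. H n \<in> sigma_sets (space M) {G n}"
      unfolding H_def by (intro ballI sigma_sets.Compl sigma_sets.Basic) simp
  qed (use that in auto)
  define N where "N = (\<Inter>n\<in>{a..}. H n)"
  have N: "N \<in> events" unfolding N_def using evH by (intro sets.countable_INT') auto
  have le: "prob N \<le> exp (- (\<Sum>n=a..b. prob (G n)))" if "a \<le> b" for b
  proof -
    have "prob N \<le> prob (\<Inter>n\<in>{a..b}. H n)"
      unfolding N_def using evH that by (intro finite_measure_mono INF_superset_mono sets.finite_INT) auto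
    also have "\<dots> = (\<Prod>n=a..b. prob (H n))" using that by (intro prod) auto
    also have "\<dots> \<le> (\<Prod>n=a..b. exp (- prob (G n)))"
    proof (rule prod_mono)
      fix n
      have "prob (H n) = 1 - prob (G n)" unfolding H_def by (rule prob_compl[OF ev])
      then show "0 \<le> prob (H n) \<and> prob (H n) \<le> exp (- prob (G n))"
        using exp_ge_add_one_self[of "- prob (G n)"] by simp
    qed
    also have "\<dots> = exp (- (\<Sum>n=a..b. prob (G n)))" by (simp add: exp_sum sum_negf[symmetric])
    finally show ?thesis .
  qed
  have "prob N = 0"
  proof (rule ccontr)
    assume "prob N \<noteq> 0"
    then have pos: "0 < prob N" by (simp add: zero_less_measure_iff)
    have bound: "(\<Sum>n=a..b. prob (G n)) \<le> - ln (prob N)" if "a \<le> b" for b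
    proof -
      have "ln (prob N) \<le> ln (exp (- (\<Sum>n=a..b. prob (G n))))"
        using pos le[OF that] by (subst ln_le_cancel_iff) auto
      then show ?thesis by simp
    qed
    have "summable (\<lambda>n. prob (G (n + a)))"
    proof (rule summableI_nonneg_bounded)
      fix b
      have "(\<Sum>n<b. prob (G (n + a))) \<le> (\<Sum>n<Suc b. prob (G (n + a)))" by simp
      also have "\<dots> = (\<Sum>n=a..b + a. prob (G n))"
        by (rule sum.reindex_bij_witness[of _ "\<lambda>n. n - a" "\<lambda>n. n + a"]) auto
      also have "\<dots> \<le> - ln (prob N)" by (rule bound) simp
      finally show "(\<Sum>n<b. prob (G (n + a))) \<le> - ln (prob N)" .
    qed simp
    then show False using ns summable_iff_shift[of "\<lambda>n. prob (G n)" a] by blast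
  qed
  then have "AE \<omega> in M. \<omega> \<notin> N" using N by (simp add: prob_eq_0)
  moreover have "AE \<omega> in M. \<omega> \<in> space M" by (rule AE_space)
  ultimately show "AE \<omega> in M. \<exists>n\<ge>a. \<omega> \<in> G n"
  proof eventually_elim
    case (elim \<omega>)
    then show ?case unfolding N_def H_def by auto
  qed
qed

text \<open>The probabilities of one block and of several disjoint blocks are products over the
  indices involved, so independence of the block events is a regrouping of products.\<close>

lemma block_events:
  fixes X :: "nat \<Rightarrow> 'a \<Rightarrow> real"
  assumes ind: "\<And>N. indep_vars (\<lambda>_. borel) X {..<N}" and A: "\<And>j. A j \<in> sets borel"
    and I: "\<And>n :: nat. finite (I n)" "\<And>n. I n \<noteq> {}" "disjoint_family I"
  shows indep_events_blocks: "indep_events (\<lambda>n. {\<omega> \<in> space M. \<forall>j\<in>I n. X j \<omega> \<in> A j}) UNIV"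
    and prob_block: "prob {\<omega> \<in> space M. \<forall>j\<in>I n. X j \<omega> \<in> A j} = (\<Prod>j\<in>I n. prob (X j -` A j \<inter> space M))"
proof -
  let ?G = "\<lambda>n. {\<omega> \<in> space M. \<forall>j\<in>I n. X j \<omega> \<in> A j}"
  have *: "prob (\<Inter>j\<in>J. X j -` A j \<inter> space M) = (\<Prod>j\<in>J. prob (X j -` A j \<inter> space M))"
    if J: "finite J" "J \<noteq> {}" for J
  proof -
    obtain N where N: "J \<subseteq> {..<N}" using finite_nat_bounded[OF J(1)] by blast
    show ?thesis by (rule indep_varsD[OF ind[of N] J(2) J(1) N]) (rule A)
  qed
  have G: "?G n = (\<Inter>j\<in>I n. X j -` A j \<inter> space M)" for n using I(2)[of n] by auto
  have single: "prob (?G n) = (\<Prod>j\<in>I n. prob (X j -` A j \<inter> space M))" for n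
    unfolding G using I by (intro *) auto
  then show "prob (?G n) = (\<Prod>j\<in>I n. prob (X j -` A j \<inter> space M))" .
  have rv: "X j \<in> borel_measurable M" for j
    using ind[of "Suc j"] unfolding indep_vars_def by auto
  show "indep_events ?G UNIV"
  proof (rule indep_eventsI)
    show "?G n \<in> sets M" for n
      unfolding G using rv A I by (intro sets.finite_INT measurable_sets) auto
    fix J :: "nat set" assume J: "finite J" "J \<noteq> {}"
    have "(\<Inter>n\<in>J. ?G n) = (\<Inter>j\<in>(\<Union>n\<in>J. I n). X j -` A j \<inter> space M)" unfolding G by blast
    then have "prob (\<Inter>n\<in>J. ?G n) = (\<Prod>j\<in>(\<Union>n\<in>J. I n). prob (X j -` A j \<inter> space M))"
      using J I by (simp only:) (intro *; force)
    also have "\<dots> = (\<Prod>n\<in>J. \<Prod>j\<in>I n. prob (X j -` A j \<inter> space M))"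
      using J I by (intro prod.UNION_disjoint ballI impI) (auto simp: disjoint_family_on_def)
    finally show "prob (\<Inter>n\<in>J. ?G n) = (\<Prod>n\<in>J. prob (?G n))" unfolding single .
  qed
qed

end

text \<open>The crude bound \<open>(\<bar>a\<bar> + 1)\<^sup>2 \<le> a\<^sup>2 / \<rho> + 1 / (1 - \<rho>)\<close> leaves the exponent
  \<open>a\<^sup>2 / (2 * \<rho>)\<close>, which for \<open>\<rho> < 1\<close> is affordable because the target path has energy at most \<open>\<rho>\<close>.\<close>

lemma std_gauss_ball_ge:
  assumes \<rho>: "0 < \<rho>" "\<rho> < 1" and y: "1 \<le> y"
  shows "exp (- 1 / (2 * (1 - \<rho>))) / sqrt (2 * pi) * exp (- a\<^sup>2 / (2 * \<rho>)) \<le> measure std_gauss {x. \<bar>x - a\<bar> < y}"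
proof -
  define c where "c = exp (- 1 / (2 * (1 - \<rho>))) / sqrt (2 * pi) * exp (- a\<^sup>2 / (2 * \<rho>))"
  have c0: "0 \<le> c" unfolding c_def by simp
  have dens: "c \<le> std_normal_density x" if "\<bar>x - a\<bar> < 1" for x
  proof -
    have "x\<^sup>2 \<le> (\<bar>a\<bar> + 1)\<^sup>2" using that by (intro abs_le_square_iff[THEN iffD1]) auto
    also have "\<dots> \<le> a\<^sup>2 / \<rho> + 1 / (1 - \<rho>)"
    proof -
      have "0 \<le> ((1 - \<rho>) * \<bar>a\<bar> - \<rho>)\<^sup>2 / (\<rho> * (1 - \<rho>))" using \<rho> by simp
      also have "\<dots> = a\<^sup>2 / \<rho> + 1 / (1 - \<rho>) - (\<bar>a\<bar> + 1)\<^sup>2"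
      proof -
        have "((1 - \<rho>) * \<bar>a\<bar> - \<rho>)\<^sup>2 = \<bar>a\<bar>\<^sup>2 * (1 - \<rho>) + \<rho> - (\<bar>a\<bar> + 1)\<^sup>2 * (\<rho> * (1 - \<rho>))" by algebra
        then have "((1 - \<rho>) * \<bar>a\<bar> - \<rho>)\<^sup>2 / (\<rho> * (1 - \<rho>)) =
            \<bar>a\<bar>\<^sup>2 * (1 - \<rho>) / (\<rho> * (1 - \<rho>)) + \<rho> / (\<rho> * (1 - \<rho>)) - (\<bar>a\<bar> + 1)\<^sup>2 * (\<rho> * (1 - \<rho>)) / (\<rho> * (1 - \<rho>))"
          by (simp only: add_divide_distrib diff_divide_distrib)
        then show ?thesis using \<rho> by simp
      qed
      finally show ?thesis by simp
    qed
    finally have "- 1 / (2 * (1 - \<rho>)) + - a\<^sup>2 / (2 * \<rho>) \<le> - x\<^sup>2 / 2" using \<rho> by (simp add: field_simps)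
    then have "exp (- 1 / (2 * (1 - \<rho>))) * exp (- a\<^sup>2 / (2 * \<rho>)) \<le> exp (- x\<^sup>2 / 2)"
      by (simp only: exp_add[symmetric] exp_le_cancel_iff)
    then show ?thesis unfolding c_def std_normal_density_def by (simp add: divide_right_mono)
  qed
  have "ennreal c = (\<integral>\<^sup>+ x. ennreal c * indicator {a - 1/2..a + 1/2} x \<partial>lborel)"
    by (simp add: nn_integral_cmult_indicator)
  also have "\<dots> \<le> (\<integral>\<^sup>+ x. ennreal (std_normal_density x) * indicator {x. \<bar>x - a\<bar> < y} x \<partial>lborel)"
  proof (rule nn_integral_mono)
    fix x
    show "ennreal c * indicator {a - 1/2..a + 1/2} x \<le> ennreal (std_normal_density x) * indicator {x. \<bar>x - a\<bar> < y} x"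
    proof (cases "x \<in> {a - 1/2..a + 1/2}")
      case True
      then have "\<bar>x - a\<bar> < 1" by (auto simp: abs_if)
      then show ?thesis using dens[of x] True y by (simp add: ennreal_leI)
    qed simp
  qed
  also have "\<dots> = emeasure std_gauss {x. \<bar>x - a\<bar> < y}"
    unfolding std_gauss_def by (subst emeasure_density) auto
  also have "\<dots> = ennreal (measure std_gauss {x. \<bar>x - a\<bar> < y})" by (rule finite_measure.emeasure_eq_measure[OF prob_space.finite_measure[OF prob_space_std_gauss]])
  finally show ?thesis unfolding c_def[symmetric] by simp
qed

section \<open>Every element of K (1/2) is a limit point\<close>

text \<open>The increments over all cells but the first determine the grid values up to the one at 1
  / m. That value is small for w by Hoelder continuity, and for z because z is close to v in K
  (1/2). The terms with e and sqrt (1 / m) collect the approximation by v and the oscillations of v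
  and w within a cell.\<close>

lemma dist_le_if_grid_increments_close:
  fixes m :: nat
  assumes z: "z \<in> C0" and v: "v \<in> K (1/2)" "dist z v < e" and w: "w \<in> K (1/2)" and m: "0 < m" and \<delta>: "0 \<le> \<delta>"
    and incr: "\<And>i. Suc i < m \<Longrightarrow> \<bar>(apply_bcontfun z (real (i + 2) / real m) - apply_bcontfun z (real (i + 1) / real m))
        - (apply_bcontfun w (real (i + 2) / real m) - apply_bcontfun w (real (i + 1) / real m))\<bar> \<le> \<delta>"
  shows "dist z w \<le> 3 * e + 4 * sqrt (1 / real m) + real m * \<delta>"
proof (rule dist_C0_le)
  show "z \<in> C0" "w \<in> C0" using z w K_subset_C0 by auto
  define f where "f t = apply_bcontfun z t - apply_bcontfun w t" for t
  have C0z: "apply_bcontfun v 0 = 0" "apply_bcontfun w 0 = 0" "apply_bcontfun z 0 = 0"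
    using z v w K_subset_C0 unfolding C0_def by auto
  have zv: "\<bar>apply_bcontfun z t - apply_bcontfun v t\<bar> \<le> e" for t
    using dist_bounded[of z t v] v(2) by (simp add: dist_real_def)
  have e0: "0 \<le> e" using v(2) zero_le_dist[of z v] by linarith
  have hold: "\<bar>apply_bcontfun u y - apply_bcontfun u x\<bar> \<le> sqrt (1 / real m)"
    if "u \<in> K (1/2)" "0 \<le> x" "x \<le> y" "y \<le> 1" "y - x \<le> 1 / real m" for u x y
  proof -
    have "\<bar>apply_bcontfun u y - apply_bcontfun u x\<bar> \<le> sqrt (2 * (1/2) * (y - x))"
      using that by (intro K_Holder) auto
    also have "\<dots> \<le> sqrt (1 / real m)" using that by (intro real_sqrt_le_mono) simp
    finally show ?thesis .
  qed
  have f1: "\<bar>f (1 / real m)\<bar> \<le> 2 * sqrt (1 / real m) + e"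
    using zv[of "1 / real m"] hold[OF v(1), of 0 "1 / real m"] hold[OF w, of 0 "1 / real m"] C0z m
    unfolding f_def by simp
  have fi: "\<bar>f (real (i + 1) / real m)\<bar> \<le> 2 * sqrt (1 / real m) + e + real i * \<delta>" if "i < m" for i
    using that
  proof (induction i)
    case 0
    then show ?case using f1 by simp
  next
    case (Suc i)
    have "\<bar>f (real (i + 2) / real m) - f (real (i + 1) / real m)\<bar> \<le> \<delta>"
      using incr[of i] Suc.prems unfolding f_def by (simp add: algebra_simps)
    moreover have "real (Suc i) * \<delta> = real i * \<delta> + \<delta>" by (simp add: distrib_right)
    moreover have "Suc i + 1 = i + 2" by simp
    ultimately show ?case using Suc.IH Suc.prems by (simp only:) linarith
  qed
  have grid: "\<bar>f (real i / real m)\<bar> \<le> 2 * sqrt (1 / real m) + e + real m * \<delta>" if "i \<le> m" for i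
  proof (cases i)
    case 0
    then show ?thesis using C0z e0 \<delta> unfolding f_def by simp
  next
    case (Suc j)
    have "real j * \<delta> \<le> real m * \<delta>" using Suc that \<delta> by (intro mult_right_mono) auto
    then show ?thesis using fi[of j] Suc that by simp
  qed
  fix t :: real assume t: "0 \<le> t" "t \<le> 1"
  define i where "i = nat \<lfloor>real m * t\<rfloor>"
  define x where "x = real i / real m"
  have i: "real i \<le> real m * t" "real m * t < real i + 1" unfolding i_def using t by (auto simp: of_nat_nat)
  have "real m * t \<le> real m" using t by (simp add: mult_left_le)
  then have im: "i \<le> m" using i by linarith
  have x: "0 \<le> x" "x \<le> t" "t - x \<le> 1 / real m"
  proof -
    have "(real m * t - real i) / real m \<le> 1 / real m" using i by (intro divide_right_mono) auto
    then show "0 \<le> x" "x \<le> t" "t - x \<le> 1 / real m"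
      unfolding x_def using i m by (simp_all add: diff_divide_distrib divide_le_eq mult.commute)
  qed
  have "\<bar>f x\<bar> \<le> 2 * sqrt (1 / real m) + e + real m * \<delta>" unfolding x_def by (rule grid[OF im])
  moreover have "f t = (apply_bcontfun z t - apply_bcontfun v t) + (apply_bcontfun v t - apply_bcontfun v x)
      - (apply_bcontfun z x - apply_bcontfun v x) + f x - (apply_bcontfun w t - apply_bcontfun w x)"
    unfolding f_def by simp
  ultimately show "\<bar>apply_bcontfun z t - apply_bcontfun w t\<bar> \<le> 3 * e + 4 * sqrt (1 / real m) + real m * \<delta>"
    using zv[of t] zv[of x] hold[OF v(1) x(1,2) t(2) x(3)] hold[OF w x(1,2) t(2) x(3)]
    unfolding f_def[symmetric] by linarith
qed

text \<open>Attraction by a closed set confines the limit points. Conversely, for each n a visit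
  after time n with accuracy 1 / (n + 1) supplies the sequence of times.\<close>

lemma limit_points_eqI:
  fixes f :: "real \<Rightarrow> 'b :: metric_space"
  assumes C: "closed C" "C \<noteq> {}"
    and lim: "((\<lambda>s. infdist (f s) C) \<longlongrightarrow> 0) at_top"
    and hit: "\<And>w e T. w \<in> C \<Longrightarrow> 0 < e \<Longrightarrow> \<exists>s>T. exp 1 < s \<and> dist (f s) w < e"
  shows "limit_points f = C"
proof (intro equalityI subsetI)
  fix w assume "w \<in> limit_points f"
  then obtain \<sigma> :: "nat \<Rightarrow> real" where \<sigma>: "filterlim \<sigma> at_top sequentially" "(\<lambda>n. f (\<sigma> n)) \<longlonglongrightarrow> w"
    unfolding limit_points_def by blast
  have "(\<lambda>n. infdist (f (\<sigma> n)) C) \<longlonglongrightarrow> 0" by (rule filterlim_compose[OF lim \<sigma>(1)])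
  moreover have "(\<lambda>n. infdist (f (\<sigma> n)) C) \<longlonglongrightarrow> infdist w C" by (rule tendsto_infdist[OF \<sigma>(2)])
  ultimately have "infdist w C = 0" using LIMSEQ_unique by blast
  then show "w \<in> C" using in_closed_iff_infdist_zero[OF C] by simp
next
  fix w assume w: "w \<in> C"
  have "\<forall>n. \<exists>s. real n < s \<and> exp 1 < s \<and> dist (f s) w < inverse (real (Suc n))"
    using hit[OF w, of "inverse (real (Suc n))" "real n" for n] by simp
  from choice[OF this] obtain \<sigma> where
    \<sigma>: "\<And>n. real n < \<sigma> n" "\<And>n. exp 1 < \<sigma> n" "\<And>n. dist (f (\<sigma> n)) w < inverse (real (Suc n))" by blast
  have "filterlim \<sigma> at_top sequentially"
    by (rule filterlim_at_top_mono[OF filterlim_real_sequentially]) (use \<sigma>(1) in \<open>simp add: less_imp_le\<close>)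
  moreover have "(\<lambda>n. f (\<sigma> n)) \<longlonglongrightarrow> w"
  proof (rule tendsto_dist_iff[THEN iffD2], rule tendsto_sandwich[OF _ _ tendsto_const LIMSEQ_inverse_real_of_nat])
    show "eventually (\<lambda>n. dist (f (\<sigma> n)) w \<le> inverse (real (Suc n))) sequentially"
      by (intro always_eventually allI less_imp_le \<sigma>(3))
  qed simp
  ultimately show "w \<in> limit_points f" unfolding limit_points_def using \<sigma>(2) by blast
qed

lemma K_mono: "r \<le> r' \<Longrightarrow> K r \<subseteq> K r'"
  unfolding K_def by (auto intro: order_trans ennreal_leI)

lemma energy_ge_tail:
  assumes m: "m = 2 ^ k" "m = Suc d"
  shows "real m * (\<Sum>i<d. (w (real (i + 2) / real m) - w (real (i + 1) / real m))\<^sup>2) \<le> energy k w"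
proof -
  define g where "g i = (w (real (Suc i) / real m) - w (real i / real m))\<^sup>2" for i
  have "(\<Sum>i<d. g (Suc i)) \<le> g 0 + (\<Sum>i<d. g (Suc i))" unfolding g_def by simp
  also have "\<dots> = (\<Sum>i<m. g i)" unfolding m(2) by (rule sum.lessThan_Suc_shift[symmetric])
  finally have "real m * (\<Sum>i<d. g (Suc i)) \<le> real m * (\<Sum>i<m. g i)" by (intro mult_left_mono) auto
  also have "\<dots> = energy k w" unfolding energy_def g_def m(1) by simp
  finally show ?thesis unfolding g_def by simp
qed

context brownian_motion
begin

lemma scaled_increments_indep:
  assumes \<tau>: "0 \<le> \<tau> 0" "strict_mono \<tau>"
  shows "indep_vars (\<lambda>_. borel) (\<lambda>j \<omega>. (W (\<tau> (Suc j)) \<omega> - W (\<tau> j) \<omega>) / sqrt (\<tau> (Suc j) - \<tau> j)) {..<N}"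
proof -
  have "indep_vars (\<lambda>_. borel) (\<lambda>i \<omega>. W (\<tau> (Suc i)) \<omega> - W (\<tau> i) \<omega>) {..<N}"
    using \<tau> by (intro indep_increments strict_mono_mono)
  from indep_vars_compose2[OF this, of "\<lambda>i x. x / sqrt (\<tau> (Suc i) - \<tau> i)" "\<lambda>_. borel"]
  show ?thesis by simp
qed

text \<open>At time \<open>m ^ Suc n\<close> the increments of \<open>Z\<close> over all cells of the grid of mesh \<open>1 / m\<close> but the
  first come from \<open>W\<close> on \<open>[m ^ n, m ^ Suc n]\<close>, hence are independent for different \<open>n\<close>.\<close>

lemma grid_increments_close_infinitely_often:
  fixes m :: nat
  assumes w: "w \<in> K (\<rho> / 2)" and \<rho>: "0 < \<rho>" "\<rho> < 1" and k: "1 \<le> k" and m: "m = 2 ^ k" and \<delta>: "0 < \<delta>"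
  defines "z n \<omega> \<equiv> apply_bcontfun (Z W (real m ^ Suc n) \<omega>)"
  shows "AE \<omega> in M. \<forall>a. \<exists>n\<ge>a. \<forall>i. Suc i < m \<longrightarrow>
    \<bar>(z n \<omega> (real (i + 2) / real m) - z n \<omega> (real (i + 1) / real m))
      - (apply_bcontfun w (real (i + 2) / real m) - apply_bcontfun w (real (i + 1) / real m))\<bar> \<le> \<delta>"
proof -
  have "(2::nat) ^ 1 \<le> m" unfolding m using k by (intro power_increasing) auto
  then have m2: "2 \<le> m" by simp
  define d where "d = m - 1"
  have d: "1 \<le> d" "m = Suc d" unfolding d_def using m2 by auto
  have m1: "1 < real m" using m2 by simp
  have lm: "0 < ln (real m)" using m1 by simp
  \<comment> \<open>The times m^n * (i + 1) with i < d = m - 1, enumerated by j = n * d + i. Block n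
    consists of the d cells of length m^n between m^n and m^(n + 1).\<close>
  define \<tau> where "\<tau> j = real m ^ (j div d) * (real (j mod d) + 1)" for j
  have \<tau>1: "\<tau> (n * d + i) = real m ^ n * (real i + 1)" if "i < d" for n i
    unfolding \<tau>_def using that by simp
  have \<tau>2: "\<tau> (Suc (n * d + i)) = real m ^ n * (real i + 2)" if i: "i < d" for n i
  proof (cases "Suc i < d")
    case True
    then show ?thesis using \<tau>1[of "Suc i" n] by (simp add: add.commute)
  next
    case False
    then have "d = Suc i" using i by simp
    then have eq: "Suc (n * d + i) = Suc n * d + 0" and rm: "real m = real i + 2" using d by simp_all
    have "\<tau> (Suc (n * d + i)) = real m ^ Suc n * (real 0 + 1)" unfolding eq using i by (intro \<tau>1) simp
    then show ?thesis unfolding rm by simp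
  qed
  have \<tau>diff: "\<tau> (Suc (n * d + i)) - \<tau> (n * d + i) = real m ^ n" if "i < d" for n i
    unfolding \<tau>1[OF that] \<tau>2[OF that] by (simp add: algebra_simps)
  have \<tau>0: "0 \<le> \<tau> j" for j unfolding \<tau>_def by simp
  have \<tau>mono: "strict_mono \<tau>"
    unfolding strict_mono_Suc_iff
  proof
    fix j
    have "0 < real m ^ (j div d)" using m1 by simp
    also have "\<dots> = \<tau> (Suc j) - \<tau> j" using \<tau>diff[of "j mod d" "j div d"] d by simp
    finally show "\<tau> j < \<tau> (Suc j)" by simp
  qed
  define X where "X j \<omega> = (W (\<tau> (Suc j)) \<omega> - W (\<tau> j) \<omega>) / sqrt (\<tau> (Suc j) - \<tau> j)" for j \<omega>
  have ind: "indep_vars (\<lambda>_. borel) X {..<N}" for N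
    unfolding X_def by (rule scaled_increments_indep[OF \<tau>0 \<tau>mono])
  have rv: "X j \<in> borel_measurable M" for j
    using ind[of "Suc j"] unfolding indep_vars_def by auto
  have distr: "distr M borel (X j) = std_gauss" for j
    unfolding X_def using \<tau>0 \<tau>mono by (intro normal_increment_distr) (auto simp: strict_mono_less)
  define L where "L n = ln (ln (real m ^ Suc n))" for n
  have lns: "ln (real m ^ Suc n) = (real n + 1) * ln (real m)" for n
    using m1 by (simp only: ln_realpow of_nat_Suc add.commute)
  have L: "L n = ln ((real n + 1) * ln (real m))" for n unfolding L_def lns ..
  \<comment> \<open>An increment of Z at time m^(n + 1) over such a cell is X / \<alpha> n, so
    closeness \<delta> for Z is closeness \<alpha> n * \<delta> for the standard normal X.\<close>
  define \<alpha> where "\<alpha> n = sqrt (2 * real m * L n)" for n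
  define D where "D i = apply_bcontfun w (real (i + 2) / real m) - apply_bcontfun w (real (i + 1) / real m)" for i
  define A where "A j = {x. \<bar>x - \<alpha> (j div d) * D (j mod d)\<bar> < \<alpha> (j div d) * \<delta>}" for j
  define I where "I n = (\<lambda>i. n * d + i) ` {..<d}" for n
  have A: "A j \<in> sets borel" for j
    unfolding A_def by (intro borel_open open_Collect_less continuous_intros)
  have I: "finite (I n)" "I n \<noteq> {}" for n unfolding I_def using d by (auto simp: lessThan_empty_iff)
  have Idiv: "j div d = n" if "j \<in> I n" for n j using that unfolding I_def by auto
  have Idis: "disjoint_family I" unfolding disjoint_family_on_def using Idiv by blast
  define G where "G n = {\<omega> \<in> space M. \<forall>j\<in>I n. X j \<omega> \<in> A j}" for n
  have Gind: "indep_events G UNIV"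
    unfolding G_def by (rule indep_events_blocks[OF ind A I Idis])
  \<comment> \<open>Eventually the tolerance is at least 1, as \<open>std_gauss_ball_ge\<close>
    requires.\<close>
  have "filterlim (\<lambda>n. sqrt (2 * real m * L n) * \<delta>) at_top sequentially"
    unfolding L using \<delta> lm m1 by real_asymp
  then have "eventually (\<lambda>n. 1 \<le> \<alpha> n * \<delta>) sequentially"
    unfolding filterlim_at_top \<alpha>_def by blast
  then obtain N0 where N0: "\<And>n. N0 \<le> n \<Longrightarrow> 1 \<le> \<alpha> n * \<delta>" unfolding eventually_sequentially by blast
  have \<alpha>pos: "0 < \<alpha> n" if "N0 \<le> n" for n
    using N0[OF that] \<delta> mult_nonpos_nonneg[of "\<alpha> n" \<delta>] by linarith
  have Lpos: "0 < L n" if "N0 \<le> n" for n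
  proof -
    have "0 < 2 * real m * L n" using \<alpha>pos[OF that] unfolding \<alpha>_def by simp
    then show ?thesis using m1 by (simp add: zero_less_mult_iff)
  qed
  define c0 where "c0 = exp (- 1 / (2 * (1 - \<rho>))) / sqrt (2 * pi)"
  have c0: "0 < c0" unfolding c0_def by simp
  define c where "c = c0 ^ d / ln (real m)"
  have c: "0 < c" unfolding c_def using c0 lm by simp
  have Gprob: "c * inverse (real (Suc n)) \<le> prob (G n)" if n: "N0 \<le> n" for n
  proof -
    \<comment> \<open>The energy of w is at most \<rho>, which cancels the \<rho> in the exponent of
      \<open>std_gauss_ball_ge\<close>. What remains is exp (- L n), a constant multiple of 1 / (n +
      1).\<close>
    have sumD: "\<alpha> n ^ 2 * (\<Sum>i<d. (D i)\<^sup>2) \<le> 2 * L n * \<rho>"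
    proof -
      have "real m * (\<Sum>i<d. (D i)\<^sup>2) \<le> energy k (apply_bcontfun w)"
        unfolding D_def by (rule energy_ge_tail[OF m d(2)])
      also have "\<dots> \<le> 2 * (\<rho> / 2)" using w \<rho> by (intro K_imp_energy_le) auto
      finally have "2 * L n * (real m * (\<Sum>i<d. (D i)\<^sup>2)) \<le> 2 * L n * \<rho>"
        using Lpos[OF n] by (intro mult_left_mono) auto
      moreover have "\<alpha> n ^ 2 = 2 * real m * L n" unfolding \<alpha>_def using Lpos[OF n] by simp
      ultimately show ?thesis by (simp add: mult_ac)
    qed
    have "exp (L n) = (real n + 1) * ln (real m)"
      unfolding L using lm by (intro exp_ln) (simp add: add_pos_nonneg)
    then have eL: "exp (- L n) = inverse ((real n + 1) * ln (real m))" by (simp add: exp_minus)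
    have "c * inverse (real (Suc n)) = c0 ^ d * exp (- L n)"
      unfolding c_def eL using lm by (simp add: divide_inverse add.commute)
    also have "\<dots> \<le> c0 ^ d * exp (\<Sum>i<d. - (\<alpha> n * D i)\<^sup>2 / (2 * \<rho>))"
    proof (rule mult_left_mono)
      have "(\<Sum>i<d. - (\<alpha> n * D i)\<^sup>2 / (2 * \<rho>)) = - (\<alpha> n ^ 2 * (\<Sum>i<d. (D i)\<^sup>2)) / (2 * \<rho>)"
        by (simp add: power_mult_distrib sum_distrib_left sum_divide_distrib sum_negf)
      also have "\<dots> \<ge> - (2 * L n * \<rho>) / (2 * \<rho>)"
        using sumD \<rho> by (intro divide_right_mono) auto
      finally show "exp (- L n) \<le> exp (\<Sum>i<d. - (\<alpha> n * D i)\<^sup>2 / (2 * \<rho>))" using \<rho> by simp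
    qed (use c0 in simp)
    also have "\<dots> = (\<Prod>i<d. c0 * exp (- (\<alpha> n * D i)\<^sup>2 / (2 * \<rho>)))"
      by (simp add: exp_sum prod.distrib)
    also have "\<dots> \<le> (\<Prod>i<d. measure std_gauss {x. \<bar>x - \<alpha> n * D i\<bar> < \<alpha> n * \<delta>})"
    proof (rule prod_mono)
      fix i
      show "0 \<le> c0 * exp (- (\<alpha> n * D i)\<^sup>2 / (2 * \<rho>)) \<and>
          c0 * exp (- (\<alpha> n * D i)\<^sup>2 / (2 * \<rho>)) \<le> measure std_gauss {x. \<bar>x - \<alpha> n * D i\<bar> < \<alpha> n * \<delta>}"
        using std_gauss_ball_ge[OF \<rho> N0[OF n], of "\<alpha> n * D i"] c0 unfolding c0_def[symmetric] by simp
    qed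
    also have "\<dots> = (\<Prod>i<d. prob (X (n * d + i) -` A (n * d + i) \<inter> space M))"
    proof (rule prod.cong[OF refl])
      fix i assume "i \<in> {..<d}"
      then have "A (n * d + i) = {x. \<bar>x - \<alpha> n * D i\<bar> < \<alpha> n * \<delta>}" unfolding A_def by simp
      then show "measure std_gauss {x. \<bar>x - \<alpha> n * D i\<bar> < \<alpha> n * \<delta>} = prob (X (n * d + i) -` A (n * d + i) \<inter> space M)"
        using measure_distr[OF rv[of "n * d + i"] A[of "n * d + i"]] unfolding distr by simp
    qed
    also have "\<dots> = (\<Prod>j\<in>I n. prob (X j -` A j \<inter> space M))"
      unfolding I_def by (subst prod.reindex) (auto simp: inj_on_def)
    also have "\<dots> = prob (G n)" unfolding G_def by (rule prob_block[OF ind A I Idis, symmetric])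
    finally show ?thesis .
  qed
  have "\<not> summable (\<lambda>n. prob (G n))"
  proof
    assume "summable (\<lambda>n. prob (G n))"
    then have "summable (\<lambda>n. c * inverse (real (Suc n)))"
    proof (rule summable_comparison_test'[where N = N0])
      show "norm (c * inverse (real (Suc n))) \<le> prob (G n)" if "N0 \<le> n" for n
        using Gprob[OF that] c by simp
    qed
    then have "summable (\<lambda>n. inverse (real (Suc n)))" using c by (simp only: summable_cmult_iff) simp
    then show False
      using not_summable_harmonic[where 'a = real] summable_Suc_iff[of "\<lambda>n. inverse (real n)"] by blast
  qed
  from AE_infinitely_often_if_indep_events[OF Gind this] show ?thesis
  proof eventually_elim
    case (elim \<omega>)
    show ?case
    proof
      fix a
      from elim obtain n where n: "max a N0 \<le> n" "\<omega> \<in> G n" by blast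
      have \<omega>: "\<omega> \<in> space M" using n(2) unfolding G_def by simp
      have an: "0 < \<alpha> n" using n(1) by (intro \<alpha>pos) simp
      have "\<bar>(z n \<omega> (real (i + 2) / real m) - z n \<omega> (real (i + 1) / real m)) - D i\<bar> \<le> \<delta>" if i: "Suc i < m" for i
      proof -
        have id: "i < d" using i d by simp
        define j where "j = n * d + i"
        have "j \<in> I n" unfolding j_def I_def using id by simp
        then have "X j \<omega> \<in> A j" using n(2) unfolding G_def by blast
        then have XA: "\<bar>X j \<omega> - \<alpha> n * D i\<bar> < \<alpha> n * \<delta>" unfolding A_def j_def using id by simp
        have in01: "real (i + 1) / real m \<in> {0..1}" "real (i + 2) / real m \<in> {0..1}" using i by simp_all
        have s1: "real m ^ Suc n * (real (i + 2) / real m) = \<tau> (Suc j)" "real m ^ Suc n * (real (i + 1) / real m) = \<tau> j"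
          unfolding j_def \<tau>1[OF id] \<tau>2[OF id] using m1 by (simp_all add: add.commute)
        have sq: "sqrt (2 * real m ^ Suc n * ln (ln (real m ^ Suc n))) = sqrt (real m ^ n) * \<alpha> n"
          unfolding \<alpha>_def L_def[symmetric] real_sqrt_mult[symmetric] by (simp add: mult_ac)
        have "z n \<omega> (real (i + 2) / real m) - z n \<omega> (real (i + 1) / real m) =
            (W (\<tau> (Suc j)) \<omega> - W (\<tau> j) \<omega>) / (sqrt (real m ^ n) * \<alpha> n)"
          unfolding z_def s1[symmetric] sq[symmetric] by (rule Z_as_increments[OF \<omega> _ in01]) simp
        also have "\<dots> = X j \<omega> / \<alpha> n" unfolding X_def using \<tau>diff[OF id, of n] unfolding j_def by simp
        finally have "(z n \<omega> (real (i + 2) / real m) - z n \<omega> (real (i + 1) / real m)) - D i = (X j \<omega> - \<alpha> n * D i) / \<alpha> n"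
          using an by (simp add: diff_divide_distrib)
        then show ?thesis using XA an by (simp add: abs_divide divide_le_eq mult.commute)
      qed
      then show "\<exists>n\<ge>a. \<forall>i. Suc i < m \<longrightarrow> \<bar>(z n \<omega> (real (i + 2) / real m) - z n \<omega> (real (i + 1) / real m))
          - (apply_bcontfun w (real (i + 2) / real m) - apply_bcontfun w (real (i + 1) / real m))\<bar> \<le> \<delta>"
        using n(1) unfolding D_def by (intro exI[of _ n]) auto
    qed
  qed
qed

text \<open>A target of full energy is first shrunk to \<beta> * w, of energy at most \<beta>^2 < 1,
  which costs e / 4. Each of the three terms in \<open>dist_le_if_grid_increments_close\<close> gets
  e / 8.\<close>

lemma Z_hits_neighbourhood:
  assumes w: "w \<in> K (1/2)" and e: "0 < e"
  shows "AE \<omega> in M. \<forall>T. \<exists>s>T. exp 1 < s \<and> dist (Z W s \<omega>) w < e"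
proof -
  define \<beta> where "\<beta> = 1 - min (1/2) (e / 4)"
  have \<beta>: "0 < \<beta>" "\<beta> < 1" "1 - \<beta> \<le> e / 4" unfolding \<beta>_def using e by auto
  have \<beta>2: "0 < \<beta>\<^sup>2" "\<beta>\<^sup>2 < 1" using \<beta> by (auto simp: power_less_one_iff abs_square_less_1)
  define w' where "w' = \<beta> *\<^sub>R w"
  have w': "w' \<in> K (\<beta>\<^sup>2 / 2)" using K_scaleR[OF w, of \<beta>] unfolding w'_def by simp
  then have w'h: "w' \<in> K (1/2)" using K_mono[of "\<beta>\<^sup>2 / 2" "1/2"] \<beta>2 by auto
  have w'w: "dist w' w \<le> e / 4"
  proof -
    have "w' - w = (\<beta> - 1) *\<^sub>R w" unfolding w'_def by (simp add: scaleR_diff_left)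
    then have "dist w' w = (1 - \<beta>) * norm w" using \<beta> by (simp add: dist_norm)
    also have "\<dots> \<le> (1 - \<beta>) * 1" using K_norm_le[OF w] \<beta> by (intro mult_left_mono) auto
    finally show ?thesis using \<beta> by simp
  qed
  have "(\<lambda>k :: nat. sqrt (1 / 2 ^ k)) \<longlonglongrightarrow> 0" by real_asymp
  then have "eventually (\<lambda>k :: nat. sqrt (1 / 2 ^ k) < e / 32) sequentially"
    using e by (intro order_tendstoD(2)) auto
  then obtain k0 where k0: "\<And>k. k0 \<le> k \<Longrightarrow> sqrt (1 / 2 ^ k) < e / 32" unfolding eventually_sequentially by blast
  define k where "k = Suc k0"
  define m :: nat where "m = 2 ^ k"
  have mk: "sqrt (1 / real m) < e / 32" using k0[of k] unfolding m_def k_def by simp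
  have m0: "0 < m" unfolding m_def by simp
  have "2 ^ 1 \<le> m" unfolding m_def k_def by (intro power_increasing) auto
  then have m1: "1 < real m" by simp
  define \<delta> where "\<delta> = e / (8 * real m)"
  have \<delta>: "0 < \<delta>" "real m * \<delta> = e / 8" unfolding \<delta>_def using e m0 by simp_all
  have "1 \<le> k" unfolding k_def by simp
  from grid_increments_close_infinitely_often[OF w' \<beta>2 this m_def \<delta>(1)] Z_attracted AE_space
  show ?thesis
  proof eventually_elim
    case (elim \<omega>)
    show ?case
    proof
      fix T
      have "eventually (\<lambda>s. infdist (Z W s \<omega>) (K (1/2)) < e / 24) at_top"
        using e by (intro order_tendstoD(2)[OF elim(2)]) auto
      from eventually_conj[OF this eventually_conj[OF eventually_gt_at_top[of T] eventually_gt_at_top[of "exp 1"]]]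
      have "eventually (\<lambda>s. infdist (Z W s \<omega>) (K (1/2)) < e / 24 \<and> T < s \<and> exp 1 < s) at_top" .
      moreover have "filterlim (\<lambda>n. real m ^ Suc n) at_top sequentially" using m1 by real_asymp
      ultimately have "eventually (\<lambda>n. infdist (Z W (real m ^ Suc n) \<omega>) (K (1/2)) < e / 24 \<and> T < real m ^ Suc n \<and> exp 1 < real m ^ Suc n) sequentially"
        by (rule eventually_compose_filterlim)
      then obtain a where a: "\<And>n. a \<le> n \<Longrightarrow> infdist (Z W (real m ^ Suc n) \<omega>) (K (1/2)) < e / 24 \<and> T < real m ^ Suc n \<and> exp 1 < real m ^ Suc n"
        unfolding eventually_sequentially by blast
      from elim(1) obtain n where n: "a \<le> n" "\<And>i. Suc i < m \<Longrightarrow>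
          \<bar>(apply_bcontfun (Z W (real m ^ Suc n) \<omega>) (real (i + 2) / real m) - apply_bcontfun (Z W (real m ^ Suc n) \<omega>) (real (i + 1) / real m))
            - (apply_bcontfun w' (real (i + 2) / real m) - apply_bcontfun w' (real (i + 1) / real m))\<bar> \<le> \<delta>" by blast
      define s where "s = real m ^ Suc n"
      have s: "infdist (Z W s \<omega>) (K (1/2)) < e / 24" "T < s" "exp 1 < s" using a[OF n(1)] unfolding s_def by blast+
      have "K (1/2) \<noteq> {}" using w by blast
      from infdist_lt_obtain[OF s(1) this] obtain v where v: "v \<in> K (1/2)" "dist (Z W s \<omega>) v < e / 24" .
      have "Z W s \<omega> \<in> C0" using elim(3) by (rule apply_Z(2)) (simp add: s_def)
      from dist_le_if_grid_increments_close[OF this v w'h m0 less_imp_le[OF \<delta>(1)] n(2)[folded s_def]]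
      have "dist (Z W s \<omega>) w' \<le> 3 * (e / 24) + 4 * sqrt (1 / real m) + real m * \<delta>" .
      then have "dist (Z W s \<omega>) w < e"
        using dist_triangle[of "Z W s \<omega>" w w'] w'w mk \<delta>(2) e by linarith
      with s show "\<exists>s>T. exp 1 < s \<and> dist (Z W s \<omega>) w < e" by blast
    qed
  qed
qed

text \<open>The null set in \<open>Z_hits_neighbourhood\<close> depends on w and e. Finite nets of
  the compact set K (1/2) with radii 1 / (i + 1) reduce the pairs to countably many.\<close>

lemma Z_limit_points: "AE \<omega> in M. limit_points (\<lambda>s. Z W s \<omega>) = K (1/2)"
proof -
  have comp: "compact (K (1/2))" by (rule compact_K) simp
  have "\<forall>i. \<exists>F. finite F \<and> F \<subseteq> K (1/2) \<and> K (1/2) \<subseteq> (\<Union>x\<in>F. ball x (inverse (real (Suc i))))"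
  proof
    fix i
    have "0 < inverse (real (Suc i))" by simp
    with seq_compact_imp_totally_bounded[OF comp[unfolded compact_eq_seq_compact_metric]]
    show "\<exists>F. finite F \<and> F \<subseteq> K (1/2) \<and> K (1/2) \<subseteq> (\<Union>x\<in>F. ball x (inverse (real (Suc i))))" by blast
  qed
  from choice[OF this] obtain F where F: "\<And>i. finite (F i)" "\<And>i. F i \<subseteq> K (1/2)"
    "\<And>i. K (1/2) \<subseteq> (\<Union>x\<in>F i. ball x (inverse (real (Suc i))))" by blast
  have "AE \<omega> in M. \<forall>i. \<forall>v\<in>F i. \<forall>T. \<exists>s>T. exp 1 < s \<and> dist (Z W s \<omega>) v < inverse (real (Suc i))"
    unfolding AE_all_countable
  proof
    fix i
    show "AE \<omega> in M. \<forall>v\<in>F i. \<forall>T. \<exists>s>T. exp 1 < s \<and> dist (Z W s \<omega>) v < inverse (real (Suc i))"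
      by (rule AE_finite_allI[OF F(1)], rule Z_hits_neighbourhood) (use F(2) in auto)
  qed
  with Z_attracted show ?thesis
  proof eventually_elim
    case (elim \<omega>)
    show ?case
    proof (rule limit_points_eqI)
      show "closed (K (1/2))" by (rule compact_imp_closed[OF comp])
      show "K (1/2) \<noteq> {}" using zero_in_K[of "1/2"] by auto
      show "((\<lambda>s. infdist (Z W s \<omega>) (K (1/2))) \<longlongrightarrow> 0) at_top" by (rule elim(1))
      fix w e T assume w: "w \<in> K (1/2)" and "0 < (e :: real)"
      then obtain i where i: "inverse (real (Suc i)) < e / 2" using reals_Archimedean[of "e / 2"] by auto
      obtain v where v: "v \<in> F i" "dist v w < inverse (real (Suc i))" using F(3)[of i] w by auto
      obtain s where s: "T < s" "exp 1 < s" "dist (Z W s \<omega>) v < inverse (real (Suc i))" using elim(2) v(1) by blast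
      have "dist (Z W s \<omega>) w < e" using dist_triangle[of "Z W s \<omega>" w v] v(2) s(3) i by linarith
      with s show "\<exists>s>T. exp 1 < s \<and> dist (Z W s \<omega>) w < e" by blast
    qed
  qed
qed

end

theorem theorem13:
  fixes M :: "'a measure" and W :: "real \<Rightarrow> 'a \<Rightarrow> real"
  assumes "brownian_motion M W"
  shows
    \<comment> \<open>(1)\<close>
    "(AE \<omega> in M.
        (\<forall>s\<^sub>0>exp 1. compact (closure {Z W s \<omega> | s. s\<^sub>0 \<le> s})) \<and>
        limit_points (\<lambda>s. Z W s \<omega>) = K (1/2)) \<and>
     \<comment> \<open>(2)\<close>
     (\<forall>\<eta>>0. \<forall>\<epsilon>>0. \<forall>q>1. \<forall>vartheta. 0 < vartheta \<and> vartheta < \<eta> \<longrightarrow>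
        (\<exists>a>0. \<forall>k::nat. 1 \<le> k \<longrightarrow>
           \<P>(\<omega> in M. enat k \<le> exceed_num W q \<eta> \<epsilon> \<omega>)
             \<le> 1 / real k * (a * zeta (1 + 2 * vartheta) / ln q powr (1 + 2 * vartheta)))) \<and>
     \<comment> \<open>(3)\<close>
     (\<forall>\<eta>>1/2.
        \<comment> \<open>(a)\<close>
        (\<forall>\<epsilon>>0. \<forall>q>1. \<forall>vartheta p. 1/2 < vartheta \<and> vartheta < \<eta> \<and> -1 < p \<and> p < 2 * vartheta - 1 \<longrightarrow>
           (AE \<omega> in M. \<forall>n::nat. exceed_sup W q \<eta> \<epsilon> \<omega> < enat n \<and> exp 1 < q ^ n \<longrightarrow>
              infdist (Z W (q ^ n) \<omega>) (K (1/2 + \<eta>)) \<le> \<epsilon>) \<and>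
           (\<forall>k::nat. 1 \<le> k \<longrightarrow>
              \<P>(\<omega> in M. enat k \<le> exceed_num W q \<eta> \<epsilon> \<omega>)
                \<le> \<P>(\<omega> in M. enat k \<le> exceed_sup W q \<eta> \<epsilon> \<omega>) \<and>
              \<P>(\<omega> in M. enat k \<le> exceed_sup W q \<eta> \<epsilon> \<omega>)
                \<le> real k powr (- (1 + p)) * ((p + 1) * (1 + 2 * vartheta) / (2 * vartheta)) *
                     (bconst \<eta> \<epsilon> * zeta (2 * vartheta - p) / ln q powr (1 + 2 * vartheta))
                   + real k powr (- (1 + p)) * of_bool (p < 0) \<and>
              real k powr (- (1 + p)) * ((p + 1) * (1 + 2 * vartheta) / (2 * vartheta)) *
                     (bconst \<eta> \<epsilon> * zeta (2 * vartheta - p) / ln q powr (1 + 2 * vartheta))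
                   + real k powr (- (1 + p)) * of_bool (p < 0)
                \<le> real k powr (- (1 + p)) * (1 + 2 * vartheta) *
                     (bconst \<eta> \<epsilon> * zeta (2 * vartheta - p) / ln q powr (1 + 2 * vartheta))
                   + real k powr (- (1 + p)) * of_bool (p < 0))) \<and>
        \<comment> \<open>(b)\<close>
        (\<forall>\<epsilon>>0. \<forall>q>1.
           let rhs = (\<lambda>k::nat.
                 real k powr (- (2 * \<eta>)) *
                 zeta (1 + 1 / (ln (real k) + euler_mascheroni)) *
                 real k powr (1 / (ln (real k) + euler_mascheroni)) *
                 (bconst \<eta> \<epsilon> / ln q powr (1 + 2 * \<eta>)) *
                 (2 * \<eta> - 1 / (ln (real k) + euler_mascheroni)) *
                 (1 + 1 / (2 * \<eta>))
               + real k powr (- (2 * \<eta>)) *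
                 of_bool (real k < exp (1 / (2 * \<eta> - 1) - euler_mascheroni)))
           in
             (\<forall>k::nat. max (1 / ln q) (exp (1 / (2 * \<eta>) - euler_mascheroni)) \<le> real k \<longrightarrow>
                \<P>(\<omega> in M. enat k \<le> exceed_num W q \<eta> \<epsilon> \<omega>)
                  \<le> \<P>(\<omega> in M. enat k \<le> exceed_sup W q \<eta> \<epsilon> \<omega>) \<and>
                \<P>(\<omega> in M. enat k \<le> exceed_sup W q \<eta> \<epsilon> \<omega>) \<le> rhs k) \<and>
             rhs \<sim>[sequentially]
               (\<lambda>k. real k powr (- (2 * \<eta>)) * (2 * euler_mascheroni + ln (real k)) *
                    (exp 1 * bconst \<eta> \<epsilon> * (2 * \<eta> + 1) / ln q powr (1 + 2 * \<eta>)))) \<and>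
        \<comment> \<open>(c)\<close>
        (\<forall>\<theta>>0. \<forall>q>1. \<forall>vartheta. 1/2 < vartheta \<and> vartheta < \<eta> \<longrightarrow>
           eps_seq \<eta> vartheta \<theta> q \<in> \<Theta>[sequentially](\<lambda>n.
             ln (real n / ln (real n + 1) powr ((1 + \<theta>) / (2 * vartheta))) powr (- (1/2))) \<and>
           (AE \<omega> in M. limsup (\<lambda>n.
              ereal (infdist (Z W (q ^ n) \<omega>) (K (1/2 + \<eta>)) * inverse (eps_seq \<eta> vartheta \<theta> q n))) \<le> 1) \<and>
           (\<forall>k::nat. 1 \<le> k \<longrightarrow>
              \<P>(\<omega> in M. enat k \<le> ecard {n. exp 1 < q ^ n \<and> 0 < eps_denom vartheta \<theta> q n \<and>
                   eps_seq \<eta> vartheta \<theta> q n < infdist (Z W (q ^ n) \<omega>) (K (1/2 + \<eta>))})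
                \<le> 1 / real k *
                   (\<Sum>n. 1 / (real (Suc n) * ln (real (Suc n) + 1) powr (1 + \<theta>))))))"
proof -
  interpret brownian_motion M W by (rule assms)
  have limit: "AE \<omega> in M. (\<forall>s\<^sub>0>exp 1. compact (closure {Z W s \<omega> | s. s\<^sub>0 \<le> s})) \<and> limit_points (\<lambda>s. Z W s \<omega>) = K (1/2)"
    using Z_limit_points Z_attracted AE_space
  proof eventually_elim
    case (elim \<omega>)
    then show ?case by (intro conjI allI impI Z_relatively_compact)
  qed
  have above: "infdist (Z W (q ^ n) \<omega>) (K (1/2 + \<eta>)) \<le> \<epsilon>"
    if "exceed_sup W q \<eta> \<epsilon> \<omega> < enat n" "exp 1 < q ^ n" for q \<eta> \<epsilon> \<omega> n
  proof (rule ccontr)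
    assume "\<not> ?thesis"
    then have "n \<in> exceed_set W q \<eta> \<epsilon> \<omega>" using that(2) unfolding exceed_set_def by simp
    then have "enat n \<le> exceed_sup W q \<eta> \<epsilon> \<omega>" unfolding exceed_sup_def by (intro Sup_upper imageI)
    then show False using that(1) by simp
  qed
  have asymp: "let rhs = (\<lambda>k::nat.
                 real k powr (- (2 * \<eta>)) *
                 zeta (1 + 1 / (ln (real k) + euler_mascheroni)) *
                 real k powr (1 / (ln (real k) + euler_mascheroni)) *
                 (bconst \<eta> \<epsilon> / ln q powr (1 + 2 * \<eta>)) *
                 (2 * \<eta> - 1 / (ln (real k) + euler_mascheroni)) *
                 (1 + 1 / (2 * \<eta>))
               + real k powr (- (2 * \<eta>)) *
                 of_bool (real k < exp (1 / (2 * \<eta> - 1) - euler_mascheroni)))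
           in
             (\<forall>k::nat. max (1 / ln q) (exp (1 / (2 * \<eta>) - euler_mascheroni)) \<le> real k \<longrightarrow>
                \<P>(\<omega> in M. enat k \<le> exceed_num W q \<eta> \<epsilon> \<omega>)
                  \<le> \<P>(\<omega> in M. enat k \<le> exceed_sup W q \<eta> \<epsilon> \<omega>) \<and>
                \<P>(\<omega> in M. enat k \<le> exceed_sup W q \<eta> \<epsilon> \<omega>) \<le> rhs k) \<and>
             rhs \<sim>[sequentially]
               (\<lambda>k. real k powr (- (2 * \<eta>)) * (2 * euler_mascheroni + ln (real k)) *
                    (exp 1 * bconst \<eta> \<epsilon> * (2 * \<eta> + 1) / ln q powr (1 + 2 * \<eta>)))"
    if "1/2 < \<eta>" "0 < \<epsilon>" "1 < q" for \<eta> \<epsilon> q :: real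
  proof -
    have pos: "0 < bconst \<eta> \<epsilon> / ln q powr (1 + 2 * \<eta>)" "0 < (euler_mascheroni :: real)"
      using bconst_pos[of \<eta> \<epsilon>] that(3) euler_mascheroni_gt_19_over_33 by simp_all
    have "exp 1 * (bconst \<eta> \<epsilon> / ln q powr (1 + 2 * \<eta>)) * (2 * \<eta> + 1) =
        exp 1 * bconst \<eta> \<epsilon> * (2 * \<eta> + 1) / ln q powr (1 + 2 * \<eta>)" by simp
    from part_3b_asymp[OF that(1) pos, of "exp (1 / (2 * \<eta> - 1) - euler_mascheroni)", unfolded this]
    show ?thesis
      unfolding Let_def using part_3b[OF that] exceed_num_le_sup[OF that(3)] by blast
  qed
  show ?thesis
    apply (intro conjI)
      apply (rule limit)
     apply (intro allI impI; elim conjE; rule part_2; assumption)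
    apply (intro allI impI)
    apply (intro conjI; intro allI impI; (elim conjE)?)
      apply (intro conjI allI impI)
         apply (intro AE_I2 allI impI; elim conjE; rule above; assumption)
        apply (rule exceed_num_le_sup; assumption)
       apply (rule part_3a; assumption)
      apply (rule part_3a; assumption)
     apply (rule asymp; assumption)
    apply (intro conjI allI impI)
      apply (rule eps_seq_bigtheta; linarith)
     apply (rule part_3c_limsup; linarith)
    apply (rule part_3c_count; linarith)
    done
qed

end
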